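(* Let $m\ge2$ and let $S^m=\{x\in\mathbb{R}^{m+1}:|x|=1\}$ be the standard (round) sphere. For any $\frac{2m}{m-1}<p<\infty$, the symmetric relatively dense condition is necessary and sufficient for a family $\mathcal{A}=\{A_\lambda\}_{\lambda\ge1}$ of subsets of $S^m$ to be $L^p$-Logvinenko-Sereda for eigenfunctions on $S^m$.
   Context: $-\Delta$ is the nonnegative Laplace-Beltrami operator on the round sphere, $dV$ and $\mathrm{vol}$ are the Riemannian volume element and volume, $B(z,r)$ is the geodesic ball centered at $z$ of radius $r$, and $-z$ is the antipodal point of $z$. The sets $A_\lambda$ are (measurable) subsets of $S^m$. $\mathcal{A}$ is $L^p$-Logvinenko-Sereda for eigenfunctions on $S^m$ if there exists $C>0$ such that for all $\lambda\ge1$ and all eigenfunctions $e_\lambda$ satisfying $-\Delta e_\lambda=\lambda^2e_\lambda$, we have $\int_{A_\lambda}|e_\lambda|^p\,dV\ge C\int_{S^m}|e_\lambda|^p\,dV$. $\mathcal{A}$ is symmetric relatively dense if there exist $r>0$ and $\rho>0$ such that for all $\lambda\ge1$ and $z\in S^m$, $\dfrac{\mathrm{vol}(A_\lambda\cap B(z,r/\lambda))+\mathrm{vol}(A_\lambda\cap B(-z,r/\lambda))}{\mathrm{vol}(B(z,r/\lambda))}\ge\rho$.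
   Formalization: Symmetric relative density is required only at those λ≥1 for which λ² is an eigenvalue of −Δ; at other λ the Logvinenko-Sereda condition is vacuous (A_λ may be empty there), so density at every real λ≥1 is not necessary. *)

theory Defs
  imports "HOL-Analysis.Analysis"
begin

primrec C_k_on :: "nat \<Rightarrow> ('a::real_normed_vector \<Rightarrow> 'b::real_normed_vector) \<Rightarrow> 'a set \<Rightarrow> bool"
  where
    "C_k_on 0 f U \<longleftrightarrow> continuous_on U f"
  | "C_k_on (Suc k) f U \<longleftrightarrow>
       (\<forall>x\<in>U. f differentiable (at x)) \<and>
       (\<forall>v. C_k_on k (\<lambda>x. frechet_derivative f (at x) v) U)"

text \<open>
  A function on the unit sphere is a function on the ambient space whose values off
  the sphere are irrelevant. It is differentiated through its extension
  \<open>\<lambda>y. f (sgn y)\<close> to the punctured space, where \<open>sgn y = y /\<^sub>R norm y\<close>. This extension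
  is constant along rays, so its derivative at a point \<open>x\<close> of the sphere in direction \<open>v\<close>
  is the derivative of \<open>f\<close> along the projection of \<open>v\<close> to the tangent space at \<open>x\<close>.
\<close>

definition sphere_smooth :: "('a::euclidean_space \<Rightarrow> complex) \<Rightarrow> bool"
  where "sphere_smooth f \<longleftrightarrow> (\<forall>k. C_k_on k (\<lambda>y. f (sgn y)) (- {0}))"

definition tangential_deriv :: "('a::euclidean_space \<Rightarrow> complex) \<Rightarrow> 'a \<Rightarrow> 'a \<Rightarrow> complex"
  where "tangential_deriv f x v = frechet_derivative (\<lambda>y. f (sgn y)) (at x) v"

text \<open>
  The gradient of a complex-valued function is a section of the complexified tangent
  bundle. It is represented by its components: \<open>sphere_grad f x b\<close> is the inner
  product of the Riemannian gradient at \<open>x\<close> with the ambient vector \<open>b\<close>.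
  The divergence of a tangent field, that is, the trace over the tangent space of its
  covariant derivative (the tangential part of the ambient derivative), is computed with
  an orthonormal basis of the ambient space: the radial direction contributes nothing,
  since tangential derivatives vanish in that direction.
\<close>

definition sphere_grad :: "('a::euclidean_space \<Rightarrow> complex) \<Rightarrow> 'a \<Rightarrow> 'a \<Rightarrow> complex"
  where "sphere_grad f x b = tangential_deriv f x b"

definition sphere_div :: "('a::euclidean_space \<Rightarrow> 'a \<Rightarrow> complex) \<Rightarrow> 'a \<Rightarrow> complex"
  where "sphere_div X x = (\<Sum>b\<in>Basis. tangential_deriv (\<lambda>y. X y b) x b)"

definition sphere_laplacian :: "('a::euclidean_space \<Rightarrow> complex) \<Rightarrow> 'a \<Rightarrow> complex"
  where "sphere_laplacian f = sphere_div (sphere_grad f)"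

definition sphere_eigenfunction :: "real \<Rightarrow> ('a::euclidean_space \<Rightarrow> complex) \<Rightarrow> bool"
  where "sphere_eigenfunction l e \<longleftrightarrow>
    sphere_smooth e \<and> (\<exists>x\<in>sphere 0 1. e x \<noteq> 0) \<and>
    (\<forall>x\<in>sphere 0 1. - sphere_laplacian e x = of_real (l\<^sup>2) * e x)"

text \<open>
  The Riemannian volume in polar coordinates \<open>dx = t ^ (DIM('a) - 1) dt dV\<close>: a Borel set
  of the sphere has \<open>DIM('a)\<close> times the Lebesgue measure of the solid cone over it in
  the unit ball. The measure is completed, so that its measurable sets are the
  Lebesgue measurable subsets of the sphere.
\<close>

definition sphere_borel_volume :: "'a::euclidean_space measure"
  where "sphere_borel_volume =
    scale_measure (of_nat DIM('a))
      (distr (restrict_space lborel (ball 0 1 - {0})) (restrict_space borel (sphere 0 1)) sgn)"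

definition sphere_volume :: "'a::euclidean_space measure"
  where "sphere_volume = completion sphere_borel_volume"

lemma space_sphere_volume: "space sphere_volume = sphere 0 1"
  by (simp add: sphere_volume_def sphere_borel_volume_def space_scale_measure space_restrict_space)

lemma sgn_measurable_sphere:
  "(sgn :: 'a::euclidean_space \<Rightarrow> 'a)
     \<in> restrict_space lborel (ball 0 1 - {0}) \<rightarrow>\<^sub>M restrict_space borel (sphere 0 1)"
proof (rule measurable_restrict_space3)
  show "(sgn :: 'a \<Rightarrow> 'a) \<in> lborel \<rightarrow>\<^sub>M borel"
    unfolding sgn_div_norm[abs_def] by measurable
qed (auto simp: norm_sgn)

lemma emeasure_sphere_volume:
  fixes A :: "'a::euclidean_space set"
  assumes "A \<in> sets borel" "A \<subseteq> sphere 0 1"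
  shows "emeasure sphere_volume A =
    of_nat DIM('a) * emeasure lborel {x \<in> ball 0 1 - {0}. sgn x \<in> A}"
proof -
  have A: "A \<in> sets (restrict_space borel (sphere 0 1))"
    using assms by (auto simp: sets_restrict_space_iff)
  have "{x \<in> ball 0 1 - {0}. sgn x \<in> A} = sgn -` A \<inter> (ball 0 1 - {0})"
    by auto
  then show ?thesis
    using A by (simp add: sphere_volume_def sphere_borel_volume_def emeasure_completion
        main_part_sets emeasure_distr[OF sgn_measurable_sphere] emeasure_restrict_space
        space_restrict_space)
qed

definition geodesic_dist :: "'a::euclidean_space \<Rightarrow> 'a \<Rightarrow> real"
  where "geodesic_dist x y = arccos (x \<bullet> y)"

definition geodesic_ball :: "'a::euclidean_space \<Rightarrow> real \<Rightarrow> 'a set"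
  where "geodesic_ball z r = {x \<in> sphere 0 1. geodesic_dist z x < r}"

definition Logvinenko_Sereda :: "real \<Rightarrow> (real \<Rightarrow> 'a::euclidean_space set) \<Rightarrow> bool"
  where "Logvinenko_Sereda p A \<longleftrightarrow>
    (\<exists>C>0. \<forall>l\<ge>1. \<forall>e. sphere_eigenfunction l e \<longrightarrow>
       (LINT x:A l|sphere_volume. cmod (e x) powr p)
         \<ge> C * (LINT x:sphere 0 1|sphere_volume. cmod (e x) powr p))"

text \<open>
  Density is required at those \<open>l \<ge> 1\<close> for which \<open>l\<^sup>2\<close> is an eigenvalue. At any other \<open>l\<close> the
  Logvinenko--Sereda inequality is vacuous and says nothing about \<open>A l\<close> (which may
  be empty), so density at every real \<open>l \<ge> 1\<close> would not be a necessary condition.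
\<close>

definition sphere_frequencies :: "'a::euclidean_space itself \<Rightarrow> real set"
  where "sphere_frequencies _ = {l. l \<ge> 1 \<and> (\<exists>e :: 'a \<Rightarrow> complex. sphere_eigenfunction l e)}"

definition symmetric_relatively_dense :: "(real \<Rightarrow> 'a::euclidean_space set) \<Rightarrow> bool"
  where "symmetric_relatively_dense A \<longleftrightarrow>
    (\<exists>r>0. \<exists>\<rho>>0. \<forall>l\<in>sphere_frequencies TYPE('a). \<forall>z\<in>sphere 0 1.
       (measure sphere_volume (A l \<inter> geodesic_ball z (r / l)) +
        measure sphere_volume (A l \<inter> geodesic_ball (- z) (r / l)))
       / measure sphere_volume (geodesic_ball z (r / l)) \<ge> \<rho>)"

end

theory Submission
  imports Defs "HOL-Complex_Analysis.Complex_Analysis" "HOL-Real_Asymp.Real_Asymp"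
begin

text \<open>
  Write \<open>n = m + 1\<close>. Both directions rest on one fact. If \<open>e\<close> is an eigenfunction with \<open>l\<^sup>2 = s (s
  + n - 2)\<close>, \<open>s > 0\<close>, then its homogeneous extension \<open>H y = norm y powr s * e (sgn y)\<close> is harmonic
  off the origin, and the origin is a removable singularity (\<open>eigenfunction_harmonic_extension\<close>).
  Harmonicity is used in the form of a mean value property over balls with a smooth radial weight;
  it makes all directional derivatives computable from the values on a ball, with Cauchy-type
  bounds (\<open>norm_iterated_deriv_le\<close>). Comparing these bounds with the homogeneity of \<open>H\<close> on very
  small and very large balls leaves a single Taylor term at the origin: \<open>s\<close> is a natural number
  \<open>k\<close> and \<open>H (- y) = (- 1) ^ k * H y\<close> (\<open>homogeneous_harmonic_degree\<close>). So the absolute value of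
  \<open>e\<close> is even, which is why density only has to hold after adding up antipodal balls.

  Density is sufficient. Since \<open>k\<close> and \<open>l\<close> are comparable, at scale \<open>1 / k\<close> everything takes place
  in the shell \<open>1 - 1 / (2 k) < norm x < 1\<close> of \<open>\<real>\<^sup>n\<close>, where \<open>H\<close> and \<open>e \<circ> sgn\<close> have comparable
  absolute values, and a set on the sphere is replaced by the solid cone over it. Call \<open>x\<close> good if
  the integral of \<open>\<bar>H\<bar> powr p\<close> over a ball of radius \<open>O(1 / k)\<close> at \<open>x\<close> is at most a large constant
  times \<open>\<bar>H x\<bar> powr p / k ^ n\<close>. By Fubini and homogeneity the bad points carry little of the \<open>L\<^sup>p\<close>
  mass. At a good point, \<open>H\<close> rescaled and divided by \<open>H x\<close> has value 1 at the centre and a bound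
  independent of \<open>k\<close>; on each ray it extends holomorphically to a disc, so a normal family
  argument shows that it is small only on a set of small measure (\<open>sublevel_measure_harmonic\<close>). A
  set of positive density near \<open>x\<close> or near \<open>- x\<close> therefore sees a fixed fraction of \<open>\<bar>H x\<bar> powr p
  / k ^ n\<close> (\<open>local_logvinenko_sereda\<close>), and integrating over good points gives
  \<open>solid_logvinenko_sereda\<close>.

  Density is necessary. For each frequency and each point \<open>z\<close> there is a zonal eigenfunction, a
  polynomial of degree \<open>k\<close> in \<open>x \<bullet> z\<close>. Two monotone energies of its differential equation show
  that it is of size 1 on the ball of radius \<open>1 / (2 l)\<close> at \<open>z\<close> and that at angle \<open>\<theta>\<close> from \<open>z\<close> and
  \<open>- z\<close> it is at most a constant times \<open>(l \<theta>) powr (- (m - 1) / 2)\<close> (\<open>zonal_ode_bounds\<close>). The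
  \<open>p\<close>-th power of this decay is summable over dyadic shells, whose volumes grow like the \<open>m\<close>-th
  power of \<open>\<theta>\<close>, exactly when \<open>p (m - 1) / 2 > m\<close>. Hence, up to a small fraction, the whole \<open>L\<^sup>p\<close>
  mass sits in the balls of radius \<open>r / l\<close> at \<open>z\<close> and \<open>- z\<close>, and the inequality for this one
  function forces \<open>A l\<close> to have positive density there.
\<close>

section \<open>Integration on Euclidean space\<close>

lemma nn_integral_lborel_affine:
  fixes f :: "'a::euclidean_space \<Rightarrow> ennreal"
  assumes [measurable]: "f \<in> borel_measurable borel" and c: "c \<noteq> 0"
  shows "(\<integral>\<^sup>+x. f x \<partial>lborel) = ennreal (\<bar>c\<bar> ^ DIM('a)) * (\<integral>\<^sup>+x. f (t + c *\<^sub>R x) \<partial>lborel)"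
  by (subst lborel_affine[OF c, of t])
     (simp add: nn_integral_density nn_integral_distr nn_integral_cmult)

lemma lborel_integral_affine:
  fixes f :: "'a::euclidean_space \<Rightarrow> 'b::{banach, second_countable_topology}"
  assumes [measurable]: "f \<in> borel_measurable borel" and c: "c \<noteq> 0"
  shows "(\<integral>x. f x \<partial>lborel) = (\<bar>c\<bar> ^ DIM('a)) *\<^sub>R (\<integral>x. f (t + c *\<^sub>R x) \<partial>lborel)"
  by (subst lborel_affine[OF c, of t])
     (simp add: integral_density integral_distr)

lemma lborel_integral_translation:
  fixes f :: "'a::euclidean_space \<Rightarrow> 'b::{banach, second_countable_topology}"
  assumes "f \<in> borel_measurable borel"
  shows "(\<integral>x. f (t + x) \<partial>lborel) = (\<integral>x. f x \<partial>lborel)"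
  using lborel_integral_affine[OF assms, of 1 t] by simp

lemma integrable_continuous_compact_support:
  fixes f :: "'a::euclidean_space \<Rightarrow> 'b::{banach, second_countable_topology}"
  assumes "continuous_on UNIV f" "\<And>x. x \<notin> cball a R \<Longrightarrow> f x = 0"
  shows "integrable lborel f"
proof -
  have "integrable lborel (\<lambda>x. indicator (cball a R) x *\<^sub>R f x)"
    by (rule borel_integrable_compact) (auto intro: continuous_on_subset[OF assms(1)])
  moreover have "(\<lambda>x. indicator (cball a R) x *\<^sub>R f x) = f"
    using assms(2) by (auto simp: indicator_def fun_eq_iff)
  ultimately show ?thesis by simp
qed

text \<open>The form of the derivative that passes directly to limits of integrals.\<close>

lemma has_vector_derivative_iff_quotient:
  fixes f :: "real \<Rightarrow> 'b::real_normed_vector"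
  shows "(f has_vector_derivative D) (at t) \<longleftrightarrow> ((\<lambda>s. (f s - f t) /\<^sub>R (s - t)) \<longlongrightarrow> D) (at t)"
proof -
  have "((\<lambda>s. (f s - f t - (s - t) *\<^sub>R D) /\<^sub>R \<bar>s - t\<bar>) \<longlongrightarrow> 0) (at t) \<longleftrightarrow>
        ((\<lambda>s. (f s - f t) /\<^sub>R (s - t) - D) \<longlongrightarrow> 0) (at t)" (is "?L \<longleftrightarrow> ?R")
  proof -
    have "?L \<longleftrightarrow> ((\<lambda>s. norm ((f s - f t - (s - t) *\<^sub>R D) /\<^sub>R \<bar>s - t\<bar>)) \<longlongrightarrow> 0) (at t)"
      by (rule tendsto_norm_zero_iff[symmetric])
    also have "\<dots> \<longleftrightarrow> ((\<lambda>s. norm ((f s - f t) /\<^sub>R (s - t) - D)) \<longlongrightarrow> 0) (at t)"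
    proof (rule tendsto_cong)
      show "\<forall>\<^sub>F s in at t. norm ((f s - f t - (s - t) *\<^sub>R D) /\<^sub>R \<bar>s - t\<bar>) = norm ((f s - f t) /\<^sub>R (s - t) - D)"
      proof (rule eventually_at_ball'[OF zero_less_one, THEN eventually_mono], clarify)
        fix s :: real assume "s \<noteq> t"
        then have "(f s - f t) /\<^sub>R (s - t) - D = (f s - f t - (s - t) *\<^sub>R D) /\<^sub>R (s - t)"
          by (simp add: scaleR_diff_right)
        then show "norm ((f s - f t - (s - t) *\<^sub>R D) /\<^sub>R \<bar>s - t\<bar>) = norm ((f s - f t) /\<^sub>R (s - t) - D)"
          by simp
      qed
    qed
    also have "\<dots> \<longleftrightarrow> ?R" by (rule tendsto_norm_zero_iff)
    finally show ?thesis .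
  qed
  then show ?thesis
    by (simp add: has_vector_derivative_def has_derivative_at_within bounded_linear_scaleR_left
        LIM_zero_iff diff_diff_eq add.commute)
qed

text \<open>
  Difference quotients are dominated by \<open>g\<close> through the mean value inequality, so dominated
  convergence applies along every sequence tending to \<open>t0\<close>.
\<close>

lemma has_vector_derivative_integral_dominated:
  fixes f f' :: "real \<Rightarrow> 'a \<Rightarrow> 'b::{banach, second_countable_topology}"
  assumes "d > 0"
    and der: "\<And>t y. \<bar>t - t0\<bar> < d \<Longrightarrow> ((\<lambda>t. f t y) has_vector_derivative f' t y) (at t)"
    and int: "\<And>t. \<bar>t - t0\<bar> < d \<Longrightarrow> integrable M (f t)"
    and bound: "\<And>t y. \<bar>t - t0\<bar> < d \<Longrightarrow> norm (f' t y) \<le> g y"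
    and g: "integrable M g"
  shows "((\<lambda>t. \<integral>y. f t y \<partial>M) has_vector_derivative (\<integral>y. f' t0 y \<partial>M)) (at t0)"
    and "integrable M (f' t0)"
proof -
  have main: "((\<lambda>i. ((\<integral>y. f (X i) y \<partial>M) - (\<integral>y. f t0 y \<partial>M)) /\<^sub>R (X i - t0)) \<longlonglongrightarrow> (\<integral>y. f' t0 y \<partial>M))
     \<and> integrable M (f' t0)"
    if X: "\<And>i. X i \<noteq> t0" "\<And>i. \<bar>X i - t0\<bar> < d" "X \<longlonglongrightarrow> t0" for X
  proof -
    define q where "q i y = (f (X i) y - f t0 y) /\<^sub>R (X i - t0)" for i y
    have intq: "integrable M (q i)" for i
      unfolding q_def using int[of "X i"] int[of t0] X(2) \<open>d > 0\<close> by auto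
    have lim: "(\<lambda>i. q i y) \<longlonglongrightarrow> f' t0 y" for y
    proof -
      have "((\<lambda>s. (f s y - f t0 y) /\<^sub>R (s - t0)) \<longlongrightarrow> f' t0 y) (at t0)"
        using der[of t0 y] \<open>d > 0\<close> by (simp add: has_vector_derivative_iff_quotient)
      then show ?thesis
        unfolding q_def using X by (auto simp: tendsto_at_iff_sequentially o_def)
    qed
    have meas: "f' t0 \<in> borel_measurable M"
      by (rule borel_measurable_LIMSEQ_metric[of q]) (use intq lim in auto)
    have qb: "norm (q i y) \<le> g y" for i y
    proof -
      have "norm (f (X i) y - f t0 y) \<le> \<bar>X i - t0\<bar> * g y"
      proof -
        have cv: "convex {t. \<bar>t - t0\<bar> < d}"
        proof -
          have "{t. \<bar>t - t0\<bar> < d} = ball t0 d" by (auto simp: dist_real_def)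
          then show ?thesis by simp
        qed
        have "norm (f (X i) y - f t0 y) \<le> g y * norm (X i - t0)"
        proof (rule differentiable_bound[OF cv, of _ "\<lambda>t h. h *\<^sub>R f' t y"])
          fix t assume t: "t \<in> {t. \<bar>t - t0\<bar> < d}"
          show "((\<lambda>t. f t y) has_derivative (\<lambda>h. h *\<^sub>R f' t y)) (at t within {t. \<bar>t - t0\<bar> < d})"
            using der[of t y] t by (simp add: has_vector_derivative_def has_derivative_at_withinI)
          show "onorm (\<lambda>h. h *\<^sub>R f' t y) \<le> g y"
            using bound[of t y] t
            by (intro onorm_le) (auto simp: mult.commute intro!: mult_left_mono)
        qed (use X \<open>d > 0\<close> in auto)
        then show ?thesis by (simp add: mult.commute)
      qed
      then show ?thesis
        using X(1)[of i] by (simp add: q_def divide_simps mult.commute)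
    qed
    have "(\<lambda>i. \<integral>y. q i y \<partial>M) \<longlonglongrightarrow> (\<integral>y. f' t0 y \<partial>M)"
      by (rule integral_dominated_convergence[where w=g]) (use meas intq lim qb g in auto)
    moreover have "(\<integral>y. q i y \<partial>M) = ((\<integral>y. f (X i) y \<partial>M) - (\<integral>y. f t0 y \<partial>M)) /\<^sub>R (X i - t0)" for i
      unfolding q_def using int[of "X i"] int[of t0] X(2) \<open>d > 0\<close> by simp
    moreover have "integrable M (f' t0)"
      by (rule integrable_dominated_convergence[where w=g and s=q]) (use meas intq lim qb g in auto)
    ultimately show ?thesis by simp
  qed
  show "integrable M (f' t0)"
  proof -
    have "(\<lambda>i. t0 + d / (2 + real i)) \<longlonglongrightarrow> t0"
      by real_asymp
    then show ?thesis
      using main[of "\<lambda>i. t0 + d / (2 + real i)"] \<open>d > 0\<close> by (simp add: divide_simps add_pos_nonneg)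
  qed
  show "((\<lambda>t. \<integral>y. f t y \<partial>M) has_vector_derivative (\<integral>y. f' t0 y \<partial>M)) (at t0)"
    unfolding has_vector_derivative_iff_quotient tendsto_at_iff_sequentially o_def
  proof (intro allI impI)
    fix X :: "nat \<Rightarrow> real" assume X: "\<forall>i. X i \<in> UNIV - {t0}" "X \<longlonglongrightarrow> t0"
    obtain N where N: "\<And>i. i \<ge> N \<Longrightarrow> \<bar>X i - t0\<bar> < d"
      using X(2) \<open>d > 0\<close> by (auto simp: LIMSEQ_def dist_real_def)
    have "(\<lambda>i. ((\<integral>y. f (X (i + N)) y \<partial>M) - (\<integral>y. f t0 y \<partial>M)) /\<^sub>R (X (i + N) - t0)) \<longlonglongrightarrow> (\<integral>y. f' t0 y \<partial>M)"
      by (rule conjunct1[OF main]) (use X N in \<open>auto simp: LIMSEQ_ignore_initial_segment\<close>)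
    then show "(\<lambda>i. ((\<integral>y. f (X i) y \<partial>M) - (\<integral>y. f t0 y \<partial>M)) /\<^sub>R (X i - t0)) \<longlonglongrightarrow> (\<integral>y. f' t0 y \<partial>M)"
      by (rule LIMSEQ_offset)
  qed
qed

text \<open>
  The integral of \<open>G (y + t v)\<close> does not depend on \<open>t\<close>, by translation invariance; differentiate
  under the integral sign. This is the only form of integration by parts that is used.
\<close>

lemma integral_directional_derivative_eq_0:
  fixes G G' :: "'a::euclidean_space \<Rightarrow> 'b::{banach, second_countable_topology}"
  assumes der: "\<And>y. ((\<lambda>t. G (y + t *\<^sub>R v)) has_vector_derivative G' y) (at 0)"
    and cont: "continuous_on UNIV G"
    and bound: "\<And>y. norm (G' y) \<le> B"
    and supp: "\<And>y. y \<notin> cball a R \<Longrightarrow> G y = 0"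
  shows "(\<integral>y. G' y \<partial>lborel) = 0" and "integrable lborel G'"
proof -
  define S where "S = cball a (R + norm v)"
  have der': "((\<lambda>t. G (y + t *\<^sub>R v)) has_vector_derivative G' (y + t *\<^sub>R v)) (at t)" for t y
  proof -
    have "((\<lambda>t. G (y + t *\<^sub>R v)) has_vector_derivative G' (y + t *\<^sub>R v)) (at t) \<longleftrightarrow>
      ((\<lambda>s. G ((y + t *\<^sub>R v) + s *\<^sub>R v)) has_vector_derivative G' (y + t *\<^sub>R v)) (at 0)"
      unfolding has_vector_derivative_iff_quotient
      using LIM_offset_zero_iff[of t "\<lambda>s. (G (y + s *\<^sub>R v) - G (y + t *\<^sub>R v)) /\<^sub>R (s - t)" "G' (y + t *\<^sub>R v)"]
      by (simp add: scaleR_add_left add.assoc)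
    then show ?thesis using der by blast
  qed
  have G'0: "G' y = 0" if "y \<notin> cball a R" for y
  proof -
    have "((\<lambda>t::real. 0::'b) has_vector_derivative G' y) (at 0)"
    proof (rule has_vector_derivative_transform_within_open[OF der[of y]])
      show "open ((\<lambda>t. y + t *\<^sub>R v) -` (- cball a R))"
        by (intro continuous_open_vimage) (auto intro!: continuous_intros)
    qed (use that supp in auto)
    then show ?thesis
      using vector_derivative_unique_at has_vector_derivative_const by blast
  qed
  have bd: "norm (G' (y + t *\<^sub>R v)) \<le> indicator S y * B" if "\<bar>t - 0\<bar> < 1" for t y
  proof (cases "y \<in> S")
    case False
    have "norm (t *\<^sub>R v) \<le> norm v" using that mult_right_mono[of "\<bar>t\<bar>" 1 "norm v"] by simp
    then have "y + t *\<^sub>R v \<notin> cball a R" using False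
      unfolding S_def using norm_triangle_ineq4[of "a - y - t *\<^sub>R v" "- t *\<^sub>R v"] norm_triangle_ineq[of "a - y - t *\<^sub>R v" "t *\<^sub>R v"]
      by (simp add: dist_norm algebra_simps)
    then show ?thesis using False G'0 by simp
  qed (use bound in auto)
  have int: "integrable lborel (\<lambda>y. G (y + t *\<^sub>R v))" for t
  proof (rule integrable_continuous_compact_support)
    show "continuous_on UNIV (\<lambda>y. G (y + t *\<^sub>R v))"
      by (rule continuous_on_compose2[OF cont]) (auto intro!: continuous_intros)
    show "G (x + t *\<^sub>R v) = 0" if "x \<notin> cball (a - t *\<^sub>R v) R" for x
      using that supp by (auto simp: dist_norm algebra_simps)
  qed
  have gi: "integrable lborel (\<lambda>y. indicator S y * B)"
    unfolding S_def using borel_integrable_compact[of "cball a (R + norm v)" "\<lambda>_. B"] by simp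
  note L = has_vector_derivative_integral_dominated[of 1 0 "\<lambda>t y. G (y + t *\<^sub>R v)" "\<lambda>t y. G' (y + t *\<^sub>R v)" lborel,
      OF zero_less_one der' int bd gi]
  have "(\<integral>y. G (y + t *\<^sub>R v) \<partial>lborel) = (\<integral>y. G y \<partial>lborel)" for t
    using lborel_integral_translation[of G "t *\<^sub>R v"] borel_measurable_continuous_onI[OF cont]
    by (simp add: add.commute)
  then have "((\<lambda>t. \<integral>y. G y \<partial>lborel) has_vector_derivative (\<integral>y. G' (y + 0 *\<^sub>R v) \<partial>lborel)) (at 0)"
    using L(1) by simp
  from vector_derivative_unique_at[OF this has_vector_derivative_const]
  show "(\<integral>y. G' y \<partial>lborel) = 0" by simp
  show "integrable lborel G'" using L(2) by simp
qed

text \<open>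
  On the shell \<open>2 ^ (- j - 1) \<le> norm y < 2 ^ (- j)\<close> the integrand is at most \<open>4 ^ (j + 1)\<close>, while
  the volume of the ball of radius \<open>2 ^ (- j)\<close> is proportional to \<open>2 ^ (- n j)\<close> with \<open>n \<ge> 3\<close>; the
  products are summable.
\<close>

lemma integrable_inverse_norm_square_on_ball:
  assumes "DIM('a::euclidean_space) \<ge> 3"
  shows "integrable lborel (\<lambda>y::'a. indicator (ball 0 1) y * (1 / (norm y)\<^sup>2))"
proof -
  let ?n = "DIM('a)"
  let ?f = "\<lambda>y::'a. indicator (ball 0 1) y * (1 / (norm y)\<^sup>2) :: real"
  let ?m = "emeasure lborel (ball (0::'a) 1)"
  have le: "ennreal (?f y) \<le> (\<Sum>j. ennreal (4 ^ (j + 1)) * indicator (ball (0::'a) (1 / 2 ^ j)) y)" (is "_ \<le> suminf ?g") for y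
  proof (cases "y \<in> ball 0 1 \<and> y \<noteq> 0")
    case True
    then have n: "0 < norm y" "norm y < 1" by auto
    obtain j0 where "1 / 2 ^ j0 \<le> norm y"
      using real_arch_pow_inv[OF n(1), of "1/2"] by (auto simp: power_one_over intro: less_imp_le)
    define j where "j = (LEAST j. 1 / 2 ^ j \<le> norm y)"
    have j: "1 / 2 ^ j \<le> norm y" unfolding j_def by (rule LeastI) fact
    have "j \<noteq> 0" using j n by (intro notI) simp
    then obtain i where i: "j = Suc i" by (cases j) auto
    have yi: "norm y < 1 / 2 ^ i" using not_less_Least[of i "\<lambda>j. 1 / 2 ^ j \<le> norm y"] i j_def by auto
    have "1 / (norm y)\<^sup>2 \<le> 1 / (1 / 2 ^ j)\<^sup>2"
      using j n by (intro divide_left_mono power_mono mult_pos_pos) auto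
    also have "\<dots> = 4 ^ (i + 1)" using i by (simp add: power2_eq_square power_mult_distrib[symmetric] flip: power_add)
    finally have 1: "ennreal (?f y) \<le> ?g i" using True yi by (simp add: ennreal_leI indicator_def)
    have "sum ?g {i} \<le> suminf ?g"
      by (rule sum_le_suminf) auto
    then have "?g i \<le> suminf ?g"
      by (subst (asm) sum.insert) (simp_all del: sum_mult_indicator)
    with 1 show ?thesis by (rule order_trans)
  next
    case False
    then have "ennreal (?f y) = 0" by (auto simp: indicator_def)
    then show ?thesis by (metis zero_le)
  qed
  have em: "emeasure lborel (ball (0::'a) (1 / 2 ^ j)) = ennreal ((1 / 2 ^ j) ^ ?n) * ?m" for j
  proof -
    have "emeasure lborel (ball (0::'a) (1 / 2 ^ j)) = (\<integral>\<^sup>+y. indicator (ball (0::'a) (1 / 2 ^ j)) y \<partial>lborel)"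
      by simp
    also have "\<dots> = ennreal ((1 / 2 ^ j) ^ ?n) * (\<integral>\<^sup>+y. indicator (ball (0::'a) (1 / 2 ^ j)) (0 + (1 / 2 ^ j) *\<^sub>R y) \<partial>lborel)"
      by (subst nn_integral_lborel_affine[of _ "1 / 2 ^ j" 0]) (auto intro!: borel_measurable_indicator)
    also have "(\<lambda>y. indicator (ball (0::'a) (1 / 2 ^ j)) (0 + (1 / 2 ^ j) *\<^sub>R y)) = (indicator (ball 0 1) :: 'a \<Rightarrow> ennreal)"
      by (auto simp: fun_eq_iff indicator_def field_simps)
    finally show ?thesis by simp
  qed
  have "(\<integral>\<^sup>+y. ennreal (?f y) \<partial>lborel) \<le> (\<integral>\<^sup>+y. (\<Sum>j. ennreal (4 ^ (j + 1)) * indicator (ball (0::'a) (1 / 2 ^ j)) y) \<partial>lborel)"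
    by (intro nn_integral_mono le)
  also have "\<dots> = (\<Sum>j. \<integral>\<^sup>+y. ennreal (4 ^ (j + 1)) * indicator (ball (0::'a) (1 / 2 ^ j)) y \<partial>lborel)"
    by (rule nn_integral_suminf) (intro borel_measurable_times_ennreal borel_measurable_const borel_measurable_indicator; simp)
  also have "\<dots> = (\<Sum>j. ennreal (4 ^ (j + 1)) * (ennreal ((1 / 2 ^ j) ^ ?n) * ?m))"
    by (simp add: nn_integral_cmult_indicator em)
  also have "\<dots> \<le> (\<Sum>j. ennreal (4 * (1 / 2) ^ j) * ?m)"
  proof (rule suminf_le)
    fix j
    have "(1 / 2 ^ j :: real) ^ ?n \<le> (1 / 2 ^ j) ^ 3"
      using assms by (intro power_decreasing) auto
    then have "4 ^ (j + 1) * (1 / 2 ^ j :: real) ^ ?n \<le> 4 ^ (j + 1) * (1 / 2 ^ j) ^ 3"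
      by (intro mult_left_mono) auto
    also have "\<dots> = 4 * (1 / 2) ^ j"
    proof -
      have "(4::real) ^ j = 2 ^ j * 2 ^ j" by (simp flip: power_mult_distrib)
      then show ?thesis by (simp add: power_one_over power3_eq_cube field_simps)
    qed
    finally have "ennreal (4 ^ (j + 1)) * ennreal ((1 / 2 ^ j) ^ ?n) \<le> ennreal (4 * (1 / 2) ^ j)"
      by (simp add: ennreal_mult[symmetric] ennreal_leI)
    then show "ennreal (4 ^ (j + 1)) * (ennreal ((1 / 2 ^ j) ^ ?n) * ?m) \<le> ennreal (4 * (1 / 2) ^ j) * ?m"
      by (simp add: mult.assoc[symmetric] mult_right_mono)
  qed auto
  also have "\<dots> = ennreal 8 * ?m"
  proof -
    have "(\<lambda>j. 4 * (1 / 2) ^ j :: real) sums (4 * (1 / (1 - 1/2)))"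
      by (intro sums_mult geometric_sums) simp
    then have "(\<Sum>j. ennreal (4 * (1 / 2) ^ j)) = ennreal 8"
      by (intro suminf_ennreal_eq) auto
    then show ?thesis by simp
  qed
  also have "\<dots> < \<infinity>"
    using emeasure_lborel_ball_finite[of "0::'a" 1] by (simp add: ennreal_mult_less_top)
  finally have fin: "(\<integral>\<^sup>+y. ennreal (?f y) \<partial>lborel) < \<infinity>" .
  have "?f \<in> borel_measurable lborel"
    by (intro borel_measurable_times borel_measurable_indicator) auto
  then show ?thesis
    by (rule integrableI_nonneg[OF _ _ fin]) auto
qed

section \<open>A Green identity for radial cut-offs\<close>

text \<open>
  A named predicate rather than the derivative along a line spelled out, so that product and chain
  rules can be applied by first-order unification.
\<close>

definition has_dir_deriv :: "('a::euclidean_space \<Rightarrow> complex) \<Rightarrow> 'a \<Rightarrow> 'a \<Rightarrow> complex \<Rightarrow> bool"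
  where "has_dir_deriv f v y D \<longleftrightarrow> ((\<lambda>t. f (y + t *\<^sub>R v)) has_vector_derivative D) (at 0)"

lemma has_dir_deriv_const: "has_dir_deriv (\<lambda>_. c) v y 0"
  by (simp add: has_dir_deriv_def)

lemma has_dir_deriv_add:
  "has_dir_deriv f v y f' \<Longrightarrow> has_dir_deriv g v y g' \<Longrightarrow> has_dir_deriv (\<lambda>y. f y + g y) v y (f' + g')"
  unfolding has_dir_deriv_def by (rule has_vector_derivative_add)

lemma has_dir_deriv_diff:
  "has_dir_deriv f v y f' \<Longrightarrow> has_dir_deriv g v y g' \<Longrightarrow> has_dir_deriv (\<lambda>y. f y - g y) v y (f' - g')"
  unfolding has_dir_deriv_def by (rule has_vector_derivative_diff)

lemma has_dir_deriv_mult: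
  assumes "has_dir_deriv f v y f'" "has_dir_deriv g v y g'"
  shows "has_dir_deriv (\<lambda>y. f y * g y) v y (f y * g' + f' * g y)"
  using has_vector_derivative_mult[OF assms[unfolded has_dir_deriv_def]] by (simp add: has_dir_deriv_def)

text \<open>
  Powers of the positive part are the source of all compactly supported test functions and weights
  below.
\<close>

lemma DERIV_pos_part_power:
  "((\<lambda>t. max 0 t ^ (N + 2)) has_real_derivative real (N + 2) * max 0 t ^ (N + 1)) (at t)"
proof -
  consider "t < 0" | "t = 0" | "t > 0" by linarith
  then show ?thesis
  proof cases
    case 1
    have "((\<lambda>t. 0) has_real_derivative 0) (at t)" by simp
    then have "((\<lambda>t. max 0 t ^ (N + 2)) has_real_derivative 0) (at t)"
      by (rule has_field_derivative_transform_within_open[of _ _ _ "{..<0}"]) (use 1 in auto)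
    then show ?thesis using 1 by (simp add: max_def)
  next
    case 3
    have "((\<lambda>t. t ^ (N + 2)) has_real_derivative real (N + 2) * t ^ (N + 1)) (at t)"
      using DERIV_pow[of "N + 2" t UNIV] by simp
    then have "((\<lambda>t. max 0 t ^ (N + 2)) has_real_derivative real (N + 2) * t ^ (N + 1)) (at t)"
      by (rule has_field_derivative_transform_within_open[of _ _ _ "{0<..}"]) (use 3 in auto)
    then show ?thesis using 3 by (simp add: max_def)
  next
    case 2
    have "continuous_on UNIV (\<lambda>z::real. max 0 z ^ (N + 1))" by (intro continuous_intros)
    then have "isCont (\<lambda>z::real. max 0 z ^ (N + 1)) 0" by (simp add: continuous_on_eq_continuous_at)
    then have "((\<lambda>t. max 0 t ^ (N + 2)) has_real_derivative 0) (at (0::real))"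
      unfolding CARAT_DERIV
      by (intro exI[of _ "\<lambda>z. max 0 z ^ (N + 1)"]) (auto simp: max_def)
    then show ?thesis using 2 by simp
  qed
qed

text \<open>
  Differentiates a function of the squared distance to \<open>c\<close>; the squared distance, unlike the
  distance, is smooth at \<open>c\<close>.
\<close>

lemma has_dir_deriv_radial:
  assumes "(g has_real_derivative g') (at ((norm (y - c))\<^sup>2))"
  shows "has_dir_deriv (\<lambda>y. complex_of_real (g ((norm (y - c))\<^sup>2))) b y (of_real (2 * g' * ((y - c) \<bullet> b)))"
proof -
  have "((\<lambda>t. (norm (y + t *\<^sub>R b - c))\<^sup>2) has_real_derivative 2 * ((y - c) \<bullet> b)) (at 0)"
  proof -
    have "(norm (w + t *\<^sub>R b))\<^sup>2 = (norm w)\<^sup>2 + 2 * t * (w \<bullet> b) + t\<^sup>2 * (b \<bullet> b)" for w t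
      unfolding power2_norm_eq_inner
      by (simp add: inner_add_left inner_add_right inner_commute[of b w] power2_eq_square distrib_left)
    then have "(\<lambda>t. (norm (y + t *\<^sub>R b - c))\<^sup>2) = (\<lambda>t. (norm (y - c))\<^sup>2 + 2 * t * ((y - c) \<bullet> b) + t\<^sup>2 * (b \<bullet> b))"
      by (simp only: diff_add_eq[symmetric])
    then show ?thesis by (auto intro!: derivative_eq_intros)
  qed
  from DERIV_chain2[of g g' "\<lambda>t. (norm (y + t *\<^sub>R b - c))\<^sup>2", OF _ this]
  have "((\<lambda>t. g ((norm (y + t *\<^sub>R b - c))\<^sup>2)) has_real_derivative g' * (2 * ((y - c) \<bullet> b))) (at 0)"
    using assms by simp
  then show ?thesis
    using has_vector_derivative_of_real[of _ "2 * g' * ((y - c) \<bullet> b)" "at 0"]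
    by (simp add: has_dir_deriv_def mult_ac)
qed

lemma has_dir_deriv_inner:
  "has_dir_deriv (\<lambda>y. complex_of_real ((y - c) \<bullet> b)) b y (of_real (b \<bullet> b))"
proof -
  have "((\<lambda>t. (y + t *\<^sub>R b - c) \<bullet> b) has_real_derivative b \<bullet> b) (at 0)"
    unfolding inner_simps by (auto intro!: derivative_eq_intros)
  then show ?thesis unfolding has_dir_deriv_def by (rule has_vector_derivative_of_real)
qed


lemma has_dir_deriv_transform:
  assumes "has_dir_deriv f v y f'" "open S" "y \<in> S" "\<And>z. z \<in> S \<Longrightarrow> f z = g z"
  shows "has_dir_deriv g v y f'"
  unfolding has_dir_deriv_def
proof (rule has_vector_derivative_transform_within_open[OF assms(1)[unfolded has_dir_deriv_def]])
  show "open ((\<lambda>t. y + t *\<^sub>R v) -` S)"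
    by (rule open_vimage[OF assms(2)]) (auto intro!: continuous_intros)
qed (use assms in auto)

text \<open>A radial factor that vanishes near the origin removes any singularity of \<open>f\<close> there.\<close>

lemma continuous_on_cutoff_at_0:
  fixes f :: "'a::euclidean_space \<Rightarrow> complex"
  assumes "continuous_on (- {0}) f" "continuous_on UNIV g" "\<And>\<tau>. \<tau> \<le> d \<Longrightarrow> g \<tau> = 0" "d > 0"
  shows "continuous_on UNIV (\<lambda>y. complex_of_real (g ((norm y)\<^sup>2)) * f y)"
proof -
  have "continuous_on (- {0} \<union> ball 0 (sqrt d)) (\<lambda>y. complex_of_real (g ((norm y)\<^sup>2)) * f y)"
  proof (rule continuous_on_open_Un)
    show "continuous_on (- {0}) (\<lambda>y. complex_of_real (g ((norm y)\<^sup>2)) * f y)"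
      by (intro continuous_intros assms(1) continuous_on_compose2[OF assms(2)]) auto
    have "complex_of_real (g ((norm y)\<^sup>2)) * f y = 0" if "y \<in> ball 0 (sqrt d)" for y
    proof -
      have "(norm y)\<^sup>2 \<le> (sqrt d)\<^sup>2" using that by (intro power_mono) auto
      then show ?thesis using assms(3,4) by simp
    qed
    then show "continuous_on (ball 0 (sqrt d)) (\<lambda>y. complex_of_real (g ((norm y)\<^sup>2)) * f y)"
      by (subst continuous_on_cong[OF refl, where g="\<lambda>_. 0"]) auto
  qed auto
  moreover have "- {0} \<union> ball 0 (sqrt d) = (UNIV :: 'a set)" using assms(4) by auto
  ultimately show ?thesis by simp
qed

lemma bounded_continuous_compact_support:
  fixes f :: "'a::euclidean_space \<Rightarrow> 'b::real_normed_vector"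
  assumes "continuous_on UNIV f" "\<And>x. x \<notin> cball a R \<Longrightarrow> f x = 0"
  obtains B where "\<And>y. norm (f y) \<le> B"
proof -
  have "bounded (f ` cball a R)"
    by (intro compact_imp_bounded compact_continuous_image continuous_on_subset[OF assms(1)]) auto
  then obtain B where "\<And>z. z \<in> f ` cball a R \<Longrightarrow> norm z \<le> B"
    unfolding bounded_iff by blast
  then have "norm (f y) \<le> max 0 B" for y
    using assms(2)[of y] by (cases "y \<in> cball a R") (auto simp: le_max_iff_disj simp del: mem_cball)
  then show thesis by (rule that)
qed

lemma bounded_on_cball:
  fixes h :: "'a::euclidean_space \<Rightarrow> complex"
  assumes "continuous_on UNIV h"
  obtains B where "B > 0" "\<And>y. y \<in> cball x R \<Longrightarrow> norm (h y) \<le> B"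
proof -
  have "bounded (h ` cball x R)"
    by (intro compact_imp_bounded compact_continuous_image continuous_on_subset[OF assms]) auto
  then obtain B where "\<And>y. y \<in> cball x R \<Longrightarrow> norm (h y) \<le> B" unfolding bounded_iff by blast
  then have "\<And>y. y \<in> cball x R \<Longrightarrow> norm (h y) \<le> max 1 B" by (simp add: le_max_iff_disj)
  then show thesis by (intro that[of "max 1 B"]) auto
qed

lemma sum_inner_Basis_squared: "(\<Sum>b\<in>Basis. (z \<bullet> b)\<^sup>2) = (norm z)\<^sup>2" for z :: "'a::euclidean_space"
  unfolding power2_norm_eq_inner using euclidean_inner[of z z] by (simp add: power2_eq_square)

text \<open>
  With \<open>u = g0 (norm y ^ 2) F\<close> and \<open>p = h0 (norm (y - x) ^ 2)\<close> the fields \<open>u D\<^sub>b p - p D\<^sub>b u\<close> are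
  compactly supported and have integrable derivatives along \<open>b\<close>, whose integrals vanish. Summing
  over the basis gives the equality of the integrals of \<open>u \<Delta>p\<close> and \<open>p \<Delta>u\<close>. The hypotheses on \<open>F\<close>
  (no radial derivative, Laplacian \<open>- L F / norm y ^ 2\<close>) turn \<open>\<Delta>u\<close> into an ordinary differential
  expression in \<open>g0\<close> times \<open>F\<close>.
\<close>

lemma green_identity_radial:
  fixes F :: "'a::euclidean_space \<Rightarrow> complex" and D1 D2 :: "'a \<Rightarrow> 'a \<Rightarrow> complex"
  assumes F: "\<And>b y. b \<in> Basis \<Longrightarrow> y \<noteq> 0 \<Longrightarrow> has_dir_deriv F b y (D1 b y)"
    "\<And>b y. b \<in> Basis \<Longrightarrow> y \<noteq> 0 \<Longrightarrow> has_dir_deriv (D1 b) b y (D2 b y)"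
    and cont: "continuous_on (- {0}) F" "\<And>b. b \<in> Basis \<Longrightarrow> continuous_on (- {0}) (D1 b)"
      "\<And>b. b \<in> Basis \<Longrightarrow> continuous_on (- {0}) (D2 b)"
    and rad: "\<And>y. y \<noteq> 0 \<Longrightarrow> (\<Sum>b\<in>Basis. of_real (y \<bullet> b) * D1 b y) = 0"
    and lap: "\<And>y. y \<noteq> 0 \<Longrightarrow> (\<Sum>b\<in>Basis. D2 b y) = - of_real (L / (norm y)\<^sup>2) * F y"
    and g: "\<And>\<tau>. (g0 has_real_derivative g1 \<tau>) (at \<tau>)" "\<And>\<tau>. (g1 has_real_derivative g2 \<tau>) (at \<tau>)"
      "continuous_on UNIV g2" "\<And>\<tau>. \<tau> \<le> d \<Longrightarrow> g0 \<tau> = 0 \<and> g1 \<tau> = 0 \<and> g2 \<tau> = 0" "d > 0"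
    and h: "\<And>\<tau>. (h0 has_real_derivative h1 \<tau>) (at \<tau>)" "\<And>\<tau>. (h1 has_real_derivative h2 \<tau>) (at \<tau>)"
      "continuous_on UNIV h2" "\<And>\<tau>. \<tau> \<ge> r\<^sup>2 \<Longrightarrow> h0 \<tau> = 0 \<and> h1 \<tau> = 0 \<and> h2 \<tau> = 0" "r > 0"
  shows "(\<integral>y. of_real (g0 ((norm y)\<^sup>2)) * F y *
            of_real (4 * h2 ((norm (y - x))\<^sup>2) * (norm (y - x))\<^sup>2 + 2 * real DIM('a) * h1 ((norm (y - x))\<^sup>2)) \<partial>lborel) =
         (\<integral>y. of_real (h0 ((norm (y - x))\<^sup>2)) *
            (of_real (4 * g2 ((norm y)\<^sup>2) * (norm y)\<^sup>2 + 2 * real DIM('a) * g1 ((norm y)\<^sup>2) - L / (norm y)\<^sup>2 * g0 ((norm y)\<^sup>2)) * F y) \<partial>lborel)"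
    (is "(\<integral>y. ?A y \<partial>_) = (\<integral>y. ?B y \<partial>_)")
proof -
  have cg0: "continuous_on UNIV g0" using g(1) by (meson DERIV_isCont continuous_at_imp_continuous_on)
  have cg1: "continuous_on UNIV g1" using g(2) by (meson DERIV_isCont continuous_at_imp_continuous_on)
  have ch0: "continuous_on UNIV h0" using h(1) by (meson DERIV_isCont continuous_at_imp_continuous_on)
  have ch1: "continuous_on UNIV h1" using h(2) by (meson DERIV_isCont continuous_at_imp_continuous_on)
  define u where "u y = complex_of_real (g0 ((norm y)\<^sup>2)) * F y" for y
  define u1 where "u1 b y = complex_of_real (2 * g1 ((norm y)\<^sup>2)) * (of_real (y \<bullet> b) * F y)
     + complex_of_real (g0 ((norm y)\<^sup>2)) * D1 b y" for b y
  define u2 where "u2 b y = complex_of_real (4 * g2 ((norm y)\<^sup>2)) * (of_real ((y \<bullet> b)\<^sup>2) * F y)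
     + complex_of_real (2 * g1 ((norm y)\<^sup>2)) * F y
     + complex_of_real (4 * g1 ((norm y)\<^sup>2)) * (of_real (y \<bullet> b) * D1 b y)
     + complex_of_real (g0 ((norm y)\<^sup>2)) * D2 b y" for b y
  define p where "p y = complex_of_real (h0 ((norm (y - x))\<^sup>2))" for y
  define p1 where "p1 b y = complex_of_real (2 * h1 ((norm (y - x))\<^sup>2) * ((y - x) \<bullet> b))" for b y
  define p2 where "p2 b y = complex_of_real (4 * h2 ((norm (y - x))\<^sup>2) * ((y - x) \<bullet> b)\<^sup>2 + 2 * h1 ((norm (y - x))\<^sup>2))" for b y
  have near0: "open (ball (0::'a) (sqrt d))" "(0::'a) \<in> ball 0 (sqrt d)" using g(5) by auto
  have small: "(norm z)\<^sup>2 \<le> d" if "z \<in> ball 0 (sqrt d)" for z :: 'a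
  proof -
    have "(norm z)\<^sup>2 \<le> (sqrt d)\<^sup>2" using that by (intro power_mono) auto
    then show ?thesis using g(5) by simp
  qed
  have dzero: "has_dir_deriv (\<lambda>_::'a. 0) b 0 0" for b by (rule has_dir_deriv_const)
  have u_z: "u z = 0" "u1 b z = 0" "u2 b z = 0" if "z \<in> ball 0 (sqrt d)" for z b
    using g(4)[OF small[OF that]] by (auto simp: u_def u1_def u2_def)
  have du: "has_dir_deriv u b y (u1 b y)" if b: "b \<in> Basis" for b y
  proof (cases "y = 0")
    case True
    have "has_dir_deriv u b 0 0"
      by (rule has_dir_deriv_transform[OF dzero near0]) (use u_z in auto)
    then show ?thesis using True u_z(2)[OF near0(2)] by simp
  next
    case False
    have "has_dir_deriv u b y (of_real (g0 ((norm y)\<^sup>2)) * D1 b y + of_real (2 * g1 ((norm y)\<^sup>2) * (y \<bullet> b)) * F y)"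
      unfolding u_def
      by (rule has_dir_deriv_mult[OF _ F(1)[OF b False]])
         (use has_dir_deriv_radial[of g0 "g1 ((norm y)\<^sup>2)" y 0 b] g(1) in simp)
    then show ?thesis unfolding u1_def by (simp add: algebra_simps)
  qed
  have du1: "has_dir_deriv (u1 b) b y (u2 b y)" if b: "b \<in> Basis" for b y
  proof (cases "y = 0")
    case True
    have "has_dir_deriv (u1 b) b 0 0"
      by (rule has_dir_deriv_transform[OF dzero near0]) (use u_z in auto)
    then show ?thesis using True u_z(3)[OF near0(2)] by simp
  next
    case False
    have i: "has_dir_deriv (\<lambda>y. complex_of_real (y \<bullet> b)) b y 1"
      using has_dir_deriv_inner[of 0 b y] b by simp
    have 0: "has_dir_deriv (\<lambda>y. complex_of_real (g0 ((norm y)\<^sup>2))) b y (of_real (2 * g1 ((norm y)\<^sup>2) * (y \<bullet> b)))"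
      using has_dir_deriv_radial[of g0 "g1 ((norm y)\<^sup>2)" y 0 b] g(1) by simp
    have "((\<lambda>t. 2 * g1 t) has_real_derivative 2 * g2 ((norm y)\<^sup>2)) (at ((norm y)\<^sup>2))"
      using g(2) by (auto intro!: derivative_eq_intros)
    then have 1: "has_dir_deriv (\<lambda>y. complex_of_real (2 * g1 ((norm y)\<^sup>2))) b y (of_real (2 * (2 * g2 ((norm y)\<^sup>2)) * (y \<bullet> b)))"
      using has_dir_deriv_radial[of "\<lambda>t. 2 * g1 t" "2 * g2 ((norm y)\<^sup>2)" y 0 b] by simp
    note * = has_dir_deriv_add[OF has_dir_deriv_mult[OF 1 has_dir_deriv_mult[OF i F(1)[OF b False]]]
        has_dir_deriv_mult[OF 0 F(2)[OF b False]]]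
    have "of_real (2 * g1 ((norm y)\<^sup>2)) * (of_real (y \<bullet> b) * D1 b y + 1 * F y) + of_real (2 * (2 * g2 ((norm y)\<^sup>2)) * (y \<bullet> b)) * (of_real (y \<bullet> b) * F y)
       + (of_real (g0 ((norm y)\<^sup>2)) * D2 b y + of_real (2 * g1 ((norm y)\<^sup>2) * (y \<bullet> b)) * D1 b y) = u2 b y"
      by (simp add: u2_def algebra_simps power2_eq_square)
    then show ?thesis using * unfolding u1_def by simp
  qed
  have dp: "has_dir_deriv p b y (p1 b y)" for b y
    unfolding p_def p1_def by (rule has_dir_deriv_radial) (rule h(1))
  have dp1: "has_dir_deriv (p1 b) b y (p2 b y)" if b: "b \<in> Basis" for b y
  proof -
    have "((\<lambda>t. 2 * h1 t) has_real_derivative 2 * h2 ((norm (y - x))\<^sup>2)) (at ((norm (y - x))\<^sup>2))"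
      using h(2) by (auto intro!: derivative_eq_intros)
    from has_dir_deriv_mult[OF has_dir_deriv_radial[OF this] has_dir_deriv_inner[of x b y]]
    have "has_dir_deriv (p1 b) b y (of_real (2 * h1 ((norm (y - x))\<^sup>2)) * of_real (b \<bullet> b) +
       of_real (2 * (2 * h2 ((norm (y - x))\<^sup>2)) * ((y - x) \<bullet> b)) * of_real ((y - x) \<bullet> b))"
      unfolding p1_def of_real_mult .
    moreover have "of_real (2 * h1 ((norm (y - x))\<^sup>2)) * of_real (b \<bullet> b) +
       of_real (2 * (2 * h2 ((norm (y - x))\<^sup>2)) * ((y - x) \<bullet> b)) * of_real ((y - x) \<bullet> b) = p2 b y"
      using b by (simp add: p2_def power2_eq_square)
    ultimately show ?thesis by simp
  qed
  have cu: "continuous_on UNIV u"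
    unfolding u_def by (rule continuous_on_cutoff_at_0[OF cont(1) cg0 _ g(5)]) (use g(4) in auto)
  have cu1: "continuous_on UNIV (u1 b)" if "b \<in> Basis" for b
    unfolding u1_def
    apply (intro continuous_on_add)
    subgoal by (rule continuous_on_cutoff_at_0[where g="\<lambda>t. 2 * g1 t", OF _ _ _ g(5)]) (use g(4) cont cg1 that in \<open>auto intro!: continuous_intros\<close>)
    subgoal by (rule continuous_on_cutoff_at_0[where g="g0", OF _ _ _ g(5)]) (use g(4) cont cg0 that in \<open>auto intro!: continuous_intros\<close>)
    done
  have cu2: "continuous_on UNIV (u2 b)" if "b \<in> Basis" for b
    unfolding u2_def
    apply (intro continuous_on_add)
    subgoal by (rule continuous_on_cutoff_at_0[where g="\<lambda>t. 4 * g2 t", OF _ _ _ g(5)]) (use g(3,4) cont that in \<open>auto intro!: continuous_intros\<close>)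
    subgoal by (rule continuous_on_cutoff_at_0[where g="\<lambda>t. 2 * g1 t", OF _ _ _ g(5)]) (use g(4) cont cg1 that in \<open>auto intro!: continuous_intros\<close>)
    subgoal by (rule continuous_on_cutoff_at_0[where g="\<lambda>t. 4 * g1 t", OF _ _ _ g(5)]) (use g(4) cont cg1 that in \<open>auto intro!: continuous_intros\<close>)
    subgoal by (rule continuous_on_cutoff_at_0[where g="g0", OF _ _ _ g(5)]) (use g(4) cont cg0 that in \<open>auto intro!: continuous_intros\<close>)
    done
  have cp: "continuous_on UNIV p" unfolding p_def
    by (intro continuous_intros continuous_on_compose2[OF ch0]) auto
  have cp1: "continuous_on UNIV (p1 b)" for b unfolding p1_def
    by (intro continuous_intros continuous_on_compose2[OF ch1]) auto
  have cp2: "continuous_on UNIV (p2 b)" for b unfolding p2_def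
    by (intro continuous_intros continuous_on_compose2[OF ch1] continuous_on_compose2[OF h(3)]) auto
  have supp: "p y = 0" "p1 b y = 0" "p2 b y = 0" if "y \<notin> cball x r" for y b
  proof -
    have "r \<le> norm (y - x)" using that by (simp add: dist_norm norm_minus_commute)
    then have "r\<^sup>2 \<le> (norm (y - x))\<^sup>2" using h(5) by (intro power_mono) auto
    then show "p y = 0" "p1 b y = 0" "p2 b y = 0" using h(4) by (auto simp: p_def p1_def p2_def)
  qed
  have *: "(\<integral>y. u y * p2 b y - u2 b y * p y \<partial>lborel) = 0 \<and> integrable lborel (\<lambda>y. u y * p2 b y - u2 b y * p y)"
    if b: "b \<in> Basis" for b
  proof -
    define G where "G y = u y * p1 b y - u1 b y * p y" for y
    have "has_dir_deriv G b y (u y * p2 b y - u2 b y * p y)" for y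
      unfolding G_def
      using has_dir_deriv_diff[OF has_dir_deriv_mult[OF du[OF b] dp1[OF b]] has_dir_deriv_mult[OF du1[OF b] dp]]
      by simp
    moreover have "continuous_on UNIV G" unfolding G_def
      by (intro continuous_intros cu cu1 cp cp1 b)
    moreover obtain B where "\<And>y. norm (u y * p2 b y - u2 b y * p y) \<le> B"
      by (rule bounded_continuous_compact_support[of "\<lambda>y. u y * p2 b y - u2 b y * p y" x r])
         (auto simp: supp simp del: mem_cball intro!: continuous_intros cu cu2 cp cp2 b)
    moreover have "G y = 0" if "y \<notin> cball x r" for y using supp[OF that] by (simp add: G_def)
    ultimately show ?thesis
      using integral_directional_derivative_eq_0[of G b "\<lambda>y. u y * p2 b y - u2 b y * p y" B x r]
      unfolding has_dir_deriv_def by blast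
  qed
  note n2 = sum_inner_Basis_squared[where 'a='a]
  have sum: "(\<Sum>b\<in>Basis. u y * p2 b y - u2 b y * p y) = ?A y - ?B y" for y
  proof (cases "y = 0")
    case True
    then show ?thesis using g(4)[of 0] g(5) by (simp add: u_def u2_def)
  next
    case False
    have A: "(\<Sum>b\<in>Basis. p2 b y) = of_real (4 * h2 ((norm (y - x))\<^sup>2) * (norm (y - x))\<^sup>2 + 2 * real DIM('a) * h1 ((norm (y - x))\<^sup>2))"
      unfolding p2_def of_real_sum[symmetric] sum.distrib sum_distrib_left[symmetric] n2 by simp
    have "(\<Sum>b\<in>Basis. u2 b y) = complex_of_real (4 * g2 ((norm y)\<^sup>2)) * (of_real (\<Sum>b\<in>Basis. (y \<bullet> b)\<^sup>2) * F y)
       + of_nat DIM('a) * (complex_of_real (2 * g1 ((norm y)\<^sup>2)) * F y)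
       + complex_of_real (4 * g1 ((norm y)\<^sup>2)) * (\<Sum>b\<in>Basis. of_real (y \<bullet> b) * D1 b y)
       + complex_of_real (g0 ((norm y)\<^sup>2)) * (\<Sum>b\<in>Basis. D2 b y)"
      by (simp add: u2_def sum.distrib sum_distrib_left sum_distrib_right)
    also have "\<dots> = of_real (4 * g2 ((norm y)\<^sup>2) * (norm y)\<^sup>2 + 2 * real DIM('a) * g1 ((norm y)\<^sup>2) - L / (norm y)\<^sup>2 * g0 ((norm y)\<^sup>2)) * F y"
      unfolding n2 rad[OF False] lap[OF False] by (simp add: algebra_simps)
    finally have B: "(\<Sum>b\<in>Basis. u2 b y) = \<dots>" .
    have "(\<Sum>b\<in>Basis. u y * p2 b y - u2 b y * p y) = u y * (\<Sum>b\<in>Basis. p2 b y) - (\<Sum>b\<in>Basis. u2 b y) * p y"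
      by (simp add: sum_subtractf sum_distrib_left sum_distrib_right)
    then show ?thesis unfolding A B by (simp add: u_def p_def mult.commute)
  qed
  have "(\<integral>y. ?A y - ?B y \<partial>lborel) = (\<Sum>b\<in>Basis. \<integral>y. u y * p2 b y - u2 b y * p y \<partial>lborel)"
    unfolding sum[symmetric] by (rule Bochner_Integration.integral_sum) (use * in auto)
  also have "\<dots> = 0" using * by simp
  finally have eq0: "(\<integral>y. ?A y - ?B y \<partial>lborel) = 0" .
  have iA: "integrable lborel ?A"
  proof -
    have "integrable lborel (\<lambda>y. u y * (\<Sum>b\<in>Basis. p2 b y))"
      by (rule integrable_continuous_compact_support[of _ x r])
         (auto simp: supp simp del: mem_cball intro!: continuous_intros cu cp2)
    moreover have "u y * (\<Sum>b\<in>Basis. p2 b y) = ?A y" for y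
      unfolding p2_def of_real_sum[symmetric] sum.distrib sum_distrib_left[symmetric] n2
      by (simp add: u_def)
    ultimately show ?thesis by simp
  qed
  have iB: "integrable lborel ?B"
  proof -
    have "integrable lborel (\<lambda>y. ?A y - (\<Sum>b\<in>Basis. u y * p2 b y - u2 b y * p y))"
      by (rule Bochner_Integration.integrable_diff[OF iA Bochner_Integration.integrable_sum]) (rule conjunct2[OF *])
    then show ?thesis unfolding sum by simp
  qed
  show ?thesis
    using eq0 unfolding Bochner_Integration.integral_diff[OF iA iB] by (simp only: right_minus_eq)
qed

section \<open>The mean value property\<close>

text \<open>
  A \<open>C\<^sup>2\<close> radial weight supported in the unit ball: smooth enough for the mean value identity to
  be differentiated in the centre and in the radius.
\<close>

definition bump :: "'a::euclidean_space \<Rightarrow> real"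
  where "bump y = max 0 (1 - (norm y)\<^sup>2) ^ 3"

text \<open>
  Harmonicity of a function on the whole space, in integrated form. It passes from \<open>h\<close> to its
  directional derivatives, and no derivatives are needed to state it.
\<close>

definition mean_value_property :: "('a::euclidean_space \<Rightarrow> complex) \<Rightarrow> bool"
  where "mean_value_property h \<longleftrightarrow> continuous_on UNIV h \<and>
    (\<forall>x. \<forall>\<epsilon>>0. (\<integral>y. of_real (bump y) * h (x + \<epsilon> *\<^sub>R y) \<partial>lborel) =
       of_real (\<integral>y. bump (y::'a) \<partial>lborel) * h x)"

lemma bump_zero: "bump y = 0" if "\<not> norm y < 1"
proof -
  have "1 \<le> (norm y)\<^sup>2" using that by simp
  then show ?thesis by (simp add: bump_def)
qed

lemma bump_nonneg: "0 \<le> bump y" by (simp add: bump_def)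

lemma bump_le_1: "bump y \<le> 1"
  unfolding bump_def by (rule power_le_one) auto

lemma continuous_on_bump: "continuous_on S bump"
  unfolding bump_def by (intro continuous_intros)

lemma integrable_bump_mult:
  fixes h :: "'a::euclidean_space \<Rightarrow> complex"
  assumes "continuous_on UNIV h"
  shows "integrable lborel (\<lambda>y. of_real (bump y) * h y)"
  by (rule integrable_continuous_compact_support[of _ 0 1])
     (auto intro!: continuous_intros assms continuous_on_bump bump_zero)

lemma integral_bump_pos: "(\<integral>y. bump (y::'a::euclidean_space) \<partial>lborel) > 0"
proof -
  have int: "integrable lborel (bump :: 'a \<Rightarrow> real)"
    by (rule integrable_continuous_compact_support[of _ 0 1])
       (auto intro!: continuous_on_bump bump_zero)
  have "(\<integral>y. bump (y::'a) \<partial>lborel) \<noteq> 0"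
  proof
    assume "(\<integral>y. bump (y::'a) \<partial>lborel) = 0"
    then have "AE y in lborel. bump (y::'a) = 0"
      using integral_nonneg_eq_0_iff_AE[OF int] bump_nonneg by auto
    then have "AE y in lborel. y \<notin> ball (0::'a) 1"
    proof (eventually_elim)
      case (elim y)
      show ?case
      proof
        assume "y \<in> ball 0 1"
        then have "(norm y)\<^sup>2 < 1" by (simp add: power_less_one_iff abs_square_less_1)
        then show False using elim by (simp add: bump_def)
      qed
    qed
    then have "ball (0::'a) 1 \<in> null_sets lborel"
      by (subst AE_iff_null_sets) auto
    then have "measure lborel (ball (0::'a) 1) = 0"
      by (simp add: null_sets_def measure_def)
    then show False
      using content_ball_pos[of 1 "0::'a"] by simp
  qed
  moreover have "0 \<le> (\<integral>y. bump (y::'a) \<partial>lborel)" by (intro integral_nonneg_AE) (auto simp: bump_nonneg)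
  ultimately show ?thesis by simp
qed

text \<open>
  Let \<open>J e\<close> be the weighted mean of \<open>H\<close> over the ball of radius \<open>e\<close> at \<open>x\<close>. The derivative in \<open>e\<close>
  of the weight is a multiple of the Laplacian of \<open>max 0 (1 - norm (y - x) ^ 2 / e ^ 2) ^ 4\<close>, so
  \<open>J' = 0\<close> by weak harmonicity. Hence \<open>J\<close> is constant, and its limit at \<open>0\<close> is the value at the
  centre.
\<close>

lemma mean_value_property_of_weakly_harmonic:
  fixes H :: "'a::euclidean_space \<Rightarrow> complex"
  assumes cont: "continuous_on UNIV H"
    and weak: "\<And>x r h0 h1 h2. r > 0 \<Longrightarrow> (\<And>\<tau>. (h0 has_real_derivative h1 \<tau>) (at \<tau>)) \<Longrightarrow>
      (\<And>\<tau>. (h1 has_real_derivative h2 \<tau>) (at \<tau>)) \<Longrightarrow> continuous_on UNIV h2 \<Longrightarrow>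
      (\<And>\<tau>. \<tau> \<ge> r\<^sup>2 \<Longrightarrow> h0 \<tau> = 0 \<and> h1 \<tau> = 0 \<and> h2 \<tau> = 0) \<Longrightarrow>
      (\<integral>y. H y * of_real (4 * h2 ((norm (y - x))\<^sup>2) * (norm (y - x))\<^sup>2 + 2 * real DIM('a) * h1 ((norm (y - x))\<^sup>2)) \<partial>lborel) = 0"
  shows "mean_value_property H"
  unfolding mean_value_property_def
proof (intro conjI cont allI impI)
  let ?n = "DIM('a)"
  let ?c = "\<integral>y. bump (y::'a) \<partial>lborel"
  fix x :: 'a and \<epsilon> :: real assume "\<epsilon> > 0"
  define J where "J e = (\<integral>y. of_real (bump y) * H (x + e *\<^sub>R y) \<partial>lborel)" for e
  define k where "k e y = (1 / e) ^ ?n * max 0 (1 - (norm (y - x))\<^sup>2 / e\<^sup>2) ^ 3" for e y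
  define k' where "k' e y = (1 / e) ^ (?n + 1) * (6 * ((norm (y - x))\<^sup>2 / e\<^sup>2) * max 0 (1 - (norm (y - x))\<^sup>2 / e\<^sup>2) ^ 2
      - ?n * max 0 (1 - (norm (y - x))\<^sup>2 / e\<^sup>2) ^ 3)" for e y
  have J: "J e = (\<integral>y. of_real (k e y) * H y \<partial>lborel)" if "e > 0" for e
  proof -
    have eq: "complex_of_real (bump y) * H (x + e *\<^sub>R y) = of_real (e ^ ?n) * (of_real (k e (x + e *\<^sub>R y)) * H (x + e *\<^sub>R y))" for y
      using that by (simp add: bump_def k_def power_one_over field_simps power_mult_distrib)
    have "(\<integral>y. of_real (k e y) * H y \<partial>lborel) = e ^ ?n *\<^sub>R (\<integral>y. of_real (k e (x + e *\<^sub>R y)) * H (x + e *\<^sub>R y) \<partial>lborel)"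
    proof (subst lborel_integral_affine[where c=e and t=x])
      have "continuous_on UNIV (\<lambda>y. of_real (k e y) * H y)"
        unfolding k_def using that by (intro continuous_intros cont) auto
      then show "(\<lambda>y. of_real (k e y) * H y) \<in> borel_measurable borel"
        by (rule borel_measurable_continuous_onI)
    qed (use that in auto)
    then show ?thesis unfolding J_def eq by (simp add: scaleR_conv_of_real)
  qed
  have dk: "((\<lambda>e. k e y) has_real_derivative k' e y) (at e)" if e: "e > 0" for e y
  proof -
    obtain n' where n': "?n = Suc n'" using DIM_positive[where 'a='a] by (metis Suc_pred)
    have u: "((\<lambda>e. 1 - (norm (y - x))\<^sup>2 / e\<^sup>2) has_real_derivative 2 * (norm (y - x))\<^sup>2 / e ^ 3) (at e)"
      using e by (auto intro!: derivative_eq_intros simp: power2_eq_square power3_eq_cube field_simps)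
    have m: "((\<lambda>e. max 0 (1 - (norm (y - x))\<^sup>2 / e\<^sup>2) ^ 3) has_real_derivative
       3 * max 0 (1 - (norm (y - x))\<^sup>2 / e\<^sup>2) ^ 2 * (2 * (norm (y - x))\<^sup>2 / e ^ 3)) (at e)"
      using DERIV_chain2[OF DERIV_pos_part_power[of 1] u] by (simp add: numeral_3_eq_3 numeral_2_eq_2)
    have p: "((\<lambda>e. (1 / e) ^ ?n) has_real_derivative - ?n * (1 / e) ^ (?n + 1)) (at e)"
    proof -
      have "((\<lambda>e. 1 / e) has_real_derivative - (1 / e\<^sup>2)) (at e)"
        using e by (auto intro!: derivative_eq_intros simp: power2_eq_square)
      from DERIV_power[OF this, of ?n] show ?thesis
        by (rule DERIV_cong) (use e in \<open>simp add: n' power_one_over field_simps power2_eq_square\<close>)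
    qed
    show ?thesis unfolding k_def
      by (rule DERIV_cong[OF DERIV_mult[OF p m]])
         (use e in \<open>simp add: k'_def power_one_over field_simps power2_eq_square power3_eq_cube\<close>)
  qed
  have cv: "continuous_on UNIV (\<lambda>y. of_real (k e y) * H y)" if "e > 0" for e
    unfolding k_def using that by (intro continuous_intros cont) auto
  have far: "max 0 (1 - (norm (y - x))\<^sup>2 / e\<^sup>2) = 0" if "y \<notin> cball x R" "0 < e" "e \<le> R" for y e R
  proof -
    have "e \<le> norm (y - x)" using that by (simp add: dist_norm norm_minus_commute)
    then have "e\<^sup>2 \<le> (norm (y - x))\<^sup>2" using that by (intro power_mono) auto
    then show ?thesis using that(2) by (simp add: divide_simps)
  qed
  have "(J has_vector_derivative 0) (at e)" if e: "e > 0" for e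
  proof -
    obtain B where B0: "0 < B" and B: "\<And>y. y \<in> cball x (2 * e) \<Longrightarrow> norm (H y) \<le> B"
      using bounded_on_cball[OF cont] by blast
    let ?K = "(2 / e) ^ (?n + 1) * (6 * 16 + real ?n) * B"
    have "((\<lambda>e. \<integral>y. of_real (k e y) * H y \<partial>lborel) has_vector_derivative (\<integral>y. of_real (k' e y) * H y \<partial>lborel)) (at e)"
    proof (rule has_vector_derivative_integral_dominated(1)[where d="e / 2" and f'="\<lambda>e y. of_real (k' e y) * H y" and g="\<lambda>y. indicator (cball x (2 * e)) y * ?K"])
      fix s y assume s: "\<bar>s - e\<bar> < e / 2"
      then have s': "e / 2 < s" "0 < s" "s \<le> 2 * e" using e by (auto simp: abs_if split: if_splits)
      have "((\<lambda>t. k t y) has_real_derivative k' s y) (at s)" by (rule dk) (use s' in auto)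
      then show "((\<lambda>e. of_real (k e y) * H y) has_vector_derivative of_real (k' s y) * H y) (at s)"
        by (auto intro!: has_vector_derivative_mult_left has_vector_derivative_of_real)
      show "norm (of_real (k' s y) * H y) \<le> indicator (cball x (2 * e)) y * ?K"
      proof (cases "y \<in> cball x (2 * e)")
        case False
        from far[OF this s'(2,3)] show ?thesis using False by (simp add: k'_def)
      next
        case True
        let ?m = "max 0 (1 - (norm (y - x))\<^sup>2 / s\<^sup>2)"
        have m: "0 \<le> ?m" "?m \<le> 1" by auto
        have u: "(norm (y - x))\<^sup>2 / s\<^sup>2 \<le> 16"
        proof -
          have "norm (y - x) \<le> 4 * s" using True s' by (simp add: dist_norm norm_minus_commute)
          then have "(norm (y - x))\<^sup>2 \<le> (4 * s)\<^sup>2" by (intro power_mono) auto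
          then show ?thesis using s' by (simp add: divide_simps power_mult_distrib)
        qed
        have "\<bar>6 * ((norm (y - x))\<^sup>2 / s\<^sup>2) * ?m ^ 2 - ?n * ?m ^ 3\<bar> \<le> 6 * ((norm (y - x))\<^sup>2 / s\<^sup>2) * ?m ^ 2 + ?n * ?m ^ 3"
          using m by (intro abs_triangle_ineq4[THEN order_trans]) (simp add: abs_mult)
        also have "\<dots> \<le> 6 * 16 * 1 + real ?n * 1"
          using m u by (intro add_mono mult_mono power_le_one) auto
        finally have 1: "\<bar>6 * ((norm (y - x))\<^sup>2 / s\<^sup>2) * ?m ^ 2 - ?n * ?m ^ 3\<bar> \<le> 6 * 16 + real ?n" by simp
        have 2: "(1 / s) ^ (?n + 1) \<le> (2 / e) ^ (?n + 1)"
          using s' e by (intro power_mono) (auto simp: divide_simps)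
        have "norm (of_real (k' s y) * H y) = (1 / s) ^ (?n + 1) * \<bar>6 * ((norm (y - x))\<^sup>2 / s\<^sup>2) * ?m ^ 2 - ?n * ?m ^ 3\<bar> * norm (H y)"
          unfolding norm_mult norm_of_real k'_def abs_mult using s' by simp
        also have "\<dots> \<le> ?K"
          using 1 2 B[OF True] B0 e s' by (intro mult_mono) auto
        finally show ?thesis using True by simp
      qed
    next
      fix s assume s: "\<bar>s - e\<bar> < e / 2"
      then have s': "0 < s" "s \<le> 2 * e" using e by (auto simp: abs_if split: if_splits)
      show "integrable lborel (\<lambda>y. of_real (k s y) * H y)"
      proof (rule integrable_continuous_compact_support[OF cv[OF s'(1)], of x "2 * e"])
        fix y assume "y \<notin> cball x (2 * e)"
        from far[OF this s'] show "of_real (k s y) * H y = 0" by (simp add: k_def)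
      qed
    next
      show "integrable lborel (\<lambda>y. indicator (cball x (2 * e)) y * ?K)"
        using borel_integrable_compact[of "cball x (2 * e)" "\<lambda>_. ?K"] by simp
    qed (use e in auto)
    moreover have "(\<integral>y. of_real (k' e y) * H y \<partial>lborel) = 0"
    proof -
      let ?h0 = "\<lambda>\<tau>. max 0 (1 - \<tau> / e\<^sup>2) ^ 4" and ?h1 = "\<lambda>\<tau>. - (4 / e\<^sup>2) * max 0 (1 - \<tau> / e\<^sup>2) ^ 3"
        and ?h2 = "\<lambda>\<tau>. 12 / e ^ 4 * max 0 (1 - \<tau> / e\<^sup>2) ^ 2"
      have e4: "e ^ 4 = e\<^sup>2 * e\<^sup>2" by (simp flip: power_add)
      have q: "e\<^sup>2 / e ^ 4 = 1 / e\<^sup>2"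
        unfolding e4 by (rule nonzero_divide_mult_cancel_left) (use e in simp)
      have i: "((\<lambda>\<tau>. 1 - \<tau> / e\<^sup>2) has_real_derivative - (1 / e\<^sup>2)) (at \<tau>)" for \<tau>
        using e by (auto intro!: derivative_eq_intros simp: q)
      have "(\<integral>y. H y * of_real (4 * ?h2 ((norm (y - x))\<^sup>2) * (norm (y - x))\<^sup>2 + 2 * real ?n * ?h1 ((norm (y - x))\<^sup>2)) \<partial>lborel) = 0"
      proof (rule weak[OF e])
        show "(?h0 has_real_derivative ?h1 \<tau>) (at \<tau>)" for \<tau>
          by (rule DERIV_cong[OF DERIV_chain2[OF DERIV_pos_part_power[of 2, simplified] i]]) simp
        have "((\<lambda>\<tau>. max 0 (1 - \<tau> / e\<^sup>2) ^ 3) has_real_derivative 3 * max 0 (1 - \<tau> / e\<^sup>2) ^ 2 * - (1 / e\<^sup>2)) (at \<tau>)" for \<tau>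
          using DERIV_chain2[OF DERIV_pos_part_power[of 1] i] by (simp add: numeral_3_eq_3 numeral_2_eq_2)
        from DERIV_cmult[OF this, of "- (4 / e\<^sup>2)"] show "(?h1 has_real_derivative ?h2 \<tau>) (at \<tau>)" for \<tau>
          unfolding e4 by (rule DERIV_cong) simp
        show "continuous_on UNIV ?h2" using e by (intro continuous_intros) auto
        show "?h0 \<tau> = 0 \<and> ?h1 \<tau> = 0 \<and> ?h2 \<tau> = 0" if "\<tau> \<ge> e\<^sup>2" for \<tau>
          using that e by (simp add: divide_simps)
      qed
      moreover have "of_real (k' e y) * H y = of_real ((1 / e) ^ ?n * e / 8) *
          (H y * of_real (4 * ?h2 ((norm (y - x))\<^sup>2) * (norm (y - x))\<^sup>2 + 2 * real ?n * ?h1 ((norm (y - x))\<^sup>2)))" for y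
      proof -
        have "k' e y = ((1 / e) ^ ?n * e / 8) * (4 * ?h2 ((norm (y - x))\<^sup>2) * (norm (y - x))\<^sup>2 + 2 * real ?n * ?h1 ((norm (y - x))\<^sup>2))"
          using e by (simp add: k'_def e4 field_simps power2_eq_square power3_eq_cube)
        then show ?thesis by (simp only: of_real_mult mult_ac)
      qed
      ultimately show ?thesis by (simp only: integral_mult_right_zero mult_zero_right)
    qed
    ultimately have "((\<lambda>e. \<integral>y. of_real (k e y) * H y \<partial>lborel) has_vector_derivative 0) (at e)" by simp
    then show ?thesis
      by (rule has_vector_derivative_transform_within_open[of _ _ _ "{0<..}"]) (use J e in auto)
  qed
  then have const: "J e = J \<epsilon>" if "e > 0" for e
  proof -
    have "(J has_derivative (\<lambda>h. 0)) (at s within {0<..})" if "s \<in> {0<..}" for s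
      using \<open>\<And>e. e > 0 \<Longrightarrow> (J has_vector_derivative 0) (at e)\<close>[of s] that
      by (auto simp: has_vector_derivative_def intro: has_derivative_at_withinI)
    then have "\<exists>c. \<forall>s\<in>{0<..}. J s = c" by (intro has_derivative_zero_constant) auto
    then show ?thesis using that \<open>\<epsilon> > 0\<close> by auto
  qed
  obtain B where "0 < B" and B: "\<And>y. y \<in> cball x 1 \<Longrightarrow> norm (H y) \<le> B"
    using bounded_on_cball[OF cont] by blast
  have lim: "(\<lambda>i. J (1 / (real i + 1))) \<longlonglongrightarrow> (\<integral>y. of_real (bump (y::'a)) * H x \<partial>lborel)"
    unfolding J_def
  proof (rule integral_dominated_convergence[where w="\<lambda>y. indicator (cball (0::'a) 1) y * B"])
    have ci: "continuous_on UNIV (\<lambda>y. of_real (bump y) * H (x + e *\<^sub>R y))" for e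
      by (intro continuous_intros continuous_on_bump continuous_on_compose2[OF cont]) auto
    then show "(\<lambda>y. of_real (bump y) * H (x + (1 / (real i + 1)) *\<^sub>R y)) \<in> borel_measurable lborel" for i
      using borel_measurable_continuous_onI[OF ci] by simp
    show "(\<lambda>y::'a. of_real (bump y) * H x) \<in> borel_measurable lborel"
    proof -
      have "continuous_on UNIV (\<lambda>y::'a. of_real (bump y) * H x)"
        by (intro continuous_intros continuous_on_bump)
      from borel_measurable_continuous_onI[OF this] show ?thesis by simp
    qed
    show "integrable lborel (\<lambda>y. indicator (cball (0::'a) 1) y * B)"
      using borel_integrable_compact[of "cball (0::'a) 1" "\<lambda>_. B"] by simp
    show "AE y in lborel. (\<lambda>i. of_real (bump y) * H (x + (1 / (real i + 1)) *\<^sub>R y)) \<longlonglongrightarrow> of_real (bump y) * H x"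
    proof (rule AE_I2)
      fix y
      have "(\<lambda>i. 1 / (real i + 1)) \<longlonglongrightarrow> 0" by real_asymp
      then have "(\<lambda>i. x + (1 / (real i + 1)) *\<^sub>R y) \<longlonglongrightarrow> x + 0 *\<^sub>R y"
        by (intro tendsto_intros)
      then have "(\<lambda>i. H (x + (1 / (real i + 1)) *\<^sub>R y)) \<longlonglongrightarrow> H x"
        using continuous_on_tendsto_compose[OF cont, of "\<lambda>i. x + (1 / (real i + 1)) *\<^sub>R y" x] by simp
      then show "(\<lambda>i. of_real (bump y) * H (x + (1 / (real i + 1)) *\<^sub>R y)) \<longlonglongrightarrow> of_real (bump y) * H x"
        by (intro tendsto_intros)
    qed
    show "AE y in lborel. norm (of_real (bump y) * H (x + (1 / (real i + 1)) *\<^sub>R y)) \<le> indicator (cball 0 1) y * B" for i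
    proof (rule AE_I2)
      fix y :: 'a
      show "norm (of_real (bump y) * H (x + (1 / (real i + 1)) *\<^sub>R y)) \<le> indicator (cball 0 1) y * B"
      proof (cases "y \<in> cball 0 1")
        case True
        then have "norm ((1 / (real i + 1)) *\<^sub>R y) \<le> 1 * 1" unfolding norm_scaleR by (intro mult_mono) auto
        then have "norm (H (x + (1 / (real i + 1)) *\<^sub>R y)) \<le> B" by (intro B) (simp add: dist_norm)
        then have "bump y * norm (H (x + (1 / (real i + 1)) *\<^sub>R y)) \<le> 1 * B"
          by (intro mult_mono bump_le_1) auto
        then show ?thesis using True bump_nonneg[of y] unfolding norm_mult norm_of_real by simp
      qed (simp add: bump_zero)
    qed
  qed
  have "(\<lambda>i. J \<epsilon>) \<longlonglongrightarrow> (\<integral>y. of_real (bump (y::'a)) * H x \<partial>lborel)"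
    using lim const by simp
  then have "J \<epsilon> = (\<integral>y. of_real (bump (y::'a)) * H x \<partial>lborel)"
    using LIMSEQ_const_iff by blast
  also have "\<dots> = of_real ?c * H x"
  proof -
    have "integrable lborel (\<lambda>y::'a. complex_of_real (bump y))"
      using integrable_bump_mult[of "\<lambda>_::'a. 1"] by simp
    then show ?thesis by simp
  qed
  finally show "(\<integral>y. of_real (bump y) * H (x + \<epsilon> *\<^sub>R y) \<partial>lborel) = of_real ?c * H x" unfolding J_def .
qed

section \<open>Homogeneous extensions across the origin\<close>

lemma integrable_inverse_norm_square_on_cball:
  assumes "DIM('a::euclidean_space) \<ge> 3"
  shows "integrable lborel (\<lambda>y::'a. indicator (cball 0 R) y * (1 / (norm y)\<^sup>2))"
proof (rule Bochner_Integration.integrable_bound)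
  show "integrable lborel (\<lambda>y::'a. indicator (ball 0 1) y * (1 / (norm y)\<^sup>2) + indicator (cball 0 R) y *\<^sub>R (1::real))"
    by (intro Bochner_Integration.integrable_add integrable_inverse_norm_square_on_ball assms borel_integrable_compact) auto
  show "(\<lambda>y::'a. indicator (cball 0 R) y * (1 / (norm y)\<^sup>2)) \<in> borel_measurable lborel"
    by (intro borel_measurable_times borel_measurable_indicator) auto
  show "AE y in lborel. norm (indicator (cball 0 R) y * (1 / (norm (y::'a))\<^sup>2))
      \<le> norm (indicator (ball 0 1) y * (1 / (norm y)\<^sup>2) + indicator (cball 0 R) y *\<^sub>R (1::real))"
  proof (rule AE_I2)
    fix y :: 'a
    show "norm (indicator (cball 0 R) y * (1 / (norm y)\<^sup>2))
      \<le> norm (indicator (ball 0 1) y * (1 / (norm y)\<^sup>2) + indicator (cball 0 R) y *\<^sub>R (1::real))"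
    proof (cases "norm y < 1")
      case False
      then have "1 \<le> (norm y)\<^sup>2" by simp
      then have "1 / (norm y)\<^sup>2 \<le> 1" by (simp add: divide_le_eq_1)
      then show ?thesis using False by (auto simp: indicator_def)
    qed (auto simp: indicator_def)
  qed
qed

lemma borel_measurable_continuous_off_0:
  fixes F :: "'a::euclidean_space \<Rightarrow> complex"
  assumes "continuous_on (- {0}) F"
  shows "F \<in> borel_measurable borel"
proof -
  have "F = (\<lambda>y. if y \<in> {0} then F 0 else F y)" by auto
  moreover have "(\<lambda>y. if y \<in> {0} then F 0 else F y) \<in> borel_measurable borel"
    by (rule borel_measurable_continuous_on_if) (use assms in auto)
  ultimately show ?thesis by simp
qed

text \<open>
  The function \<open>norm y powr (2 s) * F y\<close> is formally annihilated by the Laplacian because \<open>L = 2 s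
  (2 s + n - 2)\<close>, but it may be singular at the origin. Multiplying it by \<open>max 0 (1 - d / norm y ^
  2) ^ 3\<close> gives a function to which the Green identity applies and whose Laplacian is bounded by a
  multiple of \<open>norm y powr (2 s - 2)\<close>, which is locally integrable in dimension at least 3, and
  tends to \<open>0\<close> pointwise as \<open>d\<close> tends to \<open>0\<close>. Dominated convergence shows that the origin
  contributes nothing.
\<close>

lemma weakly_harmonic_homogeneous_extension:
  fixes F :: "'a::euclidean_space \<Rightarrow> complex" and D1 D2 :: "'a \<Rightarrow> 'a \<Rightarrow> complex"
  assumes F: "\<And>b y. b \<in> Basis \<Longrightarrow> y \<noteq> 0 \<Longrightarrow> has_dir_deriv F b y (D1 b y)"
    "\<And>b y. b \<in> Basis \<Longrightarrow> y \<noteq> 0 \<Longrightarrow> has_dir_deriv (D1 b) b y (D2 b y)"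
    and cont: "continuous_on (- {0}) F" "\<And>b. b \<in> Basis \<Longrightarrow> continuous_on (- {0}) (D1 b)"
      "\<And>b. b \<in> Basis \<Longrightarrow> continuous_on (- {0}) (D2 b)"
    and rad: "\<And>y. y \<noteq> 0 \<Longrightarrow> (\<Sum>b\<in>Basis. of_real (y \<bullet> b) * D1 b y) = 0"
    and lap: "\<And>y. y \<noteq> 0 \<Longrightarrow> (\<Sum>b\<in>Basis. D2 b y) = - of_real (L / (norm y)\<^sup>2) * F y"
    and M: "\<And>y. norm (F y) \<le> M"
    and dim: "DIM('a) \<ge> 3"
    and s: "s > 0" "L = 4 * s\<^sup>2 + 2 * s * (real DIM('a) - 2)"
    and h: "\<And>\<tau>. (h0 has_real_derivative h1 \<tau>) (at \<tau>)" "\<And>\<tau>. (h1 has_real_derivative h2 \<tau>) (at \<tau>)"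
      "continuous_on UNIV h2" "\<And>\<tau>. \<tau> \<ge> r\<^sup>2 \<Longrightarrow> h0 \<tau> = 0 \<and> h1 \<tau> = 0 \<and> h2 \<tau> = 0" "r > 0"
  shows "(\<integral>y. of_real (norm y powr (2 * s)) * F y *
            of_real (4 * h2 ((norm (y - x))\<^sup>2) * (norm (y - x))\<^sup>2 + 2 * real DIM('a) * h1 ((norm (y - x))\<^sup>2)) \<partial>lborel) = 0"
proof -
  let ?n = "real DIM('a)"
  define P where "P y = 4 * h2 ((norm (y - x))\<^sup>2) * (norm (y - x))\<^sup>2 + 2 * ?n * h1 ((norm (y - x))\<^sup>2)" for y
  define p where "p y = h0 ((norm (y - x))\<^sup>2)" for y
  define R where "R = norm x + r"
  have R: "R > 0" using h(5) by (simp add: R_def add_nonneg_pos)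
  define g0 where "g0 d \<tau> = max 0 (\<tau> - d) ^ 3 * \<tau> powr (s - 3)" for d \<tau> :: real
  define g1 where "g1 d \<tau> = 3 * max 0 (\<tau> - d) ^ 2 * \<tau> powr (s - 3) + (s - 3) * (max 0 (\<tau> - d) ^ 3 * \<tau> powr (s - 4))" for d \<tau> :: real
  define g2 where "g2 d \<tau> = 6 * max 0 (\<tau> - d) * \<tau> powr (s - 3) + 6 * (s - 3) * (max 0 (\<tau> - d) ^ 2 * \<tau> powr (s - 4))
    + (s - 3) * (s - 4) * (max 0 (\<tau> - d) ^ 3 * \<tau> powr (s - 5))" for d \<tau> :: real
  \<comment> \<open>\<open>q (1 - d / \<tau>) * \<tau> powr (s - 1)\<close> is the radial factor of the Laplacian of the cut-off
    function; \<open>q 1 = 0\<close> expresses that the exponent is the harmonic one\<close>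
  define q where "q \<theta> = 24 * \<theta> + 24 * (s - 3) * \<theta>\<^sup>2 + 4 * (s - 3) * (s - 4) * \<theta> ^ 3 + 6 * ?n * \<theta>\<^sup>2 + 2 * ?n * (s - 3) * \<theta> ^ 3 - L * \<theta> ^ 3" for \<theta>
  have q1: "q 1 = 0" using s(2) by (simp add: q_def algebra_simps power2_eq_square)
  have qcont: "continuous_on S q" for S unfolding q_def by (intro continuous_intros)
  obtain C where C: "\<And>\<theta>. \<theta> \<in> {0..1} \<Longrightarrow> \<bar>q \<theta>\<bar> \<le> C"
  proof -
    have "bounded (q ` {0..1})" by (intro compact_imp_bounded compact_continuous_image qcont) auto
    then show thesis using that unfolding bounded_iff real_norm_def by blast
  qed
  have gz: "g0 d \<tau> = 0" "g1 d \<tau> = 0" "g2 d \<tau> = 0" if "\<tau> \<le> d" for d \<tau>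
    using that by (simp_all add: g0_def g1_def g2_def)
  have mpow: "((\<lambda>\<tau>. max 0 (\<tau> - d) ^ (N + 2)) has_real_derivative real (N + 2) * max 0 (\<tau> - d) ^ (N + 1)) (at \<tau>)" for d \<tau> N
  proof -
    have "((\<lambda>\<tau>. \<tau> - d) has_real_derivative 1) (at \<tau>)" by (auto intro!: derivative_eq_intros)
    from DERIV_chain2[OF DERIV_pos_part_power this] show ?thesis by simp
  qed
  have m3: "((\<lambda>\<tau>. max 0 (\<tau> - d) ^ 3) has_real_derivative 3 * max 0 (\<tau> - d) ^ 2) (at \<tau>)" for d \<tau>
    using mpow[of d 1 \<tau>] by (simp add: numeral_3_eq_3 numeral_2_eq_2)
  have m2: "((\<lambda>\<tau>. max 0 (\<tau> - d) ^ 2) has_real_derivative 2 * max 0 (\<tau> - d)) (at \<tau>)" for d \<tau>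
    using mpow[of d 0 \<tau>] by (simp add: power2_eq_square)
  have pw: "((\<lambda>\<tau>. \<tau> powr a) has_real_derivative a * \<tau> powr (a - 1)) (at \<tau>)" if "\<tau> > 0" for a \<tau>
    using has_real_derivative_powr[OF that] .
  have dg0: "(g0 d has_real_derivative g1 d \<tau>) (at \<tau>)" if "d > 0" for d \<tau>
  proof (cases "\<tau> < d")
    case True
    have "((\<lambda>_. 0) has_real_derivative 0) (at \<tau>)" by simp
    then have "(g0 d has_real_derivative 0) (at \<tau>)"
      by (rule has_field_derivative_transform_within_open[of _ _ _ "{..<d}"]) (use True gz in auto)
    then show ?thesis using gz True by simp
  next
    case False
    then have "\<tau> > 0" using that by simp
    from DERIV_mult[OF m3[of d \<tau>] pw[OF this, of "s - 3"]]
    show ?thesis unfolding g0_def[abs_def] g1_def by (rule DERIV_cong) (simp add: algebra_simps)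
  qed
  have dg1: "(g1 d has_real_derivative g2 d \<tau>) (at \<tau>)" if "d > 0" for d \<tau>
  proof (cases "\<tau> < d")
    case True
    have "((\<lambda>_. 0) has_real_derivative 0) (at \<tau>)" by simp
    then have "(g1 d has_real_derivative 0) (at \<tau>)"
      by (rule has_field_derivative_transform_within_open[of _ _ _ "{..<d}"]) (use True gz in auto)
    then show ?thesis using gz True by simp
  next
    case False
    then have "\<tau> > 0" using that by simp
    from DERIV_add[OF DERIV_mult[OF DERIV_cmult[OF m2[of d \<tau>], of 3] pw[OF this, of "s - 3"]]
        DERIV_cmult[OF DERIV_mult[OF m3[of d \<tau>] pw[OF this, of "s - 4"]], of "s - 3"]]
    show ?thesis unfolding g1_def[abs_def] g2_def by (rule DERIV_cong) (simp add: algebra_simps)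
  qed
  have cg2: "continuous_on UNIV (g2 d)" if "d > 0" for d
  proof -
    have "continuous_on ({..<d} \<union> {0<..}) (g2 d)"
    proof (rule continuous_on_open_Un)
      show "continuous_on {..<d} (g2 d)"
        by (subst continuous_on_cong[OF refl, where g="\<lambda>_. 0"]) (auto simp: gz)
      show "continuous_on {0<..} (g2 d)"
        unfolding g2_def[abs_def] by (intro continuous_intros) auto
    qed auto
    moreover have "{..<d} \<union> {0<..} = UNIV" using that by auto
    ultimately show ?thesis by simp
  qed
  have Lg: "4 * g2 d \<tau> * \<tau> + 2 * ?n * g1 d \<tau> - L / \<tau> * g0 d \<tau> = \<tau> powr (s - 1) * q (max 0 (\<tau> - d) / \<tau>)"
    if "\<tau> > 0" for d \<tau>
  proof -
    define m where "m = max 0 (\<tau> - d)"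
    define T where "T = \<tau> powr (s - 1)"
    have e: "\<tau> powr (s - 3) = T / \<tau> ^ 2" "\<tau> powr (s - 4) = T / \<tau> ^ 3" "\<tau> powr (s - 5) = T / \<tau> ^ 4"
      using that powr_diff[of \<tau> "s - 1" 2] powr_diff[of \<tau> "s - 1" 3] powr_diff[of \<tau> "s - 1" 4]
      by (simp_all add: T_def powr_numeral)
    show ?thesis
      unfolding g0_def g1_def g2_def q_def e m_def[symmetric] T_def[symmetric]
      using that by (simp add: field_simps power2_eq_square power3_eq_cube eval_nat_numeral)
  qed
  have th: "max 0 (\<tau> - d) / \<tau> \<in> {0..1}" if "\<tau> > 0" "d > 0" for \<tau> d :: real
    using that by (auto simp: divide_simps)
  have ch0: "continuous_on UNIV h0" using h(1) by (meson DERIV_isCont continuous_at_imp_continuous_on)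
  have ch1: "continuous_on UNIV h1" using h(2) by (meson DERIV_isCont continuous_at_imp_continuous_on)
  have cP: "continuous_on UNIV P" unfolding P_def
    by (intro continuous_intros continuous_on_compose2[OF ch1] continuous_on_compose2[OF h(3)]) auto
  have cp: "continuous_on UNIV p" unfolding p_def
    by (intro continuous_intros continuous_on_compose2[OF ch0]) auto
  have supp: "p y = 0" "P y = 0" if "y \<notin> cball x r" for y
  proof -
    have "r \<le> norm (y - x)" using that by (simp add: dist_norm norm_minus_commute)
    then have "r\<^sup>2 \<le> (norm (y - x))\<^sup>2" using h(5) by (intro power_mono) auto
    then show "p y = 0" "P y = 0" using h(4) by (auto simp: p_def P_def)
  qed
  obtain BP where BP: "\<And>y. norm (P y) \<le> BP" by (rule bounded_continuous_compact_support[OF cP supp(2)]) auto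
  obtain Bp where Bp: "\<And>y. norm (p y) \<le> Bp" by (rule bounded_continuous_compact_support[OF cp supp(1)]) auto
  have nn: "0 \<le> M" "0 \<le> BP" "0 \<le> Bp" "0 \<le> C"
    using M[of 0] BP[of 0] Bp[of 0] C[of 0] norm_ge_zero order_trans by (auto, blast+)
  have inR: "norm y \<le> R" if "y \<in> cball x r" for y
    using that norm_triangle_ineq[of x "y - x"] by (simp add: R_def dist_norm norm_minus_commute)
  have n2: "(norm y)\<^sup>2 powr a = norm y powr (2 * a)" for y :: 'a and a
    using powr_powr[of "norm y" 2 a] by (cases "y = 0") (simp_all add: powr_numeral)
  have nR: "norm y powr (2 * s) \<le> R powr (2 * s)" if "norm y \<le> R" for y :: 'a
    using that s(1) by (intro powr_mono2) auto
  define d where "d i = 1 / (real i + 1)" for i :: nat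
  have d: "d i > 0" for i by (simp add: d_def)
  have dlim: "d \<longlonglongrightarrow> 0" unfolding d_def[abs_def] by real_asymp
  have thlim: "(\<lambda>i. max 0 (\<tau> - d i) / \<tau>) \<longlonglongrightarrow> 1" if "\<tau> > 0" for \<tau>
  proof -
    have "(\<lambda>i. max 0 (\<tau> - d i) / \<tau>) \<longlonglongrightarrow> max 0 (\<tau> - 0) / \<tau>"
      by (intro tendsto_intros dlim) (use that in auto)
    then show ?thesis using that by simp
  qed
  define A where "A i y = complex_of_real (g0 (d i) ((norm y)\<^sup>2)) * F y * of_real (P y)" for i and y :: 'a
  define B where "B i y = complex_of_real (p y) *
    (of_real (4 * g2 (d i) ((norm y)\<^sup>2) * (norm y)\<^sup>2 + 2 * ?n * g1 (d i) ((norm y)\<^sup>2) - L / (norm y)\<^sup>2 * g0 (d i) ((norm y)\<^sup>2)) * F y)" for i and y :: 'a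
  have AB: "(\<integral>y. A i y \<partial>lborel) = (\<integral>y. B i y \<partial>lborel)" for i
    unfolding A_def B_def P_def p_def
    by (rule green_identity_radial[OF F cont rad lap dg0[OF d] dg1[OF d] cg2[OF d] _ d h]) (use gz in auto)
  have Fm: "F \<in> borel_measurable lborel" using borel_measurable_continuous_off_0[OF cont(1)] by simp
  have cg0: "continuous_on UNIV (g0 (d i))" and cg1: "continuous_on UNIV (g1 (d i))" for i
    using dg0[OF d] dg1[OF d] by (meson DERIV_isCont continuous_at_imp_continuous_on)+
  have Pm: "P \<in> borel_measurable lborel" and pm: "p \<in> borel_measurable lborel"
    using borel_measurable_continuous_onI[OF cP] borel_measurable_continuous_onI[OF cp] by auto
  have gm: "(\<lambda>y::'a. g0 (d i) ((norm y)\<^sup>2)) \<in> borel_measurable lborel"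
    "(\<lambda>y::'a. g1 (d i) ((norm y)\<^sup>2)) \<in> borel_measurable lborel"
    "(\<lambda>y::'a. g2 (d i) ((norm y)\<^sup>2)) \<in> borel_measurable lborel" for i
    using borel_measurable_continuous_onI[OF cg0] borel_measurable_continuous_onI[OF cg1]
      borel_measurable_continuous_onI[OF cg2[OF d]] by (auto intro!: measurable_compose[where N=borel])
  have limA: "(\<lambda>i. \<integral>y. A i y \<partial>lborel) \<longlonglongrightarrow> (\<integral>y. of_real (norm y powr (2 * s)) * F y * of_real (P y) \<partial>lborel)"
  proof (rule integral_dominated_convergence[where w="\<lambda>y. indicator (cball x r) y * (R powr (2 * s) * M * BP)"])
    show "A i \<in> borel_measurable lborel" for i
      unfolding A_def[abs_def] using Fm Pm gm by measurable
    show "(\<lambda>y. of_real (norm y powr (2 * s)) * F y * of_real (P y)) \<in> borel_measurable lborel"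
      using Fm Pm by measurable
    show "integrable lborel (\<lambda>y. indicator (cball x r) y * (R powr (2 * s) * M * BP))"
      using borel_integrable_compact[of "cball x r" "\<lambda>_. R powr (2 * s) * M * BP"] by simp
    show "AE y in lborel. (\<lambda>i. A i y) \<longlonglongrightarrow> of_real (norm y powr (2 * s)) * F y * of_real (P y)"
    proof (rule AE_I2)
      fix y :: 'a
      have "(\<lambda>i. g0 (d i) ((norm y)\<^sup>2)) \<longlonglongrightarrow> norm y powr (2 * s)"
      proof (cases "y = 0")
        case False
        then have y: "(norm y)\<^sup>2 > 0" by simp
        have "(\<lambda>i. (norm y)\<^sup>2 powr s * (max 0 ((norm y)\<^sup>2 - d i) / (norm y)\<^sup>2) ^ 3) \<longlonglongrightarrow> (norm y)\<^sup>2 powr s * 1 ^ 3"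
          by (intro tendsto_intros thlim y)
        moreover have "(norm y)\<^sup>2 powr s * (m / (norm y)\<^sup>2) ^ 3 = m ^ 3 * (norm y)\<^sup>2 powr (s - 3)" for m
          using y by (simp add: powr_diff powr_numeral power_divide)
        ultimately show ?thesis by (simp add: g0_def n2)
      qed (simp add: g0_def)
      then show "(\<lambda>i. A i y) \<longlonglongrightarrow> of_real (norm y powr (2 * s)) * F y * of_real (P y)"
        unfolding A_def by (intro tendsto_intros)
    qed
    show "AE y in lborel. norm (A i y) \<le> indicator (cball x r) y * (R powr (2 * s) * M * BP)" for i
    proof (rule AE_I2)
      fix y :: 'a
      show "norm (A i y) \<le> indicator (cball x r) y * (R powr (2 * s) * M * BP)"
      proof (cases "y \<in> cball x r")
        case True
        have "\<bar>g0 (d i) ((norm y)\<^sup>2)\<bar> \<le> R powr (2 * s)"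
        proof (cases "y = 0")
          case False
          then have y: "(norm y)\<^sup>2 > 0" by simp
          have "max 0 ((norm y)\<^sup>2 - d i) ^ 3 \<le> ((norm y)\<^sup>2) ^ 3"
            using d[of i] by (intro power_mono) auto
          then have "g0 (d i) ((norm y)\<^sup>2) \<le> ((norm y)\<^sup>2) ^ 3 * (norm y)\<^sup>2 powr (s - 3)"
            unfolding g0_def by (intro mult_right_mono) auto
          also have "\<dots> = (norm y)\<^sup>2 powr s" using y by (simp add: powr_diff powr_numeral)
          also have "\<dots> \<le> R powr (2 * s)" unfolding n2 by (rule nR[OF inR[OF True]])
          finally show ?thesis by (simp add: g0_def)
        qed (simp add: g0_def)
        then have "norm (A i y) \<le> R powr (2 * s) * M * BP"
          unfolding A_def norm_mult norm_of_real using M BP nn by (intro mult_mono) auto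
        then show ?thesis using True by simp
      qed (simp add: A_def supp del: mem_cball)
    qed
  qed
  have limB: "(\<lambda>i. \<integral>y. B i y \<partial>lborel) \<longlonglongrightarrow> (\<integral>y. 0 \<partial>(lborel :: 'a measure))"
  proof (rule integral_dominated_convergence[where w="\<lambda>y. Bp * (R powr (2 * s) * C) * M * (indicator (cball 0 R) y * (1 / (norm y)\<^sup>2))"])
    show "B i \<in> borel_measurable lborel" for i
      unfolding B_def[abs_def] using Fm pm gm by measurable
    show "integrable lborel (\<lambda>y::'a. Bp * (R powr (2 * s) * C) * M * (indicator (cball 0 R) y * (1 / (norm y)\<^sup>2)))"
      by (intro integrable_mult_right integrable_inverse_norm_square_on_cball dim)
    have Beq: "B i y = complex_of_real (p y) * (of_real ((norm y)\<^sup>2 powr (s - 1) * q (max 0 ((norm y)\<^sup>2 - d i) / (norm y)\<^sup>2)) * F y)"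
      if "y \<noteq> 0" for i y
      unfolding B_def by (subst Lg) (use that in auto)
    have B0: "B i 0 = 0" for i using gz[of 0 "d i"] d[of i] by (simp add: B_def)
    show "AE y in (lborel :: 'a measure). (\<lambda>i. B i y) \<longlonglongrightarrow> 0"
    proof (rule AE_I2)
      fix y :: 'a
      show "(\<lambda>i. B i y) \<longlonglongrightarrow> 0"
      proof (cases "y = 0")
        case False
        then have y: "(norm y)\<^sup>2 > 0" by simp
        have "(\<lambda>i. q (max 0 ((norm y)\<^sup>2 - d i) / (norm y)\<^sup>2)) \<longlonglongrightarrow> q 1"
          by (rule continuous_on_tendsto_compose[OF qcont[of UNIV] thlim[OF y]]) auto
        then have "(\<lambda>i. complex_of_real (p y) * (of_real ((norm y)\<^sup>2 powr (s - 1) * q (max 0 ((norm y)\<^sup>2 - d i) / (norm y)\<^sup>2)) * F y))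
            \<longlonglongrightarrow> complex_of_real (p y) * (of_real ((norm y)\<^sup>2 powr (s - 1) * q 1) * F y)"
          by (intro tendsto_intros)
        then show ?thesis by (simp add: q1 Beq[OF False])
      qed (simp add: B0)
    qed
    show "AE y in lborel. norm (B i y) \<le> Bp * (R powr (2 * s) * C) * M * (indicator (cball 0 R) y * (1 / (norm y)\<^sup>2))" for i
    proof (rule AE_I2)
      fix y :: 'a
      consider "y = 0" | "y \<noteq> 0" "y \<notin> cball x r" | "y \<noteq> 0" "y \<in> cball x r" by blast
      then show "norm (B i y) \<le> Bp * (R powr (2 * s) * C) * M * (indicator (cball 0 R) y * (1 / (norm y)\<^sup>2))"
      proof cases
        case 2
        then show ?thesis using supp(1)[OF 2(2)] nn by (simp add: B_def)
      next
        case 3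
        then have y: "(norm y)\<^sup>2 > 0" by simp
        have "(norm y)\<^sup>2 powr (s - 1) = norm y powr (2 * s) * (1 / (norm y)\<^sup>2)"
          using y n2[of y s] by (simp add: powr_diff)
        also have "\<dots> \<le> R powr (2 * s) * (1 / (norm y)\<^sup>2)"
          by (intro mult_right_mono nR inR 3) auto
        finally have 1: "(norm y)\<^sup>2 powr (s - 1) \<le> R powr (2 * s) * (1 / (norm y)\<^sup>2)" .
        have "norm (B i y) = \<bar>p y\<bar> * ((norm y)\<^sup>2 powr (s - 1) * \<bar>q (max 0 ((norm y)\<^sup>2 - d i) / (norm y)\<^sup>2)\<bar> * norm (F y))"
          unfolding Beq[OF 3(1)] norm_mult norm_of_real abs_mult by simp
        also have "\<dots> \<le> Bp * ((R powr (2 * s) * (1 / (norm y)\<^sup>2)) * C * M)"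
          using Bp M nn C[OF th[OF y d]] 1 by (intro mult_mono mult_nonneg_nonneg) auto
        finally show ?thesis using inR[OF 3(2)] by (simp add: mult_ac)
      qed (simp add: B0)
    qed
  qed auto
  have "(\<integral>y. of_real (norm y powr (2 * s)) * F y * of_real (P y) \<partial>lborel) = (\<integral>y. 0 \<partial>(lborel :: 'a measure))"
    by (rule LIMSEQ_unique[OF limA]) (use limB AB in simp)
  then show ?thesis by (simp add: P_def)
qed

section \<open>From eigenfunctions to harmonic functions\<close>

lemma has_dir_deriv_of_differentiable:
  assumes "f differentiable (at y)"
  shows "has_dir_deriv f v y (frechet_derivative f (at y) v)"
proof -
  have "(f has_derivative frechet_derivative f (at y)) (at (y + 0 *\<^sub>R v))"
    using assms by (simp add: frechet_derivative_works)
  moreover have "((\<lambda>t. y + t *\<^sub>R v) has_derivative (\<lambda>t. t *\<^sub>R v)) (at 0)"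
    by (auto intro!: derivative_eq_intros)
  ultimately have "((\<lambda>t. f (y + t *\<^sub>R v)) has_derivative (\<lambda>t. frechet_derivative f (at y) (t *\<^sub>R v))) (at 0)"
    using has_derivative_compose[of "\<lambda>t. y + t *\<^sub>R v" "\<lambda>t. t *\<^sub>R v" 0 UNIV f] by simp
  moreover have "linear (frechet_derivative f (at y))"
    using assms by (rule linear_frechet_derivative)
  ultimately show ?thesis
    by (simp add: has_dir_deriv_def has_vector_derivative_def linear_cmul)
qed

lemma has_dir_deriv_unique: "has_dir_deriv f v y D \<Longrightarrow> has_dir_deriv f v y D' \<Longrightarrow> D = D'"
  unfolding has_dir_deriv_def by (rule vector_derivative_unique_at)

lemma differentiable_transform_open:
  assumes "f differentiable (at x)" "open S" "x \<in> S" "\<And>y. y \<in> S \<Longrightarrow> f y = g y"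
  shows "g differentiable (at x)"
  using assms unfolding differentiable_def by (meson has_derivative_transform_within_open)

definition radial_extension :: "('a::euclidean_space \<Rightarrow> complex) \<Rightarrow> 'a \<Rightarrow> complex"
  where "radial_extension f y = f (sgn y)"

definition radial_extension_d1 :: "('a::euclidean_space \<Rightarrow> complex) \<Rightarrow> 'a \<Rightarrow> 'a \<Rightarrow> complex"
  where "radial_extension_d1 f b y = frechet_derivative (\<lambda>y. f (sgn y)) (at y) b"

definition radial_extension_d2 :: "('a::euclidean_space \<Rightarrow> complex) \<Rightarrow> 'a \<Rightarrow> 'a \<Rightarrow> complex"
  where "radial_extension_d2 f b y = frechet_derivative (radial_extension_d1 f b) (at y) b"

lemma radial_extension_differentiable:
  assumes "sphere_smooth f"
  shows "\<And>y. y \<noteq> 0 \<Longrightarrow> radial_extension f differentiable (at y)"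
    "\<And>y b. y \<noteq> 0 \<Longrightarrow> radial_extension_d1 f b differentiable (at y)"
    "\<And>b. continuous_on (- {0}) (radial_extension_d2 f b)"
proof -
  have "C_k_on (Suc (Suc 0)) (\<lambda>y. f (sgn y)) (- {0})" using assms unfolding sphere_smooth_def by blast
  then show "\<And>y. y \<noteq> 0 \<Longrightarrow> radial_extension f differentiable (at y)"
    "\<And>y b. y \<noteq> 0 \<Longrightarrow> radial_extension_d1 f b differentiable (at y)"
    "\<And>b. continuous_on (- {0}) (radial_extension_d2 f b)"
    by (simp_all add: radial_extension_def[abs_def] radial_extension_d1_def[abs_def] radial_extension_d2_def[abs_def])
qed

lemma radial_extension_has_dir_deriv:
  assumes "sphere_smooth f" "y \<noteq> 0"
  shows "has_dir_deriv (radial_extension f) b y (radial_extension_d1 f b y)"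
    "has_dir_deriv (radial_extension_d1 f b) b y (radial_extension_d2 f b y)"
  using has_dir_deriv_of_differentiable[OF radial_extension_differentiable(1)[OF assms]]
    has_dir_deriv_of_differentiable[OF radial_extension_differentiable(2)[OF assms]]
  by (simp_all add: radial_extension_def[abs_def] radial_extension_d1_def[abs_def] radial_extension_d2_def)

lemma continuous_on_radial_extension:
  assumes "sphere_smooth f"
  shows "continuous_on (- {0}) (radial_extension f)" "continuous_on (- {0}) (radial_extension_d1 f b)"
  using radial_extension_differentiable[OF assms]
  by (auto intro!: continuous_at_imp_continuous_on differentiable_imp_continuous_within)

lemma radial_extension_scale: "c > 0 \<Longrightarrow> radial_extension f (c *\<^sub>R y) = radial_extension f y"
  by (simp add: radial_extension_def sgn_scaleR)

lemma has_dir_deriv_scale: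
  assumes "has_dir_deriv f v (c *\<^sub>R y) D" "c > 0" 
  shows "has_dir_deriv (\<lambda>y. f (c *\<^sub>R y)) v y (of_real c * D)"
proof -
  have "((\<lambda>t. f (c *\<^sub>R y + (c * t) *\<^sub>R v)) has_vector_derivative c *\<^sub>R D) (at 0)"
  proof -
    have "((\<lambda>t. c * t) has_vector_derivative c) (at 0)"
      by (auto intro!: derivative_eq_intros simp flip: has_real_derivative_iff_has_vector_derivative)
    from vector_diff_chain_at[OF this, of "\<lambda>t. f (c *\<^sub>R y + t *\<^sub>R v)" D] assms(1)
    show ?thesis by (simp add: has_dir_deriv_def o_def)
  qed
  then show ?thesis by (simp add: has_dir_deriv_def scaleR_add_right scaleR_conv_of_real)
qed

text \<open>
  The extension is homogeneous of degree 0, so its first derivatives have degree \<open>- 1\<close> and its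
  second derivatives degree \<open>- 2\<close>.
\<close>

lemma radial_extension_d1_scale:
  assumes "sphere_smooth f" "y \<noteq> 0" "c > 0"
  shows "radial_extension_d1 f b (c *\<^sub>R y) = of_real (1 / c) * radial_extension_d1 f b y"
proof -
  have "has_dir_deriv (\<lambda>y. radial_extension f (c *\<^sub>R y)) b y (of_real c * radial_extension_d1 f b (c *\<^sub>R y))"
    by (rule has_dir_deriv_scale[OF radial_extension_has_dir_deriv(1)]) (use assms in auto)
  then have "has_dir_deriv (radial_extension f) b y (of_real c * radial_extension_d1 f b (c *\<^sub>R y))"
    unfolding radial_extension_scale[OF assms(3)] .
  from has_dir_deriv_unique[OF this radial_extension_has_dir_deriv(1)[OF assms(1,2)]]
  show ?thesis using assms(3) by (simp add: field_simps)
qed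

lemma radial_extension_d2_scale:
  assumes "sphere_smooth f" "y \<noteq> 0" "c > 0"
  shows "radial_extension_d2 f b (c *\<^sub>R y) = of_real (1 / c\<^sup>2) * radial_extension_d2 f b y"
proof -
  have "has_dir_deriv (\<lambda>y. radial_extension_d1 f b (c *\<^sub>R y)) b y (of_real c * radial_extension_d2 f b (c *\<^sub>R y))"
    by (rule has_dir_deriv_scale[OF radial_extension_has_dir_deriv(2)]) (use assms in auto)
  then have "has_dir_deriv (\<lambda>y. of_real (1 / c) * radial_extension_d1 f b y) b y (of_real c * radial_extension_d2 f b (c *\<^sub>R y))"
    by (rule has_dir_deriv_transform[of _ _ _ _ "- {0}"]) (use assms radial_extension_d1_scale in auto)
  moreover have "has_dir_deriv (\<lambda>y. of_real (1 / c) * radial_extension_d1 f b y) b y (of_real (1 / c) * radial_extension_d2 f b y)"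
    using has_dir_deriv_mult[OF has_dir_deriv_const radial_extension_has_dir_deriv(2)[OF assms(1,2)], of "of_real (1/c)" b] by simp
  ultimately have "of_real c * radial_extension_d2 f b (c *\<^sub>R y) = of_real (1 / c) * radial_extension_d2 f b y"
    by (rule has_dir_deriv_unique)
  then show ?thesis using assms(3) by (simp add: field_simps power2_eq_square)
qed

lemma radial_extension_radial_derivative:
  assumes "sphere_smooth f" "y \<noteq> 0"
  shows "(\<Sum>b\<in>Basis. of_real (y \<bullet> b) * radial_extension_d1 f b y) = 0"
proof -
  let ?D = "frechet_derivative (\<lambda>y. f (sgn y)) (at y)"
  have df: "(\<lambda>y. f (sgn y)) differentiable (at y)"
    using radial_extension_differentiable(1)[OF assms] by (simp add: radial_extension_def[abs_def])
  have lin: "linear ?D" using df by (rule linear_frechet_derivative)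
  have "(\<Sum>b\<in>Basis. of_real (y \<bullet> b) * radial_extension_d1 f b y) = (\<Sum>b\<in>Basis. ?D ((y \<bullet> b) *\<^sub>R b))"
    by (simp add: radial_extension_d1_def linear_cmul[OF lin] scaleR_conv_of_real)
  also have "\<dots> = ?D y"
    by (simp flip: linear_sum[OF lin] add: euclidean_representation)
  also have "\<dots> = 0"
  proof -
    have "((\<lambda>t::real. f (sgn y)) has_vector_derivative 0) (at 0)" by simp
    then have "((\<lambda>t. f (sgn (y + t *\<^sub>R y))) has_vector_derivative 0) (at 0)"
    proof (rule has_vector_derivative_transform_within_open[of _ _ _ "{-1<..}"])
      fix t :: real assume "t \<in> {-1<..}"
      then have "y + t *\<^sub>R y = (1 + t) *\<^sub>R y" "1 + t > 0" by (auto simp: algebra_simps)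
      then show "f (sgn y) = f (sgn (y + t *\<^sub>R y))" by (simp add: sgn_scaleR)
    qed auto
    then have "has_dir_deriv (\<lambda>y. f (sgn y)) y y 0" by (simp add: has_dir_deriv_def)
    then show ?thesis using has_dir_deriv_unique[OF has_dir_deriv_of_differentiable[OF df]] by blast
  qed
  finally show ?thesis .
qed

text \<open>
  On the sphere \<open>D\<^sub>b F (sgn y) = norm y * D\<^sub>b F y\<close>; differentiating along \<open>b\<close> and summing gives
  the flat Laplacian plus the radial derivative, and the latter vanishes.
\<close>

lemma sphere_laplacian_eq_flat_laplacian:
  assumes f: "sphere_smooth f" and z: "norm z = 1"
  shows "sphere_laplacian f z = (\<Sum>b\<in>Basis. radial_extension_d2 f b z)"
proof -
  have z0: "z \<noteq> 0" using z by auto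
  have "frechet_derivative (\<lambda>y. radial_extension_d1 f b (sgn y)) (at z) b =
      of_real (z \<bullet> b) * radial_extension_d1 f b z + radial_extension_d2 f b z" (is "?l = ?r") if b: "b \<in> Basis" for b
  proof -
    have eq: "radial_extension_d1 f b (sgn y) = of_real (norm y) * radial_extension_d1 f b y" if "y \<noteq> 0" for y
      using radial_extension_d1_scale[OF f that, of "1 / norm y" b] that by (simp add: sgn_div_norm inverse_eq_divide)
    have dn: "(\<lambda>y. complex_of_real (norm y)) differentiable (at z)"
      using differentiable_norm_at[OF z0] unfolding differentiable_def by (blast intro: has_derivative_of_real)
    have "(\<lambda>y. of_real (norm y) * radial_extension_d1 f b y) differentiable (at z)"
      by (intro differentiable_mult dn radial_extension_differentiable(2)[OF f z0])
    then have d: "(\<lambda>y. radial_extension_d1 f b (sgn y)) differentiable (at z)"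
      by (rule differentiable_transform_open[of _ _ "- {0}"]) (use eq z0 in auto)
    have "has_dir_deriv (\<lambda>y. complex_of_real (norm y)) b z (of_real (z \<bullet> b))"
    proof -
      have "(sqrt has_real_derivative 1 / 2) (at ((norm (z - 0))\<^sup>2))"
        using z by (auto intro!: derivative_eq_intros)
      from has_dir_deriv_radial[OF this, of b] show ?thesis by simp
    qed
    from has_dir_deriv_mult[OF this radial_extension_has_dir_deriv(2)[OF f z0]]
    have "has_dir_deriv (\<lambda>y. of_real (norm y) * radial_extension_d1 f b y) b z ?r"
      using z by (simp add: add.commute)
    then have "has_dir_deriv (\<lambda>y. radial_extension_d1 f b (sgn y)) b z ?r"
      by (rule has_dir_deriv_transform[of _ _ _ _ "- {0}"]) (use eq z0 in auto)
    then show ?thesis using has_dir_deriv_unique[OF has_dir_deriv_of_differentiable[OF d]] by blast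
  qed
  then have "sphere_laplacian f z = (\<Sum>b\<in>Basis. of_real (z \<bullet> b) * radial_extension_d1 f b z) + (\<Sum>b\<in>Basis. radial_extension_d2 f b z)"
    by (simp add: sphere_laplacian_def sphere_div_def sphere_grad_def tangential_deriv_def sum.distrib
        radial_extension_d1_def)
  then show ?thesis using radial_extension_radial_derivative[OF f z0] by simp
qed

lemma bounded_radial_extension:
  fixes e :: "'a::euclidean_space \<Rightarrow> complex"
  assumes sm: "sphere_smooth e"
  obtains M where "M > 0" "\<And>y. norm (radial_extension e y) \<le> M"
proof -
  let ?F = "radial_extension e"
  have "bounded (?F ` sphere 0 1)"
    by (intro compact_imp_bounded compact_continuous_image continuous_on_subset[OF continuous_on_radial_extension(1)[OF sm]]) auto
  then obtain M where M: "\<And>y. y \<in> sphere 0 1 \<Longrightarrow> norm (?F y) \<le> M" unfolding bounded_iff by blast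
  have "norm (?F y) \<le> max 1 (max M (norm (?F 0)))" for y
  proof (cases "y = 0")
    case False
    then have "?F y = ?F (sgn y)" by (simp add: radial_extension_def sgn_div_norm)
    then show ?thesis using M[of "sgn y"] False by (simp add: norm_sgn)
  qed simp
  then show thesis by (intro that[of "max 1 (max M (norm (?F 0)))"]) auto
qed

text \<open>
  For the positive root of \<open>s (s + n - 2) = l ^ 2\<close> the radial and the spherical part of the
  Laplacian of \<open>norm y powr s * e (sgn y)\<close> cancel.
\<close>

theorem eigenfunction_harmonic_extension:
  fixes e :: "'a::euclidean_space \<Rightarrow> complex"
  assumes e: "sphere_eigenfunction l e" and l: "l > 0" and dim: "DIM('a) \<ge> 3"
  obtains s where "s > 0" "l\<^sup>2 = s * (s + real DIM('a) - 2)"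
    "mean_value_property (\<lambda>y. of_real (norm y powr s) * radial_extension e y)"
proof -
  let ?n = "real DIM('a)"
  have sm: "sphere_smooth e" and lap: "\<And>x. norm x = 1 \<Longrightarrow> - sphere_laplacian e x = of_real (l\<^sup>2) * e x"
    using e by (auto simp: sphere_eigenfunction_def)
  define \<sigma> where "\<sigma> = (sqrt ((?n - 2)\<^sup>2 + 4 * l\<^sup>2) - (?n - 2)) / 4"
  have n: "?n - 2 \<ge> 0" using dim by simp
  have sq: "(sqrt ((?n - 2)\<^sup>2 + 4 * l\<^sup>2))\<^sup>2 = (?n - 2)\<^sup>2 + 4 * l\<^sup>2" by simp
  have "sqrt ((?n - 2)\<^sup>2) < sqrt ((?n - 2)\<^sup>2 + 4 * l\<^sup>2)" using l by (intro real_sqrt_less_mono) simp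
  then have s0: "\<sigma> > 0" using n by (simp add: \<sigma>_def)
  have sig: "l\<^sup>2 = 4 * \<sigma>\<^sup>2 + 2 * \<sigma> * (?n - 2)"
  proof -
    have "4 * \<sigma> + (?n - 2) = sqrt ((?n - 2)\<^sup>2 + 4 * l\<^sup>2)" by (simp add: \<sigma>_def field_simps)
    then have "(4 * \<sigma> + (?n - 2))\<^sup>2 = (?n - 2)\<^sup>2 + 4 * l\<^sup>2" using sq by simp
    then show ?thesis by (simp add: power2_eq_square algebra_simps)
  qed
  let ?F = "radial_extension e"
  have lapF: "(\<Sum>b\<in>Basis. radial_extension_d2 e b y) = - of_real (l\<^sup>2 / (norm y)\<^sup>2) * ?F y" if y: "y \<noteq> 0" for y
  proof -
    have "y = norm y *\<^sub>R sgn y" using y by (simp add: sgn_div_norm)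
    then have "(\<Sum>b\<in>Basis. radial_extension_d2 e b y) = (\<Sum>b\<in>Basis. radial_extension_d2 e b (norm y *\<^sub>R sgn y))" by simp
    also have "\<dots> = of_real (1 / (norm y)\<^sup>2) * sphere_laplacian e (sgn y)"
      using y by (simp add: radial_extension_d2_scale[OF sm] sgn_zero_iff sphere_laplacian_eq_flat_laplacian[OF sm] norm_sgn sum_distrib_left)
    also have "sphere_laplacian e (sgn y) = - of_real (l\<^sup>2) * e (sgn y)"
    proof -
      have "- sphere_laplacian e (sgn y) = of_real (l\<^sup>2) * e (sgn y)"
        by (rule lap) (simp add: norm_sgn y)
      then have "sphere_laplacian e (sgn y) = - (of_real (l\<^sup>2) * e (sgn y))"
        by (metis minus_minus)
      then show ?thesis by simp
    qed
    finally show ?thesis by (simp add: radial_extension_def)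
  qed
  obtain M where M: "\<And>y. norm (?F y) \<le> M" using bounded_radial_extension[OF sm] by blast
  let ?H = "\<lambda>y. of_real (norm y powr (2 * \<sigma>)) * ?F y"
  have "continuous_on UNIV ?H"
  proof (rule continuous_at_imp_continuous_on, clarify)
    fix y :: 'a
    show "isCont ?H y"
    proof (cases "y = 0")
      case False
      have "continuous_on (- {0}) ?H"
        by (intro continuous_intros continuous_on_radial_extension(1)[OF sm]) auto
      then show ?thesis
        using continuous_on_eq_continuous_at[of "- {0::'a}" ?H] False by (simp add: open_Compl)
    next
      case True
      have "(?H \<longlongrightarrow> 0) (at 0)"
      proof (rule Lim_null_comparison)
        show "\<forall>\<^sub>F y in at 0. norm (?H y) \<le> norm y powr (2 * \<sigma>) * M"
          using M by (intro always_eventually) (auto simp: norm_mult intro!: mult_left_mono)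
        have "((\<lambda>y::'a. norm y powr (2 * \<sigma>)) \<longlongrightarrow> 0 powr (2 * \<sigma>)) (at 0)"
          by (rule tendsto_powr2) (use s0 in \<open>auto intro!: tendsto_eq_intros\<close>)
        from tendsto_mult_right[OF this, of M]
        show "((\<lambda>y::'a. norm y powr (2 * \<sigma>) * M) \<longlongrightarrow> 0) (at 0)" by simp
      qed
      then show ?thesis using True by (simp add: isCont_def)
    qed
  qed
  then have "mean_value_property ?H"
  proof (rule mean_value_property_of_weakly_harmonic)
    fix x :: 'a and r :: real and h0 h1 h2 :: "real \<Rightarrow> real"
    assume h: "r > 0" "\<And>\<tau>. (h0 has_real_derivative h1 \<tau>) (at \<tau>)"
      "\<And>\<tau>. (h1 has_real_derivative h2 \<tau>) (at \<tau>)" "continuous_on UNIV h2"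
      "\<And>\<tau>. \<tau> \<ge> r\<^sup>2 \<Longrightarrow> h0 \<tau> = 0 \<and> h1 \<tau> = 0 \<and> h2 \<tau> = 0"
    show "(\<integral>y. of_real (norm y powr (2 * \<sigma>)) * ?F y *
       of_real (4 * h2 ((norm (y - x))\<^sup>2) * (norm (y - x))\<^sup>2 + 2 * real DIM('a) * h1 ((norm (y - x))\<^sup>2)) \<partial>lborel) = 0"
      by (rule weakly_harmonic_homogeneous_extension[OF radial_extension_has_dir_deriv[OF sm] continuous_on_radial_extension[OF sm]
          radial_extension_differentiable(3)[OF sm] radial_extension_radial_derivative[OF sm] lapF M dim s0 sig h(2,3,4,5,1)])
  qed
  then show thesis
    using s0 sig by (intro that[of "2 * \<sigma>"]) (auto simp: power2_eq_square algebra_simps)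
qed

section \<open>Derivatives of functions with the mean value property\<close>

lemma has_dir_deriv_line:
  assumes "has_dir_deriv f v (y + t *\<^sub>R v) D"
  shows "((\<lambda>s. f (y + s *\<^sub>R v)) has_vector_derivative D) (at t)"
  using LIM_offset_zero_iff[of t "\<lambda>s. (f (y + s *\<^sub>R v) - f (y + t *\<^sub>R v)) /\<^sub>R (s - t)" D] assms
  by (simp add: has_dir_deriv_def has_vector_derivative_iff_quotient scaleR_add_left add.assoc)

lemma integrable_indicator_cball: "integrable lborel (\<lambda>y::'a::euclidean_space. indicator (cball x R) y * (B::real))"
  using borel_integrable_compact[of "cball x R" "\<lambda>_. B"] by simp

text \<open>Dominated convergence along a convergent sequence of centres.\<close>

lemma continuous_on_translated_integral:
  fixes h k :: "'a::euclidean_space \<Rightarrow> complex"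
  assumes h: "continuous_on UNIV h" and k: "continuous_on UNIV k" "\<And>y. \<not> norm y < 1 \<Longrightarrow> k y = 0"
  shows "continuous_on UNIV (\<lambda>x. \<integral>y. k y * h (x + y) \<partial>lborel)"
  unfolding continuous_on_sequentially
proof (intro allI ballI impI, elim conjE)
  fix X :: "nat \<Rightarrow> 'a" and x assume X: "X \<longlonglongrightarrow> x"
  obtain r where r: "\<And>i. norm (X i) \<le> r"
    using convergent_imp_bounded[OF X] unfolding bounded_iff by auto
  obtain B where B: "B > 0" "\<And>y. y \<in> cball 0 (r + 1) \<Longrightarrow> norm (h y) \<le> B"
    using bounded_on_cball[OF h] by blast
  obtain Bk where Bk: "Bk > 0" "\<And>y. y \<in> cball 0 1 \<Longrightarrow> norm (k y) \<le> Bk"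
    using bounded_on_cball[OF k(1)] by blast
  have c: "continuous_on UNIV (\<lambda>y. k y * h (x + y))" for x
    by (intro continuous_intros k(1) continuous_on_compose2[OF h]) auto
  have "(\<lambda>i. \<integral>y. k y * h (X i + y) \<partial>lborel) \<longlonglongrightarrow> (\<integral>y. k y * h (x + y) \<partial>lborel)"
  proof (rule integral_dominated_convergence[where w="\<lambda>y. indicator (cball (0::'a) 1) y * (Bk * B)"])
    show "(\<lambda>y. k y * h (x + y)) \<in> borel_measurable lborel" "(\<lambda>y. k y * h (X i + y)) \<in> borel_measurable lborel" for i
      using borel_measurable_continuous_onI[OF c] by auto
    show "integrable lborel (\<lambda>y::'a. indicator (cball 0 1) y * (Bk * B))"
      by (rule integrable_indicator_cball)
    show "AE y in lborel. (\<lambda>i. k y * h (X i + y)) \<longlonglongrightarrow> k y * h (x + y)"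
    proof (rule AE_I2)
      fix y
      have "(\<lambda>i. X i + y) \<longlonglongrightarrow> x + y" by (intro tendsto_intros X)
      then have "(\<lambda>i. h (X i + y)) \<longlonglongrightarrow> h (x + y)"
        by (intro continuous_on_tendsto_compose[OF h]) auto
      then show "(\<lambda>i. k y * h (X i + y)) \<longlonglongrightarrow> k y * h (x + y)" by (intro tendsto_intros)
    qed
    show "AE y in lborel. norm (k y * h (X i + y)) \<le> indicator (cball 0 1) y * (Bk * B)" for i
    proof (rule AE_I2)
      fix y :: 'a
      show "norm (k y * h (X i + y)) \<le> indicator (cball 0 1) y * (Bk * B)"
      proof (cases "norm y < 1")
        case True
        have "norm (X i + y) \<le> r + 1" using norm_triangle_ineq[of "X i" y] r[of i] True by linarith
        then show ?thesis using True B Bk(1) Bk(2)[of y] by (auto simp: norm_mult intro!: mult_mono)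
      qed (use k(2) B Bk in simp)
    qed
  qed
  then show "((\<lambda>x. \<integral>y. k y * h (x + y) \<partial>lborel) \<circ> X) \<longlonglongrightarrow> (\<integral>y. k y * h (x + y) \<partial>lborel)"
    by (simp add: o_def)
qed

text \<open>
  Minus the derivative of \<open>bump\<close> along \<open>v\<close>. The sign is the one that appears when a derivative in
  the centre of the ball is moved to the weight.
\<close>

definition bump_deriv :: "'a::euclidean_space \<Rightarrow> 'a \<Rightarrow> real"
  where "bump_deriv v y = 6 * max 0 (1 - (norm y)\<^sup>2) ^ 2 * (y \<bullet> v)"

text \<open>
  For functions with the mean value property this is the derivative along \<open>v\<close>, obtained by letting
  the derivative fall on the weight.
\<close>

definition harmonic_deriv :: "'a::euclidean_space \<Rightarrow> ('a \<Rightarrow> complex) \<Rightarrow> 'a \<Rightarrow> complex"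
  where "harmonic_deriv v h x = (\<integral>y. of_real (bump_deriv v y) * h (x + y) \<partial>lborel) / of_real (\<integral>y. bump (y::'a) \<partial>lborel)"

definition gradient_constant :: "'a::euclidean_space itself \<Rightarrow> real"
  where "gradient_constant _ = 6 * measure lborel (cball (0::'a) 1) / (\<integral>y. bump (y::'a) \<partial>lborel)"

lemma gradient_constant_pos: "gradient_constant TYPE('a::euclidean_space) > 0"
  using content_cball_pos[of 1 "0::'a"] integral_bump_pos[where 'a='a]
  by (simp add: gradient_constant_def)

lemma continuous_on_bump_deriv: "continuous_on S (bump_deriv v)"
  unfolding bump_deriv_def by (intro continuous_intros)

lemma bump_deriv_zero: "bump_deriv v y = 0" if "\<not> norm y < 1"
proof -
  have "1 \<le> (norm y)\<^sup>2" using that by simp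
  then show ?thesis by (simp add: bump_deriv_def)
qed

lemma abs_bump_deriv_le: "\<bar>bump_deriv v y\<bar> \<le> 6 * norm v"
proof (cases "norm y < 1")
  case True
  have "max 0 (1 - (norm y)\<^sup>2) ^ 2 \<le> 1" by (rule power_le_one) auto
  moreover have "\<bar>y \<bullet> v\<bar> \<le> norm y * norm v" by (rule Cauchy_Schwarz_ineq2)
  moreover have "norm y * norm v \<le> 1 * norm v" using True by (intro mult_right_mono) auto
  ultimately have "max 0 (1 - (norm y)\<^sup>2) ^ 2 * \<bar>y \<bullet> v\<bar> \<le> 1 * norm v"
    by (intro mult_mono) auto
  then show ?thesis by (simp add: bump_deriv_def abs_mult)
qed (simp add: bump_deriv_zero)

lemma has_dir_deriv_bump: "has_dir_deriv (\<lambda>y. complex_of_real (bump y)) v y (- of_real (bump_deriv v y))"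
proof -
  have "((\<lambda>t. 1 - t) has_real_derivative -1) (at \<tau>)" for \<tau> :: real
    by (auto intro!: derivative_eq_intros)
  from DERIV_chain2[OF DERIV_pos_part_power[of 1] this]
  have "((\<lambda>t. max 0 (1 - t) ^ 3) has_real_derivative - 3 * max 0 (1 - \<tau>) ^ 2) (at \<tau>)" for \<tau> :: real
    by (simp add: numeral_3_eq_3 numeral_2_eq_2)
  from has_dir_deriv_radial[OF this, where c=0 and y=y and b=v]
  show ?thesis by (simp add: bump_def bump_deriv_def)
qed

lemma integrable_bump_deriv_mult:
  fixes h :: "'a::euclidean_space \<Rightarrow> complex"
  assumes "continuous_on UNIV h"
  shows "integrable lborel (\<lambda>y. of_real (bump_deriv v y) * h y)"
  by (rule integrable_continuous_compact_support[of _ 0 1])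
     (auto intro!: continuous_intros assms continuous_on_bump_deriv bump_deriv_zero)

text \<open>
  Moving the centre \<open>x\<close> by \<open>t v\<close> amounts to moving the weight by \<open>(t / \<epsilon>) v\<close>, and the weight is
  differentiable even though nothing is known about derivatives of \<open>h\<close>.
\<close>

lemma mean_value_has_dir_deriv:
  fixes h :: "'a::euclidean_space \<Rightarrow> complex"
  assumes h: "mean_value_property h" and \<epsilon>: "\<epsilon> > 0"
  shows "has_dir_deriv h v x ((\<integral>y. of_real (bump_deriv v y) * h (x + \<epsilon> *\<^sub>R y) \<partial>lborel) / of_real (\<epsilon> * (\<integral>y. bump (y::'a) \<partial>lborel)))"
proof -
  let ?c = "\<integral>y. bump (y::'a) \<partial>lborel"
  have c: "?c > 0" by (rule integral_bump_pos)
  have cont: "continuous_on UNIV h" using h by (simp add: mean_value_property_def)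
  define f where "f t y = of_real (bump (y - (t / \<epsilon>) *\<^sub>R v)) * h (x + \<epsilon> *\<^sub>R y)" for t y
  define f' where "f' t y = of_real (1 / \<epsilon>) * (of_real (bump_deriv v (y - (t / \<epsilon>) *\<^sub>R v)) * h (x + \<epsilon> *\<^sub>R y))" for t y
  have ch: "continuous_on UNIV (\<lambda>y. h (x + \<epsilon> *\<^sub>R y))" for x
    by (intro continuous_on_compose2[OF cont]) (auto intro!: continuous_intros)
  have hx: "of_real ?c * h (x + t *\<^sub>R v) = (\<integral>y. f t y \<partial>lborel)" for t
  proof -
    have "of_real ?c * h (x + t *\<^sub>R v) = (\<integral>y. of_real (bump y) * h (x + t *\<^sub>R v + \<epsilon> *\<^sub>R y) \<partial>lborel)"
      using h \<epsilon> by (simp add: mean_value_property_def)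
    also have "\<dots> = (\<integral>y. f t ((t / \<epsilon>) *\<^sub>R v + y) \<partial>lborel)"
      using \<epsilon> by (simp add: f_def scaleR_add_right add.assoc)
    also have "\<dots> = (\<integral>y. f t y \<partial>lborel)"
    proof (rule lborel_integral_translation)
      have "continuous_on UNIV (f t)" unfolding f_def[abs_def]
        by (intro continuous_intros ch continuous_on_compose2[OF continuous_on_bump]) auto
      then show "f t \<in> borel_measurable borel" by (rule borel_measurable_continuous_onI)
    qed
    finally show ?thesis .
  qed
  define \<rho> where "\<rho> = 1 + norm v / \<epsilon>"
  have far: "\<not> norm (y - (t / \<epsilon>) *\<^sub>R v) < 1" if "y \<notin> cball 0 \<rho>" "\<bar>t - 0\<bar> < 1" for y t
  proof -
    have "norm ((t / \<epsilon>) *\<^sub>R v) \<le> norm v / \<epsilon>"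
      using that(2) \<epsilon> by (simp add: divide_simps mult_left_le_one_le)
    then show ?thesis using that(1) norm_triangle_ineq2[of y "(t / \<epsilon>) *\<^sub>R v"] by (simp add: \<rho>_def)
  qed
  obtain B where B: "B > 0" "\<And>y. y \<in> cball 0 \<rho> \<Longrightarrow> norm (h (x + \<epsilon> *\<^sub>R y)) \<le> B"
    using bounded_on_cball[OF ch[of x], of 0 \<rho>] by blast
  have D: "((\<lambda>t. \<integral>y. f t y \<partial>lborel) has_vector_derivative (\<integral>y. f' 0 y \<partial>lborel)) (at 0)"
  proof (rule has_vector_derivative_integral_dominated(1)[where d=1 and g="\<lambda>y. indicator (cball 0 \<rho>) y * (1 / \<epsilon> * (6 * norm v * B))"])
    fix t :: real and y assume t: "\<bar>t - 0\<bar> < 1"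
    have "((\<lambda>s. complex_of_real (bump (y + s *\<^sub>R (- (1 / \<epsilon>) *\<^sub>R v)))) has_vector_derivative
        - of_real (bump_deriv (- (1 / \<epsilon>) *\<^sub>R v) (y + t *\<^sub>R (- (1 / \<epsilon>) *\<^sub>R v)))) (at t)"
      by (rule has_dir_deriv_line) (rule has_dir_deriv_bump)
    moreover have "bump_deriv (- (1 / \<epsilon>) *\<^sub>R v) z = - (1 / \<epsilon>) * bump_deriv v z" for z
      by (simp add: bump_deriv_def)
    ultimately have "((\<lambda>s. complex_of_real (bump (y - (s / \<epsilon>) *\<^sub>R v))) has_vector_derivative
        of_real (1 / \<epsilon> * bump_deriv v (y - (t / \<epsilon>) *\<^sub>R v))) (at t)"
      by simp
    from has_vector_derivative_mult_left[OF this, of "h (x + \<epsilon> *\<^sub>R y)"]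
    show "((\<lambda>t. f t y) has_vector_derivative f' t y) (at t)"
      unfolding f_def f'_def by (simp add: mult.assoc)
    show "norm (f' t y) \<le> indicator (cball 0 \<rho>) y * (1 / \<epsilon> * (6 * norm v * B))"
    proof (cases "y \<in> cball 0 \<rho>")
      case True
      have "\<bar>bump_deriv v (y - (t / \<epsilon>) *\<^sub>R v)\<bar> * norm (h (x + \<epsilon> *\<^sub>R y)) \<le> (6 * norm v) * B"
        using B by (intro mult_mono abs_bump_deriv_le B(2)[OF True]) auto
      then have "1 / \<epsilon> * (\<bar>bump_deriv v (y - (t / \<epsilon>) *\<^sub>R v)\<bar> * norm (h (x + \<epsilon> *\<^sub>R y))) \<le> 1 / \<epsilon> * (6 * norm v * B)"
        using \<epsilon> by (intro mult_left_mono) auto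
      then show ?thesis using True \<epsilon> unfolding f'_def norm_mult norm_of_real by simp
    next
      case False
      then show ?thesis using bump_deriv_zero[OF far[OF False t]] by (simp add: f'_def)
    qed
  next
    fix t :: real assume t: "\<bar>t - 0\<bar> < 1"
    show "integrable lborel (f t)"
    proof (rule integrable_continuous_compact_support)
      show "continuous_on UNIV (f t)" unfolding f_def[abs_def]
        by (intro continuous_intros ch continuous_on_compose2[OF continuous_on_bump]) auto
      show "f t y = 0" if "y \<notin> cball 0 \<rho>" for y
        using bump_zero[OF far[OF that t]] by (simp add: f_def)
    qed
  qed (auto intro: integrable_indicator_cball)
  have f'0: "(\<integral>y. f' 0 y \<partial>lborel) = of_real (1 / \<epsilon>) * (\<integral>y. of_real (bump_deriv v y) * h (x + \<epsilon> *\<^sub>R y) \<partial>lborel)"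
    unfolding f'_def by simp
  have "((\<lambda>t. of_real (1 / ?c) * (of_real ?c * h (x + t *\<^sub>R v))) has_vector_derivative of_real (1 / ?c) * (\<integral>y. f' 0 y \<partial>lborel)) (at 0)"
    unfolding hx by (rule has_vector_derivative_mult_right[OF D])
  then show ?thesis
    unfolding has_dir_deriv_def f'0 using c by (simp add: mult.assoc[symmetric] field_simps)
qed

lemma harmonic_deriv_eq:
  fixes h :: "'a::euclidean_space \<Rightarrow> complex"
  assumes "mean_value_property h" "\<epsilon> > 0"
  shows "harmonic_deriv v h x = (\<integral>y. of_real (bump_deriv v y) * h (x + \<epsilon> *\<^sub>R y) \<partial>lborel) / of_real (\<epsilon> * (\<integral>y. bump (y::'a) \<partial>lborel))"
  using has_dir_deriv_unique[OF mean_value_has_dir_deriv[OF assms(1), of 1 v x] mean_value_has_dir_deriv[OF assms]]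
  by (simp add: harmonic_deriv_def)

lemma has_dir_deriv_harmonic_deriv:
  assumes "mean_value_property h"
  shows "has_dir_deriv h v x (harmonic_deriv v h x)"
  using mean_value_has_dir_deriv[OF assms, of 1 v x] by (simp add: harmonic_deriv_def)

text \<open>A Cauchy estimate: the radius \<open>\<epsilon>\<close> of the mean value identity is free.\<close>

lemma norm_harmonic_deriv_le:
  fixes h :: "'a::euclidean_space \<Rightarrow> complex"
  assumes h: "mean_value_property h" and \<epsilon>: "\<epsilon> > 0" and K: "\<And>y. y \<in> cball x \<epsilon> \<Longrightarrow> norm (h y) \<le> K"
  shows "norm (harmonic_deriv v h x) \<le> gradient_constant TYPE('a) * norm v / \<epsilon> * K"
proof -
  let ?c = "\<integral>y. bump (y::'a) \<partial>lborel"
  have c: "?c > 0" by (rule integral_bump_pos)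
  have cont: "continuous_on UNIV h" using h by (simp add: mean_value_property_def)
  have ch: "continuous_on UNIV (\<lambda>y. h (x + \<epsilon> *\<^sub>R y))"
    by (intro continuous_on_compose2[OF cont]) (auto intro!: continuous_intros)
  have "norm (\<integral>y. of_real (bump_deriv v y) * h (x + \<epsilon> *\<^sub>R y) \<partial>lborel) \<le> (\<integral>y. indicator (cball (0::'a) 1) y * (6 * norm v * K) \<partial>lborel)"
  proof (rule Bochner_Integration.integral_norm_bound_integral)
    show "integrable lborel (\<lambda>y. of_real (bump_deriv v y) * h (x + \<epsilon> *\<^sub>R y))"
      by (rule integrable_bump_deriv_mult[OF ch])
    show "integrable lborel (\<lambda>y. indicator (cball (0::'a) 1) y * (6 * norm v * K))" by (rule integrable_indicator_cball)
    fix y :: 'a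
    show "norm (of_real (bump_deriv v y) * h (x + \<epsilon> *\<^sub>R y)) \<le> indicator (cball 0 1) y * (6 * norm v * K)"
    proof (cases "norm y < 1")
      case True
      then have "x + \<epsilon> *\<^sub>R y \<in> cball x \<epsilon>" using \<epsilon> by (simp add: dist_norm)
      then have "\<bar>bump_deriv v y\<bar> * norm (h (x + \<epsilon> *\<^sub>R y)) \<le> 6 * norm v * K"
        by (intro mult_mono abs_bump_deriv_le K) auto
      then show ?thesis using True unfolding norm_mult norm_of_real by simp
    next
      case False
      have "0 \<le> K" using K[of x] \<epsilon> norm_ge_zero[of "h x"] by (simp add: order_trans[OF norm_ge_zero])
      then show ?thesis using bump_deriv_zero[OF False] by simp
    qed
  qed
  also have "\<dots> = 6 * norm v * K * measure lborel (cball (0::'a) 1)" by (simp add: mult.commute)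
  finally have "norm (\<integral>y. of_real (bump_deriv v y) * h (x + \<epsilon> *\<^sub>R y) \<partial>lborel) / (\<epsilon> * ?c) \<le> 6 * norm v * K * measure lborel (cball (0::'a) 1) / (\<epsilon> * ?c)"
    using c \<epsilon> by (intro divide_right_mono) auto
  then show ?thesis
    unfolding harmonic_deriv_eq[OF h \<epsilon>] gradient_constant_def norm_divide norm_of_real
    using c \<epsilon> by (simp add: field_simps)
qed

text \<open>Differentiate the mean value identity for \<open>h\<close> in the direction \<open>v\<close>.\<close>

lemma mean_value_property_harmonic_deriv:
  fixes h :: "'a::euclidean_space \<Rightarrow> complex"
  assumes h: "mean_value_property h"
  shows "mean_value_property (harmonic_deriv v h)"
  unfolding mean_value_property_def
proof (intro conjI allI impI)
  let ?c = "\<integral>y. bump (y::'a) \<partial>lborel"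
  have c: "?c > 0" by (rule integral_bump_pos)
  have cont: "continuous_on UNIV h" using h by (simp add: mean_value_property_def)
  have "continuous_on UNIV (\<lambda>x. \<integral>y. of_real (bump_deriv v y) * h (x + y) \<partial>lborel)"
    by (rule continuous_on_translated_integral[OF cont])
       (auto intro!: continuous_intros continuous_on_bump_deriv simp: bump_deriv_zero)
  then show contd: "continuous_on UNIV (harmonic_deriv v h)"
    unfolding harmonic_deriv_def[abs_def] using c by (intro continuous_intros) auto
  fix x :: 'a and \<epsilon> :: real assume \<epsilon>: "\<epsilon> > 0"
  obtain B where B: "B > 0" "\<And>y. y \<in> cball x (\<epsilon> + norm v) \<Longrightarrow> norm (harmonic_deriv v h y) \<le> B"
    using bounded_on_cball[OF contd] by blast
  have "((\<lambda>t. \<integral>y. of_real (bump y) * h (x + \<epsilon> *\<^sub>R y + t *\<^sub>R v) \<partial>lborel) has_vector_derivative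
     (\<integral>y. of_real (bump y) * harmonic_deriv v h (x + \<epsilon> *\<^sub>R y + 0 *\<^sub>R v) \<partial>lborel)) (at 0)"
  proof (rule has_vector_derivative_integral_dominated(1)[where d=1 and
        f'="\<lambda>t y. of_real (bump y) * harmonic_deriv v h (x + \<epsilon> *\<^sub>R y + t *\<^sub>R v)" and g="\<lambda>y. indicator (cball 0 1) y * B"])
    fix t :: real and y :: 'a assume t: "\<bar>t - 0\<bar> < 1"
    show "((\<lambda>t. of_real (bump y) * h (x + \<epsilon> *\<^sub>R y + t *\<^sub>R v)) has_vector_derivative
        of_real (bump y) * harmonic_deriv v h (x + \<epsilon> *\<^sub>R y + t *\<^sub>R v)) (at t)"
      by (intro has_vector_derivative_mult_right has_dir_deriv_line has_dir_deriv_harmonic_deriv h)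
    show "norm (of_real (bump y) * harmonic_deriv v h (x + \<epsilon> *\<^sub>R y + t *\<^sub>R v)) \<le> indicator (cball 0 1) y * B"
    proof (cases "norm y < 1")
      case True
      have "norm (\<epsilon> *\<^sub>R y + t *\<^sub>R v) \<le> \<epsilon> * norm y + \<bar>t\<bar> * norm v"
        using norm_triangle_ineq[of "\<epsilon> *\<^sub>R y" "t *\<^sub>R v"] \<epsilon> by simp
      also have "\<dots> \<le> \<epsilon> * 1 + 1 * norm v" using True t \<epsilon> by (intro add_mono mult_mono) auto
      finally have "x + \<epsilon> *\<^sub>R y + t *\<^sub>R v \<in> cball x (\<epsilon> + norm v)"
        using norm_minus_cancel[of "\<epsilon> *\<^sub>R y + t *\<^sub>R v"] by (simp add: dist_norm)
      then have "bump y * norm (harmonic_deriv v h (x + \<epsilon> *\<^sub>R y + t *\<^sub>R v)) \<le> 1 * B"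
        by (intro mult_mono bump_le_1 B) auto
      then show ?thesis using True bump_nonneg[of y] unfolding norm_mult norm_of_real by simp
    qed (use B in \<open>simp add: bump_zero\<close>)
    show "integrable lborel (\<lambda>y. of_real (bump y) * h (x + \<epsilon> *\<^sub>R y + t *\<^sub>R v))"
      by (intro integrable_bump_mult continuous_on_compose2[OF cont]) (auto intro!: continuous_intros)
  qed (simp_all only: integrable_indicator_cball zero_less_one)
  moreover have "(\<integral>y. of_real (bump y) * h (x + \<epsilon> *\<^sub>R y + t *\<^sub>R v) \<partial>lborel) = of_real ?c * h (x + t *\<^sub>R v)" for t
  proof -
    have eq: "x + \<epsilon> *\<^sub>R y + t *\<^sub>R v = (x + t *\<^sub>R v) + \<epsilon> *\<^sub>R y" for y by simp
    show ?thesis unfolding eq using h \<epsilon> unfolding mean_value_property_def by blast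
  qed
  moreover have "((\<lambda>t. of_real ?c * h (x + t *\<^sub>R v)) has_vector_derivative of_real ?c * harmonic_deriv v h x) (at 0)"
    using has_dir_deriv_harmonic_deriv[OF h, of v x] by (intro has_vector_derivative_mult_right) (simp add: has_dir_deriv_def)
  ultimately show "(\<integral>y. of_real (bump y) * harmonic_deriv v h (x + \<epsilon> *\<^sub>R y) \<partial>lborel) = of_real ?c * harmonic_deriv v h x"
    using vector_derivative_unique_at by fastforce
qed

lemma mean_value_property_iterated_deriv:
  "mean_value_property h \<Longrightarrow> mean_value_property ((harmonic_deriv v ^^ j) h)"
  by (induction j) (auto intro: mean_value_property_harmonic_deriv)

text \<open>The radius \<open>j \<epsilon>\<close> is divided into \<open>j\<close> equal steps, one for each derivative.\<close>

lemma norm_iterated_deriv_le: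
  fixes h :: "'a::euclidean_space \<Rightarrow> complex"
  assumes h: "mean_value_property h" and \<epsilon>: "\<epsilon> > 0"
    and K: "\<And>y. y \<in> cball x (real j * \<epsilon>) \<Longrightarrow> norm (h y) \<le> K"
  shows "norm ((harmonic_deriv v ^^ j) h x) \<le> (gradient_constant TYPE('a) * norm v / \<epsilon>) ^ j * K"
  using K
proof (induction j arbitrary: x)
  case (Suc j)
  have "norm ((harmonic_deriv v ^^ j) h z) \<le> (gradient_constant TYPE('a) * norm v / \<epsilon>) ^ j * K" if z: "z \<in> cball x \<epsilon>" for z
  proof (rule Suc.IH)
    fix y assume "y \<in> cball z (real j * \<epsilon>)"
    then have "y \<in> cball x (real (Suc j) * \<epsilon>)"
      using z dist_triangle[of x y z] by (simp add: algebra_simps)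
    then show "norm (h y) \<le> K" by (rule Suc.prems)
  qed
  from norm_harmonic_deriv_le[of "(harmonic_deriv v ^^ j) h" \<epsilon> x, OF mean_value_property_iterated_deriv[OF h] \<epsilon> this, of v]
  show ?case by (simp add: mult.assoc)
qed simp

section \<open>Analyticity along segments and the degree of an eigenfunction\<close>

text \<open>
  One term of the exponential series of \<open>n\<close>. It turns the bound \<open>j ^ j\<close> from equal steps into
  \<open>fact j\<close>.
\<close>

lemma power_self_le_exp_fact: "real n ^ n \<le> exp 1 ^ n * fact n"
proof -
  have "(\<lambda>k. real n ^ k /\<^sub>R fact k) sums exp (real n)" by (rule exp_converges)
  then have "(\<Sum>k\<in>{n}. real n ^ k /\<^sub>R fact k) \<le> exp (real n)"
    using sum_le_suminf[of "\<lambda>k. real n ^ k /\<^sub>R fact k" "{n}"] by (auto simp: sums_iff)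
  then have "real n ^ n / fact n \<le> exp (real n)" by (simp add: divide_inverse mult.commute)
  also have "exp (real n) = exp 1 ^ n" by (simp flip: exp_of_nat_mult)
  finally show ?thesis by (simp add: divide_simps)
qed

text \<open>
  Chosen so that a bound on the ball of radius \<open>analyticity_constant * r\<close> makes the Taylor
  coefficients in directions of length at most \<open>r\<close>, at every point of the segment, decay like \<open>(1
  / 4) ^ j\<close>.
\<close>

definition analyticity_constant :: "'a::euclidean_space itself \<Rightarrow> real"
  where "analyticity_constant _ = 1 + 4 * exp 1 * gradient_constant TYPE('a)"

lemma analyticity_constant_gt_1: "analyticity_constant TYPE('a::euclidean_space) > 1"
  using gradient_constant_pos[where 'a='a] by (simp add: analyticity_constant_def)

lemma norm_iterated_deriv_le_fact:
  fixes h :: "'a::euclidean_space \<Rightarrow> complex"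
  assumes h: "mean_value_property h" and r: "r > 0" and v: "4 * exp 1 * gradient_constant TYPE('a) * norm v \<le> r"
    and K: "\<And>y. y \<in> cball x r \<Longrightarrow> norm (h y) \<le> K"
  shows "norm ((harmonic_deriv v ^^ j) h x) \<le> fact j * (1 / 4) ^ j * K"
proof (cases "j = 0")
  case True
  then show ?thesis using K[of x] r by simp
next
  case False
  let ?C = "gradient_constant TYPE('a)"
  have K0: "0 \<le> K" using K[of x] r by (simp add: order_trans[OF norm_ge_zero])
  have "norm ((harmonic_deriv v ^^ j) h x) \<le> (?C * norm v / (r / real j)) ^ j * K"
    by (rule norm_iterated_deriv_le[OF h]) (use r False K in auto)
  also have "(?C * norm v / (r / real j)) ^ j = (?C * norm v / r) ^ j * real j ^ j"
    by (simp add: power_mult_distrib power_divide)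
  also have "\<dots> * K \<le> ((?C * norm v / r) ^ j * (exp 1 ^ j * fact j)) * K"
    using r gradient_constant_pos[where 'a='a] K0 power_self_le_exp_fact[of j]
    by (intro mult_right_mono mult_left_mono) auto
  also have "(?C * norm v / r) ^ j * (exp 1 ^ j * fact j) = fact j * (exp 1 * ?C * norm v / r) ^ j"
    by (simp add: power_mult_distrib power_divide)
  also have "\<dots> \<le> fact j * (1 / 4) ^ j"
  proof (intro mult_left_mono power_mono)
    show "exp 1 * ?C * norm v / r \<le> 1 / 4" using v r by (simp add: divide_simps mult_ac)
    show "0 \<le> exp 1 * ?C * norm v / r" using r gradient_constant_pos[where 'a='a] by simp
  qed auto
  finally show ?thesis using K0 by (simp add: mult_right_mono)
qed

text \<open>The remainder of order \<open>p\<close> is at most \<open>p (1 / 4) ^ p K\<close>.\<close>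

lemma taylor_along_segment:
  fixes h :: "'a::euclidean_space \<Rightarrow> complex"
  assumes h: "mean_value_property h" and r: "r > 0" and v: "norm v \<le> r"
    and K: "\<And>y. y \<in> cball x (analyticity_constant TYPE('a) * r) \<Longrightarrow> norm (h y) \<le> K"
    and t: "0 \<le> t" "t \<le> 1"
  shows "(\<lambda>j. (t ^ j / fact j) *\<^sub>R (harmonic_deriv v ^^ j) h x) sums h (x + t *\<^sub>R v)"
proof -
  let ?C = "gradient_constant TYPE('a)"
  define D where "D j s = (harmonic_deriv v ^^ j) h (x + s *\<^sub>R v)" for j s
  have K0: "0 \<le> K" using K[of x] r analyticity_constant_gt_1[where 'a='a] by (simp add: order_trans[OF norm_ge_zero])
  have bound: "norm (D j s) \<le> fact j * (1 / 4) ^ j * K" if s: "0 \<le> s" "s \<le> 1" for j s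
    unfolding D_def
  proof (rule norm_iterated_deriv_le_fact[OF h])
    show "0 < 4 * exp 1 * ?C * r" using r gradient_constant_pos[where 'a='a] by simp
    show "4 * exp 1 * ?C * norm v \<le> 4 * exp 1 * ?C * r"
      using v gradient_constant_pos[where 'a='a] by (intro mult_left_mono) auto
    fix y assume y: "y \<in> cball (x + s *\<^sub>R v) (4 * exp 1 * ?C * r)"
    have "norm (s *\<^sub>R v) \<le> 1 * r" unfolding norm_scaleR using s v r by (intro mult_mono) auto
    then have "dist x (x + s *\<^sub>R v) \<le> r" by (simp add: dist_norm)
    then have "dist x y \<le> analyticity_constant TYPE('a) * r"
      using y dist_triangle[of x y "x + s *\<^sub>R v"] by (simp add: analyticity_constant_def algebra_simps)
    then show "norm (h y) \<le> K" by (intro K) simp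
  qed
  have rem: "norm (h (x + t *\<^sub>R v) - (\<Sum>j<p. (t ^ j / fact j) *\<^sub>R (harmonic_deriv v ^^ j) h x)) \<le> real p * (1 / 4) ^ p * K" if p: "p > 0" for p
  proof -
    have "((\<lambda>s. ((t - s) ^ (p - 1) / fact (p - 1)) *\<^sub>R D p s) has_integral
        h (x + t *\<^sub>R v) - (\<Sum>i<p. ((t - 0) ^ i / fact i) *\<^sub>R D i 0)) {0..t}"
    proof (rule Taylor_has_integral[OF p])
      show "D 0 = (\<lambda>s. h (x + s *\<^sub>R v))" by (simp add: D_def fun_eq_iff)
      fix m s
      have "((\<lambda>s. (harmonic_deriv v ^^ m) h (x + s *\<^sub>R v)) has_vector_derivative
          harmonic_deriv v ((harmonic_deriv v ^^ m) h) (x + s *\<^sub>R v)) (at s)"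
        by (intro has_dir_deriv_line has_dir_deriv_harmonic_deriv mean_value_property_iterated_deriv h)
      then show "(D m has_vector_derivative D (Suc m) s) (at s within {0..t})"
        unfolding D_def[abs_def] by (simp add: has_vector_derivative_at_within)
    qed (use t in auto)
    then have "norm (h (x + t *\<^sub>R v) - (\<Sum>i<p. ((t - 0) ^ i / fact i) *\<^sub>R D i 0)) \<le> (real p * (1 / 4) ^ p * K) * measure lborel {0..t}"
    proof (rule has_integral_bound_real[where S="{}", rotated 2])
      show "finite {}" by simp
      show "0 \<le> real p * (1 / 4) ^ p * K" using K0 by simp
      show "norm (((t - s) ^ (p - 1) / fact (p - 1)) *\<^sub>R D p s) \<le> real p * (1 / 4) ^ p * K" if s: "s \<in> {0..t} - {}" for s
      proof -
        have "norm (((t - s) ^ (p - 1) / fact (p - 1)) *\<^sub>R D p s) \<le> (1 / fact (p - 1)) * (fact p * (1 / 4) ^ p * K)"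
          unfolding norm_scaleR using s t
          by (intro mult_mono bound) (auto intro!: divide_right_mono power_le_one)
        also have "\<dots> = real p * (1 / 4) ^ p * K"
          using fact_reduce[OF p, where 'a=real] by (simp add: field_simps)
        finally show ?thesis .
      qed
    qed
    also have "\<dots> \<le> (real p * (1 / 4) ^ p * K) * 1" using t K0 by (intro mult_left_mono) auto
    finally show ?thesis by (simp add: D_def)
  qed
  have "(\<lambda>p. h (x + t *\<^sub>R v) - (\<Sum>j<p. (t ^ j / fact j) *\<^sub>R (harmonic_deriv v ^^ j) h x)) \<longlonglongrightarrow> 0"
  proof (rule Lim_null_comparison)
    show "\<forall>\<^sub>F p in sequentially. norm (h (x + t *\<^sub>R v) - (\<Sum>j<p. (t ^ j / fact j) *\<^sub>R (harmonic_deriv v ^^ j) h x)) \<le> real p * (1 / 4) ^ p * K"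
      using eventually_gt_at_top[of 0] by eventually_elim (rule rem)
    have "(\<lambda>p. real p * (1 / 4) ^ p) \<longlonglongrightarrow> 0" by real_asymp
    from tendsto_mult_right[OF this, of K] show "(\<lambda>p. real p * (1 / 4) ^ p * K) \<longlonglongrightarrow> 0" by simp
  qed
  from tendsto_diff[OF tendsto_const[of "h (x + t *\<^sub>R v)"] this]
  show ?thesis by (simp add: sums_def)
qed

text \<open>
  The Taylor coefficients decay like \<open>(1 / 4) ^ j\<close>, so the series converges in the disc of radius
  2 with the bound \<open>2 K\<close>. The disc is larger than the segment, which is what normal family
  arguments on the segment need.
\<close>

lemma holomorphic_extension_along_segment:
  fixes h :: "'a::euclidean_space \<Rightarrow> complex"
  assumes h: "mean_value_property h" and r: "r > 0" and v: "norm v \<le> r"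
    and K: "\<And>y. y \<in> cball x (analyticity_constant TYPE('a) * r) \<Longrightarrow> norm (h y) \<le> K"
  obtains g where "g holomorphic_on ball 0 2" "\<And>z. z \<in> ball 0 2 \<Longrightarrow> norm (g z) \<le> 2 * K"
    "\<And>t. 0 \<le> t \<Longrightarrow> t \<le> 1 \<Longrightarrow> g (of_real t) = h (x + t *\<^sub>R v)"
proof -
  let ?C = "gradient_constant TYPE('a)"
  define a where "a j = (harmonic_deriv v ^^ j) h x / fact j" for j
  have K0: "0 \<le> K" using K[of x] r analyticity_constant_gt_1[where 'a='a] by (simp add: order_trans[OF norm_ge_zero])
  have aj: "norm (a j) \<le> (1 / 4) ^ j * K" for j
  proof -
    have "norm ((harmonic_deriv v ^^ j) h x) \<le> fact j * (1 / 4) ^ j * K"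
    proof (rule norm_iterated_deriv_le_fact[OF h])
      show "0 < 4 * exp 1 * ?C * r" using r gradient_constant_pos[where 'a='a] by simp
      show "4 * exp 1 * ?C * norm v \<le> 4 * exp 1 * ?C * r"
        using v gradient_constant_pos[where 'a='a] by (intro mult_left_mono) auto
      fix y assume "y \<in> cball x (4 * exp 1 * ?C * r)"
      then have "dist x y \<le> analyticity_constant TYPE('a) * r"
        using r by (simp add: analyticity_constant_def algebra_simps)
      then show "norm (h y) \<le> K" by (intro K) simp
    qed
    then show ?thesis by (simp add: a_def norm_divide divide_simps mult_ac)
  qed
  have az: "norm (a j * z ^ j) \<le> (1 / 2) ^ j * K" if "z \<in> ball 0 2" for j z
  proof -
    have "norm (a j * z ^ j) \<le> ((1 / 4) ^ j * K) * 2 ^ j"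
      unfolding norm_mult norm_power using that K0 by (intro mult_mono aj power_mono) auto
    also have "\<dots> = (1 / 2) ^ j * K" by (simp add: power_divide power_mult_distrib[symmetric] field_simps)
    finally show ?thesis .
  qed
  have geo: "(\<lambda>j. (1 / 2) ^ j * K) sums (2 * K)"
  proof -
    have "(\<lambda>j. (1 / 2 :: real) ^ j) sums (1 / (1 - 1 / 2))" by (intro geometric_sums) auto
    from sums_mult2[OF this, of K] show ?thesis by simp
  qed
  define g where "g z = (\<Sum>j. a j * z ^ j)" for z
  have sm: "summable (\<lambda>j. a j * z ^ j)" if "z \<in> ball 0 2" for z
    by (rule summable_comparison_test[OF _ sums_summable[OF geo]]) (use az[OF that] in auto)
  show thesis
  proof (rule that)
    show "g holomorphic_on ball 0 2"
      by (rule power_series_holomorphic[where a=a]) (use sm in \<open>auto simp: g_def intro!: summable_sums\<close>)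
    show "norm (g z) \<le> 2 * K" if "z \<in> ball 0 2" for z
    proof -
      have sn: "summable (\<lambda>j. norm (a j * z ^ j))"
        by (rule summable_comparison_test[OF _ sums_summable[OF geo]]) (use az[OF that] in auto)
      have "norm (g z) \<le> (\<Sum>j. norm (a j * z ^ j))" unfolding g_def by (rule summable_norm[OF sn])
      also have "\<dots> \<le> (\<Sum>j. (1 / 2) ^ j * K)"
        by (rule suminf_le[OF az[OF that] sn sums_summable[OF geo]])
      also have "\<dots> = 2 * K" using geo by (simp add: sums_iff)
      finally show ?thesis .
    qed
    show "g (of_real t) = h (x + t *\<^sub>R v)" if "0 \<le> t" "t \<le> 1" for t
    proof -
      have "(\<lambda>j. a j * of_real t ^ j) sums h (x + t *\<^sub>R v)"
        using taylor_along_segment[OF h r v K that] by (simp add: a_def scaleR_conv_of_real mult.commute)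
      then show ?thesis by (simp add: g_def sums_iff)
    qed
  qed
qed

lemma harmonic_deriv_uminus: "harmonic_deriv (- v) h = (\<lambda>x. - harmonic_deriv v h x)"
  by (simp add: harmonic_deriv_def bump_deriv_def fun_eq_iff)

lemma harmonic_deriv_cmult: "harmonic_deriv v (\<lambda>x. c * h x) = (\<lambda>x. c * harmonic_deriv v h x)"
  by (simp add: harmonic_deriv_def fun_eq_iff mult.left_commute)

lemma iterated_deriv_uminus: "(harmonic_deriv (- v) ^^ j) h = (\<lambda>x. (-1) ^ j * (harmonic_deriv v ^^ j) h x)"
proof (induction j)
  case (Suc j)
  then show ?case using harmonic_deriv_cmult[of v "(-1) ^ j" "(harmonic_deriv v ^^ j) h"]
    by (simp add: harmonic_deriv_uminus)
qed simp

text \<open>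
  On the ball of radius \<open>\<rho>\<close> at the origin \<open>H\<close> is of size \<open>\<rho> powr s\<close>, so its derivatives of order
  \<open>j\<close> at \<open>0\<close> are at most a constant times \<open>\<rho> powr (s - j)\<close> for every \<open>\<rho> > 0\<close>. Letting \<open>\<rho>\<close> tend to
  \<open>0\<close> or to infinity kills all orders except \<open>j = s\<close>. As \<open>H\<close> is not zero, \<open>s\<close> is an integer and
  \<open>H\<close> is its Taylor term of that order, which has the stated parity.
\<close>

theorem homogeneous_harmonic_degree:
  fixes H :: "'a::euclidean_space \<Rightarrow> complex"
  assumes H: "mean_value_property H" and s: "s > 0"
    and hom: "\<And>c y. c > 0 \<Longrightarrow> H (c *\<^sub>R y) = of_real (c powr s) * H y" and nz: "H y0 \<noteq> 0"
  obtains k :: nat where "s = real k" "k \<ge> 1" "\<And>y. H (- y) = (-1) ^ k * H y"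
proof -
  let ?C = "gradient_constant TYPE('a)"
  have cont: "continuous_on UNIV H" using H by (simp add: mean_value_property_def)
  have H0: "H 0 = 0"
  proof -
    have "H 0 = of_real (2 powr s) * H 0" using hom[of 2 0] by simp
    moreover have "2 powr s \<noteq> (1::real)" using s by simp
    ultimately show ?thesis by (metis mult_cancel_right1 of_real_eq_1_iff)
  qed
  obtain M where M: "M > 0" "\<And>y. y \<in> cball 0 1 \<Longrightarrow> norm (H y) \<le> M"
    using bounded_on_cball[OF cont] by blast
  have grow: "norm (H y) \<le> \<rho> powr s * M" if "\<rho> > 0" "y \<in> cball 0 \<rho>" for \<rho> y
  proof -
    have "H (\<rho> *\<^sub>R ((1 / \<rho>) *\<^sub>R y)) = of_real (\<rho> powr s) * H ((1 / \<rho>) *\<^sub>R y)" by (rule hom) fact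
    then have "norm (H y) = \<rho> powr s * norm (H ((1 / \<rho>) *\<^sub>R y))" using that by (simp add: norm_mult)
    also have "\<dots> \<le> \<rho> powr s * M" using that by (intro mult_left_mono M) (auto simp: divide_simps)
    finally show ?thesis .
  qed
  have D0: "(harmonic_deriv v ^^ j) H 0 = 0" if js: "real j \<noteq> s" for j v
  proof (cases "j = 0")
    case False
    define B where "B = (?C * norm v * real j) ^ j * M"
    have est: "norm ((harmonic_deriv v ^^ j) H 0) \<le> B * \<rho> powr (s - real j)" if \<rho>: "\<rho> > 0" for \<rho>
    proof -
      have "norm ((harmonic_deriv v ^^ j) H 0) \<le> (?C * norm v / (\<rho> / real j)) ^ j * (\<rho> powr s * M)"
        by (rule norm_iterated_deriv_le[OF H]) (use \<rho> False grow in auto)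
      also have "\<dots> = B * \<rho> powr (s - real j)"
        using \<rho> False by (simp add: B_def powr_diff powr_realpow power_mult_distrib power_divide)
      finally show ?thesis .
    qed
    \<comment> \<open>small balls for \<open>j < s\<close>, large balls for \<open>j > s\<close>\<close>
    have "((\<lambda>\<rho>. B * \<rho> powr (s - real j)) \<longlongrightarrow> B * 0) (if real j < s then at_right 0 else at_top)"
    proof (rule tendsto_mult_left)
      show "((\<lambda>\<rho>. \<rho> powr (s - real j)) \<longlongrightarrow> 0) (if real j < s then at_right 0 else at_top)"
      proof (cases "real j < s")
        case True
        have "((\<lambda>\<rho>::real. \<rho> powr (s - real j)) \<longlongrightarrow> 0 powr (s - real j)) (at_right 0)"
          by (rule tendsto_powr2) (use True in \<open>auto intro!: tendsto_eq_intros simp: eventually_at_right_less eventually_at_filter\<close>)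
        then show ?thesis using True by simp
      next
        case F: False
        then show ?thesis using js by (auto intro!: tendsto_neg_powr filterlim_ident)
      qed
    qed
    moreover have "\<forall>\<^sub>F \<rho> in (if real j < s then at_right 0 else at_top). norm ((harmonic_deriv v ^^ j) H 0) \<le> B * \<rho> powr (s - real j)"
      using eventually_mono[OF eventually_at_right_less[of 0] est] eventually_mono[OF eventually_gt_at_top[of 0] est] by auto
    ultimately have "norm ((harmonic_deriv v ^^ j) H 0) \<le> B * 0"
      by (intro tendsto_lowerbound) (auto simp: trivial_limit_at_right_real split: if_splits)
    then show ?thesis by simp
  qed (use H0 in simp)
  have tay: "(\<lambda>j. (1 / fact j) *\<^sub>R (harmonic_deriv v ^^ j) H 0) sums H v" for v
  proof -
    obtain B where B: "B > 0" "\<And>y. y \<in> cball 0 (analyticity_constant TYPE('a) * (norm v + 1)) \<Longrightarrow> norm (H y) \<le> B"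
      using bounded_on_cball[OF cont] by blast
    have "(\<lambda>j. (1 ^ j / fact j) *\<^sub>R (harmonic_deriv v ^^ j) H 0) sums H (0 + 1 *\<^sub>R v)"
      by (rule taylor_along_segment[OF H _ _ B(2)]) (auto simp: add_nonneg_pos)
    then show ?thesis by simp
  qed
  have "\<exists>k::nat. s = real k"
  proof (rule ccontr)
    assume "\<nexists>k::nat. s = real k"
    then have "(harmonic_deriv y0 ^^ j) H 0 = 0" for j by (intro D0) auto
    then show False using tay[of y0] nz by (simp add: sums_iff)
  qed
  then obtain k :: nat where k: "s = real k" by blast
  have Hv: "H v = (1 / fact k) *\<^sub>R (harmonic_deriv v ^^ k) H 0" for v
  proof -
    have "(\<lambda>j. (1 / fact j) *\<^sub>R (harmonic_deriv v ^^ j) H 0) sums (\<Sum>j\<in>{k}. (1 / fact j) *\<^sub>R (harmonic_deriv v ^^ j) H 0)"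
      by (rule sums_finite) (use D0 k in auto)
    then show ?thesis using sums_unique2[OF tay] by auto
  qed
  show thesis
  proof (rule that[OF k])
    show "k \<ge> 1" using k s by simp
    show "H (- y) = (-1) ^ k * H y" for y
      unfolding Hv[of "- y"] Hv[of y] iterated_deriv_uminus by simp
  qed
qed

section \<open>Small sublevel sets of harmonic functions\<close>

text \<open>
  If this fails for every \<open>c = 1 / (j + 1)\<close>, Montel's theorem gives a limit function \<open>g\<close> of the
  counterexamples, uniform on \<open>[0, 1]\<close>, whose zero set on \<open>[0, 1]\<close> has measure at least \<open>\<delta>\<close>. But
  \<open>\<bar>g 0\<bar> \<ge> 1\<close>, so \<open>g\<close> has only finitely many zeros there.
\<close>

lemma sublevel_measure_holomorphic:
  fixes K \<delta> :: real
  assumes \<delta>: "\<delta> > 0"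
  shows "\<exists>c>0. \<forall>g. g holomorphic_on ball 0 2 \<longrightarrow> (\<forall>z\<in>ball 0 2. norm (g z) \<le> K) \<longrightarrow> norm (g 0) \<ge> 1 \<longrightarrow>
     emeasure lborel {t\<in>{0..1}. norm (g (of_real t)) < c} \<le> ennreal \<delta>"
proof (rule ccontr)
  assume neg: "\<not> ?thesis"
  define P where "P g \<longleftrightarrow> g holomorphic_on ball 0 2 \<and> (\<forall>z\<in>ball 0 2. norm (g z) \<le> K) \<and> norm (g 0) \<ge> 1" for g :: "complex \<Rightarrow> complex"
  have "\<exists>g. P g \<and> emeasure lborel {t\<in>{0..1}. norm (g (of_real t)) < 1 / (real j + 1)} > ennreal \<delta>" for j :: nat
  proof (rule ccontr)
    assume "\<not> ?thesis"
    then have "0 < 1 / (real j + 1) \<and> (\<forall>g. g holomorphic_on ball 0 2 \<longrightarrow> (\<forall>z\<in>ball 0 2. norm (g z) \<le> K) \<longrightarrow> norm (g 0) \<ge> 1 \<longrightarrow>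
     emeasure lborel {t\<in>{0..1}. norm (g (of_real t)) < 1 / (real j + 1)} \<le> ennreal \<delta>)"
      by (auto simp: P_def not_less)
    then show False using neg by blast
  qed
  then obtain F where F: "\<And>j. P (F j)"
    "\<And>j. emeasure lborel {t\<in>{0..1}. norm (F j (of_real t)) < 1 / (real j + 1)} > ennreal \<delta>" by metis
  obtain g r where g: "g holomorphic_on ball 0 2" and r: "strict_mono (r :: nat \<Rightarrow> nat)"
    and lim: "\<And>x. x \<in> ball 0 2 \<Longrightarrow> ((\<lambda>n. F (r n) x) \<longlongrightarrow> g x) sequentially"
    and unif: "\<And>K. \<lbrakk>compact K; K \<subseteq> ball 0 2\<rbrakk> \<Longrightarrow> uniform_limit K (F \<circ> r) g sequentially"
  proof (rule Montel[of "ball 0 2" "Collect P" F])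
    show "\<exists>B. \<forall>h\<in>Collect P. \<forall>z\<in>K'. norm (h z) \<le> B" if "K' \<subseteq> ball 0 2" for K'
      using that by (intro exI[of _ K]) (auto simp: P_def)
  qed (use F in \<open>auto simp: P_def\<close>)
  have g0: "norm (g 0) \<ge> 1"
    by (rule tendsto_lowerbound[OF tendsto_norm[OF lim[of 0]]]) (use F(1) in \<open>auto simp: P_def\<close>)
  have fin: "finite {z\<in>cball 0 1. g z = 0}"
  proof (cases "g constant_on ball 0 2")
    case True
    then obtain a where a: "\<And>z. z \<in> ball 0 2 \<Longrightarrow> g z = a" unfolding constant_on_def by blast
    have "a \<noteq> 0" using a[of 0] g0 by auto
    then have "{z\<in>cball 0 1. g z = 0} = {}" using a by auto
    then show ?thesis by (metis finite.emptyI)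
  next
    case False
    show ?thesis by (rule holomorphic_compact_finite_zeros[OF g _ _ _ _ False]) auto
  qed
  define Z where "Z = {t\<in>{0..1::real}. g (of_real t) = 0}"
  have "of_real ` Z \<subseteq> {z\<in>cball 0 1. g z = 0}" by (auto simp: Z_def)
  then have "finite (complex_of_real ` Z)" using fin finite_subset by blast
  then have "finite Z" by (rule finite_imageD) (auto intro: inj_onI)
  then have Z0: "emeasure lborel Z = 0" by (simp add: emeasure_lborel_countable countable_finite)
  have contg: "continuous_on {0..1} (\<lambda>t. g (complex_of_real t))"
    by (intro continuous_on_compose2[OF holomorphic_on_imp_continuous_on[OF g]] continuous_intros) auto
  define E where "E N = {t\<in>{0..1}. norm (g (complex_of_real t)) \<le> 1 / (real N + 1)}" for N :: nat
  have Eclosed: "E N \<in> sets lborel" for N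
  proof -
    have "closed ({0..1} \<inter> (\<lambda>t. norm (g (complex_of_real t))) -` {..1 / (real N + 1)})"
      by (rule continuous_closed_preimage) (auto intro!: continuous_intros contg)
    moreover have "E N = {0..1} \<inter> (\<lambda>t. norm (g (complex_of_real t))) -` {..1 / (real N + 1)}"
      by (auto simp: E_def)
    ultimately show ?thesis by simp
  qed
  have EN: "ennreal \<delta> \<le> emeasure lborel (E N)" for N
  proof -
    let ?e = "1 / (2 * (real N + 1))"
    have "\<forall>\<^sub>F n in sequentially. \<forall>x\<in>cball 0 1. dist ((F \<circ> r) n x) (g x) < ?e"
    proof (rule uniform_limitD[OF unif[OF compact_cball]])
      show "cball 0 1 \<subseteq> ball (0::complex) 2" by auto
    qed simp
    moreover have "\<forall>\<^sub>F n in sequentially. n \<ge> 2 * N + 1" by (rule eventually_ge_at_top)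
    ultimately have "\<forall>\<^sub>F n in sequentially. n \<ge> 2 * N + 1 \<and> (\<forall>x\<in>cball 0 1. dist ((F \<circ> r) n x) (g x) < ?e)"
      by eventually_elim auto
    then obtain n where n: "n \<ge> 2 * N + 1" "\<And>x. x \<in> cball 0 1 \<Longrightarrow> dist (F (r n) x) (g x) < ?e"
      by (auto simp: eventually_sequentially)
    have rn: "1 / (real (r n) + 1) \<le> ?e"
      using seq_suble[OF r, of n] n(1) by (intro divide_left_mono) auto
    have "{t\<in>{0..1}. norm (F (r n) (of_real t)) < 1 / (real (r n) + 1)} \<subseteq> E N"
    proof
      fix t assume "t \<in> {t\<in>{0..1}. norm (F (r n) (of_real t)) < 1 / (real (r n) + 1)}"
      then have t: "t \<in> {0..1}" "norm (F (r n) (of_real t)) < ?e" using rn by auto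
      have "dist (F (r n) (of_real t)) (g (of_real t)) < ?e" by (rule n(2)) (use t in auto)
      then have "norm (g (of_real t)) < ?e + ?e"
        using t(2) norm_triangle_sub[of "g (of_real t)" "F (r n) (of_real t)"] by (simp add: dist_norm norm_minus_commute)
      also have "?e + ?e = 1 / (real N + 1)" by (simp add: field_simps)
      finally show "t \<in> E N" using t by (simp add: E_def)
    qed
    then have "emeasure lborel {t\<in>{0..1}. norm (F (r n) (of_real t)) < 1 / (real (r n) + 1)} \<le> emeasure lborel (E N)"
      by (rule emeasure_mono[OF _ Eclosed])
    then show ?thesis using F(2)[of "r n"] by order
  qed
  have "(\<lambda>N. emeasure lborel (E N)) \<longlonglongrightarrow> emeasure lborel (\<Inter>N. E N)"
  proof (rule Lim_emeasure_decseq)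
    show "decseq E" unfolding decseq_def E_def
      by (auto intro: order_trans[OF _ divide_left_mono])
    have "emeasure lborel (E N) \<le> emeasure lborel {0..1::real}" for N
      by (rule emeasure_mono) (auto simp: E_def)
    then show "emeasure lborel (E N) \<noteq> \<infinity>" for N
      by (metis emeasure_lborel_Icc ennreal_less_top infinity_ennreal_def less_irrefl order.strict_trans1 zero_le_one)
  qed (use Eclosed in auto)
  moreover have "(\<Inter>N. E N) = Z"
  proof -
    have "g (of_real t) = 0" if "\<And>N. norm (g (complex_of_real t)) \<le> 1 / (real N + 1)" for t
    proof -
      have "(\<lambda>N. 1 / (real N + 1)) \<longlonglongrightarrow> 0" by real_asymp
      then have "norm (g (complex_of_real t)) \<le> 0"
        by (rule tendsto_lowerbound) (use that in auto)
      then show ?thesis by simp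
    qed
    then show ?thesis unfolding E_def Z_def by auto
  qed
  ultimately have "(\<lambda>N. emeasure lborel (E N)) \<longlonglongrightarrow> 0" using Z0 by simp
  then have "ennreal \<delta> \<le> 0" by (rule tendsto_lowerbound) (use EN in auto)
  then show False using \<delta> by (simp add: ennreal_eq_0_iff[symmetric])
qed

lemma emeasure_ball_scaled:
  fixes c :: "'a::euclidean_space"
  assumes "r > 0"
  shows "emeasure lborel (ball c r) = ennreal (r ^ DIM('a) * measure lborel (ball (0::'a) 1))"
  using assms by (simp add: emeasure_ball content_ball mult.commute)

text \<open>
  On every ray from the origin the one-dimensional lemma applies, which bounds the measure of the
  sublevel set \<open>Z\<close> on the part \<open>[1 - \<tau>, 1]\<close> of each segment. By Fubini the dilates of \<open>Z\<close> are
  small on average, and a dilation by a factor close to 1 changes the measure of a set in the ball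
  only by \<open>O(\<tau>)\<close>.
\<close>

lemma sublevel_measure_harmonic:
  fixes K R \<delta> :: real
  assumes \<delta>: "\<delta> > 0" and R: "R > 0"
  shows "\<exists>c>0. \<forall>h :: 'a::euclidean_space \<Rightarrow> complex. mean_value_property h \<longrightarrow>
      (\<forall>y\<in>cball 0 (analyticity_constant TYPE('a) * R). norm (h y) \<le> K) \<longrightarrow> norm (h 0) \<ge> 1 \<longrightarrow>
      measure lborel {y\<in>ball 0 R. norm (h y) < c} \<le> \<delta>"
proof -
  let ?n = "DIM('a)"
  define V where "V = measure lborel (ball (0::'a) R)"
  have V: "V > 0" unfolding V_def by (rule content_ball_pos[OF R])
  have eV: "emeasure lborel (ball (0::'a) R) = ennreal V"
    unfolding V_def using emeasure_lborel_ball_finite[of "0::'a" R] by (simp add: emeasure_eq_ennreal_measure)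
  \<comment> \<open>the loss \<open>n \<tau> V\<close> from dilating by factors in \<open>[1 - \<tau>, 1]\<close> uses up half of \<open>\<delta>\<close>, the
    one-dimensional lemma the other half\<close>
  define \<tau> where "\<tau> = min (1 / 2) (\<delta> / (2 * ?n * V))"
  have \<tau>: "\<tau> > 0" "\<tau> \<le> 1 / 2" "?n * \<tau> * V \<le> \<delta> / 2"
  proof -
    show "\<tau> > 0" "\<tau> \<le> 1 / 2" using \<delta> V by (auto simp: \<tau>_def)
    have "\<tau> \<le> \<delta> / (2 * ?n * V)" by (simp add: \<tau>_def)
    then show "?n * \<tau> * V \<le> \<delta> / 2" using V by (simp add: field_simps)
  qed
  obtain c where c: "c > 0" "\<And>g. g holomorphic_on ball 0 2 \<Longrightarrow> (\<And>z. z\<in>ball 0 2 \<Longrightarrow> norm (g z) \<le> 2 * K) \<Longrightarrow> norm (g 0) \<ge> 1 \<Longrightarrow>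
     emeasure lborel {t\<in>{0..1}. norm (g (of_real t)) < c} \<le> ennreal (\<delta> * \<tau> / (2 * V))"
    using sublevel_measure_holomorphic[of "\<delta> * \<tau> / (2 * V)" "2 * K"] \<delta> \<tau> V by (auto 5 0)
  show ?thesis
  proof (intro exI[of _ c] conjI c(1) allI impI)
    fix h :: "'a \<Rightarrow> complex"
    assume h: "mean_value_property h" and K: "\<forall>y\<in>cball 0 (analyticity_constant TYPE('a) * R). norm (h y) \<le> K" and h0: "norm (h 0) \<ge> 1"
    have cont: "continuous_on UNIV h" using h by (simp add: mean_value_property_def)
    define Z where "Z = {y\<in>ball 0 R. norm (h y) < c}"
    have "open Z"
    proof -
      have "Z = ball 0 R \<inter> (\<lambda>y. norm (h y)) -` {..<c}" by (auto simp: Z_def)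
      also have "open \<dots>" by (intro open_Int open_ball open_vimage) (auto intro!: continuous_intros cont)
      finally show ?thesis .
    qed
    then have [measurable]: "Z \<in> sets borel" by simp
    have Bm [measurable]: "ball (0::'a) R \<in> sets borel" by simp
    have Zsub: "Z \<subseteq> ball 0 R" by (auto simp: Z_def)
    have Zf: "emeasure lborel Z < \<infinity>"
      using emeasure_mono[OF Zsub, of lborel] eV by (simp add: order.strict_trans1)
    have line: "(\<integral>\<^sup>+t. indicator {1 - \<tau>..1} t * indicator Z (t *\<^sub>R y) \<partial>lborel) \<le> ennreal (\<delta> * \<tau> / (2 * V))" if y: "y \<in> ball 0 R" for y
    proof -
      obtain g where g: "g holomorphic_on ball 0 2" "\<And>z. z \<in> ball 0 2 \<Longrightarrow> norm (g z) \<le> 2 * K"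
        "\<And>t. 0 \<le> t \<Longrightarrow> t \<le> 1 \<Longrightarrow> g (of_real t) = h (0 + t *\<^sub>R y)"
        by (rule holomorphic_extension_along_segment[OF h R, of y 0 K]) (use K y in auto)
      have S: "{t\<in>{0..1}. norm (g (of_real t)) < c} \<in> sets lborel"
      proof -
        have c1: "continuous_on UNIV (\<lambda>t::real. norm (h (t *\<^sub>R y)))"
          by (intro continuous_intros continuous_on_compose2[OF cont]) auto
        have "{t\<in>{0..1}. norm (g (of_real t)) < c} = {0..1} \<inter> (\<lambda>t. norm (h (t *\<^sub>R y))) -` {..<c}"
          using g(3) by auto
        also have "\<dots> \<in> sets borel"
          by (intro sets.Int borel_open[OF open_vimage[OF _ c1]]) auto
        finally show ?thesis by simp
      qed
      have "(\<integral>\<^sup>+t. indicator {1 - \<tau>..1} t * indicator Z (t *\<^sub>R y) \<partial>lborel) \<le>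
         (\<integral>\<^sup>+t. indicator {t\<in>{0..1}. norm (g (of_real t)) < c} t \<partial>lborel)"
        using \<tau> g(3) by (intro nn_integral_mono) (auto simp: indicator_def Z_def)
      also have "\<dots> = emeasure lborel {t\<in>{0..1}. norm (g (of_real t)) < c}"
        using S by simp
      also have "\<dots> \<le> ennreal (\<delta> * \<tau> / (2 * V))"
        by (rule c(2)[OF g(1,2)]) (use g(3)[of 0] h0 in auto)
      finally show ?thesis .
    qed
    have slice: "ennreal (measure lborel Z - ?n * \<tau> * V) \<le> (\<integral>\<^sup>+y. indicator (ball 0 R) y * indicator Z (t *\<^sub>R y) \<partial>lborel)"
      if t: "t \<in> {1 - \<tau>..1}" for t
    proof -
      have t0: "t > 0" "t \<le> 1" using t \<tau> by auto
      define S where "S = Z \<inter> ball 0 (t * R)"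
      have Sm: "S \<in> sets borel" by (simp add: S_def)
      have Sf: "emeasure lborel S < \<infinity>"
        using emeasure_mono[of S Z lborel] Zf by (simp add: S_def order.strict_trans1)
      have Vt: "measure lborel (ball (0::'a) (t * R)) = t ^ ?n * V"
        using t0 R by (simp add: V_def content_ball power_mult_distrib)
      have "measure lborel Z \<le> measure lborel (S \<union> (ball 0 R - ball 0 (t * R)))"
      proof (rule measure_mono_fmeasurable)
        show "S \<union> (ball 0 R - ball 0 (t * R)) \<in> fmeasurable lborel"
          using Sm Sf eV by (intro fmeasurable.Un fmeasurable_Diff) (auto simp: fmeasurable_def)
      qed (use Zsub in \<open>auto simp: S_def\<close>)
      also have "\<dots> \<le> measure lborel S + measure lborel (ball (0::'a) R - ball 0 (t * R))"
        using Sm by (intro measure_Un_le) auto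
      also have "measure lborel (ball (0::'a) R - ball 0 (t * R)) = V - t ^ ?n * V"
        unfolding V_def Vt[unfolded V_def, symmetric]
        by (rule measure_Diff) (use emeasure_lborel_ball_finite[of "0::'a" R] t0 R in \<open>auto simp: subset_ball mult_left_le_one_le less_le_trans\<close>)
      also have "\<dots> \<le> ?n * \<tau> * V"
      proof -
        have "1 + real ?n * (t - 1) \<le> (1 + (t - 1)) ^ ?n" by (rule Bernoulli_inequality) (use t0 in auto)
        then have "1 - t ^ ?n \<le> ?n * (1 - t)" by (simp add: algebra_simps)
        also have "\<dots> \<le> ?n * \<tau>" using t by (intro mult_left_mono) auto
        finally have "(1 - t ^ ?n) * V \<le> ?n * \<tau> * V" using V by (intro mult_right_mono) auto
        then show ?thesis by (simp add: algebra_simps)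
      qed
      finally have "measure lborel Z - ?n * \<tau> * V \<le> measure lborel S" by simp
      then have "ennreal (measure lborel Z - ?n * \<tau> * V) \<le> emeasure lborel S"
        using Sf by (simp add: emeasure_eq_ennreal_measure ennreal_leI)
      also have "\<dots> = (\<integral>\<^sup>+y. indicator S y \<partial>lborel)" using Sm by simp
      also have "\<dots> = ennreal (\<bar>t\<bar> ^ ?n) * (\<integral>\<^sup>+y. indicator S (0 + t *\<^sub>R y) \<partial>lborel)"
        by (rule nn_integral_lborel_affine) (use Sm t0 in auto)
      also have "\<dots> \<le> 1 * (\<integral>\<^sup>+y. indicator S (0 + t *\<^sub>R y) \<partial>lborel)"
        using t0 by (intro mult_right_mono) (auto simp: power_le_one)
      also have "\<dots> \<le> (\<integral>\<^sup>+y. indicator (ball 0 R) y * indicator Z (t *\<^sub>R y) \<partial>lborel)"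
        unfolding mult_1 using t0 by (intro nn_integral_mono) (auto simp: indicator_def S_def)
      finally show ?thesis .
    qed
    have "ennreal (\<tau> * (measure lborel Z - ?n * \<tau> * V)) = (\<integral>\<^sup>+t. ennreal (measure lborel Z - ?n * \<tau> * V) * indicator {1 - \<tau>..1} t \<partial>lborel)"
      using \<tau> by (subst nn_integral_cmult_indicator) (auto simp: ennreal_mult' mult.commute)
    also have "\<dots> \<le> (\<integral>\<^sup>+t. (\<integral>\<^sup>+y. indicator (ball 0 R) y * (indicator {1 - \<tau>..1} t * indicator Z (t *\<^sub>R y)) \<partial>lborel) \<partial>lborel)"
    proof (rule nn_integral_mono)
      fix t :: real
      show "ennreal (measure lborel Z - ?n * \<tau> * V) * indicator {1 - \<tau>..1} t \<le>
        (\<integral>\<^sup>+y. indicator (ball 0 R) y * (indicator {1 - \<tau>..1} t * indicator Z (t *\<^sub>R y)) \<partial>lborel)"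
        using slice[of t] by (cases "t \<in> {1 - \<tau>..1}") auto
    qed
    also have "\<dots> = (\<integral>\<^sup>+y. (\<integral>\<^sup>+t. indicator (ball 0 R) y * (indicator {1 - \<tau>..1} t * indicator Z (t *\<^sub>R y)) \<partial>lborel) \<partial>lborel)"
      by (rule lborel_pair.Fubini') measurable
    also have "\<dots> = (\<integral>\<^sup>+y. indicator (ball 0 R) y * (\<integral>\<^sup>+t. (indicator {1 - \<tau>..1} t * indicator Z (t *\<^sub>R y)) \<partial>lborel) \<partial>lborel)"
      by (intro nn_integral_cong nn_integral_cmult) measurable
    also have "\<dots> \<le> (\<integral>\<^sup>+y. ennreal (\<delta> * \<tau> / (2 * V)) * indicator (ball (0::'a) R) y \<partial>lborel)"
    proof (rule nn_integral_mono)
      fix y :: 'a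
      show "indicator (ball 0 R) y * (\<integral>\<^sup>+t. (indicator {1 - \<tau>..1} t * indicator Z (t *\<^sub>R y)) \<partial>lborel) \<le> ennreal (\<delta> * \<tau> / (2 * V)) * indicator (ball (0::'a) R) y"
        using line[of y] by (cases "y \<in> ball 0 R") (auto simp del: mem_ball)
    qed
    also have "\<dots> = ennreal (\<delta> * \<tau> / (2 * V)) * ennreal V"
      by (simp only: nn_integral_cmult_indicator Bm sets_lborel eV)
    also have "\<dots> = ennreal (\<tau> * (\<delta> / 2))"
      using V \<delta> \<tau> by (simp flip: ennreal_mult)
    finally have "\<tau> * (measure lborel Z - ?n * \<tau> * V) \<le> \<tau> * (\<delta> / 2)"
      using \<tau> \<delta> by (subst (asm) ennreal_le_iff) auto
    then have "measure lborel Z - ?n * \<tau> * V \<le> \<delta> / 2" using \<tau> by simp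
    then show "measure lborel {y\<in>ball 0 R. norm (h y) < c} \<le> \<delta>" using \<tau>(3) unfolding Z_def by linarith
  qed
qed

section \<open>The local inequality\<close>

text \<open>
  The \<open>L\<^sup>p\<close> mass of \<open>H\<close> as a measure, which makes the bookkeeping with good and bad sets a matter
  of additivity.
\<close>

definition power_measure :: "real \<Rightarrow> ('a::euclidean_space \<Rightarrow> complex) \<Rightarrow> 'a measure"
  where "power_measure p H = density lborel (\<lambda>y. ennreal (norm (H y) powr p))"

lemma sets_power_measure [simp, measurable_cong]: "sets (power_measure p H) = sets borel"
  by (simp add: power_measure_def)

lemma continuous_on_norm_powr:
  fixes H :: "'a::euclidean_space \<Rightarrow> complex"
  assumes "continuous_on S H" "p > 0"
  shows "continuous_on S (\<lambda>y. norm (H y) powr p)"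
  using assms by (intro continuous_on_powr' continuous_intros) auto

lemma borel_measurable_norm_powr:
  fixes H :: "'a::euclidean_space \<Rightarrow> complex"
  assumes "continuous_on UNIV H"
  shows "(\<lambda>y. norm (H y) powr p) \<in> borel_measurable borel"
  using borel_measurable_continuous_onI[OF assms] by measurable

lemma emeasure_power_measure_measurable:
  fixes H :: "'a::euclidean_space \<Rightarrow> complex"
  assumes [measurable]: "H \<in> borel_measurable borel" and "A \<in> sets borel"
  shows "emeasure (power_measure p H) A = (\<integral>\<^sup>+y. ennreal (norm (H y) powr p) * indicator A y \<partial>lborel)"
  unfolding power_measure_def
  by (rule emeasure_density) (use assms in auto)

lemma emeasure_power_measure:
  fixes H :: "'a::euclidean_space \<Rightarrow> complex"
  assumes "continuous_on UNIV H" "A \<in> sets borel"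
  shows "emeasure (power_measure p H) A = (\<integral>\<^sup>+y. ennreal (norm (H y) powr p) * indicator A y \<partial>lborel)"
  using emeasure_power_measure_measurable[OF borel_measurable_continuous_onI[OF assms(1)] assms(2)] .

lemma measure_power_measure:
  fixes H :: "'a::euclidean_space \<Rightarrow> complex"
  assumes "continuous_on UNIV H" "A \<in> sets borel"
  shows "measure (power_measure p H) A = (\<integral>y. indicator A y * norm (H y) powr p \<partial>lborel)"
proof -
  have "measure (power_measure p H) A = (\<integral>y. indicator A y \<partial>power_measure p H)"
    using assms by (simp add: power_measure_def)
  also have "\<dots> = (\<integral>y. norm (H y) powr p *\<^sub>R indicator A y \<partial>lborel)"
    unfolding power_measure_def
    by (rule integral_density) (use assms borel_measurable_norm_powr[OF assms(1), of p] in auto)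
  finally show ?thesis by (simp add: mult.commute)
qed

lemma emeasure_power_measure_bounded:
  fixes H :: "'a::euclidean_space \<Rightarrow> complex"
  assumes H: "continuous_on UNIV H" and A: "A \<in> sets borel" "A \<subseteq> cball x R" and p: "p > 0"
  shows "emeasure (power_measure p H) A < \<infinity>"
proof -
  obtain B where B: "B > 0" "\<And>y. y \<in> cball x R \<Longrightarrow> norm (H y) \<le> B"
    using bounded_on_cball[OF H] by blast
  have "emeasure (power_measure p H) A \<le> (\<integral>\<^sup>+y. ennreal (B powr p) * indicator (cball x R) y \<partial>lborel)"
    unfolding emeasure_power_measure[OF H A(1)] using A(2) B p
    by (intro nn_integral_mono) (auto simp: indicator_def powr_mono2 ennreal_leI)
  also have "\<dots> = ennreal (B powr p) * emeasure lborel (cball x R)"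
    by (rule nn_integral_cmult_indicator) simp
  also have "\<dots> < \<infinity>"
    using emeasure_lborel_cball_finite[of x R] by (simp add: ennreal_mult_less_top)
  finally show ?thesis .
qed

lemma emeasure_power_measure_bounded':
  fixes H :: "'a::euclidean_space \<Rightarrow> complex"
  assumes "continuous_on UNIV H" "A \<in> sets borel" "A \<subseteq> cball x R" "p > 0"
  shows "emeasure (power_measure p H) A = ennreal (measure (power_measure p H) A)"
  using emeasure_power_measure_bounded[OF assms] by (simp add: emeasure_eq_ennreal_measure)

text \<open>
  Below \<open>\<tau>\<close> there is nothing to show; above it, \<open>(a / \<tau>) powr (p - 1) \<ge> 1\<close>. With \<open>\<tau>\<close> proportional
  to the quantity to be estimated this replaces Hoelder's inequality.
\<close>

lemma le_add_powr_excess: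
  fixes a \<tau> p :: real
  assumes "a \<ge> 0" "\<tau> > 0" "p \<ge> 1"
  shows "a \<le> \<tau> + \<tau> powr (1 - p) * a powr p"
proof (cases "a \<le> \<tau>")
  case False
  then have a: "a > 0" using assms by simp
  have "a powr (1 - p) \<le> \<tau> powr (1 - p)"
    using False assms by (intro powr_mono2') auto
  then have "a powr (1 - p) * a powr p \<le> \<tau> powr (1 - p) * a powr p" by (intro mult_right_mono) auto
  then show ?thesis using a assms(2) by (simp flip: powr_add)
qed (use assms in \<open>simp add: add_increasing2\<close>)

definition submean_constant :: "'a::euclidean_space itself \<Rightarrow> real \<Rightarrow> real"
  where "submean_constant _ p = (let c = (\<integral>y. bump (y::'a) \<partial>lborel); V = measure lborel (ball (0::'a) 1)
     in 2 / c * (c / (2 * V)) powr (1 - p))"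

lemma submean_constant_pos: "submean_constant TYPE('a::euclidean_space) p > 0"
  using integral_bump_pos[where 'a='a] content_ball_pos[of 1 "0::'a"] by (simp add: submean_constant_def Let_def)

text \<open>
  The mean value identity bounds \<open>\<bar>h x\<bar>\<close> by the mean of \<open>\<bar>h\<bar>\<close>, and the preceding inequality with
  \<open>\<tau>\<close> a small multiple of \<open>\<bar>h x\<bar>\<close> passes to \<open>p\<close>-th powers, the first term being absorbed on the
  left.
\<close>

lemma submean_value_inequality:
  fixes h :: "'a::euclidean_space \<Rightarrow> complex"
  assumes h: "mean_value_property h" and p: "p \<ge> 1" and \<epsilon>: "\<epsilon> > 0"
  shows "\<epsilon> ^ DIM('a) * norm (h x) powr p \<le> submean_constant TYPE('a) p * measure (power_measure p h) (ball x \<epsilon>)"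
proof (cases "h x = 0")
  case True
  then show ?thesis using p submean_constant_pos[where 'a='a, of p] by simp
next
  case False
  define c where "c = (\<integral>y. bump (y::'a) \<partial>lborel)"
  define V where "V = measure lborel (ball (0::'a) 1)"
  define a where "a = norm (h x)"
  define I where "I = (\<integral>y. indicator (ball 0 1) y * norm (h (x + \<epsilon> *\<^sub>R y)) powr p \<partial>lborel)"
  have c: "c > 0" unfolding c_def by (rule integral_bump_pos)
  have V: "V > 0" unfolding V_def by (rule content_ball_pos) simp
  have a: "a > 0" using False by (simp add: a_def)
  have cont: "continuous_on UNIV h" using h by (simp add: mean_value_property_def)
  have ch: "continuous_on UNIV (\<lambda>y. h (x + \<epsilon> *\<^sub>R y))"
    by (intro continuous_on_compose2[OF cont]) (auto intro!: continuous_intros)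
  have I: "measure (power_measure p h) (ball x \<epsilon>) = \<epsilon> ^ DIM('a) * I"
  proof -
    have m: "(\<lambda>y. indicator (ball x \<epsilon>) y * norm (h y) powr p) \<in> borel_measurable borel"
      by (intro borel_measurable_times borel_measurable_indicator borel_measurable_norm_powr cont) simp
    have "indicator (ball x \<epsilon>) (x + \<epsilon> *\<^sub>R y) = (indicator (ball 0 1) y :: real)" for y :: 'a
      using \<epsilon> by (simp add: indicator_def dist_norm)
    then show ?thesis
      unfolding measure_power_measure[OF cont borel_open[OF open_ball]] I_def
      using lborel_integral_affine[OF m, of \<epsilon> x] \<epsilon> by simp
  qed
  have intI: "integrable lborel (\<lambda>y. indicator (ball 0 1) y * norm (h (x + \<epsilon> *\<^sub>R y)) powr p)"
  proof -
    have "integrable lborel (\<lambda>y. indicator (cball 0 1) y *\<^sub>R (norm (h (x + \<epsilon> *\<^sub>R y)) powr p))"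
      by (rule borel_integrable_compact) (use continuous_on_subset[OF ch] p in \<open>auto intro!: continuous_on_norm_powr\<close>)
    then show ?thesis
    proof (rule Bochner_Integration.integrable_bound)
      show "(\<lambda>y. indicator (ball 0 1) y * norm (h (x + \<epsilon> *\<^sub>R y)) powr p) \<in> borel_measurable lborel"
        using borel_measurable_norm_powr[OF ch, of p]
        by (intro borel_measurable_times borel_measurable_indicator) auto
    qed (auto simp: indicator_def)
  qed
  define \<tau> where "\<tau> = c * a / (2 * V)"
  have \<tau>: "\<tau> > 0" using a c V by (simp add: \<tau>_def)
  have "c * a = norm (\<integral>y. of_real (bump y) * h (x + \<epsilon> *\<^sub>R y) \<partial>lborel)"
    using h \<epsilon> c by (simp add: mean_value_property_def norm_mult a_def c_def)
  also have "\<dots> \<le> (\<integral>y. indicator (ball 0 1) y * \<tau> + \<tau> powr (1 - p) * (indicator (ball 0 1) y * norm (h (x + \<epsilon> *\<^sub>R y)) powr p) \<partial>lborel)"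
  proof (rule Bochner_Integration.integral_norm_bound_integral)
    show "integrable lborel (\<lambda>y. of_real (bump y) * h (x + \<epsilon> *\<^sub>R y))" by (rule integrable_bump_mult[OF ch])
    show "integrable lborel (\<lambda>y. indicator (ball 0 1) y * \<tau> + \<tau> powr (1 - p) * (indicator (ball 0 1) y * norm (h (x + \<epsilon> *\<^sub>R y)) powr p))"
      using emeasure_lborel_ball_finite[of "0::'a" 1]
      by (intro Bochner_Integration.integrable_add integrable_mult_right intI integrable_mult_left integrable_real_indicator) auto
    fix y :: 'a
    show "norm (of_real (bump y) * h (x + \<epsilon> *\<^sub>R y)) \<le> indicator (ball 0 1) y * \<tau> + \<tau> powr (1 - p) * (indicator (ball 0 1) y * norm (h (x + \<epsilon> *\<^sub>R y)) powr p)"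
    proof (cases "norm y < 1")
      case True
      have "norm (of_real (bump y) * h (x + \<epsilon> *\<^sub>R y)) \<le> 1 * norm (h (x + \<epsilon> *\<^sub>R y))"
        unfolding norm_mult norm_of_real using bump_nonneg[of y] bump_le_1[of y] by (intro mult_right_mono) auto
      also have "\<dots> \<le> \<tau> + \<tau> powr (1 - p) * norm (h (x + \<epsilon> *\<^sub>R y)) powr p"
        unfolding mult_1 by (rule le_add_powr_excess) (use \<tau> p in auto)
      finally show ?thesis using True by simp
    qed (simp add: bump_zero)
  qed
  also have "\<dots> = V * \<tau> + \<tau> powr (1 - p) * I"
    using emeasure_lborel_ball_finite[of "0::'a" 1]
    unfolding I_def V_def by (subst Bochner_Integration.integral_add) (auto intro!: intI integrable_mult_right integrable_mult_left integrable_real_indicator)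
  also have "V * \<tau> = c * a / 2" using V by (simp add: \<tau>_def)
  finally have "c * a / 2 \<le> \<tau> powr (1 - p) * I" by simp
  also have "\<tau> powr (1 - p) = (c / (2 * V)) powr (1 - p) * a powr (1 - p)"
    using a c V by (simp add: \<tau>_def powr_mult[symmetric])
  finally have "c * a / 2 \<le> (c / (2 * V)) powr (1 - p) * a powr (1 - p) * I" .
  then have "a powr (p - 1) * (c * a / 2) \<le> a powr (p - 1) * ((c / (2 * V)) powr (1 - p) * a powr (1 - p) * I)"
    by (intro mult_left_mono) auto
  also have "\<dots> = (a powr (p - 1) * a powr (1 - p)) * ((c / (2 * V)) powr (1 - p) * I)" by (simp add: mult_ac)
  also have "a powr (p - 1) * a powr (1 - p) = 1" using a by (simp flip: powr_add)
  also have "a powr (p - 1) * (c * a / 2) = c / 2 * a powr p"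
    using a powr_add[of a "p - 1" 1] by (simp add: mult_ac)
  finally have "a powr p \<le> submean_constant TYPE('a) p * I"
    using c by (simp add: submean_constant_def Let_def c_def[symmetric] V_def[symmetric] field_simps)
  then have "\<epsilon> ^ DIM('a) * a powr p \<le> \<epsilon> ^ DIM('a) * (submean_constant TYPE('a) p * I)"
    using \<epsilon> by (intro mult_left_mono) auto
  then show ?thesis unfolding I a_def by (simp add: mult_ac)
qed

text \<open>The invariance that allows every estimate to be made at unit scale.\<close>

lemma mean_value_property_affine:
  fixes h :: "'a::euclidean_space \<Rightarrow> complex"
  assumes h: "mean_value_property h" and s: "s > 0"
  shows "mean_value_property (\<lambda>y. a * h (x + s *\<^sub>R y))"
  unfolding mean_value_property_def
proof (intro conjI allI impI)
  have cont: "continuous_on UNIV h" using h by (simp add: mean_value_property_def)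
  show "continuous_on UNIV (\<lambda>y. a * h (x + s *\<^sub>R y))"
    by (intro continuous_intros continuous_on_compose2[OF cont]) auto
  fix z and \<epsilon> :: real assume \<epsilon>: "\<epsilon> > 0"
  have "(\<integral>y. of_real (bump y) * h ((x + s *\<^sub>R z) + (s * \<epsilon>) *\<^sub>R y) \<partial>lborel) =
       of_real (\<integral>y. bump (y::'a) \<partial>lborel) * h (x + s *\<^sub>R z)"
    using h s \<epsilon> unfolding mean_value_property_def by simp
  moreover have "(\<integral>y. of_real (bump y) * (a * h (x + s *\<^sub>R (z + \<epsilon> *\<^sub>R y))) \<partial>lborel) =
      a * (\<integral>y. of_real (bump y) * h ((x + s *\<^sub>R z) + (s * \<epsilon>) *\<^sub>R y) \<partial>lborel)"
    by (simp add: scaleR_add_right add.assoc mult.left_commute)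
  ultimately show "(\<integral>y. of_real (bump y) * (a * h (x + s *\<^sub>R (z + \<epsilon> *\<^sub>R y))) \<partial>lborel) =
       of_real (\<integral>y. bump (y::'a) \<partial>lborel) * (a * h (x + s *\<^sub>R z))"
    by (simp add: mult.left_commute)
qed

lemma affine_preimage_borel:
  fixes A :: "'a::euclidean_space set"
  assumes "A \<in> sets borel"
  shows "{y. x + s *\<^sub>R y \<in> A} \<in> sets borel"
proof -
  have "(\<lambda>y. x + s *\<^sub>R y) -` A \<inter> space borel \<in> sets borel"
    by (rule measurable_sets[OF _ assms]) simp
  then show ?thesis by (simp add: vimage_def)
qed

lemma fmeasurable_ball: "ball (x::'a::euclidean_space) r \<in> fmeasurable lborel"
  using emeasure_lborel_ball_finite[of x r] by (intro fmeasurableI) auto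

lemma measure_lborel_affine:
  fixes A :: "'a::euclidean_space set"
  assumes "A \<in> sets borel" "s > 0"
  shows "measure lborel A = s ^ DIM('a) * measure lborel {y. x + s *\<^sub>R y \<in> A}"
proof -
  have m: "(\<lambda>y. indicator A y :: real) \<in> borel_measurable borel" using assms by simp
  have S: "{y. x + s *\<^sub>R y \<in> A} \<in> sets lborel" using affine_preimage_borel[OF assms(1)] by simp
  have "indicator A (x + s *\<^sub>R y) = (indicator {y. x + s *\<^sub>R y \<in> A} y :: real)" for y
    by (simp add: indicator_def)
  then show ?thesis
    using lborel_integral_affine[OF m, of s x] assms S by (simp add: integral_indicator)
qed

text \<open>
  Here \<open>s\<close> is the scale. The hypothesis that \<open>x\<close> is good, i.e. that the mass of the ball at \<open>x\<close> is
  at most \<open>Q s ^ n \<bar>H x\<bar> powr p\<close>, gives through the sub-mean value inequality a pointwise bound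
  \<open>\<bar>H\<bar> \<le> K \<bar>H x\<bar>\<close> on a slightly smaller ball. After rescaling and division by \<open>H x\<close> the sublevel
  estimate says that \<open>\<bar>H\<bar> \<ge> c \<bar>H x\<bar>\<close> on a part of \<open>E\<close> of measure at least \<open>\<kappa> s ^ n / 2\<close>.
\<close>

lemma local_logvinenko_sereda:
  fixes Q R \<kappa> p :: real
  assumes Q: "Q > 0" and R: "R > 0" and \<kappa>: "\<kappa> > 0" and p: "p \<ge> 1"
  shows "\<exists>c>0. \<forall>(H :: 'a::euclidean_space \<Rightarrow> complex) s x E. mean_value_property H \<longrightarrow> s > 0 \<longrightarrow>
     measure (power_measure p H) (ball x (s * (analyticity_constant TYPE('a) * R + 1))) \<le> Q * s ^ DIM('a) * norm (H x) powr p \<longrightarrow>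
     E \<in> sets borel \<longrightarrow> E \<subseteq> ball x (s * R) \<longrightarrow> measure lborel E \<ge> \<kappa> * s ^ DIM('a) \<longrightarrow>
     c * s ^ DIM('a) * norm (H x) powr p \<le> measure (power_measure p H) E"
proof -
  let ?n = "DIM('a)"
  let ?A = "analyticity_constant TYPE('a)"
  define K where "K = (submean_constant TYPE('a) p * Q) powr (1 / p)"
  obtain c where c: "c > 0" "\<And>h :: 'a \<Rightarrow> complex. mean_value_property h \<Longrightarrow>
      (\<And>y. y\<in>cball 0 (?A * R) \<Longrightarrow> norm (h y) \<le> K) \<Longrightarrow> norm (h 0) \<ge> 1 \<Longrightarrow>
      measure lborel {y\<in>ball 0 R. norm (h y) < c} \<le> \<kappa> / 2"
    using sublevel_measure_harmonic[of "\<kappa> / 2" R K, where 'a='a] \<kappa> R by auto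
  show ?thesis
  proof (intro exI[of _ "c powr p * (\<kappa> / 2)"] conjI allI impI)
    show "0 < c powr p * (\<kappa> / 2)" using c \<kappa> by simp
    fix H :: "'a \<Rightarrow> complex" and s :: real and x E
    assume H: "mean_value_property H" and s: "s > 0"
      and good: "measure (power_measure p H) (ball x (s * (?A * R + 1))) \<le> Q * s ^ ?n * norm (H x) powr p"
      and E: "E \<in> sets borel" "E \<subseteq> ball x (s * R)" "\<kappa> * s ^ ?n \<le> measure lborel E"
    have cont: "continuous_on UNIV H" using H by (simp add: mean_value_property_def)
    show "c powr p * (\<kappa> / 2) * s ^ ?n * norm (H x) powr p \<le> measure (power_measure p H) E"
    proof (cases "H x = 0")
      case False
      define h where "h y = (1 / H x) * H (x + s *\<^sub>R y)" for y
      have mh: "mean_value_property h" unfolding h_def[abs_def] by (rule mean_value_property_affine[OF H s])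
      have bound: "norm (H y) powr p \<le> submean_constant TYPE('a) p * Q * norm (H x) powr p" if y: "y \<in> cball x (s * (?A * R))" for y
      proof -
        have "s ^ ?n * norm (H y) powr p \<le> submean_constant TYPE('a) p * measure (power_measure p H) (ball y s)"
          by (rule submean_value_inequality[OF H p s])
        also have "\<dots> \<le> submean_constant TYPE('a) p * measure (power_measure p H) (ball x (s * (?A * R + 1)))"
        proof (intro mult_left_mono measure_mono_fmeasurable)
          show "ball y s \<subseteq> ball x (s * (?A * R + 1))"
          proof
            fix z assume "z \<in> ball y s"
            then show "z \<in> ball x (s * (?A * R + 1))"
              using y dist_triangle[of x z y] by (simp add: algebra_simps)
          qed
          show "ball x (s * (?A * R + 1)) \<in> fmeasurable (power_measure p H)"
            using emeasure_power_measure_bounded[OF cont borel_open[OF open_ball] ball_subset_cball, of p] p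
            by (intro fmeasurableI) auto
        qed (use submean_constant_pos[where 'a='a, of p] in auto)
        also have "\<dots> \<le> submean_constant TYPE('a) p * (Q * s ^ ?n * norm (H x) powr p)"
          using submean_constant_pos[where 'a='a, of p] by (intro mult_left_mono good) auto
        finally have "s ^ ?n * norm (H y) powr p \<le> s ^ ?n * (submean_constant TYPE('a) p * Q * norm (H x) powr p)"
          by (simp add: mult_ac)
        then show ?thesis using s by simp
      qed
      have hK: "norm (h y) \<le> K" if "y \<in> cball 0 (?A * R)" for y
      proof -
        have "norm (H (x + s *\<^sub>R y)) powr p \<le> submean_constant TYPE('a) p * Q * norm (H x) powr p"
          by (rule bound) (use that s in \<open>auto simp: dist_norm\<close>)
        then have "(norm (H (x + s *\<^sub>R y)) / norm (H x)) powr p \<le> submean_constant TYPE('a) p * Q"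
          using False by (simp add: powr_divide divide_le_eq)
        then have "((norm (H (x + s *\<^sub>R y)) / norm (H x)) powr p) powr (1 / p) \<le> K"
          unfolding K_def using p by (intro powr_mono2) auto
        then show ?thesis using p by (simp add: h_def norm_mult norm_divide powr_powr)
      qed
      have h0: "norm (h 0) \<ge> 1" using False by (simp add: h_def)
      define Z where "Z = {y\<in>ball 0 R. norm (h y) < c}"
      have Z: "measure lborel Z \<le> \<kappa> / 2" unfolding Z_def by (rule c(2)[OF mh hK h0])
      have ch: "continuous_on UNIV h" using mh by (simp add: mean_value_property_def)
      have "open Z"
      proof -
        have "Z = ball 0 R \<inter> (\<lambda>y. norm (h y)) -` {..<c}" by (auto simp: Z_def)
        also have "open \<dots>" by (intro open_Int open_ball open_vimage) (auto intro!: continuous_intros ch)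
        finally show ?thesis .
      qed
      then have Zm: "Z \<in> sets borel" by simp
      define E' where "E' = {y. x + s *\<^sub>R y \<in> E}"
      have E'm: "E' \<in> sets borel" unfolding E'_def by (rule affine_preimage_borel[OF E(1)])
      have mE: "measure lborel E = s ^ ?n * measure lborel E'"
        unfolding E'_def by (rule measure_lborel_affine[OF E(1) s])
      have E'sub: "E' \<subseteq> ball 0 R"
      proof
        fix y assume "y \<in> E'"
        then have "dist x (x + s *\<^sub>R y) < s * R" using E(2) by (auto simp: E'_def)
        then show "y \<in> ball 0 R" using s by (simp add: dist_norm)
      qed
      note bf = fmeasurable_ball[of "0::'a" R]
      have E'f: "E' \<in> fmeasurable lborel" by (rule fmeasurableI2[OF bf E'sub]) (use E'm in simp)
      have Zf: "Z \<in> fmeasurable lborel" by (rule fmeasurableI2[OF bf]) (use Zm in \<open>auto simp: Z_def\<close>)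
      have "measure lborel E' \<le> measure lborel (E' - Z) + measure lborel Z"
      proof -
        have "measure lborel E' \<le> measure lborel ((E' - Z) \<union> Z)"
          by (rule measure_mono_fmeasurable) (use E'f Zf E'm in \<open>auto intro!: fmeasurable.Un fmeasurable_Diff dest: fmeasurableD\<close>)
        also have "\<dots> \<le> measure lborel (E' - Z) + measure lborel Z"
          by (rule measure_Un_le) (use E'm Zm in auto)
        finally show ?thesis .
      qed
      moreover have "\<kappa> \<le> measure lborel E'"
        using E(3) s unfolding mE by (simp add: mult.commute)
      ultimately have big: "\<kappa> / 2 \<le> measure lborel (E' - Z)" using Z by linarith
      have low: "c powr p * norm (H x) powr p \<le> norm (H (x + s *\<^sub>R y)) powr p" if "y \<in> E' - Z" for y
      proof -
        have "c \<le> norm (h y)" using that E'sub by (auto simp: Z_def)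
        then have "c powr p \<le> norm (h y) powr p" using c p by (intro powr_mono2) auto
        then show ?thesis using False by (simp add: h_def norm_mult norm_divide powr_divide field_simps)
      qed
      have EZf: "E' - Z \<in> fmeasurable lborel" using E'f Zf by (auto intro!: fmeasurable_Diff dest: fmeasurableD)
      have chs: "continuous_on UNIV (\<lambda>y. H (x + s *\<^sub>R y))"
        by (intro continuous_on_compose2[OF cont]) (auto intro!: continuous_intros)
      have "c powr p * norm (H x) powr p * (\<kappa> / 2) \<le> c powr p * norm (H x) powr p * measure lborel (E' - Z)"
        by (intro mult_left_mono big) auto
      also have "\<dots> = (\<integral>y. indicator (E' - Z) y * (c powr p * norm (H x) powr p) \<partial>lborel)"
        using fmeasurableD[OF EZf] by (simp add: mult.commute)
      also have "\<dots> \<le> (\<integral>y. indicator E' y * norm (H (x + s *\<^sub>R y)) powr p \<partial>lborel)"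
      proof (rule integral_mono)
        show "integrable lborel (\<lambda>y. indicator (E' - Z) y * (c powr p * norm (H x) powr p))"
          using EZf by (intro integrable_mult_left integrable_real_indicator) (auto simp: fmeasurable_def)
        have "integrable lborel (\<lambda>y. indicator (cball 0 R) y *\<^sub>R (norm (H (x + s *\<^sub>R y)) powr p))"
          by (rule borel_integrable_compact) (use continuous_on_subset[OF chs] p in \<open>auto intro!: continuous_on_norm_powr\<close>)
        then show "integrable lborel (\<lambda>y. indicator E' y * norm (H (x + s *\<^sub>R y)) powr p)"
        proof (rule Bochner_Integration.integrable_bound)
          show "(\<lambda>y. indicator E' y * norm (H (x + s *\<^sub>R y)) powr p) \<in> borel_measurable lborel"
            using borel_measurable_norm_powr[OF chs, of p] E'm
            by (intro borel_measurable_times borel_measurable_indicator) auto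
          show "AE y in lborel. norm (indicator E' y * norm (H (x + s *\<^sub>R y)) powr p)
              \<le> norm (indicator (cball 0 R) y *\<^sub>R (norm (H (x + s *\<^sub>R y)) powr p))"
          proof (rule AE_I2)
            fix y
            show "norm (indicator E' y * norm (H (x + s *\<^sub>R y)) powr p)
              \<le> norm (indicator (cball 0 R) y *\<^sub>R (norm (H (x + s *\<^sub>R y)) powr p))"
              using subsetD[OF E'sub, of y] by (auto simp: indicator_def)
          qed
        qed
      qed (use low in \<open>auto simp: indicator_def\<close>)
      finally have "s ^ ?n * (c powr p * norm (H x) powr p * (\<kappa> / 2)) \<le> s ^ ?n * (\<integral>y. indicator E' y * norm (H (x + s *\<^sub>R y)) powr p \<partial>lborel)"
        using s by (intro mult_left_mono) auto
      also have "\<dots> = measure (power_measure p H) E"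
      proof -
        have m: "(\<lambda>y. indicator E y * norm (H y) powr p) \<in> borel_measurable borel"
          by (intro borel_measurable_times borel_measurable_indicator borel_measurable_norm_powr cont E)
        have "indicator E (x + s *\<^sub>R y) = (indicator E' y :: real)" for y
          by (simp add: indicator_def E'_def)
        then show ?thesis
          unfolding measure_power_measure[OF cont E(1)]
          using lborel_integral_affine[OF m, of s x] s by simp
      qed
      finally show ?thesis by (simp add: mult_ac)
    qed (use p in simp)
  qed
qed

section \<open>The inequality in the unit ball\<close>

text \<open>Fubini. The sign \<open>s\<close> covers balls centred at the point and at its antipode.\<close>

lemma nn_integral_power_measure_ball:
  fixes H :: "'a::euclidean_space \<Rightarrow> complex"
  assumes H: "continuous_on UNIV H" and S: "S \<in> sets borel" and T: "T \<in> sets borel" and s: "\<bar>s\<bar> = 1" and \<rho>: "\<rho> > 0"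
  shows "(\<integral>\<^sup>+x. indicator S x * emeasure (power_measure p H) (T \<inter> ball (s *\<^sub>R x) \<rho>) \<partial>lborel)
      \<le> ennreal (\<rho> ^ DIM('a) * measure lborel (ball (0::'a) 1)) * emeasure (power_measure p H) T"
proof -
  let ?w = "\<lambda>y. ennreal (norm (H y) powr p)"
  have [measurable]: "?w \<in> borel_measurable borel" using borel_measurable_norm_powr[OF H, of p] by measurable
  note S[measurable] T[measurable]
  have s0: "s \<noteq> 0" "s * s = 1" using s by (auto simp: abs_if split: if_splits)
  have "(\<integral>\<^sup>+x. indicator S x * emeasure (power_measure p H) (T \<inter> ball (s *\<^sub>R x) \<rho>) \<partial>lborel)
      = (\<integral>\<^sup>+x. (\<integral>\<^sup>+y. indicator S x * (?w y * (indicator T y * indicator {z. dist (fst z) (snd z) < \<rho>} (s *\<^sub>R x, y))) \<partial>lborel) \<partial>lborel)"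
  proof (rule nn_integral_cong)
    fix x :: 'a
    have "emeasure (power_measure p H) (T \<inter> ball (s *\<^sub>R x) \<rho>) = (\<integral>\<^sup>+y. ?w y * (indicator T y * indicator {z. dist (fst z) (snd z) < \<rho>} (s *\<^sub>R x, y)) \<partial>lborel)"
      using T by (subst emeasure_power_measure[OF H]) (auto intro!: nn_integral_cong simp: indicator_def)
    then show "indicator S x * emeasure (power_measure p H) (T \<inter> ball (s *\<^sub>R x) \<rho>) = (\<integral>\<^sup>+y. indicator S x * (?w y * (indicator T y * indicator {z. dist (fst z) (snd z) < \<rho>} (s *\<^sub>R x, y))) \<partial>lborel)"
      by (simp only:) (rule nn_integral_cmult[symmetric], measurable)
  qed
  also have "\<dots> = (\<integral>\<^sup>+y. (\<integral>\<^sup>+x. indicator S x * (?w y * (indicator T y * indicator {z. dist (fst z) (snd z) < \<rho>} (s *\<^sub>R x, y))) \<partial>lborel) \<partial>lborel)"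
    by (rule lborel_pair.Fubini'[symmetric]) measurable
  also have "\<dots> \<le> (\<integral>\<^sup>+y. ennreal (\<rho> ^ DIM('a) * measure lborel (ball (0::'a) 1)) * (?w y * indicator T y) \<partial>lborel)"
  proof (rule nn_integral_mono)
    fix y :: 'a
    have "(\<integral>\<^sup>+x. indicator S x * (?w y * (indicator T y * indicator {z. dist (fst z) (snd z) < \<rho>} (s *\<^sub>R x, y))) \<partial>lborel)
       \<le> (\<integral>\<^sup>+x. (?w y * indicator T y) * indicator (ball (s *\<^sub>R y) \<rho>) x \<partial>lborel)"
    proof (rule nn_integral_mono)
      fix x :: 'a
      have "dist (s *\<^sub>R x) y = dist (s *\<^sub>R y) x"
      proof -
        have "s *\<^sub>R x - y = s *\<^sub>R (x - s *\<^sub>R y)" using s0 by (simp add: scaleR_diff_right)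
        then show ?thesis using s by (simp add: dist_norm norm_minus_commute)
      qed
      then show "indicator S x * (?w y * (indicator T y * indicator {z. dist (fst z) (snd z) < \<rho>} (s *\<^sub>R x, y)))
        \<le> (?w y * indicator T y) * indicator (ball (s *\<^sub>R y) \<rho>) x"
        by (auto simp: indicator_def)
    qed
    also have "\<dots> = (?w y * indicator T y) * emeasure lborel (ball (s *\<^sub>R y) \<rho>)"
      by (rule nn_integral_cmult_indicator) simp
    also have "\<dots> = ennreal (\<rho> ^ DIM('a) * measure lborel (ball (0::'a) 1)) * (?w y * indicator T y)"
      unfolding emeasure_ball_scaled[OF \<rho>] by (rule mult.commute)
    finally show "(\<integral>\<^sup>+x. indicator S x * (?w y * (indicator T y * indicator {z. dist (fst z) (snd z) < \<rho>} (s *\<^sub>R x, y))) \<partial>lborel) \<le> \<dots>" .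
  qed
  also have "\<dots> = ennreal (\<rho> ^ DIM('a) * measure lborel (ball (0::'a) 1)) * emeasure (power_measure p H) T"
    unfolding emeasure_power_measure[OF H T] by (rule nn_integral_cmult) measurable
  finally show ?thesis .
qed

text \<open>
  Mass in the radial direction is explicit: a dilation by \<open>t\<close> multiplies the mass by \<open>t powr (k p
  + n)\<close>. This is what ties the shell of width \<open>1 / (2 k)\<close> to the whole ball with constants
  independent of \<open>k\<close>.
\<close>

lemma emeasure_power_measure_homogeneous:
  fixes H :: "'a::euclidean_space \<Rightarrow> complex"
  assumes H[measurable]: "H \<in> borel_measurable borel" and hom: "\<And>c y. c > 0 \<Longrightarrow> H (c *\<^sub>R y) = of_real (c ^ k) * H y"
    and A: "A \<in> sets borel" and t: "t > 0"
  shows "emeasure (power_measure p H) A = ennreal (t powr (real k * p + real DIM('a))) * emeasure (power_measure p H) {y. t *\<^sub>R y \<in> A}"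
proof -
  let ?w = "\<lambda>y. ennreal (norm (H y) powr p)"
  note A[measurable]
  have B: "{y. t *\<^sub>R y \<in> A} \<in> sets borel" using affine_preimage_borel[OF A, of 0 t] by simp
  have w: "?w (t *\<^sub>R y) = ennreal (t powr (real k * p)) * ?w y" for y
    using t by (simp add: hom norm_mult powr_mult norm_power powr_realpow[symmetric] powr_powr ennreal_mult')
  have "emeasure (power_measure p H) A = (\<integral>\<^sup>+y. ?w y * indicator A y \<partial>lborel)"
    by (rule emeasure_power_measure_measurable[OF H A])
  also have "\<dots> = ennreal (\<bar>t\<bar> ^ DIM('a)) * (\<integral>\<^sup>+y. ?w (0 + t *\<^sub>R y) * indicator A (0 + t *\<^sub>R y) \<partial>lborel)"
    by (rule nn_integral_lborel_affine) (use t in auto)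
  also have "(\<integral>\<^sup>+y. ?w (0 + t *\<^sub>R y) * indicator A (0 + t *\<^sub>R y) \<partial>lborel)
       = (\<integral>\<^sup>+y. ennreal (t powr (real k * p)) * (?w y * indicator {y. t *\<^sub>R y \<in> A} y) \<partial>lborel)"
    by (intro nn_integral_cong) (simp add: w[simplified] indicator_def)
  also have "\<dots> = ennreal (t powr (real k * p)) * emeasure (power_measure p H) {y. t *\<^sub>R y \<in> A}"
    unfolding emeasure_power_measure_measurable[OF H B] by (rule nn_integral_cmult) (use B in measurable)
  also have "ennreal (\<bar>t\<bar> ^ DIM('a)) * (ennreal (t powr (real k * p)) * emeasure (power_measure p H) {y. t *\<^sub>R y \<in> A})
     = ennreal (t powr (real k * p + real DIM('a))) * emeasure (power_measure p H) {y. t *\<^sub>R y \<in> A}"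
    using t by (simp add: powr_add powr_realpow ennreal_mult mult_ac)
  finally show ?thesis .
qed

lemma emeasure_power_measure_reflect_ball:
  fixes H :: "'a::euclidean_space \<Rightarrow> complex"
  assumes H: "continuous_on UNIV H" and even: "\<And>y. norm (H (- y)) = norm (H y)"
  shows "emeasure (power_measure p H) (ball (- x) \<rho>) = emeasure (power_measure p H) (ball x \<rho>)"
proof -
  let ?w = "\<lambda>y. ennreal (norm (H y) powr p)"
  have wm: "?w \<in> borel_measurable borel" using borel_measurable_norm_powr[OF H, of p] by measurable
  have "(\<integral>\<^sup>+y. ?w y * indicator (ball (- x) \<rho>) y \<partial>lborel) =
     ennreal (\<bar>-1\<bar> ^ DIM('a)) * (\<integral>\<^sup>+y. ?w (0 + (-1) *\<^sub>R y) * indicator (ball (- x) \<rho>) (0 + (-1) *\<^sub>R y) \<partial>lborel)"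
    by (rule nn_integral_lborel_affine) (use wm in \<open>auto intro!: borel_measurable_times_ennreal borel_measurable_indicator\<close>)
  also have "\<dots> = (\<integral>\<^sup>+y. ?w y * indicator (ball x \<rho>) y \<partial>lborel)"
    by (auto intro!: nn_integral_cong simp: even indicator_def dist_norm norm_minus_commute add.commute)
  finally show ?thesis by (simp only: emeasure_power_measure[OF H borel_open[OF open_ball]])
qed

text \<open>The inner ball of radius \<open>1 - 1 / (2 k)\<close> misses a fixed fraction of the mass.\<close>

lemma one_minus_power_le_exp:
  assumes "k \<ge> 1"
  shows "(1 - 1 / (2 * real k)) ^ k \<le> exp (- (1 / 2))"
proof -
  have "1 - 1 / (2 * real k) \<le> exp (- (1 / (2 * real k)))"
    using exp_ge_add_one_self[of "- (1 / (2 * real k))"] by simp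
  moreover have "0 \<le> 1 - 1 / (2 * real k)" using assms by (simp add: divide_simps)
  ultimately have "(1 - 1 / (2 * real k)) ^ k \<le> exp (- (1 / (2 * real k))) ^ k" by (intro power_mono) auto
  also have "\<dots> = exp (- (1 / 2))" using assms by (simp flip: exp_of_nat_mult)
  finally show ?thesis .
qed

text \<open>
  Bad points, at which the ball of radius \<open>R' / k\<close> carries more than \<open>Q k ^ (- n) \<bar>H x\<bar> powr p\<close>,
  hold at most half of the mass of the shell: integrate the defining inequality over the shell,
  exchange the integrals, and note that the ball of radius \<open>1 + R' / k\<close> has at most \<open>exp (R' (p +
  n))\<close> times the mass of the unit ball. At the remaining points the local inequality applies at
  \<open>x\<close> or at \<open>- x\<close>, and a second exchange of integrals collects these contributions into the mass
  of \<open>A\<close>.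
\<close>

theorem solid_logvinenko_sereda:
  fixes R \<kappa> p :: real
  assumes R: "R > 0" and \<kappa>: "\<kappa> > 0" and p: "p \<ge> 1"
  shows "\<exists>c>0. \<forall>(H :: 'a::euclidean_space \<Rightarrow> complex) k A. mean_value_property H \<longrightarrow> k \<ge> 1 \<longrightarrow>
     (\<forall>c>0. \<forall>y. H (c *\<^sub>R y) = of_real (c ^ k) * H y) \<longrightarrow> (\<forall>y. norm (H (- y)) = norm (H y)) \<longrightarrow>
     A \<in> sets borel \<longrightarrow> A \<subseteq> ball 0 1 \<longrightarrow>
     (\<forall>x. 1 - 1 / (2 * real k) < norm x \<longrightarrow> norm x < 1 \<longrightarrow>
        measure lborel (A \<inter> ball x (R / real k)) \<ge> \<kappa> / real k ^ DIM('a) \<or>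
        measure lborel (A \<inter> ball (- x) (R / real k)) \<ge> \<kappa> / real k ^ DIM('a)) \<longrightarrow>
     c * measure (power_measure p H) (ball 0 1) \<le> measure (power_measure p H) A"
proof -
  let ?n = "DIM('a)"
  define V where "V = measure lborel (ball (0::'a) 1)"
  define R' where "R' = analyticity_constant TYPE('a) * R + 1"
  define \<theta> where "\<theta> = 1 - exp (- (1 / 2) :: real)"
  have \<theta>: "\<theta> > 0" "\<theta> \<le> 1" by (simp_all add: \<theta>_def)
  have V: "V > 0" unfolding V_def by (rule content_ball_pos) simp
  have R': "R' > 0" using R analyticity_constant_gt_1[where 'a='a] by (simp add: R'_def add_pos_pos)
  \<comment> \<open>large enough that the bad points hold at most half of the fraction \<open>\<theta>\<close> of the mass that lies
    in the shell\<close>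
  define Q where "Q = 2 * (V * R' ^ ?n * exp (R' * (p + ?n))) / \<theta>"
  have Q: "Q > 0" using V R' \<theta> by (simp add: Q_def)
  obtain c1 where c1: "c1 > 0" "\<And>(H :: 'a \<Rightarrow> complex) s x E. mean_value_property H \<Longrightarrow> s > 0 \<Longrightarrow>
     measure (power_measure p H) (ball x (s * R')) \<le> Q * s ^ DIM('a) * norm (H x) powr p \<Longrightarrow>
     E \<in> sets borel \<Longrightarrow> E \<subseteq> ball x (s * R) \<Longrightarrow> measure lborel E \<ge> \<kappa> * s ^ DIM('a) \<Longrightarrow>
     c1 * s ^ DIM('a) * norm (H x) powr p \<le> measure (power_measure p H) E"
    using local_logvinenko_sereda[OF Q R \<kappa> p, where 'a='a] unfolding R'_def by blast
  define c where "c = (\<theta> / 2) * (c1 / (2 * V * R ^ ?n))"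
  show ?thesis
  proof (intro exI[of _ c] conjI allI impI)
    show "c > 0" using \<theta> c1 V R by (simp add: c_def)
    fix H :: "'a \<Rightarrow> complex" and k :: nat and A :: "'a set"
    assume H: "mean_value_property H" and k: "k \<ge> 1" and hom': "\<forall>c>0. \<forall>y. H (c *\<^sub>R y) = of_real (c ^ k) * H y"
      and even': "\<forall>y. norm (H (- y)) = norm (H y)" and A: "A \<in> sets borel" "A \<subseteq> ball 0 1"
      and dense: "\<forall>x. 1 - 1 / (2 * real k) < norm x \<longrightarrow> norm x < 1 \<longrightarrow>
        measure lborel (A \<inter> ball x (R / real k)) \<ge> \<kappa> / real k ^ DIM('a) \<or>
        measure lborel (A \<inter> ball (- x) (R / real k)) \<ge> \<kappa> / real k ^ DIM('a)"
    have hom: "H (c *\<^sub>R y) = of_real (c ^ k) * H y" if "c > 0" for c y using hom' that by blast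
    have even: "norm (H (- y)) = norm (H y)" for y using even' by blast
    have cont: "continuous_on UNIV H" using H by (simp add: mean_value_property_def)
    let ?\<mu> = "power_measure p H"
    define s where "s = 1 / real k"
    have s: "s > 0" "s \<le> 1" using k by (auto simp: s_def)
    have p0: "p > 0" using p by simp
    define w where "w y = norm (H y) powr p" for y
    have wm [measurable]: "w \<in> borel_measurable borel" unfolding w_def[abs_def] by (rule borel_measurable_norm_powr[OF cont])
    define W where "W = {x::'a. 1 - 1 / (2 * real k) < norm x \<and> norm x < 1}"
    have "open W"
    proof -
      have "W = {x. 1 - 1 / (2 * real k) < norm x} \<inter> {x. norm x < 1}" by (auto simp: W_def)
      also have "open \<dots>" by (intro open_Int open_Collect_less continuous_intros)
      finally show ?thesis .
    qed
    then have Wm [measurable]: "W \<in> sets borel" by simp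
    define m1 where "m1 = measure ?\<mu> (ball 0 1)"
    have m1: "emeasure ?\<mu> (ball 0 1) = ennreal m1" unfolding m1_def
      by (rule emeasure_power_measure_bounded'[OF cont _ ball_subset_cball p0]) simp
    have m1_0: "m1 \<ge> 0" by (simp add: m1_def)
    have ballt: "emeasure ?\<mu> (ball 0 t) = ennreal (t powr (real k * p + real ?n) * m1)" if "t > 0" for t
    proof -
      have "{y. t *\<^sub>R y \<in> ball 0 t} = ball (0::'a) 1" using that by auto
      then show ?thesis
        using emeasure_power_measure_homogeneous[OF borel_measurable_continuous_onI[OF cont] hom borel_open[OF open_ball] that, of p 0 t] m1
        by (simp add: ennreal_mult')
    qed
    have Wlow: "ennreal (\<theta> * m1) \<le> emeasure ?\<mu> W"
    proof -
      define r where "r = 1 - 1 / (2 * real k)"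
      have r: "r > 0" "r \<le> 1" using k by (auto simp: r_def divide_simps)
      have cb: "emeasure ?\<mu> (cball 0 r) \<le> ennreal ((1 - \<theta>) * m1)"
      proof -
        have "emeasure ?\<mu> (cball 0 r) = ennreal (r powr (real k * p + real ?n)) * emeasure ?\<mu> {y. r *\<^sub>R y \<in> cball 0 r}"
          by (rule emeasure_power_measure_homogeneous[OF borel_measurable_continuous_onI[OF cont] hom _ r(1)]) simp_all
        also have "{y. r *\<^sub>R y \<in> cball 0 r} = cball (0::'a) 1" using r by auto
        also have "emeasure ?\<mu> (cball (0::'a) 1) = emeasure ?\<mu> (ball 0 1)"
        proof (rule emeasure_eq_AE)
          have "sphere (0::'a) 1 \<in> null_sets lborel"
            using negligible_sphere[of "0::'a" 1] by (simp add: negligible_iff_null_sets null_sets_completion_iff)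
          then have "AE y in lborel. y \<notin> sphere (0::'a) 1" by (rule AE_not_in)
          then have "AE y in lborel. (y \<in> cball (0::'a) 1) = (y \<in> ball 0 1)" by eventually_elim auto
          then show "AE y in ?\<mu>. (y \<in> cball 0 1) = (y \<in> ball 0 1)"
            unfolding power_measure_def using wm unfolding w_def[abs_def] by (subst AE_density) auto
        qed simp_all
        also have "ennreal (r powr (real k * p + real ?n)) * emeasure ?\<mu> (ball 0 1) \<le> ennreal (1 - \<theta>) * ennreal m1"
          unfolding m1
        proof (intro mult_right_mono ennreal_leI)
          have "r powr (real k * p + real ?n) \<le> r powr (real k)"
            using r p k by (intro powr_mono') (auto simp: add_increasing2 mult_le_cancel_left1)
          also have "\<dots> = r ^ k" using r by (simp add: powr_realpow)
          also have "\<dots> \<le> 1 - \<theta>" using one_minus_power_le_exp[OF k] by (simp add: r_def \<theta>_def)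
          finally show "r powr (real k * p + real ?n) \<le> 1 - \<theta>" .
        qed simp
        finally show ?thesis using \<theta> by (simp add: ennreal_mult')
      qed
      have "ennreal m1 \<le> emeasure ?\<mu> (W \<union> cball 0 r)"
        unfolding m1[symmetric] by (rule emeasure_mono) (auto simp: W_def r_def)
      also have "\<dots> \<le> emeasure ?\<mu> W + emeasure ?\<mu> (cball 0 r)" by (rule emeasure_subadditive) auto
      also have "\<dots> \<le> emeasure ?\<mu> W + ennreal ((1 - \<theta>) * m1)" by (intro add_left_mono cb)
      finally have "ennreal m1 - ennreal ((1 - \<theta>) * m1) \<le> emeasure ?\<mu> W"
        by (simp add: ennreal_minus_le_iff add.commute)
      moreover have "0 \<le> (1 - \<theta>) * m1" using \<theta> m1_0 by simp
      moreover have "m1 - (1 - \<theta>) * m1 = \<theta> * m1" by (simp add: algebra_simps)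
      ultimately show ?thesis by (simp only: ennreal_minus)
    qed
    define N where "N x = emeasure ?\<mu> (ball x (s * R'))" for x
    have Nm [measurable]: "N \<in> borel_measurable borel"
    proof -
      have "N = (\<lambda>x. \<integral>\<^sup>+y. ennreal (w y) * indicator {z. dist (fst z) (snd z) < s * R'} (x, y) \<partial>lborel)"
        unfolding N_def by (rule ext, subst emeasure_power_measure[OF cont])
          (auto intro!: nn_integral_cong simp: indicator_def w_def)
      also have "\<dots> \<in> borel_measurable borel" by measurable
      finally show ?thesis .
    qed
    define Bad where "Bad = {x\<in>W. ennreal (Q * s ^ ?n * w x) < N x}"
    have Badm [measurable]: "Bad \<in> sets borel"
      unfolding Bad_def by measurable
    have bad: "emeasure ?\<mu> Bad \<le> ennreal (\<theta> / 2 * m1)"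
    proof -
      have "ennreal (Q * s ^ ?n) * emeasure ?\<mu> Bad = (\<integral>\<^sup>+x. ennreal (Q * s ^ ?n) * (ennreal (w x) * indicator Bad x) \<partial>lborel)"
        unfolding emeasure_power_measure[OF cont Badm] w_def[symmetric] by (rule nn_integral_cmult[symmetric]) measurable
      also have "\<dots> \<le> (\<integral>\<^sup>+x. indicator W x * emeasure ?\<mu> (ball 0 (1 + s * R') \<inter> ball (1 *\<^sub>R x) (s * R')) \<partial>lborel)"
      proof (rule nn_integral_mono)
        fix x :: 'a
        show "ennreal (Q * s ^ ?n) * (ennreal (w x) * indicator Bad x) \<le> indicator W x * emeasure ?\<mu> (ball 0 (1 + s * R') \<inter> ball (1 *\<^sub>R x) (s * R'))"
        proof (cases "x \<in> Bad")
          case True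
          then have x: "x \<in> W" "ennreal (Q * s ^ ?n * w x) < N x" by (auto simp: Bad_def)
          have "ball x (s * R') \<subseteq> ball 0 (1 + s * R')"
          proof
            fix y assume "y \<in> ball x (s * R')"
            then show "y \<in> ball 0 (1 + s * R')"
              using x(1) dist_triangle[of 0 y x] by (simp add: W_def)
          qed
          then have "ball 0 (1 + s * R') \<inter> ball x (s * R') = ball x (s * R')" by blast
          then show ?thesis using x True Q s by (simp add: N_def ennreal_mult[symmetric] w_def less_imp_le)
        qed simp
      qed
      also have "\<dots> \<le> ennreal ((s * R') ^ ?n * V) * emeasure ?\<mu> (ball 0 (1 + s * R'))"
        unfolding V_def by (rule nn_integral_power_measure_ball[OF cont]) (use s R' in auto)
      also have "\<dots> \<le> ennreal ((s * R') ^ ?n * V) * ennreal (exp (R' * (p + ?n)) * m1)"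
      proof (rule mult_left_mono)
        have "1 + s * R' > 0" using s R' by (simp add: add_pos_pos)
        moreover have "(1 + s * R') powr (real k * p + real ?n) \<le> exp (R' * (p + ?n))"
        proof -
          have "(1 + s * R') powr (real k * p + real ?n) \<le> exp (s * R') powr (real k * p + real ?n)"
            using s R' p by (intro powr_mono2) auto
          also have "\<dots> = exp (R' * (s * real k * p + s * real ?n))"
            by (simp add: powr_def algebra_simps)
          also have "\<dots> \<le> exp (R' * (p + ?n))"
          proof -
            have "s * real ?n \<le> 1 * real ?n" using s by (intro mult_right_mono) auto
            moreover have "s * real k = 1" using k by (simp add: s_def)
            ultimately show ?thesis using R' by simp
          qed
          finally show ?thesis .
        qed
        ultimately show "emeasure ?\<mu> (ball 0 (1 + s * R')) \<le> ennreal (exp (R' * (p + ?n)) * m1)"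
          using m1_0 by (subst ballt) (auto intro!: ennreal_leI mult_right_mono)
      qed simp
      also have "\<dots> = ennreal (Q * s ^ ?n) * ennreal (\<theta> / 2 * m1)"
        using \<theta> V R' s m1_0 by (simp add: Q_def ennreal_mult[symmetric] power_mult_distrib mult_ac)
      finally show ?thesis
        using Q s by (subst (asm) ennreal_mult_le_mult_iff) auto
    qed
    define Good where "Good = W - Bad"
    have Goodm [measurable]: "Good \<in> sets borel" by (simp add: Good_def)
    have good_low: "ennreal (\<theta> / 2 * m1) \<le> emeasure ?\<mu> Good"
    proof -
      have "ennreal (\<theta> * m1) \<le> emeasure ?\<mu> Good + emeasure ?\<mu> Bad"
      proof -
        have "emeasure ?\<mu> W \<le> emeasure ?\<mu> (Good \<union> Bad)" by (rule emeasure_mono) (auto simp: Good_def)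
        also have "\<dots> \<le> emeasure ?\<mu> Good + emeasure ?\<mu> Bad" by (rule emeasure_subadditive) auto
        finally show ?thesis using Wlow by order
      qed
      also have "\<dots> \<le> emeasure ?\<mu> Good + ennreal (\<theta> / 2 * m1)" by (intro add_left_mono bad)
      finally have "ennreal (\<theta> * m1) - ennreal (\<theta> / 2 * m1) \<le> emeasure ?\<mu> Good"
        by (simp add: ennreal_minus_le_iff add.commute)
      then show ?thesis using \<theta> m1_0 by (simp add: ennreal_minus algebra_simps)
    qed
    have loc: "ennreal (c1 * s ^ ?n * w x) \<le> emeasure ?\<mu> (A \<inter> ball (1 *\<^sub>R x) (s * R)) + emeasure ?\<mu> (A \<inter> ball ((-1) *\<^sub>R x) (s * R))"
      if x: "x \<in> Good" for x
    proof -
      have xW: "x \<in> W" and xN: "N x \<le> ennreal (Q * s ^ ?n * w x)" using x by (auto simp: Good_def Bad_def not_less)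
      have Nx: "measure ?\<mu> (ball x (s * R')) \<le> Q * s ^ ?n * norm (H x) powr p"
        using xN Q s emeasure_power_measure_bounded'[OF cont borel_open[OF open_ball] ball_subset_cball p0]
        by (simp add: N_def w_def)
      have Nx': "measure ?\<mu> (ball (- x) (s * R')) \<le> Q * s ^ ?n * norm (H (- x)) powr p"
        using Nx emeasure_power_measure_reflect_ball[OF cont even, of p x "s * R'"] even[of x] by (simp add: measure_def)
      have kap: "\<kappa> / real k ^ ?n = \<kappa> * s ^ ?n" "R / real k = s * R" using k by (simp_all add: s_def power_one_over divide_simps)
      have bnd: "emeasure ?\<mu> (A \<inter> B) = ennreal (measure ?\<mu> (A \<inter> B))" if "B \<in> sets borel" for B
        by (rule emeasure_power_measure_bounded'[OF cont _ _ p0, of _ 0 1]) (use A that in auto)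
      from dense xW consider "measure lborel (A \<inter> ball x (s * R)) \<ge> \<kappa> * s ^ ?n" | "measure lborel (A \<inter> ball (- x) (s * R)) \<ge> \<kappa> * s ^ ?n"
        unfolding kap W_def by blast
      then show ?thesis
      proof cases
        case 1
        have "c1 * s ^ ?n * norm (H x) powr p \<le> measure ?\<mu> (A \<inter> ball x (s * R))"
          by (rule c1(2)[OF H s(1) Nx _ _ 1]) (use A in auto)
        then have "ennreal (c1 * s ^ ?n * w x) \<le> emeasure ?\<mu> (A \<inter> ball x (s * R))"
          unfolding w_def bnd[OF borel_open[OF open_ball]] by (rule ennreal_leI)
        then show ?thesis by (simp add: add_increasing2)
      next
        case 2
        have "c1 * s ^ ?n * norm (H (- x)) powr p \<le> measure ?\<mu> (A \<inter> ball (- x) (s * R))"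
          by (rule c1(2)[OF H s(1) Nx' _ _ 2]) (use A in auto)
        then have "ennreal (c1 * s ^ ?n * w x) \<le> emeasure ?\<mu> (A \<inter> ball (- x) (s * R))"
          unfolding w_def even bnd[OF borel_open[OF open_ball]] by (rule ennreal_leI)
        then show ?thesis by (simp add: add_increasing)
      qed
    qed
    have mA: "emeasure ?\<mu> A = ennreal (measure ?\<mu> A)"
      by (rule emeasure_power_measure_bounded'[OF cont A(1) _ p0, of 0 1]) (use A in auto)
    have lm: "(\<lambda>x. emeasure ?\<mu> (A \<inter> ball (t *\<^sub>R x) (s * R))) \<in> borel_measurable borel" for t
    proof -
      note A(1)[measurable]
      have "(\<lambda>x. emeasure ?\<mu> (A \<inter> ball (t *\<^sub>R x) (s * R))) = (\<lambda>x. \<integral>\<^sup>+y. ennreal (w y) * (indicator A y * indicator {z. dist (fst z) (snd z) < s * R} (t *\<^sub>R x, y)) \<partial>lborel)"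
        using A(1) by (intro ext, subst emeasure_power_measure[OF cont])
          (auto intro!: nn_integral_cong simp: indicator_def w_def)
      also have "\<dots> \<in> borel_measurable borel" by measurable
      finally show ?thesis .
    qed
    have "ennreal (c1 * s ^ ?n) * ennreal (\<theta> / 2 * m1) \<le> ennreal (c1 * s ^ ?n) * emeasure ?\<mu> Good"
      by (intro mult_left_mono good_low) simp
    also have "\<dots> = (\<integral>\<^sup>+x. ennreal (c1 * s ^ ?n) * (ennreal (w x) * indicator Good x) \<partial>lborel)"
      unfolding emeasure_power_measure[OF cont Goodm] w_def[symmetric] by (rule nn_integral_cmult[symmetric]) measurable
    also have "\<dots> \<le> (\<integral>\<^sup>+x. indicator Good x * emeasure ?\<mu> (A \<inter> ball (1 *\<^sub>R x) (s * R)) + indicator Good x * emeasure ?\<mu> (A \<inter> ball ((-1) *\<^sub>R x) (s * R)) \<partial>lborel)"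
    proof (rule nn_integral_mono)
      fix x :: 'a
      show "ennreal (c1 * s ^ ?n) * (ennreal (w x) * indicator Good x) \<le> indicator Good x * emeasure ?\<mu> (A \<inter> ball (1 *\<^sub>R x) (s * R)) + indicator Good x * emeasure ?\<mu> (A \<inter> ball ((-1) *\<^sub>R x) (s * R))"
        using loc[of x] c1(1) s by (cases "x \<in> Good") (auto simp: ennreal_mult[symmetric] w_def)
    qed
    also have "\<dots> = (\<integral>\<^sup>+x. indicator Good x * emeasure ?\<mu> (A \<inter> ball (1 *\<^sub>R x) (s * R)) \<partial>lborel) + (\<integral>\<^sup>+x. indicator Good x * emeasure ?\<mu> (A \<inter> ball ((-1) *\<^sub>R x) (s * R)) \<partial>lborel)"
      using lm[of 1] lm[of "-1"] by (intro nn_integral_add borel_measurable_times_ennreal) auto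
    also have "\<dots> \<le> ennreal ((s * R) ^ ?n * V) * emeasure ?\<mu> A + ennreal ((s * R) ^ ?n * V) * emeasure ?\<mu> A"
      unfolding V_def by (intro add_mono nn_integral_power_measure_ball[OF cont]) (use s R A in auto)
    also have "\<dots> = ennreal (2 * ((s * R) ^ ?n * V) * measure ?\<mu> A)"
      unfolding mA using s R V by (simp flip: ennreal_mult ennreal_plus)
    finally have "c1 * s ^ ?n * (\<theta> / 2 * m1) \<le> 2 * ((s * R) ^ ?n * V) * measure ?\<mu> A"
      using c1 s \<theta> m1_0 V R by (simp flip: ennreal_mult)
    then have "s ^ ?n * (c1 * (\<theta> / 2 * m1)) \<le> s ^ ?n * (2 * (R ^ ?n * V) * measure ?\<mu> A)"
      by (simp add: power_mult_distrib mult_ac)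
    then have "c1 * (\<theta> / 2 * m1) \<le> 2 * (R ^ ?n * V) * measure ?\<mu> A" using s by simp
    then show "c * measure ?\<mu> (ball 0 1) \<le> measure ?\<mu> A"
      using V R unfolding c_def m1_def[symmetric] by (simp add: field_simps)
  qed
qed

section \<open>The sphere as the base of a solid cone\<close>

definition solid_cone :: "'a::euclidean_space set \<Rightarrow> 'a set"
  where "solid_cone A = {y \<in> ball 0 1 - {0}. sgn y \<in> A}"

lemma sgn_borel_measurable [measurable]: "(sgn :: 'a::euclidean_space \<Rightarrow> 'a) \<in> borel_measurable borel"
  unfolding sgn_div_norm[abs_def] by measurable

lemma solid_cone_borel [measurable]: "A \<in> sets borel \<Longrightarrow> solid_cone (A :: 'a::euclidean_space set) \<in> sets borel"
proof -
  assume A: "A \<in> sets borel"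
  have "sgn -` A \<inter> space borel \<in> sets borel" by (rule measurable_sets[OF sgn_borel_measurable A])
  moreover have "solid_cone A = (ball 0 1 - {0}) \<inter> (sgn -` A \<inter> space borel)" by (auto simp: solid_cone_def)
  ultimately show ?thesis by auto
qed

lemma solid_cone_subset_ball: "solid_cone A \<subseteq> ball 0 1" by (auto simp: solid_cone_def)

lemma measure_sphere_volume_cone:
  fixes A :: "'a::euclidean_space set"
  assumes "A \<in> sets borel" "A \<subseteq> sphere 0 1"
  shows "measure sphere_volume A = DIM('a) * measure lborel (solid_cone A)"
proof -
  have "emeasure lborel (solid_cone A) < \<infinity>"
    using emeasure_mono[OF solid_cone_subset_ball, of lborel] emeasure_lborel_ball_finite[of "0::'a" 1]
    by (auto intro: order.strict_trans1)
  then show ?thesis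
    using emeasure_sphere_volume[OF assms] unfolding solid_cone_def[symmetric] measure_def
    by (simp add: enn2real_mult)
qed

lemma sets_sphere_volume_borel: "A \<in> sets borel \<Longrightarrow> A \<subseteq> sphere 0 1 \<Longrightarrow> A \<in> sets sphere_volume"
  unfolding sphere_volume_def sphere_borel_volume_def
  by (intro sets_completionI_sets) (auto simp: sets_restrict_space_iff)

lemma emeasure_sphere_volume_finite: "emeasure (sphere_volume :: 'a::euclidean_space measure) (sphere 0 1) < \<infinity>"
proof -
  have "emeasure (sphere_volume :: 'a measure) (sphere 0 1) \<le> of_nat DIM('a) * emeasure lborel (ball (0::'a) 1)"
    by (subst emeasure_sphere_volume) (auto intro!: mult_left_mono emeasure_mono)
  also have "\<dots> < \<infinity>"
    using emeasure_lborel_ball_finite[of "0::'a" 1] by (simp add: ennreal_mult_less_top of_nat_less_top)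
  finally show ?thesis .
qed

lemma finite_measure_sphere_volume: "finite_measure (sphere_volume :: 'a::euclidean_space measure)"
  by (rule finite_measureI) (use emeasure_sphere_volume_finite[where 'a='a] in \<open>simp add: space_sphere_volume\<close>)

text \<open>The measure on the sphere is complete, so measurable sets are Borel only up to null sets.\<close>

lemma borel_version_of_sphere_set:
  fixes A :: "'a::euclidean_space set"
  assumes "A \<in> sets sphere_volume"
  obtains A' where "A' \<in> sets borel" "A' \<subseteq> sphere 0 1" "AE x in sphere_volume. x \<in> A \<longleftrightarrow> x \<in> A'"
proof -
  let ?M = "sphere_borel_volume :: 'a measure"
  have A: "A \<in> sets (completion ?M)" using assms by (simp add: sphere_volume_def)
  define A' where "A' = main_part ?M A"
  have "A' \<in> sets ?M" unfolding A'_def using A by simp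
  then have "A' \<in> sets borel" "A' \<subseteq> sphere 0 1"
    by (auto simp: sphere_borel_volume_def sets_restrict_space_iff)
  moreover have "AE x in sphere_volume. x \<in> A \<longleftrightarrow> x \<in> A'"
  proof -
    have "AE x in completion ?M. x \<in> main_part ?M A \<longleftrightarrow> x \<in> A"
      using AE_in_main_part[OF A] by (rule AE_completion)
    then show ?thesis unfolding sphere_volume_def A'_def by eventually_elim blast
  qed
  ultimately show thesis by (rule that)
qed

lemma measure_borel_version:
  fixes A A' B :: "'a::euclidean_space set"
  assumes "A \<in> sets sphere_volume" "A' \<in> sets sphere_volume" "B \<in> sets sphere_volume"
    "AE x in sphere_volume. x \<in> A \<longleftrightarrow> x \<in> A'"
  shows "measure sphere_volume (A \<inter> B) = measure sphere_volume (A' \<inter> B)"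
  by (rule measure_eq_AE) (use assms in auto)

text \<open>
  The volume of the sphere is the image of Lebesgue measure on the ball under \<open>sgn\<close>, so integrals
  over the sphere are integrals of the extension of degree 0 over solid cones.
\<close>

lemma integral_sphere_volume_cone:
  fixes A :: "'a::euclidean_space set" and e :: "'a \<Rightarrow> complex"
  assumes e: "sphere_smooth e" and A: "A \<in> sets borel" "A \<subseteq> sphere 0 1"
  shows "(LINT x:A|sphere_volume. norm (e x) powr p) = DIM('a) * measure (power_measure p (radial_extension e)) (solid_cone A)"
    and "p > 0 \<Longrightarrow> integrable sphere_volume (\<lambda>x. norm (e x) powr p)"
proof -
  let ?R = "restrict_space borel (sphere 0 1) :: 'a measure"
  let ?B = "ball 0 1 - {0} :: 'a set"
  let ?F = "radial_extension e"
  have ce: "continuous_on (sphere 0 1) e"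
  proof -
    have "continuous_on (sphere 0 1) ?F"
      by (rule continuous_on_subset[OF continuous_on_radial_extension(1)[OF e]]) auto
    moreover have "continuous_on (sphere 0 1) ?F = continuous_on (sphere 0 1) e"
      by (rule continuous_on_cong) (auto simp: radial_extension_def sgn_div_norm)
    ultimately show ?thesis by simp
  qed
  have em [measurable]: "e \<in> borel_measurable ?R" by (rule borel_measurable_continuous_on_restrict[OF ce])
  have Fm [measurable]: "?F \<in> borel_measurable borel"
    by (rule borel_measurable_continuous_off_0[OF continuous_on_radial_extension(1)[OF e]])
  have setsM: "sets (sphere_borel_volume :: 'a measure) = sets ?R" by (simp add: sphere_borel_volume_def)
  have AR: "A \<in> sets ?R" using A by (auto simp: sets_restrict_space_iff)
  have fm: "(\<lambda>x. ennreal (norm (e x) powr p) * indicator A x) \<in> borel_measurable ?R"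
    using AR by measurable
  have nn: "(\<integral>\<^sup>+x. ennreal (norm (e x) powr p) * indicator A x \<partial>sphere_volume) = of_nat DIM('a) * emeasure (power_measure p ?F) (solid_cone A)"
  proof -
    have "(\<integral>\<^sup>+x. ennreal (norm (e x) powr p) * indicator A x \<partial>sphere_volume) = (\<integral>\<^sup>+x. ennreal (norm (e x) powr p) * indicator A x \<partial>sphere_borel_volume)"
      unfolding sphere_volume_def by (rule nn_integral_completion)
    also have "\<dots> = of_nat DIM('a) * (\<integral>\<^sup>+x. ennreal (norm (e x) powr p) * indicator A x \<partial>distr (restrict_space lborel ?B) ?R sgn)"
      unfolding sphere_borel_volume_def by (rule nn_integral_scale_measure) (use fm in simp)
    also have "(\<integral>\<^sup>+x. ennreal (norm (e x) powr p) * indicator A x \<partial>distr (restrict_space lborel ?B) ?R sgn)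
       = (\<integral>\<^sup>+y. ennreal (norm (e (sgn y)) powr p) * indicator A (sgn y) \<partial>restrict_space lborel ?B)"
      by (rule nn_integral_distr[OF sgn_measurable_sphere]) (simp add: fm)
    also have "\<dots> = (\<integral>\<^sup>+y. ennreal (norm (e (sgn y)) powr p) * indicator A (sgn y) * indicator ?B y \<partial>lborel)"
      by (rule nn_integral_restrict_space) auto
    also have "\<dots> = (\<integral>\<^sup>+y. ennreal (norm (?F y) powr p) * indicator (solid_cone A) y \<partial>lborel)"
      by (intro nn_integral_cong) (auto simp: indicator_def solid_cone_def radial_extension_def)
    also have "\<dots> = emeasure (power_measure p ?F) (solid_cone A)"
      by (rule emeasure_power_measure_measurable[symmetric, OF Fm]) (use A in measurable)
    finally show ?thesis .
  qed
  have mm: "(\<lambda>x. norm (e x) powr p) \<in> borel_measurable sphere_volume"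
    unfolding sphere_volume_def by (rule measurable_completion) (simp add: measurable_cong_sets[OF setsM refl])
  have AS: "A \<in> sets sphere_volume" by (rule sets_sphere_volume_borel[OF A])
  have "(LINT x:A|sphere_volume. norm (e x) powr p) = enn2real (\<integral>\<^sup>+x. ennreal (indicator A x *\<^sub>R norm (e x) powr p) \<partial>sphere_volume)"
    unfolding set_lebesgue_integral_def
    by (rule integral_eq_nn_integral) (use mm AS in auto)
  also have "(\<integral>\<^sup>+x. ennreal (indicator A x *\<^sub>R norm (e x) powr p) \<partial>sphere_volume) = (\<integral>\<^sup>+x. ennreal (norm (e x) powr p) * indicator A x \<partial>sphere_volume)"
    by (intro nn_integral_cong) (auto simp: indicator_def)
  finally show "(LINT x:A|sphere_volume. norm (e x) powr p) = DIM('a) * measure (power_measure p ?F) (solid_cone A)"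
    unfolding nn by (simp add: measure_def enn2real_mult)
  assume p: "p > 0"
  have "bounded (e ` sphere 0 1)" by (intro compact_imp_bounded compact_continuous_image ce) auto
  then obtain K where K: "\<And>x. x \<in> sphere 0 1 \<Longrightarrow> norm (e x) \<le> K" unfolding bounded_iff by blast
  show "integrable sphere_volume (\<lambda>x. norm (e x) powr p)"
  proof (rule finite_measure.integrable_const_bound[OF finite_measure_sphere_volume _ mm])
    show "AE x in sphere_volume. norm (norm (e x) powr p) \<le> K powr p"
      using K p by (intro AE_I2) (auto simp: space_sphere_volume intro!: powr_mono2)
  qed
qed

lemma set_integral_borel_version:
  fixes A A' :: "'a::euclidean_space set" and f :: "'a \<Rightarrow> real"
  assumes "f \<in> borel_measurable sphere_volume" "A \<in> sets sphere_volume" "A' \<in> sets sphere_volume"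
    "AE x in sphere_volume. x \<in> A \<longleftrightarrow> x \<in> A'"
  shows "(LINT x:A|sphere_volume. f x) = (LINT x:A'|sphere_volume. f x)"
  unfolding set_lebesgue_integral_def
proof (rule integral_cong_AE)
  show "AE x in sphere_volume. indicator A x *\<^sub>R f x = indicator A' x *\<^sub>R f x"
    using assms(4) by eventually_elim (simp add: indicator_def)
qed (use assms in auto)

text \<open>
  A crude form of Jordan's inequality: compare derivatives up to \<open>pi / 6\<close> and use monotonicity of
  the sine afterwards.
\<close>

lemma sin_ge_quarter:
  fixes u :: real
  assumes u: "0 \<le> u" "u \<le> pi / 2"
  shows "u / 4 \<le> sin u"
proof (cases "u \<le> pi / 6")
  case True
  have "sin 0 - 0 / 4 \<le> sin u - u / 4"
  proof (rule DERIV_nonneg_imp_nondecreasing[OF u(1)])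
    fix v assume v: "0 \<le> v" "v \<le> u"
    have "cos (pi / 3) \<le> cos v" using v True pi_gt_zero by (intro cos_monotone_0_pi_le) auto
    then have "cos v - 1 / 4 \<ge> 0" by (simp add: cos_60)
    moreover have "((\<lambda>v. sin v - v / 4) has_real_derivative cos v - 1 / 4) (at v)"
      by (auto intro!: derivative_eq_intros)
    ultimately show "\<exists>y. ((\<lambda>v. sin v - v / 4) has_real_derivative y) (at v) \<and> 0 \<le> y" by blast
  qed
  then show ?thesis by simp
next
  case False
  have "sin (pi / 6) \<le> sin u" using False u by (intro sin_monotone_2pi_le) auto
  then show ?thesis using u pi_less_4 by (simp add: sin_30)
qed

text \<open>The chord of an arc of length \<open>\<theta>\<close> is \<open>2 sin (\<theta> / 2)\<close>.\<close>

lemma chord_le_geodesic: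
  assumes "norm x = 1" "norm z = 1"
  shows "norm (x - z) \<le> geodesic_dist x z" "geodesic_dist x z \<le> 4 * norm (x - z)"
proof -
  let ?t = "geodesic_dist x z"
  have xz: "\<bar>x \<bullet> z\<bar> \<le> 1" using Cauchy_Schwarz_ineq2[of x z] assms by simp
  have t: "0 \<le> ?t" "?t \<le> pi" "cos ?t = x \<bullet> z"
    using xz arccos_lbound[of "x \<bullet> z"] arccos_ubound[of "x \<bullet> z"] by (auto simp: geodesic_dist_def abs_le_iff cos_arccos)
  define u where "u = ?t / 2"
  have u: "0 \<le> u" "u \<le> pi / 2" using t by (auto simp: u_def)
  have "(norm (x - z))\<^sup>2 = 2 - 2 * (x \<bullet> z)"
    using assms by (simp add: power2_norm_eq_inner inner_diff_left inner_diff_right inner_commute norm_eq_1)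
  also have "\<dots> = 2 - 2 * cos (2 * u)" using t by (simp add: u_def)
  also have "\<dots> = (2 * sin u)\<^sup>2" by (simp add: cos_double_sin power_mult_distrib)
  finally have sq: "(norm (x - z))\<^sup>2 = (2 * sin u)\<^sup>2" .
  have "0 \<le> sin u" using u pi_gt_zero by (intro sin_ge_zero) auto
  then have n: "norm (x - z) = 2 * sin u" by (intro power2_eq_imp_eq[OF sq]) auto
  have "sin u \<le> u" using u by (simp add: sin_x_le_x)
  then show "norm (x - z) \<le> ?t" by (simp add: n u_def)
  have "u / 4 \<le> sin u" by (rule sin_ge_quarter[OF u])
  then show "?t \<le> 4 * norm (x - z)" by (simp add: n u_def)
qed

lemma geodesic_dist_commute: "geodesic_dist x z = geodesic_dist z x"
  by (simp add: geodesic_dist_def inner_commute)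

lemma geodesic_ball_subset: "geodesic_ball z r \<subseteq> sphere 0 1"
  by (auto simp: geodesic_ball_def)

lemma geodesic_ball_borel:
  fixes z :: "'a::euclidean_space"
  assumes z: "norm z = 1"
  shows "geodesic_ball z r \<in> sets borel"
proof -
  have b: "\<bar>z \<bullet> x\<bar> \<le> 1" if "x \<in> sphere 0 1" for x
    using Cauchy_Schwarz_ineq2[of z x] z that by simp
  have "continuous_on (sphere 0 1) (\<lambda>x. arccos (z \<bullet> x))"
    by (intro continuous_intros) (use b in \<open>auto simp: abs_le_iff\<close>)
  then have m: "(\<lambda>x. arccos (z \<bullet> x)) \<in> borel_measurable (restrict_space borel (sphere 0 1))"
    by (rule borel_measurable_continuous_on_restrict)
  have "{x \<in> space (restrict_space borel (sphere 0 1)). arccos (z \<bullet> x) < r} \<in> sets (restrict_space borel (sphere 0 1))"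
    using m by measurable
  then show ?thesis
    by (auto simp: sets_restrict_space_iff space_restrict_space geodesic_ball_def geodesic_dist_def)
qed

lemma geodesic_ball_sets: "norm z = 1 \<Longrightarrow> geodesic_ball z r \<in> sets sphere_volume"
  by (rule sets_sphere_volume_borel[OF geodesic_ball_borel geodesic_ball_subset])

lemma solid_cone_dilation:
  assumes t: "0 < t" "t \<le> 1"
  shows "{y. t *\<^sub>R y \<in> solid_cone A \<inter> ball 0 t} = solid_cone A"
proof -
  have "t *\<^sub>R y \<in> solid_cone A \<inter> ball 0 t \<longleftrightarrow> y \<in> solid_cone A" for y
  proof -
    have "t * norm y < t \<longleftrightarrow> norm y < 1" using t by simp
    moreover have "t * norm y < 1" if "norm y < 1" using mult_left_le_one_le[of "norm y" t] that t by simp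
    ultimately show ?thesis using t by (auto simp: solid_cone_def sgn_scaleR)
  qed
  then show ?thesis by auto
qed

text \<open>
  A cone is the union of its dilates; the part outside the ball of radius \<open>t\<close> has the proportion
  \<open>1 - t ^ n\<close> of its volume.
\<close>

lemma measure_cone_shell:
  fixes A :: "'a::euclidean_space set"
  assumes A: "A \<in> sets borel" and t: "0 < t" "t \<le> 1"
  shows "measure lborel (solid_cone A - ball 0 t) = (1 - t ^ DIM('a)) * measure lborel (solid_cone A)"
proof -
  have fm: "solid_cone A \<in> fmeasurable lborel"
    by (rule fmeasurableI2[OF fmeasurable_ball solid_cone_subset_ball]) (use solid_cone_borel[OF A] in simp)
  have "measure lborel (solid_cone A \<inter> ball 0 t) = t ^ DIM('a) * measure lborel {y. 0 + t *\<^sub>R y \<in> solid_cone A \<inter> ball 0 t}"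
    by (rule measure_lborel_affine) (use solid_cone_borel[OF A] t in auto)
  also have "{y. 0 + t *\<^sub>R y \<in> solid_cone A \<inter> ball 0 t} = solid_cone A"
    using solid_cone_dilation[OF t, of A] by simp
  finally have 1: "measure lborel (solid_cone A \<inter> ball 0 t) = t ^ DIM('a) * measure lborel (solid_cone A)" .
  have "measure lborel (solid_cone A - (solid_cone A \<inter> ball 0 t)) = measure lborel (solid_cone A) - measure lborel (solid_cone A \<inter> ball 0 t)"
    by (rule measure_Diff) (use fm solid_cone_borel[OF A] in \<open>auto simp: fmeasurable_def\<close>)
  moreover have "solid_cone A - (solid_cone A \<inter> ball 0 t) = solid_cone A - ball 0 t" by blast
  ultimately show ?thesis using 1 by (simp add: algebra_simps)
qed

lemma norm_sgn_diff:
  fixes y :: "'a::euclidean_space"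
  assumes "y \<noteq> 0"
  shows "norm (y - sgn y) = \<bar>1 - norm y\<bar>"
proof -
  have "norm y *\<^sub>R sgn y = y" using assms by (simp add: sgn_div_norm)
  then have "y - sgn y = (norm y - 1) *\<^sub>R sgn y" by (simp add: scaleR_diff_left)
  then show ?thesis using assms by (simp add: norm_sgn abs_minus_commute)
qed

text \<open>
  For \<open>r < 1\<close> the part of the cone in the shell of width \<open>r\<close> has at least the proportion \<open>r\<close> of
  its volume and lies in a Euclidean ball of radius \<open>3 r\<close>.
\<close>

lemma geodesic_ball_volume_upper:
  fixes z :: "'a::euclidean_space"
  assumes z: "norm z = 1" and r: "r > 0"
  shows "measure sphere_volume (geodesic_ball z r) \<le> DIM('a) * 3 ^ DIM('a) * measure lborel (ball (0::'a) 1) * r ^ (DIM('a) - 1)"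
proof -
  let ?n = "DIM('a)" and ?V = "measure lborel (ball (0::'a) 1)" and ?C = "solid_cone (geodesic_ball z r)"
  have V: "?V > 0" by (rule content_ball_pos) simp
  have rn: "r ^ ?n = r * r ^ (?n - 1)" by (subst power_eq_if) simp
  have Cb: "?C \<in> sets borel" by (rule solid_cone_borel[OF geodesic_ball_borel[OF z]])
  have "measure lborel ?C \<le> 3 ^ ?n * ?V * r ^ (?n - 1)"
  proof (cases "r < 1")
    case True
    have sub: "?C - ball 0 (1 - r) \<subseteq> ball z (3 * r)"
    proof
      fix y assume y: "y \<in> ?C - ball 0 (1 - r)"
      then have y1: "y \<noteq> 0" "norm y < 1" "1 - r \<le> norm y" "sgn y \<in> geodesic_ball z r" by (auto simp: solid_cone_def)
      have "norm (sgn y - z) < r"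
        using y1 chord_le_geodesic(1)[of "sgn y" z] z
        by (auto simp: geodesic_ball_def norm_sgn geodesic_dist_commute[of _ z])
      moreover have "norm (y - sgn y) \<le> r" using norm_sgn_diff[OF y1(1)] y1 by simp
      ultimately show "y \<in> ball z (3 * r)"
        using norm_triangle_ineq[of "y - sgn y" "sgn y - z"] r by (simp add: dist_norm norm_minus_commute)
    qed
    have "r \<le> 1 - (1 - r) ^ ?n"
    proof -
      have "(1 - r) ^ ?n \<le> (1 - r) ^ 1" using True r by (intro power_decreasing) (auto simp: Suc_le_eq)
      then show ?thesis by simp
    qed
    then have "r * measure lborel ?C \<le> (1 - (1 - r) ^ ?n) * measure lborel ?C" by (intro mult_right_mono) auto
    also have "\<dots> = measure lborel (?C - ball 0 (1 - r))"
      by (rule measure_cone_shell[symmetric, OF geodesic_ball_borel[OF z]]) (use True r in auto)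
    also have "\<dots> \<le> measure lborel (ball z (3 * r))"
      by (rule measure_mono_fmeasurable[OF sub _ fmeasurable_ball]) (use Cb in auto)
    also have "\<dots> = (3 * r) ^ ?n * ?V" using r by (subst content_ball_conv_unit_ball) auto
    also have "\<dots> = r * (3 ^ ?n * ?V * r ^ (?n - 1))" by (simp add: power_mult_distrib rn mult_ac)
    finally show ?thesis using r by simp
  next
    case False
    have "measure lborel ?C \<le> ?V" by (rule measure_mono_fmeasurable[OF solid_cone_subset_ball _ fmeasurable_ball]) (use Cb in auto)
    also have "\<dots> = 1 * ?V * 1" by simp
    also have "\<dots> \<le> 3 ^ ?n * ?V * r ^ (?n - 1)"
      using False V by (intro mult_mono one_le_power) auto
    finally show ?thesis .
  qed
  then show ?thesis
    unfolding measure_sphere_volume_cone[OF geodesic_ball_borel[OF z] geodesic_ball_subset]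
    by (simp add: mult_left_mono mult.assoc)
qed

text \<open>
  A Euclidean ball of radius \<open>r / 32\<close> just inside the sphere fits in the part of the cone in a
  shell of width \<open>r / 2\<close>, which has at most the proportion \<open>n r\<close> of the volume of the cone.
\<close>

lemma geodesic_ball_volume_lower:
  fixes z :: "'a::euclidean_space"
  assumes z: "norm z = 1" and r: "0 < r" "r \<le> 1"
  shows "measure lborel (ball (0::'a) 1) / 32 ^ DIM('a) * r ^ (DIM('a) - 1) \<le> measure sphere_volume (geodesic_ball z r)"
proof -
  let ?n = "DIM('a)" and ?V = "measure lborel (ball (0::'a) 1)" and ?C = "solid_cone (geodesic_ball z r)"
  have rn: "r ^ ?n = r * r ^ (?n - 1)" by (subst power_eq_if) simp
  have Cb: "?C \<in> sets borel" by (rule solid_cone_borel[OF geodesic_ball_borel[OF z]])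
  have Cf: "?C \<in> fmeasurable lborel"
    by (rule fmeasurableI2[OF fmeasurable_ball solid_cone_subset_ball]) (use Cb in simp)
  define q where "q = 1 - r / 2"
  have q: "0 < q" "q \<le> 1" using r by (auto simp: q_def)
  have sub: "ball ((1 - r / 16) *\<^sub>R z) (r / 32) \<subseteq> ?C - ball 0 q"
  proof
    fix y assume "y \<in> ball ((1 - r / 16) *\<^sub>R z) (r / 32)"
    then have y: "norm (y - (1 - r / 16) *\<^sub>R z) < r / 32" by (simp add: dist_norm norm_minus_commute)
    have nz: "norm ((1 - r / 16) *\<^sub>R z) = 1 - r / 16" using z r by simp
    have "norm y < 1" "1 - 3 * r / 32 < norm y"
      using y norm_triangle_ineq2[of y "(1 - r / 16) *\<^sub>R z"] norm_triangle_ineq3[of y "(1 - r / 16) *\<^sub>R z"] r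
      unfolding nz by linarith+
    then have ny: "norm y < 1" "1 - 3 * r / 32 < norm y" "y \<noteq> 0" using r by auto
    have "norm ((1 - r / 16) *\<^sub>R z - z) = r / 16"
    proof -
      have "(1 - r / 16) *\<^sub>R z - z = - (r / 16) *\<^sub>R z" by (simp add: scaleR_diff_left)
      then show ?thesis using z r by simp
    qed
    then have "norm (y - z) < 3 * r / 32"
      using y norm_triangle_ineq[of "y - (1 - r / 16) *\<^sub>R z" "(1 - r / 16) *\<^sub>R z - z"] by simp
    moreover have "norm (sgn y - y) < 3 * r / 32" using norm_sgn_diff[OF ny(3)] ny by (simp add: norm_minus_commute)
    ultimately have "norm (sgn y - z) < 6 * r / 32" using norm_triangle_ineq[of "sgn y - y" "y - z"] by simp
    then have "geodesic_dist (sgn y) z < r"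
      using chord_le_geodesic(2)[of "sgn y" z] z ny r by (simp add: norm_sgn)
    then have "geodesic_dist z (sgn y) < r" by (simp add: geodesic_dist_def inner_commute)
    then show "y \<in> ?C - ball 0 q"
      using ny r \<open>geodesic_dist (sgn y) z < r\<close> by (auto simp: solid_cone_def geodesic_ball_def norm_sgn q_def)
  qed
  have "(r / 32) ^ ?n * ?V = measure lborel (ball ((1 - r / 16) *\<^sub>R z) (r / 32))"
    using r by (subst (2) content_ball_conv_unit_ball) auto
  also have "\<dots> \<le> measure lborel (?C - ball 0 q)"
    by (rule measure_mono_fmeasurable[OF sub]) (use Cf Cb in \<open>auto intro: fmeasurable_Diff\<close>)
  also have "\<dots> = (1 - q ^ ?n) * measure lborel ?C"
    by (rule measure_cone_shell[OF geodesic_ball_borel[OF z] q])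
  also have "\<dots> \<le> (?n * r) * measure lborel ?C"
  proof (rule mult_right_mono)
    have "1 + real ?n * (q - 1) \<le> (1 + (q - 1)) ^ ?n" by (rule Bernoulli_inequality) (use q in auto)
    then have "1 - q ^ ?n \<le> ?n * (1 - q)" by (simp add: algebra_simps)
    also have "\<dots> \<le> ?n * r" using r by (intro mult_left_mono) (auto simp: q_def)
    finally show "1 - q ^ ?n \<le> ?n * r" .
  qed simp
  also have "\<dots> = r * measure sphere_volume (geodesic_ball z r)"
    unfolding measure_sphere_volume_cone[OF geodesic_ball_borel[OF z] geodesic_ball_subset] by simp
  finally have "(r / 32) ^ ?n * ?V \<le> r * measure sphere_volume (geodesic_ball z r)" .
  moreover have "(r / 32) ^ ?n * ?V = r * (?V / 32 ^ ?n * r ^ (?n - 1))"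
    by (simp add: power_divide rn)
  ultimately have "r * (?V / 32 ^ ?n * r ^ (?n - 1)) \<le> r * measure sphere_volume (geodesic_ball z r)"
    by (simp only:)
  then show ?thesis using r by (simp only: mult_le_cancel_left_pos)
qed

section \<open>Density implies the inequality\<close>

lemma eigenfunction_degree:
  fixes e :: "'a::euclidean_space \<Rightarrow> complex"
  assumes e: "sphere_eigenfunction l e" and l: "l > 0" and dim: "DIM('a) \<ge> 3"
  obtains k :: nat where "k \<ge> 1" "l\<^sup>2 = real k * (real k + real DIM('a) - 2)"
    "mean_value_property (\<lambda>y. of_real (norm y ^ k) * radial_extension e y)"
    "\<And>y. norm (radial_extension e (- y)) = norm (radial_extension e y)"
proof -
  obtain s where s: "s > 0" "l\<^sup>2 = s * (s + real DIM('a) - 2)"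
    and mv: "mean_value_property (\<lambda>y. of_real (norm y powr s) * radial_extension e y)"
    using eigenfunction_harmonic_extension[OF e l dim] by blast
  obtain x where x: "norm x = 1" "e x \<noteq> 0" using e by (auto simp: sphere_eigenfunction_def)
  have hom: "of_real (norm (c *\<^sub>R y) powr s) * radial_extension e (c *\<^sub>R y) = of_real (c powr s) * (of_real (norm y powr s) * radial_extension e y)"
    if "c > 0" for c y using that by (simp add: radial_extension_scale powr_mult)
  obtain k :: nat where k: "s = real k" "k \<ge> 1"
    and par: "\<And>y. of_real (norm (- y) powr s) * radial_extension e (- y) = (-1) ^ k * (of_real (norm y powr s) * radial_extension e y)"
    using homogeneous_harmonic_degree[OF mv s(1) hom, of x] x by (auto simp: radial_extension_def sgn_div_norm)
  have pw: "norm y powr real k = norm y ^ k" for y :: 'a using k by (simp add: powr_realpow')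
  have "norm (radial_extension e (- y)) = norm (radial_extension e y)" for y
  proof (cases "y = 0")
    case False
    have "norm (complex_of_real (norm (- y) powr s) * radial_extension e (- y)) = norm (complex_of_real (norm y powr s) * radial_extension e y)"
      unfolding par by (simp add: norm_mult norm_power)
    then show ?thesis using False by (simp add: norm_mult)
  qed simp
  then show thesis
    using that[OF k(2) s(2)[unfolded k(1)] mv[unfolded k(1) pw]] by blast
qed

text \<open>
  Degree and frequency are comparable, so the scales \<open>1 / k\<close> and \<open>1 / l\<close> are interchangeable.
\<close>

lemma eigenvalue_bounds:
  assumes k: "k \<ge> 1" and l: "l > 0" "l\<^sup>2 = real k * (real k + real n - 2)" and n: "n \<ge> 3"
  shows "real k \<le> l" "l \<le> real n * real k"
proof -
  have "real k * real k \<le> real k * (real k + real n - 2)" using n by (intro mult_left_mono) auto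
  then have "(real k)\<^sup>2 \<le> l\<^sup>2" unfolding l(2) by (simp add: power2_eq_square)
  then show "real k \<le> l" by (rule power2_le_imp_le) (use l in simp)
  have "real k + real n - 2 \<le> real n * real n * real k"
  proof -
    have "real k \<le> real n * real k" using n by (simp add: mult_le_cancel_right1)
    moreover have "real n \<le> real n * real k" using k by (simp add: mult_le_cancel_left1)
    moreover have "2 * (real n * real k) \<le> real n * (real n * real k)" using n by (intro mult_right_mono) auto
    ultimately show ?thesis by (simp add: mult.assoc)
  qed
  then have "l\<^sup>2 \<le> (real n * real k)\<^sup>2"
    using mult_left_mono[of "real k + real n - 2" "real n * real n * real k" "real k"]
    unfolding l(2) by (simp add: power2_eq_square mult_ac)
  then show "l \<le> real n * real k" by (rule power2_le_imp_le) simp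
qed

text \<open>
  In the shell \<open>\<bar>H\<bar>\<close> and \<open>\<bar>radial_extension e\<bar>\<close> agree up to a factor 2, because \<open>(1 - 1 / (2 k)) ^
  k \<ge> 1 / 2\<close>. Both masses of a cone are in a fixed proportion, \<open>a\<close> and \<open>b\<close>, to the masses of its
  part in the shell, and these proportions do not depend on the cone, so they cancel when the
  masses of two cones are compared.
\<close>

lemma measure_power_measure_radial_shell:
  fixes e :: "'a::euclidean_space \<Rightarrow> complex"
  assumes e: "sphere_smooth e" and k: "k \<ge> 1" and p: "p > 0" and A: "A \<in> sets borel"
    and cont: "continuous_on UNIV (\<lambda>y. of_real (norm y ^ k) * radial_extension e y)"
  defines "H \<equiv> \<lambda>y. of_real (norm y ^ k) * radial_extension e y"
  defines "t \<equiv> 1 - 1 / (2 * real k)"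
  defines "a \<equiv> 1 - t powr (real k * p + real DIM('a))" and "b \<equiv> 1 - t ^ DIM('a)"
  shows "a * measure (power_measure p H) (solid_cone A) \<le> b * measure (power_measure p (radial_extension e)) (solid_cone A)"
    and "b * measure (power_measure p (radial_extension e)) (solid_cone A) \<le> 2 powr p * (a * measure (power_measure p H) (solid_cone A))"
    and "a > 0" "b > 0"
proof -
  let ?n = "DIM('a)"
  let ?F = "radial_extension e"
  have t: "0 < t" "t < 1" using k by (auto simp: t_def divide_simps)
  have cH: "continuous_on UNIV H" unfolding H_def by (rule cont)
  have Fm [measurable]: "?F \<in> borel_measurable borel"
    by (rule borel_measurable_continuous_off_0[OF continuous_on_radial_extension(1)[OF e]])
  have Hm: "H \<in> borel_measurable borel" by (rule borel_measurable_continuous_onI[OF cH])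
  have homH: "H (c *\<^sub>R y) = of_real (c ^ k) * H y" if "c > 0" for c y
    using that by (simp add: H_def radial_extension_scale power_mult_distrib)
  have homF: "?F (c *\<^sub>R y) = of_real (c ^ 0) * ?F y" if "c > 0" for c y
    using that by (simp add: radial_extension_scale)
  have C: "solid_cone A \<in> sets borel" by (rule solid_cone_borel[OF A])
  have sc: "{y. t *\<^sub>R y \<in> solid_cone A \<inter> ball 0 t} = solid_cone A"
    by (rule solid_cone_dilation) (use t in auto)
  obtain B where B: "B > 0" "\<And>y. norm (?F y) \<le> B" using bounded_radial_extension[OF e] by blast
  have finF: "emeasure (power_measure p ?F) (solid_cone A) < \<infinity>"
  proof -
    have "emeasure (power_measure p ?F) (solid_cone A) \<le> (\<integral>\<^sup>+y. ennreal (B powr p) * indicator (ball (0::'a) 1) y \<partial>lborel)"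
      unfolding emeasure_power_measure_measurable[OF Fm C] using B p solid_cone_subset_ball[of A]
      by (intro nn_integral_mono) (auto simp: indicator_def powr_mono2 ennreal_leI)
    also have "\<dots> = ennreal (B powr p) * emeasure lborel (ball (0::'a) 1)"
      by (rule nn_integral_cmult_indicator) simp
    also have "\<dots> < \<infinity>"
      using emeasure_lborel_ball_finite[of "0::'a" 1] by (simp add: ennreal_mult_less_top)
    finally show ?thesis .
  qed
  have finH: "emeasure (power_measure p H) (solid_cone A) < \<infinity>"
    by (rule emeasure_power_measure_bounded[OF cH C _ p, of 0 1]) (use solid_cone_subset_ball[of A] in auto)
  have shell: "measure (power_measure p G) (solid_cone A - ball 0 t) = (1 - t powr (real j * p + real ?n)) * measure (power_measure p G) (solid_cone A)"
    if G: "G \<in> borel_measurable borel" "\<And>c y. c > 0 \<Longrightarrow> G (c *\<^sub>R y) = of_real (c ^ j) * G y"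
      and fin: "emeasure (power_measure p G) (solid_cone A) < \<infinity>" for G :: "'a \<Rightarrow> complex" and j
  proof -
    have "emeasure (power_measure p G) (solid_cone A \<inter> ball 0 t) = ennreal (t powr (real j * p + real ?n)) * emeasure (power_measure p G) (solid_cone A)"
      using emeasure_power_measure_homogeneous[OF G(1) G(2) _ t(1), of "solid_cone A \<inter> ball 0 t" p] C unfolding sc by simp
    then have 1: "measure (power_measure p G) (solid_cone A \<inter> ball 0 t) = t powr (real j * p + real ?n) * measure (power_measure p G) (solid_cone A)"
      by (simp add: measure_def enn2real_mult)
    have "measure (power_measure p G) (solid_cone A - (solid_cone A \<inter> ball 0 t)) = measure (power_measure p G) (solid_cone A) - measure (power_measure p G) (solid_cone A \<inter> ball 0 t)"
      by (rule measure_Diff) (use fin C in auto)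
    moreover have "solid_cone A - (solid_cone A \<inter> ball 0 t) = solid_cone A - ball 0 t" by blast
    ultimately show ?thesis using 1 by (simp add: algebra_simps)
  qed
  have sH: "measure (power_measure p H) (solid_cone A - ball 0 t) = a * measure (power_measure p H) (solid_cone A)"
    unfolding a_def by (rule shell[OF Hm homH finH])
  have sF: "measure (power_measure p ?F) (solid_cone A - ball 0 t) = b * measure (power_measure p ?F) (solid_cone A)"
    using shell[of ?F 0, OF Fm homF finF] t by (simp add: b_def powr_realpow)
  have S: "solid_cone A - ball 0 t \<in> sets borel" using C by auto
  have fS: "emeasure (power_measure p G) (solid_cone A - ball 0 t) < \<infinity>" if "emeasure (power_measure p G) (solid_cone A) < \<infinity>" for G :: "'a \<Rightarrow> complex"
    using emeasure_mono[of "solid_cone A - ball 0 t" "solid_cone A" "power_measure p G"] that C by (auto intro: order.strict_trans1)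
  have "emeasure (power_measure p H) (solid_cone A - ball 0 t) \<le> emeasure (power_measure p ?F) (solid_cone A - ball 0 t)"
    unfolding emeasure_power_measure_measurable[OF Hm S] emeasure_power_measure_measurable[OF Fm S]
  proof (rule nn_integral_mono)
    fix y :: 'a
    have "norm (H y) powr p \<le> norm (?F y) powr p" if "norm y < 1"
      using that p by (intro powr_mono2) (auto simp: H_def norm_mult norm_power mult_left_le_one_le power_le_one)
    then show "ennreal (norm (H y) powr p) * indicator (solid_cone A - ball 0 t) y \<le> ennreal (norm (?F y) powr p) * indicator (solid_cone A - ball 0 t) y"
      by (auto simp: indicator_def solid_cone_def ennreal_leI)
  qed
  then have "measure (power_measure p H) (solid_cone A - ball 0 t) \<le> measure (power_measure p ?F) (solid_cone A - ball 0 t)"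
    unfolding measure_def using fS[OF finF] by (intro enn2real_mono) auto
  then show "a * measure (power_measure p H) (solid_cone A) \<le> b * measure (power_measure p ?F) (solid_cone A)"
    unfolding sH sF .
  have "emeasure (power_measure p ?F) (solid_cone A - ball 0 t) \<le> ennreal (2 powr p) * emeasure (power_measure p H) (solid_cone A - ball 0 t)"
  proof -
    have "emeasure (power_measure p ?F) (solid_cone A - ball 0 t) \<le> (\<integral>\<^sup>+y. ennreal (2 powr p) * (ennreal (norm (H y) powr p) * indicator (solid_cone A - ball 0 t) y) \<partial>lborel)"
      unfolding emeasure_power_measure_measurable[OF Fm S]
    proof (rule nn_integral_mono)
      fix y :: 'a
      have "norm (?F y) powr p \<le> 2 powr p * norm (H y) powr p" if y: "t \<le> norm y"
      proof -
        have "1 + real k * (- (1 / (2 * real k))) \<le> (1 + - (1 / (2 * real k))) ^ k"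
          by (rule Bernoulli_inequality) (use k in \<open>simp add: divide_simps\<close>)
        then have "1 / 2 \<le> t ^ k" using k by (simp add: t_def)
        also have "\<dots> \<le> norm y ^ k" using y t by (intro power_mono) auto
        finally have "1 \<le> 2 * norm y ^ k" by simp
        then have "1 * norm (?F y) \<le> 2 * norm y ^ k * norm (?F y)" by (intro mult_right_mono) auto
        then have "norm (?F y) \<le> 2 * norm (H y)" by (simp add: H_def norm_mult norm_power)
        then have "norm (?F y) powr p \<le> (2 * norm (H y)) powr p" using p by (intro powr_mono2) auto
        then show ?thesis by (simp add: powr_mult)
      qed
      then show "ennreal (norm (?F y) powr p) * indicator (solid_cone A - ball 0 t) y \<le> ennreal (2 powr p) * (ennreal (norm (H y) powr p) * indicator (solid_cone A - ball 0 t) y)"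
        by (auto simp: indicator_def ennreal_mult[symmetric] ennreal_leI)
    qed
    also have "\<dots> = ennreal (2 powr p) * emeasure (power_measure p H) (solid_cone A - ball 0 t)"
      unfolding emeasure_power_measure_measurable[OF Hm S]
      by (rule nn_integral_cmult) (use S Hm in measurable)
    finally show ?thesis .
  qed
  then have "measure (power_measure p ?F) (solid_cone A - ball 0 t) \<le> enn2real (ennreal (2 powr p) * emeasure (power_measure p H) (solid_cone A - ball 0 t))"
    unfolding measure_def using fS[OF finH] by (intro enn2real_mono) (auto simp: ennreal_mult_less_top)
  then have "measure (power_measure p ?F) (solid_cone A - ball 0 t) \<le> 2 powr p * measure (power_measure p H) (solid_cone A - ball 0 t)"
    by (simp add: measure_def enn2real_mult)
  then show "b * measure (power_measure p ?F) (solid_cone A) \<le> 2 powr p * (a * measure (power_measure p H) (solid_cone A))"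
    unfolding sH sF .
  have n: "?n \<ge> 1" by (simp add: Suc_le_eq)
  have "t ^ ?n < 1" using t n by (simp add: power_less_one_iff)
  then show "b > 0" by (simp add: b_def)
  have "t powr (real k * p + real ?n) < t powr 0"
    using t p n by (intro powr_less_mono') (auto intro!: add_nonneg_pos)
  then show "a > 0" using t by (simp add: a_def)
qed

text \<open>
  One of the two antipodal balls contains at least half of the required volume of \<open>A l\<close>. The part
  in the shell of the cone over this piece has volume of order \<open>1 / k ^ n\<close> and lies within \<open>(r +
  1) / k\<close> of every \<open>x\<close> in the shell over the centre.
\<close>

theorem Logvinenko_Sereda_if_dense:
  fixes A :: "real \<Rightarrow> 'a::euclidean_space set"
  assumes dim: "DIM('a) \<ge> 3" and p: "p \<ge> 1" and A: "\<And>l. l \<ge> 1 \<Longrightarrow> A l \<in> sets sphere_volume"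
    and dense: "symmetric_relatively_dense A"
  shows "Logvinenko_Sereda p A"
proof -
  let ?n = "DIM('a)" and ?V = "measure lborel (ball (0::'a) 1)"
  obtain r \<rho> where r: "r > 0" and \<rho>: "\<rho> > 0" and dens: "\<And>l z. l \<in> sphere_frequencies TYPE('a) \<Longrightarrow> z \<in> sphere 0 1 \<Longrightarrow>
       (measure sphere_volume (A l \<inter> geodesic_ball z (r / l)) +
        measure sphere_volume (A l \<inter> geodesic_ball (- z) (r / l)))
       / measure sphere_volume (geodesic_ball z (r / l)) \<ge> \<rho>"
    using dense unfolding symmetric_relatively_dense_def by blast
  have V: "?V > 0" by (rule content_ball_pos) simp
  \<comment> \<open>a lower bound for \<open>k ^ (n - 1)\<close> times the volume of the cone over the larger of the two
    pieces\<close>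
  define \<kappa>0 where "\<kappa>0 = \<rho> / 2 * (?V / 32 ^ ?n * (min r 1 / ?n) ^ (?n - 1)) / ?n"
  have \<kappa>0: "\<kappa>0 > 0" using \<rho> V r by (simp add: \<kappa>0_def)
  obtain c where c: "c > 0" "\<And>(H :: 'a \<Rightarrow> complex) k A. mean_value_property H \<Longrightarrow> k \<ge> 1 \<Longrightarrow>
     (\<forall>c>0. \<forall>y. H (c *\<^sub>R y) = of_real (c ^ k) * H y) \<Longrightarrow> (\<forall>y. norm (H (- y)) = norm (H y)) \<Longrightarrow>
     A \<in> sets borel \<Longrightarrow> A \<subseteq> ball 0 1 \<Longrightarrow>
     (\<forall>x. 1 - 1 / (2 * real k) < norm x \<longrightarrow> norm x < 1 \<longrightarrow>
        measure lborel (A \<inter> ball x ((r + 1) / real k)) \<ge> (\<kappa>0 / 2) / real k ^ DIM('a) \<or>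
        measure lborel (A \<inter> ball (- x) ((r + 1) / real k)) \<ge> (\<kappa>0 / 2) / real k ^ DIM('a)) \<Longrightarrow>
     c * measure (power_measure p H) (ball 0 1) \<le> measure (power_measure p H) A"
    using solid_logvinenko_sereda[of "r + 1" "\<kappa>0 / 2" p, where 'a='a] r \<kappa>0 p by (auto simp del: divide_divide_eq_left)
  show ?thesis
    unfolding Logvinenko_Sereda_def
  proof (intro exI[of _ "c / 2 powr p"] conjI allI impI)
    show "c / 2 powr p > 0" using c by simp
    fix l :: real and e :: "'a \<Rightarrow> complex"
    assume l: "l \<ge> 1" and e: "sphere_eigenfunction l e"
    have p0: "p > 0" and l0: "l > 0" using p l by auto
    have sm: "sphere_smooth e" using e by (simp add: sphere_eigenfunction_def)
    have freq: "l \<in> sphere_frequencies TYPE('a)" using l e by (auto simp: sphere_frequencies_def)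
    obtain k where k: "k \<ge> 1" "l\<^sup>2 = real k * (real k + real ?n - 2)"
      and mv: "mean_value_property (\<lambda>y. of_real (norm y ^ k) * radial_extension e y)"
      and par: "\<And>y. norm (radial_extension e (- y)) = norm (radial_extension e y)"
      using eigenfunction_degree[OF e l0 dim] by blast
    have kl: "real k \<le> l" "l \<le> real ?n * real k" using eigenvalue_bounds[OF k(1) l0 k(2) dim] by auto
    define H where "H y = of_real (norm y ^ k) * radial_extension e y" for y
    have mvH: "mean_value_property H" unfolding H_def[abs_def] by (rule mv)
    have cont: "continuous_on UNIV (\<lambda>y. of_real (norm y ^ k) * radial_extension e y)" using mv by (simp add: mean_value_property_def)
    obtain A' where A': "A' \<in> sets borel" "A' \<subseteq> sphere 0 1" "AE x in sphere_volume. x \<in> A l \<longleftrightarrow> x \<in> A'"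
      using borel_version_of_sphere_set[OF A[OF l]] by blast
    have A's: "A' \<in> sets sphere_volume" by (rule sets_sphere_volume_borel[OF A'(1,2)])
    have dA: "\<exists>z'\<in>{z, - z}. \<kappa>0 / real k ^ (?n - 1) \<le> measure lborel (solid_cone (A' \<inter> geodesic_ball z' (r / l)))" if z: "norm z = 1" for z
    proof -
      have low: "?V / 32 ^ ?n * (min r 1 / ?n / real k) ^ (?n - 1) \<le> measure sphere_volume (geodesic_ball z (r / l))"
      proof -
        have mr: "0 < min (r / l) 1" "min (r / l) 1 \<le> 1" using r l0 by auto
        have "min r 1 / ?n / real k = min r 1 / (real ?n * real k)" by simp
        also have "\<dots> \<le> min r 1 / l" using kl l0 k r by (intro divide_left_mono) auto
        also have "\<dots> \<le> min (r / l) 1" using l r by (auto simp: min_def divide_simps)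
        finally have "?V / 32 ^ ?n * (min r 1 / ?n / real k) ^ (?n - 1) \<le> ?V / 32 ^ ?n * (min (r / l) 1) ^ (?n - 1)"
          using V r by (intro mult_left_mono power_mono) auto
        also have "\<dots> \<le> measure sphere_volume (geodesic_ball z (min (r / l) 1))"
          by (rule geodesic_ball_volume_lower[OF z mr])
        also have "\<dots> \<le> measure sphere_volume (geodesic_ball z (r / l))"
          using finite_measure.finite_measure_mono[OF finite_measure_sphere_volume, of "geodesic_ball z (min (r / l) 1)" "geodesic_ball z (r / l)"]
            geodesic_ball_sets[OF z] by (auto simp: geodesic_ball_def)
        finally show ?thesis .
      qed
      have pos: "0 < ?V / 32 ^ ?n * (min r 1 / ?n / real k) ^ (?n - 1)" using V r k by simp
      have eqz: "measure sphere_volume (A l \<inter> geodesic_ball z' (r / l)) = ?n * measure lborel (solid_cone (A' \<inter> geodesic_ball z' (r / l)))"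
        if z': "norm z' = 1" for z'
      proof -
        have "measure sphere_volume (A l \<inter> geodesic_ball z' (r / l)) = measure sphere_volume (A' \<inter> geodesic_ball z' (r / l))"
          by (rule measure_borel_version[OF A[OF l] A's geodesic_ball_sets[OF z'] A'(3)])
        also have "\<dots> = ?n * measure lborel (solid_cone (A' \<inter> geodesic_ball z' (r / l)))"
          by (rule measure_sphere_volume_cone) (use A' geodesic_ball_borel[OF z'] in auto)
        finally show ?thesis .
      qed
      have "\<rho> * measure sphere_volume (geodesic_ball z (r / l)) \<le> measure sphere_volume (A l \<inter> geodesic_ball z (r / l)) + measure sphere_volume (A l \<inter> geodesic_ball (- z) (r / l))"
        using dens[OF freq, of z] z low pos by (simp add: field_simps)
      then have sum: "\<rho> * (?V / 32 ^ ?n * (min r 1 / ?n / real k) ^ (?n - 1)) \<le> ?n * measure lborel (solid_cone (A' \<inter> geodesic_ball z (r / l))) + ?n * measure lborel (solid_cone (A' \<inter> geodesic_ball (- z) (r / l)))"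
        using mult_left_mono[OF low, of \<rho>] \<rho> eqz[of z] eqz[of "- z"] z by simp
      have "\<rho> * (?V / 32 ^ ?n * (min r 1 / ?n / real k) ^ (?n - 1)) = 2 * (?n * (\<kappa>0 / real k ^ (?n - 1)))"
        unfolding \<kappa>0_def power_divide[of _ "real k"] by simp
      with sum have "2 * (?n * (\<kappa>0 / real k ^ (?n - 1))) \<le> ?n * (measure lborel (solid_cone (A' \<inter> geodesic_ball z (r / l))) + measure lborel (solid_cone (A' \<inter> geodesic_ball (- z) (r / l))))"
        by (simp only: distrib_left)
      then have "2 * (\<kappa>0 / real k ^ (?n - 1)) \<le> measure lborel (solid_cone (A' \<inter> geodesic_ball z (r / l))) + measure lborel (solid_cone (A' \<inter> geodesic_ball (- z) (r / l)))"
        using DIM_positive[where 'a='a]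
        by (simp only: mult.left_commute[of 2 "real ?n"] mult_le_cancel_left_pos of_nat_0_less_iff)
      then show ?thesis by (cases "\<kappa>0 / real k ^ (?n - 1) \<le> measure lborel (solid_cone (A' \<inter> geodesic_ball z (r / l)))") auto
    qed
    have solid: "c * measure (power_measure p H) (ball 0 1) \<le> measure (power_measure p H) (solid_cone A')"
    proof (rule c(2)[OF mvH k(1)])
      show "\<forall>c>0. \<forall>y. H (c *\<^sub>R y) = of_real (c ^ k) * H y"
        by (simp add: H_def radial_extension_scale power_mult_distrib)
      show "\<forall>y. norm (H (- y)) = norm (H y)" by (simp add: H_def norm_mult par)
      show "solid_cone A' \<in> sets borel" by (rule solid_cone_borel[OF A'(1)])
      show "solid_cone A' \<subseteq> ball 0 1" by (rule solid_cone_subset_ball)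
      show "\<forall>x. 1 - 1 / (2 * real k) < norm x \<longrightarrow> norm x < 1 \<longrightarrow>
        measure lborel (solid_cone A' \<inter> ball x ((r + 1) / real k)) \<ge> (\<kappa>0 / 2) / real k ^ ?n \<or>
        measure lborel (solid_cone A' \<inter> ball (- x) ((r + 1) / real k)) \<ge> (\<kappa>0 / 2) / real k ^ ?n"
      proof (intro allI impI)
        fix x :: 'a assume x: "1 - 1 / (2 * real k) < norm x" "norm x < 1"
        define t where "t = 1 - 1 / (2 * real k)"
        have t: "0 < t" "t \<le> 1" using k by (auto simp: t_def divide_simps)
        have x0: "x \<noteq> 0" using x t by (auto simp: t_def)
        have main: "(\<kappa>0 / 2) / real k ^ ?n \<le> measure lborel (solid_cone A' \<inter> ball x' ((r + 1) / real k))"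
          if x': "x' \<in> {x, - x}" and m: "\<kappa>0 / real k ^ (?n - 1) \<le> measure lborel (solid_cone (A' \<inter> geodesic_ball (sgn x') (r / l)))" for x'
        proof -
          let ?z = "sgn x'"
          have z: "norm ?z = 1" "norm x' = norm x" "x' \<noteq> 0" using x' x0 by (auto simp: norm_sgn)
          have AB: "A' \<inter> geodesic_ball ?z (r / l) \<in> sets borel" using A'(1) geodesic_ball_borel[OF z(1)] by auto
          let ?C = "solid_cone (A' \<inter> geodesic_ball ?z (r / l))"
          have sub: "?C - ball 0 t \<subseteq> solid_cone A' \<inter> ball x' ((r + 1) / real k)"
          proof
            fix y assume y: "y \<in> ?C - ball 0 t"
            then have y1: "y \<noteq> 0" "norm y < 1" "t \<le> norm y" "sgn y \<in> geodesic_ball ?z (r / l)" "y \<in> solid_cone A'" by (auto simp: solid_cone_def)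
            have "norm (sgn y - ?z) < r / l"
              using y1 chord_le_geodesic(1)[of "sgn y" ?z] z
              by (auto simp: geodesic_ball_def norm_sgn geodesic_dist_commute[of _ ?z])
            also have "r / l \<le> r / real k" using r kl k l0 by (intro divide_left_mono) auto
            finally have 1: "norm (sgn y - ?z) < r / real k" .
            have 2: "norm (y - sgn y) \<le> 1 / (2 * real k)" using norm_sgn_diff[OF y1(1)] y1 by (simp add: t_def)
            have 3: "norm (x' - ?z) \<le> 1 / (2 * real k)" using norm_sgn_diff[OF z(3)] x z by simp
            have "norm (y - x') \<le> norm (y - sgn y) + norm (sgn y - ?z) + norm (x' - ?z)"
              using norm_triangle_ineq[of "y - sgn y" "sgn y - ?z"] norm_triangle_ineq4[of "y - ?z" "x' - ?z"] by simp
            also have "\<dots> < 1 / (2 * real k) + r / real k + 1 / (2 * real k)" using 1 2 3 by linarith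
            also have "\<dots> = (r + 1) / real k" by (simp add: add_divide_distrib)
            finally show "y \<in> solid_cone A' \<inter> ball x' ((r + 1) / real k)" using y1 by (simp add: dist_norm norm_minus_commute)
          qed
          have "t ^ ?n \<le> t ^ 1" using t by (intro power_decreasing) (auto simp: Suc_le_eq)
          then have tn: "1 / (2 * real k) \<le> 1 - t ^ ?n" by (simp add: t_def)
          have kn: "real k ^ ?n = real k * real k ^ (?n - 1)" by (subst power_eq_if) simp
          have "(\<kappa>0 / 2) / real k ^ ?n = 1 / (2 * real k) * (\<kappa>0 / real k ^ (?n - 1))" unfolding kn by simp
          also have "\<dots> \<le> (1 - t ^ ?n) * measure lborel ?C"
            using tn m \<kappa>0 t by (intro mult_mono) (auto simp: power_le_one)
          also have "\<dots> = measure lborel (?C - ball 0 t)" by (rule measure_cone_shell[symmetric, OF AB t])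
          also have "\<dots> \<le> measure lborel (solid_cone A' \<inter> ball x' ((r + 1) / real k))"
          proof (rule measure_mono_fmeasurable[OF sub])
            show "solid_cone A' \<inter> ball x' ((r + 1) / real k) \<in> fmeasurable lborel"
              by (rule fmeasurableI2[OF fmeasurable_ball]) (use solid_cone_borel[OF A'(1)] in auto)
          qed (use solid_cone_borel[OF AB] in auto)
          finally show ?thesis .
        qed
        have "norm (sgn x) = 1" using x0 by (simp add: norm_sgn)
        from dA[OF this] show "measure lborel (solid_cone A' \<inter> ball x ((r + 1) / real k)) \<ge> (\<kappa>0 / 2) / real k ^ ?n \<or>
          measure lborel (solid_cone A' \<inter> ball (- x) ((r + 1) / real k)) \<ge> (\<kappa>0 / 2) / real k ^ ?n"
          using main[of x] main[of "- x"] by (auto simp: sgn_minus)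
      qed
    qed
    have mm: "(\<lambda>x. norm (e x) powr p) \<in> borel_measurable sphere_volume"
      by (rule borel_measurable_integrable[OF integral_sphere_volume_cone(2)[OF sm _ _ p0, of "{}"]]) auto
    define a where "a = 1 - (1 - 1 / (2 * real k)) powr (real k * p + real ?n)"
    define b where "b = 1 - (1 - 1 / (2 * real k)) ^ ?n"
    let ?\<Phi> = "\<lambda>B. measure (power_measure p (radial_extension e)) (solid_cone B)"
    let ?M = "\<lambda>B. measure (power_measure p H) (solid_cone B)"
    have ab: "a > 0" "b > 0" and up: "a * ?M A' \<le> b * ?\<Phi> A'" and dn: "b * ?\<Phi> (sphere 0 1) \<le> 2 powr p * (a * ?M (sphere 0 1))"
      using measure_power_measure_radial_shell[OF sm k(1) p0 _ cont] A'(1)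
      unfolding a_def b_def H_def[abs_def] by auto
    have "?M (sphere 0 1) \<le> measure (power_measure p H) (ball 0 1)"
    proof (rule measure_mono_fmeasurable[OF solid_cone_subset_ball])
      show "ball 0 1 \<in> fmeasurable (power_measure p H)"
        using emeasure_power_measure_bounded[OF _ borel_open[OF open_ball] ball_subset_cball p0, of H 0 1] mvH
        by (intro fmeasurableI) (auto simp: mean_value_property_def)
    qed auto
    then have "c * ?M (sphere 0 1) \<le> ?M A'" using solid c(1) by (meson mult_left_mono less_imp_le order_trans)
    have "b * (c * ?\<Phi> (sphere 0 1)) = c * (b * ?\<Phi> (sphere 0 1))" by simp
    also have "\<dots> \<le> c * (2 powr p * (a * ?M (sphere 0 1)))" using c dn by (intro mult_left_mono) auto
    also have "\<dots> = 2 powr p * (a * (c * ?M (sphere 0 1)))" by (simp add: mult_ac)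
    also have "\<dots> \<le> 2 powr p * (a * ?M A')" using ab \<open>c * ?M (sphere 0 1) \<le> ?M A'\<close> by (intro mult_left_mono) auto
    also have "\<dots> \<le> 2 powr p * (b * ?\<Phi> A')" by (intro mult_left_mono up) auto
    also have "\<dots> = b * (2 powr p * ?\<Phi> A')" by simp
    finally have fin: "c * ?\<Phi> (sphere 0 1) \<le> 2 powr p * ?\<Phi> A'" using ab by simp
    have "(LINT x:A l|sphere_volume. norm (e x) powr p) = ?n * ?\<Phi> A'"
      using set_integral_borel_version[OF mm A[OF l] A's A'(3)] integral_sphere_volume_cone(1)[OF sm A'(1,2), of p] by simp
    moreover have "(LINT x:sphere 0 1|sphere_volume. norm (e x) powr p) = ?n * ?\<Phi> (sphere 0 1)"
      by (rule integral_sphere_volume_cone(1)[OF sm]) auto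
    moreover have "c / 2 powr p * (?n * ?\<Phi> (sphere 0 1)) \<le> ?n * ?\<Phi> A'"
    proof -
      have "c * ?\<Phi> (sphere 0 1) / 2 powr p \<le> ?\<Phi> A'" using fin by (simp add: divide_simps mult.commute)
      then have "?n * (c * ?\<Phi> (sphere 0 1) / 2 powr p) \<le> ?n * ?\<Phi> A'" by (intro mult_left_mono) auto
      then show ?thesis by (simp add: mult_ac)
    qed
    ultimately show "(LINT x:A l|sphere_volume. cmod (e x) powr p) \<ge> c / 2 powr p * (LINT x:sphere 0 1|sphere_volume. cmod (e x) powr p)"
      by simp
  qed
qed

section \<open>Zonal eigenfunctions\<close>

lemma C_k_on_cong:
  assumes "open U" "\<And>x. x \<in> U \<Longrightarrow> f x = g x" "C_k_on k f U"
  shows "C_k_on k g U"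
  using assms(2,3)
proof (induction k arbitrary: f g)
  case 0
  then show ?case by (simp cong: continuous_on_cong)
next
  case (Suc k)
  have d: "f differentiable (at x)" if "x \<in> U" for x using Suc.prems(2) that by simp
  show ?case
  proof (simp, intro conjI ballI allI)
    fix x assume x: "x \<in> U"
    show "g differentiable (at x)"
      by (rule differentiable_transform_open[OF d[OF x] assms(1) x Suc.prems(1)])
  next
    fix v
    show "C_k_on k (\<lambda>x. frechet_derivative g (at x) v) U"
    proof (rule Suc.IH)
      show "C_k_on k (\<lambda>x. frechet_derivative f (at x) v) U" using Suc.prems(2) by simp
      fix x assume x: "x \<in> U"
      show "frechet_derivative f (at x) v = frechet_derivative g (at x) v"
        using frechet_derivative_transform_within_open[OF d[OF x] assms(1) x Suc.prems(1)] by simp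
    qed
  qed
qed

text \<open>
  A class of functions, closed under differentiation on the punctured space, that contains all
  polynomials in \<open>sgn y \<bullet> z\<close>.
\<close>

inductive_set radial_algebra :: "('a::euclidean_space \<Rightarrow> complex) set" where
  const: "(\<lambda>_. c) \<in> radial_algebra"
| linear: "(\<lambda>y. of_real (y \<bullet> v)) \<in> radial_algebra"
| inverse_norm: "(\<lambda>y. of_real (1 / norm y)) \<in> radial_algebra"
| add: "f \<in> radial_algebra \<Longrightarrow> g \<in> radial_algebra \<Longrightarrow> (\<lambda>y. f y + g y) \<in> radial_algebra"
| mult: "f \<in> radial_algebra \<Longrightarrow> g \<in> radial_algebra \<Longrightarrow> (\<lambda>y. f y * g y) \<in> radial_algebra"

lemma radial_algebra_derivative:
  assumes "f \<in> radial_algebra"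
  shows "\<exists>f'. (\<forall>v. f' v \<in> radial_algebra) \<and> (\<forall>y. y \<noteq> 0 \<longrightarrow> (f has_derivative (\<lambda>v. f' v y)) (at y))"
  using assms
proof induction
  case (const c)
  show ?case by (rule exI[of _ "\<lambda>v y. 0"]) (auto intro: radial_algebra.const)
next
  case (linear u)
  show ?case
    by (rule exI[of _ "\<lambda>v y. of_real (v \<bullet> u)"])
       (auto intro: radial_algebra.const intro!: has_derivative_of_real derivative_eq_intros)
next
  case inverse_norm
  let ?r = "\<lambda>y. complex_of_real (1 / norm y)"
  have "((\<lambda>y. complex_of_real (1 / norm y)) has_derivative (\<lambda>v. (-1) * ((?r y * ?r y) * (?r y * of_real (y \<bullet> v))))) (at y)"
    if "y \<noteq> 0" for y :: 'a
  proof -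
    have "((\<lambda>y. 1 / norm y) has_derivative (\<lambda>v. - (1 / norm y) * (sgn y \<bullet> v) * (1 / norm y))) (at y)"
      using that by (auto intro!: derivative_eq_intros has_derivative_norm simp: divide_inverse inner_commute)
    then have "((\<lambda>y. complex_of_real (1 / norm y)) has_derivative (\<lambda>v. of_real (- (1 / norm y) * (sgn y \<bullet> v) * (1 / norm y)))) (at y)"
      by (rule has_derivative_of_real)
    moreover have "complex_of_real (- (1 / norm y) * (sgn y \<bullet> v) * (1 / norm y)) = (-1) * ((?r y * ?r y) * (?r y * of_real (y \<bullet> v)))" for v
      by (simp add: sgn_div_norm divide_inverse)
    ultimately show ?thesis by simp
  qed
  moreover have "(\<lambda>y. (-1) * ((?r y * ?r y) * (?r y * of_real (y \<bullet> v)))) \<in> radial_algebra" for v :: 'a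
    by (intro radial_algebra.mult radial_algebra.const radial_algebra.linear radial_algebra.inverse_norm)
  ultimately show ?case
    by (intro exI[of _ "\<lambda>v y. (-1) * ((?r y * ?r y) * (?r y * of_real (y \<bullet> v)))"] conjI allI impI)
next
  case (add f g)
  then obtain f' g' where "\<forall>v. f' v \<in> radial_algebra" "\<forall>v. g' v \<in> radial_algebra"
    "\<forall>y. y \<noteq> 0 \<longrightarrow> (f has_derivative (\<lambda>v. f' v y)) (at y)" "\<forall>y. y \<noteq> 0 \<longrightarrow> (g has_derivative (\<lambda>v. g' v y)) (at y)"
    by blast
  then show ?case
    by (intro exI[of _ "\<lambda>v y. f' v y + g' v y"]) (auto intro: radial_algebra.add has_derivative_add)
next
  case (mult f g)
  then obtain f' g' where "\<forall>v. f' v \<in> radial_algebra" "\<forall>v. g' v \<in> radial_algebra"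
    "\<forall>y. y \<noteq> 0 \<longrightarrow> (f has_derivative (\<lambda>v. f' v y)) (at y)" "\<forall>y. y \<noteq> 0 \<longrightarrow> (g has_derivative (\<lambda>v. g' v y)) (at y)"
    by blast
  with mult.hyps show ?case
    by (intro exI[of _ "\<lambda>v y. f y * g' v y + f' v y * g y"])
       (auto intro!: radial_algebra.add radial_algebra.mult has_derivative_mult)
qed

lemma radial_algebra_C_k:
  assumes "f \<in> radial_algebra"
  shows "C_k_on k f (- {0})"
  using assms
proof (induction k arbitrary: f)
  case 0
  obtain f' where f': "\<And>v. f' v \<in> radial_algebra" "\<And>y. y \<noteq> 0 \<Longrightarrow> (f has_derivative (\<lambda>v. f' v y)) (at y)"
    using radial_algebra_derivative[OF 0] by blast
  have "continuous_on (- {0}) f"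
    by (intro continuous_at_imp_continuous_on ballI has_derivative_continuous[OF f'(2)]) auto
  then show ?case by simp
next
  case (Suc k)
  obtain f' where f': "\<And>v. f' v \<in> radial_algebra" "\<And>y. y \<noteq> 0 \<Longrightarrow> (f has_derivative (\<lambda>v. f' v y)) (at y)"
    using radial_algebra_derivative[OF Suc.prems] by blast
  show ?case
  proof (simp, intro conjI ballI allI)
    fix x :: 'a assume "x \<in> - {0}"
    then show "f differentiable (at x)" using f'(2)[of x] unfolding differentiable_def by auto
  next
    fix v
    show "C_k_on k (\<lambda>x. frechet_derivative f (at x) v) (- {0})"
    proof (rule C_k_on_cong[OF _ _ Suc.IH[OF f'(1)[of v]]])
      fix x :: 'a assume "x \<in> - {0}"
      then show "f' v x = frechet_derivative f (at x) v"
        using frechet_derivative_at[OF f'(2)[of x]] by (metis ComplD insertI1)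
    qed (simp add: open_Compl)
  qed
qed

text \<open>
  The polynomial is taken in the variable \<open>1 - x \<bullet> z\<close>, which vanishes at the pole \<open>z\<close>; the
  coefficients then satisfy a two-term recursion.
\<close>

definition zonal :: "real poly \<Rightarrow> 'a::euclidean_space \<Rightarrow> 'a \<Rightarrow> complex"
  where "zonal Q z x = of_real (poly Q (1 - x \<bullet> z))"

lemma sphere_smooth_zonal: "sphere_smooth (zonal Q z)"
proof -
  have "(\<lambda>y. zonal Q z (sgn y)) \<in> radial_algebra"
  proof (induction Q)
    case 0
    then show ?case by (simp add: zonal_def radial_algebra.const)
  next
    case (pCons a Q)
    have "(\<lambda>y. zonal (pCons a Q) z (sgn y)) = (\<lambda>y. of_real a + (of_real 1 + (of_real (- 1)) * (of_real (1 / norm y) * of_real (y \<bullet> z))) * zonal Q z (sgn y))"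
      by (simp add: zonal_def fun_eq_iff sgn_div_norm divide_inverse mult_ac)
    then show ?case
      using pCons.IH by (simp only:) (intro radial_algebra.intros)
  qed
  then show ?thesis unfolding sphere_smooth_def by (intro allI radial_algebra_C_k)
qed

text \<open>
  For \<open>q = y \<bullet> z / norm y\<close> one has \<open>\<bar>grad q\<bar> ^ 2 = 1 - q ^ 2\<close> and \<open>\<Delta> q = (1 - n) q\<close> on the sphere,
  so the chain rule turns the Laplacian into the given ordinary differential operator.
\<close>

lemma sphere_laplacian_zonal:
  fixes z :: "'a::euclidean_space"
  assumes z: "norm z = 1" and x: "norm x = 1"
    and ode: "\<And>u. u * (2 - u) * poly (pderiv (pderiv Q)) u + (real DIM('a) - 1) * (1 - u) * poly (pderiv Q) u + L * poly Q u = 0"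
  shows "- sphere_laplacian (zonal Q z) x = of_real L * zonal Q z x"
proof -
  define q where "q y = (y \<bullet> z) * (1 / norm y)" for y
  define q1 where "q1 b y = (b \<bullet> z) * (1 / norm y) - (y \<bullet> z) * (y \<bullet> b) * (1 / norm y) ^ 3" for b y
  define q2 where "q2 b = - 2 * (b \<bullet> z) * (x \<bullet> b) - (x \<bullet> z) + 3 * (x \<bullet> z) * (x \<bullet> b)\<^sup>2" for b
  define f1 where "f1 b y = - poly (pderiv Q) (1 - q y) * q1 b y" for b y
  define f2 where "f2 b = poly (pderiv (pderiv Q)) (1 - q x) * (q1 b x)\<^sup>2 - poly (pderiv Q) (1 - q x) * q2 b" for b
  have F: "radial_extension (zonal Q z) y = of_real (poly Q (1 - q y))" for y
    by (simp add: radial_extension_def zonal_def q_def sgn_div_norm divide_inverse mult.commute)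
  have x0: "x \<noteq> 0" using x by auto
  have dr: "((\<lambda>t. 1 / norm (y + t *\<^sub>R b)) has_real_derivative - (y \<bullet> b) * (1 / norm y) ^ 3) (at 0)" if "y \<noteq> 0" for y b :: 'a
  proof -
    have 1: "((\<lambda>y. 1 / norm y) has_derivative (\<lambda>v. - (1 / norm y) * (sgn y \<bullet> v) * (1 / norm y))) (at (y + 0 *\<^sub>R b))"
      using that by (auto intro!: derivative_eq_intros has_derivative_norm simp: divide_inverse inner_commute)
    have 2: "((\<lambda>t::real. y + t *\<^sub>R b) has_derivative (\<lambda>t. t *\<^sub>R b)) (at 0)"
      by (auto intro!: derivative_eq_intros)
    have "((\<lambda>t. 1 / norm (y + t *\<^sub>R b)) has_derivative (\<lambda>t. - (1 / norm y) * (sgn y \<bullet> (t *\<^sub>R b)) * (1 / norm y))) (at 0)"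
      using has_derivative_compose[OF 2 1] .
    moreover have "(\<lambda>t. - (1 / norm y) * (sgn y \<bullet> (t *\<^sub>R b)) * (1 / norm y)) = (*) (- (y \<bullet> b) * (1 / norm y) ^ 3)"
      by (simp add: fun_eq_iff sgn_div_norm divide_inverse power3_eq_cube mult_ac)
    ultimately show ?thesis by (simp add: has_field_derivative_def)
  qed
  have dl: "((\<lambda>t. (y + t *\<^sub>R b) \<bullet> w) has_real_derivative b \<bullet> w) (at 0)" for y b w :: 'a
    unfolding inner_add_left inner_scaleR_left by (auto intro!: derivative_eq_intros)
  have dq: "((\<lambda>t. q (y + t *\<^sub>R b)) has_real_derivative q1 b y) (at 0)" if "y \<noteq> 0" for y b
    using DERIV_mult[OF dl[of y b z] dr[OF that, of b]] by (simp add: q_def q1_def algebra_simps)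
  have dpoly: "((\<lambda>t. poly P (1 - q (y + t *\<^sub>R b))) has_real_derivative - poly (pderiv P) (1 - q y) * q1 b y) (at 0)" if "y \<noteq> 0" for y b P
  proof -
    have "((\<lambda>t. 1 - q (y + t *\<^sub>R b)) has_real_derivative - q1 b y) (at 0)"
      using DERIV_diff[OF DERIV_const[of 1] dq[OF that, of b]] by simp
    from DERIV_chain2[OF poly_DERIV[of P "1 - q (y + 0 *\<^sub>R b)"] this] show ?thesis by simp
  qed
  have d1: "radial_extension_d1 (zonal Q z) b y = of_real (f1 b y)" if "y \<noteq> 0" for b y
  proof -
    have "has_dir_deriv (radial_extension (zonal Q z)) b y (of_real (f1 b y))"
      unfolding has_dir_deriv_def F f1_def by (rule has_vector_derivative_of_real) (rule dpoly[OF that])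
    from has_dir_deriv_unique[OF radial_extension_has_dir_deriv(1)[OF sphere_smooth_zonal that] this]
    show ?thesis .
  qed
  have dq1: "((\<lambda>t. q1 b (x + t *\<^sub>R b)) has_real_derivative q2 b) (at 0)" if b: "b \<in> Basis" for b
  proof -
    have r3: "((\<lambda>t. (1 / norm (x + t *\<^sub>R b)) ^ 3) has_real_derivative - 3 * (x \<bullet> b)) (at 0)"
      using DERIV_power[OF dr[OF x0, of b], of 3] x by simp
    have "b \<bullet> b = 1" using b by simp
    with DERIV_diff[OF DERIV_cmult[OF dr[OF x0, of b], of "b \<bullet> z"] DERIV_mult[OF DERIV_mult[OF dl[of x b z] dl[of x b b]] r3]] x
    show ?thesis unfolding q1_def q2_def by (simp add: algebra_simps power2_eq_square)
  qed
  have d2: "radial_extension_d2 (zonal Q z) b x = of_real (f2 b)" if b: "b \<in> Basis" for b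
  proof -
    have "((\<lambda>t. f1 b (x + t *\<^sub>R b)) has_real_derivative f2 b) (at 0)"
    proof -
      note * = DERIV_mult[OF DERIV_minus[OF dpoly[OF x0, of "pderiv Q" b]] dq1[OF b]]
      show ?thesis unfolding f1_def by (rule DERIV_cong[OF *]) (simp add: f2_def power2_eq_square)
    qed
    then have "has_dir_deriv (\<lambda>y. complex_of_real (f1 b y)) b x (of_real (f2 b))"
      unfolding has_dir_deriv_def by (rule has_vector_derivative_of_real)
    then have "has_dir_deriv (radial_extension_d1 (zonal Q z) b) b x (of_real (f2 b))"
      by (rule has_dir_deriv_transform[of _ _ _ _ "- {0}"]) (use d1 x0 in auto)
    from has_dir_deriv_unique[OF radial_extension_has_dir_deriv(2)[OF sphere_smooth_zonal x0] this]
    show ?thesis .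
  qed
  have q: "q x = x \<bullet> z" using x by (simp add: q_def)
  note n2 = sum_inner_Basis_squared[where 'a='a]
  have xz: "(\<Sum>b\<in>Basis. (b \<bullet> z) * (x \<bullet> b)) = x \<bullet> z"
    by (subst euclidean_inner[of x z]) (simp add: inner_commute[of z] mult.commute)
  have s1: "(\<Sum>b\<in>Basis. (q1 b x)\<^sup>2) = 1 - (x \<bullet> z)\<^sup>2"
  proof -
    have "(q1 b x)\<^sup>2 = (z \<bullet> b)\<^sup>2 - 2 * (x \<bullet> z) * ((b \<bullet> z) * (x \<bullet> b)) + (x \<bullet> z)\<^sup>2 * (x \<bullet> b)\<^sup>2" for b
      using x by (simp add: q1_def power2_eq_square algebra_simps inner_commute[of z b])
    then have "(\<Sum>b\<in>Basis. (q1 b x)\<^sup>2) = (\<Sum>b\<in>Basis. (z \<bullet> b)\<^sup>2) - 2 * (x \<bullet> z) * (\<Sum>b\<in>Basis. (b \<bullet> z) * (x \<bullet> b)) + (x \<bullet> z)\<^sup>2 * (\<Sum>b\<in>Basis. (x \<bullet> b)\<^sup>2)"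
      by (simp add: sum.distrib sum_subtractf sum_distrib_left)
    then show ?thesis unfolding n2 xz using x z by (simp add: power2_eq_square)
  qed
  have s2: "(\<Sum>b\<in>Basis. q2 b) = (1 - real DIM('a)) * (x \<bullet> z)"
  proof -
    have "(\<Sum>b\<in>Basis. q2 b) = - 2 * (\<Sum>b\<in>Basis. (b \<bullet> z) * (x \<bullet> b)) - (\<Sum>b\<in>(Basis::'a set). x \<bullet> z) + 3 * (x \<bullet> z) * (\<Sum>b\<in>Basis. (x \<bullet> b)\<^sup>2)"
      unfolding q2_def by (simp add: sum.distrib sum_subtractf sum_distrib_left mult_ac)
    then show ?thesis unfolding n2 xz using x by (simp add: algebra_simps)
  qed
  have "sphere_laplacian (zonal Q z) x = (\<Sum>b\<in>Basis. radial_extension_d2 (zonal Q z) b x)"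
    by (rule sphere_laplacian_eq_flat_laplacian[OF sphere_smooth_zonal x])
  also have "\<dots> = of_real (\<Sum>b\<in>Basis. f2 b)" by (simp add: d2)
  also have "(\<Sum>b\<in>Basis. f2 b) = poly (pderiv (pderiv Q)) (1 - x \<bullet> z) * (1 - (x \<bullet> z)\<^sup>2) - poly (pderiv Q) (1 - x \<bullet> z) * ((1 - real DIM('a)) * (x \<bullet> z))"
    unfolding f2_def sum_subtractf sum_distrib_left[symmetric] s1 s2 q ..
  also have "\<dots> = - (L * poly Q (1 - x \<bullet> z))"
    using ode[of "1 - x \<bullet> z"] by (simp add: algebra_simps power2_eq_square)
  finally have "sphere_laplacian (zonal Q z) x = of_real (- (L * poly Q (1 - x \<bullet> z)))" .
  then show ?thesis by (simp add: zonal_def[of Q z x])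
qed

text \<open>
  The power series solution at \<open>u = 0\<close> of the differential equation below. It stops at degree \<open>k\<close>,
  since the factor \<open>j - k\<close> vanishes; the result is the Gegenbauer polynomial of degree \<open>k\<close>,
  normalised to be 1 at the pole.
\<close>

fun zonal_coeff :: "nat \<Rightarrow> nat \<Rightarrow> nat \<Rightarrow> real" where
  "zonal_coeff m k 0 = 1"
| "zonal_coeff m k (Suc j) = zonal_coeff m k j * ((real j - real k) * (real j + real k + real m - 1)) / (real (Suc j) * (2 * real j + real m))"

definition zonal_poly :: "nat \<Rightarrow> nat \<Rightarrow> real poly"
  where "zonal_poly m k = Poly (map (zonal_coeff m k) [0..<Suc k])"

lemma zonal_coeff_eq_0: "j > k \<Longrightarrow> zonal_coeff m k j = 0"
proof (induction j)
  case (Suc j)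
  then show ?case by (cases "j = k") auto
qed simp

lemma coeff_zonal_poly: "coeff (zonal_poly m k) j = zonal_coeff m k j"
  by (auto simp: zonal_poly_def coeff_Poly_eq nth_default_def zonal_coeff_eq_0 simp del: upt_Suc)

lemma poly_zonal_poly_0: "poly (zonal_poly m k) 0 = 1"
  by (simp add: poly_0_coeff_0 coeff_zonal_poly)

lemma zonal_poly_ode:
  assumes m: "m \<ge> 1"
  shows "u * (2 - u) * poly (pderiv (pderiv (zonal_poly m k))) u + real m * (1 - u) * poly (pderiv (zonal_poly m k)) u
    + real k * (real k + real m - 1) * poly (zonal_poly m k) u = 0"
proof -
  let ?Q = "zonal_poly m k"
  have rec: "zonal_coeff m k (Suc j) * (real (Suc j) * (2 * real j + real m)) = zonal_coeff m k j * ((real j - real k) * (real j + real k + real m - 1))" for j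
    using m by (simp add: add_nonneg_eq_0_iff)
  have "[:0, 2, -1:] * pderiv (pderiv ?Q) + smult (real m) ([:1, -1:] * pderiv ?Q) + smult (real k * (real k + real m - 1)) ?Q = 0"
  proof (rule poly_eqI)
    fix j
    show "coeff ([:0, 2, -1:] * pderiv (pderiv ?Q) + smult (real m) ([:1, -1:] * pderiv ?Q) + smult (real k * (real k + real m - 1)) ?Q) j = coeff 0 j"
      using rec[of j] 
      by (cases j; cases "j - 1") (simp_all add: coeff_pCons coeff_pderiv coeff_zonal_poly algebra_simps del: zonal_coeff.simps)
  qed
  from arg_cong[OF this, of "\<lambda>p. poly p u"] show ?thesis by (simp add: algebra_simps)
qed

section \<open>Decay of zonal functions\<close>

text \<open>
  In the angle, \<open>f'' + (m - 1) cot \<theta> f' + l ^ 2 f = 0\<close>. The energy \<open>l ^ 2 f ^ 2 + f' ^ 2\<close> is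
  nonincreasing on \<open>[0, pi / 2]\<close>, which gives the first two bounds. For the decay, the
  substitution \<open>g = (sin \<theta>) powr ((m - 1) / 2) * f\<close> removes the first-order term at the price of a
  potential of size \<open>1 / sin \<theta> ^ 2\<close>. The energy of \<open>g\<close>, written as \<open>K\<close> in terms of \<open>f\<close>, then
  changes at a rate at most \<open>B / (l sin \<theta> ^ 2)\<close>, so that \<open>K * exp (B cot \<theta> / l)\<close> is nonincreasing.
  From \<open>\<theta> = 1 / l\<close> onwards the exponential is bounded, and at \<open>\<theta> = 1 / l\<close> itself the first energy
  controls \<open>K\<close>.
\<close>

lemma zonal_ode_bounds:
  fixes l :: real and m :: nat
  assumes l: "l \<ge> 1" and m: "m \<ge> 1" and Q0: "poly Q 0 = 1"
    and ode: "\<And>u. u * (2 - u) * poly (pderiv (pderiv Q)) u + real m * (1 - u) * poly (pderiv Q) u + l\<^sup>2 * poly Q u = 0"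
  defines "f \<equiv> \<lambda>\<theta>. poly Q (1 - cos \<theta>)"
  shows "\<And>\<theta>. 0 \<le> \<theta> \<Longrightarrow> \<theta> \<le> pi / 2 \<Longrightarrow> \<bar>f \<theta>\<bar> \<le> 1"
    and "\<And>\<theta>. 0 \<le> \<theta> \<Longrightarrow> \<theta> \<le> pi / 2 \<Longrightarrow> 1 - l * \<theta> \<le> f \<theta>"
    and "\<And>\<theta>. 1 / l \<le> \<theta> \<Longrightarrow> \<theta> \<le> pi / 2 \<Longrightarrow>
       (f \<theta>)\<^sup>2 * (l * \<theta>) ^ (m - 1) \<le> 4 ^ (m - 1) * ((1 + (1 + 4 * real m)\<^sup>2) * exp (8 * (real m)\<^sup>2))"
proof -
  define g where "g \<theta> = poly (pderiv Q) (1 - cos \<theta>)" for \<theta>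
  define f' where "f' \<theta> = sin \<theta> * g \<theta>" for \<theta>
  have dcos: "((\<lambda>\<theta>. 1 - cos \<theta>) has_real_derivative sin \<theta>) (at \<theta>)" for \<theta> :: real
    by (auto intro!: derivative_eq_intros)
  have df: "(f has_real_derivative f' \<theta>) (at \<theta>)" for \<theta>
    unfolding f_def f'_def g_def
    by (rule DERIV_cong[OF DERIV_chain2[OF poly_DERIV dcos]]) simp
  have df': "(f' has_real_derivative (- (real m - 1) * cos \<theta> * g \<theta> - l\<^sup>2 * f \<theta>)) (at \<theta>)" for \<theta>
  proof -
    have "(f' has_real_derivative sin \<theta> * (poly (pderiv (pderiv Q)) (1 - cos \<theta>) * sin \<theta>) + cos \<theta> * g \<theta>) (at \<theta>)"
      unfolding f'_def g_def
      by (rule DERIV_cong[OF DERIV_mult[OF DERIV_sin DERIV_chain2[OF poly_DERIV dcos]]]) simp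
    moreover have "sin \<theta> * (poly (pderiv (pderiv Q)) (1 - cos \<theta>) * sin \<theta>) + cos \<theta> * g \<theta> = - (real m - 1) * cos \<theta> * g \<theta> - l\<^sup>2 * f \<theta>"
    proof -
      have "(1 - cos \<theta>) * (2 - (1 - cos \<theta>)) = (sin \<theta>)\<^sup>2" by (simp add: sin_squared_eq algebra_simps power2_eq_square)
      then have "(sin \<theta>)\<^sup>2 * poly (pderiv (pderiv Q)) (1 - cos \<theta>) + real m * cos \<theta> * g \<theta> + l\<^sup>2 * f \<theta> = 0"
        using ode[of "1 - cos \<theta>"] by (simp add: f_def g_def)
      then show ?thesis by (simp add: algebra_simps power2_eq_square)
    qed
    ultimately show ?thesis by simp
  qed
  \<comment> \<open>the first energy\<close>
  define E where "E \<theta> = l\<^sup>2 * (f \<theta>)\<^sup>2 + (f' \<theta>)\<^sup>2" for \<theta>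
  have E: "E \<theta> \<le> l\<^sup>2" if \<theta>: "0 \<le> \<theta>" "\<theta> \<le> pi / 2" for \<theta>
  proof -
    have "E \<theta> \<le> E 0"
    proof (rule DERIV_nonpos_imp_nonincreasing[OF \<theta>(1)])
      fix t assume t: "0 \<le> t" "t \<le> \<theta>"
      have "(E has_real_derivative l\<^sup>2 * (2 * f t * f' t) + 2 * f' t * (- (real m - 1) * cos t * g t - l\<^sup>2 * f t)) (at t)"
        unfolding E_def
        by (rule DERIV_cong[OF DERIV_add[OF DERIV_cmult[OF DERIV_power[OF df]] DERIV_power[OF df']]]) (simp add: power2_eq_square)
      moreover have "l\<^sup>2 * (2 * f t * f' t) + 2 * f' t * (- (real m - 1) * cos t * g t - l\<^sup>2 * f t) = - (2 * (real m - 1) * sin t * cos t * (g t)\<^sup>2)"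
        by (simp add: f'_def power2_eq_square algebra_simps)
      moreover have "0 \<le> 2 * (real m - 1) * sin t * cos t * (g t)\<^sup>2"
        using t \<theta> m pi_gt_zero by (intro mult_nonneg_nonneg sin_ge_zero cos_ge_zero) auto
      ultimately show "\<exists>y. (E has_real_derivative y) (at t) \<and> y \<le> 0" by (metis neg_le_0_iff_le)
    qed
    also have "E 0 = l\<^sup>2" using Q0 by (simp add: E_def f_def f'_def)
    finally show ?thesis .
  qed
  show b1: "\<bar>f \<theta>\<bar> \<le> 1" if "0 \<le> \<theta>" "\<theta> \<le> pi / 2" for \<theta>
  proof -
    have "l\<^sup>2 * (f \<theta>)\<^sup>2 \<le> l\<^sup>2 * 1" using E[OF that] by (simp add: E_def) (smt (verit) zero_le_power2)
    then have "(f \<theta>)\<^sup>2 \<le> 1" using l by simp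
    then show ?thesis by (simp add: abs_square_le_1)
  qed
  have b2: "\<bar>f' \<theta>\<bar> \<le> l" if "0 \<le> \<theta>" "\<theta> \<le> pi / 2" for \<theta>
  proof -
    have "0 \<le> l\<^sup>2 * (f \<theta>)\<^sup>2" by simp
    then have "\<bar>f' \<theta>\<bar>\<^sup>2 \<le> l\<^sup>2" using E[OF that] unfolding E_def power2_abs by linarith
    then show ?thesis by (rule power2_le_imp_le) (use l in simp)
  qed
  show "1 - l * \<theta> \<le> f \<theta>" if \<theta>: "0 \<le> \<theta>" "\<theta> \<le> pi / 2" for \<theta>
  proof -
    have "f 0 + l * 0 \<le> f \<theta> + l * \<theta>"
    proof (rule DERIV_nonneg_imp_nondecreasing[OF \<theta>(1)])
      fix t assume t: "0 \<le> t" "t \<le> \<theta>"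
      have "((\<lambda>t. f t + l * t) has_real_derivative f' t + l) (at t)"
        by (rule DERIV_cong[OF DERIV_add[OF df DERIV_cmult[OF DERIV_ident]]]) simp
      moreover have "0 \<le> f' t + l" using b2[of t] t \<theta> by linarith
      ultimately show "\<exists>y. ((\<lambda>t. f t + l * t) has_real_derivative y) (at t) \<and> 0 \<le> y" by blast
    qed
    then show ?thesis using Q0 by (simp add: f_def)
  qed
  define \<alpha> where "\<alpha> = (real m - 1) / 2"
  have \<alpha>: "0 \<le> \<alpha>" "\<alpha> \<le> real m" using m by (auto simp: \<alpha>_def)
  define h where "h \<theta> = f' \<theta> + \<alpha> * (cos \<theta> / sin \<theta>) * f \<theta>" for \<theta>
  \<comment> \<open>the second energy; \<open>h\<close> is \<open>g'\<close> divided by \<open>(sin \<theta>) powr ((m - 1) / 2)\<close>\<close>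
  define K where "K \<theta> = sin \<theta> ^ (m - 1) * (l\<^sup>2 * (f \<theta>)\<^sup>2 + (h \<theta>)\<^sup>2)" for \<theta>
  define B where "B = 2 * (real m)\<^sup>2"
  define W where "W \<theta> = exp (B / l * (cos \<theta> / sin \<theta>))" for \<theta>
  have mono: "K \<theta> * W \<theta> \<le> K \<theta>0 * W \<theta>0" if \<theta>: "0 < \<theta>0" "\<theta>0 \<le> \<theta>" "\<theta> \<le> pi / 2" for \<theta> \<theta>0
  proof (rule DERIV_nonpos_imp_nonincreasing[OF \<theta>(2), of "\<lambda>\<theta>. K \<theta> * W \<theta>"])
    fix t assume t: "\<theta>0 \<le> t" "t \<le> \<theta>"
    have s: "sin t > 0" using t \<theta> pi_gt_zero by (intro sin_gt_zero) auto
    define S where "S = sin t"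
    define c where "c = cos t"
    have S0: "S \<noteq> 0" "S > 0" using s by (auto simp: S_def)
    have cS: "c\<^sup>2 = 1 - S\<^sup>2" by (simp add: c_def S_def cos_squared_eq)
    have dcot: "((\<lambda>\<theta>. cos \<theta> / sin \<theta>) has_real_derivative - (1 / S\<^sup>2)) (at t)"
    proof -
      have "((\<lambda>\<theta>. cos \<theta> / sin \<theta>) has_real_derivative (- sin t * sin t - cos t * cos t) / (sin t * sin t)) (at t)"
        by (rule DERIV_divide[OF DERIV_cos DERIV_sin]) (use s in simp)
      moreover have "- sin t * sin t - cos t * cos t = - 1"
        using sin_cos_squared_add[of t] by (simp add: power2_eq_square)
      ultimately show ?thesis by (simp add: S_def power2_eq_square)
    qed
    have gt: "g t = f' t / S" using S0 by (simp add: f'_def S_def)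
    define h' where "h' = - \<alpha> * (c / S) * h t + f t * (\<alpha>\<^sup>2 * c\<^sup>2 / S\<^sup>2 - l\<^sup>2 - \<alpha> / S\<^sup>2)"
    have dh: "(h has_real_derivative h') (at t)"
    proof -
      have "(h has_real_derivative (- (real m - 1) * cos t * g t - l\<^sup>2 * f t) + (\<alpha> * (cos t / sin t) * f' t + \<alpha> * - (1 / S\<^sup>2) * f t)) (at t)"
        unfolding h_def[abs_def]
        by (rule DERIV_cong[OF DERIV_add[OF df' DERIV_mult[OF DERIV_cmult[OF dcot] df]]]) simp
      moreover have "(- (real m - 1) * cos t * g t - l\<^sup>2 * f t) + (\<alpha> * (cos t / sin t) * f' t + \<alpha> * - (1 / S\<^sup>2) * f t) = h'"
      proof -
        have "real m - 1 = 2 * \<alpha>" by (simp add: \<alpha>_def)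
        then show ?thesis
          unfolding h'_def h_def gt c_def[symmetric] S_def[symmetric] using S0
          by (simp add: field_simps power2_eq_square)
      qed
      ultimately show ?thesis by simp
    qed
    define X where "X = l\<^sup>2 * (f t)\<^sup>2 + (h t)\<^sup>2"
    define K' where "K' = S ^ (m - 1) * (2 * h t * f t * (\<alpha>\<^sup>2 * c\<^sup>2 - \<alpha>) / S\<^sup>2)"
    have dK: "(K has_real_derivative K') (at t)"
    proof -
      have dX: "((\<lambda>\<theta>. l\<^sup>2 * (f \<theta>)\<^sup>2 + (h \<theta>)\<^sup>2) has_real_derivative l\<^sup>2 * (2 * f t * f' t) + 2 * h t * h') (at t)"
        by (rule DERIV_cong[OF DERIV_add[OF DERIV_cmult[OF DERIV_power[OF df]] DERIV_power[OF dh]]]) simp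
      have dS: "((\<lambda>\<theta>. sin \<theta> ^ (m - 1)) has_real_derivative S ^ (m - 1) * (2 * \<alpha> * (c / S))) (at t)"
      proof (cases "m = 1")
        case True
        then show ?thesis by (simp add: \<alpha>_def)
      next
        case False
        then obtain j where j: "m - 1 = Suc j" using m by (metis Suc_pred' diff_is_0_eq le_antisym not_gr0)
        then have "m = Suc (Suc j)" using m by simp
        then have "2 * \<alpha> = real (Suc j)" by (simp add: \<alpha>_def)
        then show ?thesis unfolding j
          by (intro DERIV_cong[OF DERIV_power[OF DERIV_sin]]) (use S0 in \<open>simp add: S_def[symmetric] c_def[symmetric] mult_ac\<close>)
      qed
      have f'h: "f' t = h t - \<alpha> * (c / S) * f t" by (simp add: h_def c_def S_def)
      show ?thesis unfolding K_def[abs_def]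
      proof (rule DERIV_cong[OF DERIV_mult[OF dS dX]])
        have "(2 * \<alpha> * (c / S)) * X + (l\<^sup>2 * (2 * f t * f' t) + 2 * h t * h') = 2 * h t * f t * (\<alpha>\<^sup>2 * c\<^sup>2 - \<alpha>) / S\<^sup>2"
          unfolding f'h h'_def X_def using S0 by (simp add: field_simps power2_eq_square)
        from arg_cong[OF this, of "\<lambda>x. S ^ (m - 1) * x"]
        show "S ^ (m - 1) * (2 * \<alpha> * (c / S)) * (l\<^sup>2 * (f t)\<^sup>2 + (h t)\<^sup>2) + (l\<^sup>2 * (2 * f t * f' t) + 2 * h t * h') * sin t ^ (m - 1) = K'"
          by (simp add: K'_def X_def S_def[symmetric] algebra_simps)
      qed
    qed
    have dW: "(W has_real_derivative W t * (B / l * - (1 / S\<^sup>2))) (at t)"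
      unfolding W_def[abs_def] by (rule DERIV_chain2[OF DERIV_exp DERIV_cmult[OF dcot]])
    have "K' \<le> B / l * (1 / S\<^sup>2) * K t"
    proof -
      have "2 * h t * f t * (\<alpha>\<^sup>2 * c\<^sup>2 - \<alpha>) \<le> B / l * X"
      proof -
        have "2 * h t * f t * (\<alpha>\<^sup>2 * c\<^sup>2 - \<alpha>) \<le> 2 * \<bar>h t * f t\<bar> * \<bar>\<alpha>\<^sup>2 * c\<^sup>2 - \<alpha>\<bar>"
          using abs_ge_self[of "2 * h t * f t * (\<alpha>\<^sup>2 * c\<^sup>2 - \<alpha>)"] by (simp add: abs_mult)
        also have "\<dots> \<le> (X / l) * B"
        proof (rule mult_mono)
          have "0 \<le> (l * \<bar>f t\<bar> - \<bar>h t\<bar>)\<^sup>2" by simp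
          then have "2 * \<bar>h t * f t\<bar> * l \<le> X" by (simp add: X_def power2_diff power_mult_distrib abs_mult algebra_simps)
          then show "2 * \<bar>h t * f t\<bar> \<le> X / l" using l by (simp add: le_divide_eq)
          have c1: "c\<^sup>2 \<le> 1" using cS zero_le_power2[of S] by linarith
          have "\<alpha>\<^sup>2 * c\<^sup>2 \<le> \<alpha>\<^sup>2 * 1" using c1 by (intro mult_left_mono) auto
          moreover have "\<alpha>\<^sup>2 \<le> (real m)\<^sup>2" using \<alpha> by (intro power_mono) auto
          moreover have "real m * 1 \<le> real m * real m" using m by (intro mult_left_mono) auto
          moreover have "0 \<le> \<alpha>\<^sup>2 * c\<^sup>2" by simp
          moreover have "0 \<le> (real m)\<^sup>2" by simp
          ultimately show "\<bar>\<alpha>\<^sup>2 * c\<^sup>2 - \<alpha>\<bar> \<le> B" using \<alpha> unfolding B_def power2_eq_square[of "real m"] by linarith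
          show "0 \<le> X / l" using l by (simp add: X_def)
        qed simp
        finally show ?thesis by (simp add: mult.commute)
      qed
      then have "S ^ (m - 1) * (2 * h t * f t * (\<alpha>\<^sup>2 * c\<^sup>2 - \<alpha>) / S\<^sup>2) \<le> S ^ (m - 1) * (B / l * X / S\<^sup>2)"
        using S0 by (intro mult_left_mono divide_right_mono) auto
      then show ?thesis by (simp add: K'_def K_def X_def S_def mult_ac)
    qed
    then have "W t * K' \<le> W t * (B / l * (1 / S\<^sup>2) * K t)" by (intro mult_left_mono) (simp_all add: W_def)
    then have "K' * W t + (W t * (B / l * - (1 / S\<^sup>2))) * K t \<le> 0" by (simp add: algebra_simps)
    then show "\<exists>y. ((\<lambda>\<theta>. K \<theta> * W \<theta>) has_real_derivative y) (at t) \<and> y \<le> 0"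
      using DERIV_mult[OF dK dW] by blast
  qed
  show "(f \<theta>)\<^sup>2 * (l * \<theta>) ^ (m - 1) \<le> 4 ^ (m - 1) * ((1 + (1 + 4 * real m)\<^sup>2) * exp (8 * (real m)\<^sup>2))"
    if \<theta>: "1 / l \<le> \<theta>" "\<theta> \<le> pi / 2" for \<theta>
  proof -
    \<comment> \<open>the energy estimate starts at this angle\<close>
    define s0 where "s0 = 1 / l"
    have s0: "0 < s0" "s0 \<le> 1" using l by (auto simp: s0_def divide_simps)
    have s0p: "s0 \<le> pi / 2" using \<theta> unfolding s0_def by linarith
    note s0 = s0 s0p
    have \<theta>0: "0 < \<theta>" using s0 \<theta> unfolding s0_def by linarith
    define C where "C = (1 + (1 + 4 * real m)\<^sup>2) * exp (8 * (real m)\<^sup>2)"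
    have sin0: "s0 / 4 \<le> sin s0" "sin s0 \<le> s0" using sin_ge_quarter[of s0] sin_x_le_x[of s0] s0 by auto
    have cot0: "0 \<le> cos s0 / sin s0" "cos s0 / sin s0 \<le> 4 * l"
    proof -
      have sp: "0 < sin s0" using sin0 s0 by linarith
      show "0 \<le> cos s0 / sin s0" using sp s0 pi_gt_zero by (intro divide_nonneg_pos cos_ge_zero) auto
      have "cos s0 / sin s0 \<le> 1 / (s0 / 4)" using sin0 sp s0 by (intro frac_le) auto
      then show "cos s0 / sin s0 \<le> 4 * l" by (simp add: s0_def)
    qed
    have "K s0 \<le> s0 ^ (m - 1) * (l\<^sup>2 * (1 + (1 + 4 * real m)\<^sup>2))"
      unfolding K_def
    proof (intro mult_mono power_mono)
      have "\<bar>f s0\<bar> \<le> 1" "\<bar>f' s0\<bar> \<le> l" using b1[of s0] b2[of s0] s0 by auto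
      moreover have "\<bar>\<alpha> * (cos s0 / sin s0) * f s0\<bar> \<le> real m * (4 * l) * 1"
        unfolding abs_mult using \<alpha> cot0 \<open>\<bar>f s0\<bar> \<le> 1\<close> l by (intro mult_mono) auto
      ultimately have "\<bar>h s0\<bar> \<le> l + real m * (4 * l) * 1" unfolding h_def by linarith
      then have "\<bar>h s0\<bar> \<le> l * (1 + 4 * real m)" by (simp add: algebra_simps)
      then have "\<bar>h s0\<bar>\<^sup>2 \<le> (l * (1 + 4 * real m))\<^sup>2" by (intro power_mono) auto
      have "\<bar>f s0\<bar>\<^sup>2 \<le> 1\<^sup>2" using \<open>\<bar>f s0\<bar> \<le> 1\<close> by (intro power_mono) auto
      then have "l\<^sup>2 * (f s0)\<^sup>2 \<le> l\<^sup>2 * 1" by (intro mult_left_mono) auto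
      show "l\<^sup>2 * (f s0)\<^sup>2 + (h s0)\<^sup>2 \<le> l\<^sup>2 * (1 + (1 + 4 * real m)\<^sup>2)"
      proof -
        have "l\<^sup>2 * (1 + (1 + 4 * real m)\<^sup>2) = l\<^sup>2 * 1 + (l * (1 + 4 * real m))\<^sup>2"
          by (subst power_mult_distrib) (rule distrib_left)
        then show ?thesis
          using \<open>\<bar>h s0\<bar>\<^sup>2 \<le> (l * (1 + 4 * real m))\<^sup>2\<close> \<open>l\<^sup>2 * (f s0)\<^sup>2 \<le> l\<^sup>2 * 1\<close>
          unfolding power2_abs by linarith
      qed
    qed (use sin0 s0 in auto)
    moreover have "W s0 \<le> exp (8 * (real m)\<^sup>2)"
    proof -
      have "B / l * (cos s0 / sin s0) \<le> B / l * (4 * l)" using cot0 l by (intro mult_left_mono) (auto simp: B_def)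
      also have "\<dots> = 8 * (real m)\<^sup>2" using l by (simp add: B_def)
      finally show ?thesis by (simp add: W_def)
    qed
    ultimately have "K s0 * W s0 \<le> (s0 ^ (m - 1) * (l\<^sup>2 * (1 + (1 + 4 * real m)\<^sup>2))) * exp (8 * (real m)\<^sup>2)"
      using s0 by (intro mult_mono) (auto simp: W_def)
    then have up: "K \<theta> * W \<theta> \<le> s0 ^ (m - 1) * (l\<^sup>2 * C)"
      using mono[OF s0(1) _ \<theta>(2)] \<theta>(1) by (simp add: s0_def[symmetric] C_def mult_ac)
    have st: "\<theta> / 4 \<le> sin \<theta>" using sin_ge_quarter[of \<theta>] \<theta> \<theta>0 by auto
    have "(\<theta> / 4) ^ (m - 1) * (l\<^sup>2 * (f \<theta>)\<^sup>2) \<le> K \<theta>"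
      unfolding K_def using st \<theta>0 by (intro mult_mono power_mono) auto
    also have "\<dots> \<le> K \<theta> * W \<theta>"
    proof -
      have "0 \<le> cos \<theta> / sin \<theta>" using st \<theta>0 \<theta> by (intro divide_nonneg_pos cos_ge_zero) auto
      moreover have "0 \<le> B / l" using l by (simp add: B_def)
      ultimately have "0 \<le> B / l * (cos \<theta> / sin \<theta>)" by (rule mult_nonneg_nonneg[rotated])
      then have "1 \<le> W \<theta>" unfolding W_def by (simp only: one_le_exp_iff)
      moreover have "0 \<le> K \<theta>" using st \<theta>0 by (simp add: K_def)
      ultimately show ?thesis by (simp add: mult_le_cancel_left1)
    qed
    finally have "(\<theta> / 4) ^ (m - 1) * (l\<^sup>2 * (f \<theta>)\<^sup>2) \<le> s0 ^ (m - 1) * (l\<^sup>2 * C)" using up by linarith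
    then have "l\<^sup>2 * ((\<theta> / 4) ^ (m - 1) * (f \<theta>)\<^sup>2) \<le> l\<^sup>2 * (s0 ^ (m - 1) * C)" by (simp add: mult_ac)
    then have "(\<theta> / 4) ^ (m - 1) * (f \<theta>)\<^sup>2 \<le> s0 ^ (m - 1) * C" using l by simp
    then have "(4 * l) ^ (m - 1) * ((\<theta> / 4) ^ (m - 1) * (f \<theta>)\<^sup>2) \<le> (4 * l) ^ (m - 1) * (s0 ^ (m - 1) * C)"
      using l by (intro mult_left_mono) auto
    moreover have "(4 * l) ^ (m - 1) * (\<theta> / 4) ^ (m - 1) = (l * \<theta>) ^ (m - 1)"
      by (subst power_mult_distrib[symmetric]) simp
    moreover have "(4 * l) ^ (m - 1) * s0 ^ (m - 1) = 4 ^ (m - 1)"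
      using l by (subst power_mult_distrib[symmetric]) (simp add: s0_def)
    ultimately have "(l * \<theta>) ^ (m - 1) * (f \<theta>)\<^sup>2 \<le> 4 ^ (m - 1) * C"
      by (simp only: mult.assoc[symmetric])
    then show ?thesis unfolding C_def by (simp only: mult.commute)
  qed
qed

section \<open>The inequality implies density\<close>

lemma zonal_eigenfunction:
  fixes z :: "'a::euclidean_space"
  assumes z: "norm z = 1" and dim: "DIM('a) \<ge> 3" and l: "l\<^sup>2 = real k * (real k + real DIM('a) - 2)"
  shows "sphere_eigenfunction l (zonal (zonal_poly (DIM('a) - 1) k) z)"
proof -
  have m: "real (DIM('a) - 1) = real DIM('a) - 1" using dim by simp
  have "- sphere_laplacian (zonal (zonal_poly (DIM('a) - 1) k) z) x = of_real (l\<^sup>2) * zonal (zonal_poly (DIM('a) - 1) k) z x"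
    if "x \<in> sphere 0 1" for x
  proof (rule sphere_laplacian_zonal[OF z])
    fix u
    show "u * (2 - u) * poly (pderiv (pderiv (zonal_poly (DIM('a) - 1) k))) u + (real DIM('a) - 1) * (1 - u) * poly (pderiv (zonal_poly (DIM('a) - 1) k)) u
       + l\<^sup>2 * poly (zonal_poly (DIM('a) - 1) k) u = 0"
      using zonal_poly_ode[of "DIM('a) - 1" u k] dim unfolding m l by (simp add: algebra_simps)
  qed (use that in simp)
  moreover have "zonal (zonal_poly (DIM('a) - 1) k) z z \<noteq> 0"
    using z by (simp add: zonal_def poly_zonal_poly_0 norm_eq_1)
  ultimately show ?thesis
    unfolding sphere_eigenfunction_def using sphere_smooth_zonal z by auto
qed

text \<open>
  The absolute value of an eigenfunction is even, so angles beyond \<open>pi / 2\<close> are measured from the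
  antipodal pole.
\<close>

lemma zonal_pointwise_bounds:
  fixes p :: real
  assumes dim: "DIM('a::euclidean_space) \<ge> 3" and p: "p \<ge> 1"
  shows "\<exists>C>0. \<forall>l k (z::'a) x. l \<ge> 1 \<longrightarrow> l\<^sup>2 = real k * (real k + real DIM('a) - 2) \<longrightarrow> norm z = 1 \<longrightarrow> norm x = 1 \<longrightarrow>
     (let w = norm (zonal (zonal_poly (DIM('a) - 1) k) z x) powr p; \<theta> = min (geodesic_dist z x) (geodesic_dist (- z) x) in
       (geodesic_dist z x \<le> 1 / (2 * l) \<longrightarrow> (1 / 2) powr p \<le> w) \<and>
       w \<le> 1 \<and> (\<forall>s\<ge>1. s / l \<le> \<theta> \<longrightarrow> w \<le> C * s powr (- p * (real DIM('a) - 2) / 2)))"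
proof -
  define m where "m = DIM('a) - 1"
  have m: "m \<ge> 1" "real m = real DIM('a) - 1" "real (m - 1) = real DIM('a) - 2" using dim by (auto simp: m_def)
  define C0 where "C0 = 4 ^ (m - 1) * ((1 + (1 + 4 * real m)\<^sup>2) * exp (8 * (real m)\<^sup>2))"
  have C0: "C0 > 0" by (simp add: C0_def add_pos_nonneg)
  show ?thesis
  proof (intro exI[of _ "C0 powr (p / 2)"] conjI allI impI)
    show "C0 powr (p / 2) > 0" using C0 by simp
    fix l :: real and k :: nat and z x :: 'a
    assume l: "l \<ge> 1" "l\<^sup>2 = real k * (real k + real DIM('a) - 2)" and z: "norm z = 1" and x: "norm x = 1"
    define Q where "Q = zonal_poly m k"
    have k: "k \<ge> 1" using l by (cases k) auto
    define f where "f \<theta> = poly Q (1 - cos \<theta>)" for \<theta>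
    have Q0: "poly Q 0 = 1" by (simp add: Q_def poly_zonal_poly_0)
    have ode: "u * (2 - u) * poly (pderiv (pderiv Q)) u + real m * (1 - u) * poly (pderiv Q) u + l\<^sup>2 * poly Q u = 0" for u
      using zonal_poly_ode[OF m(1), of u k] unfolding Q_def l(2) m(2) by (simp add: algebra_simps)
    note bounds = zonal_ode_bounds[OF l(1) m(1) Q0 ode, folded f_def C0_def]
    define e where "e = zonal Q z"
    have eig: "sphere_eigenfunction l e" unfolding e_def Q_def m_def by (rule zonal_eigenfunction[OF z dim l(2)])
    have par: "norm (radial_extension e (- y)) = norm (radial_extension e y)" for y
      using eigenfunction_degree[OF eig _ dim] l(1) by (metis less_le_trans zero_less_one)
    have even: "norm (e (- x)) = norm (e x)"
      using par[of x] x by (simp add: radial_extension_def sgn_div_norm)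
    have bnd: "\<bar>y \<bullet> w\<bar> \<le> 1" if "norm y = 1" "norm w = 1" for y w :: 'a
      using Cauchy_Schwarz_ineq2[of y w] that by simp
    have ef: "norm (e y) = \<bar>f (geodesic_dist z y)\<bar>" if "norm y = 1" for y
    proof -
      have "cos (geodesic_dist z y) = y \<bullet> z"
        using bnd[OF z that] by (simp add: geodesic_dist_def cos_arccos abs_le_iff inner_commute)
      then show ?thesis by (simp add: e_def zonal_def f_def)
    qed
    define \<theta> where "\<theta> = min (geodesic_dist z x) (geodesic_dist (- z) x)"
    have anti: "geodesic_dist (- z) x = pi - geodesic_dist z x"
      using bnd[OF z x] by (simp add: geodesic_dist_def arccos_minus abs_le_iff)
    have d0: "0 \<le> geodesic_dist z x" "geodesic_dist z x \<le> pi"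
      using bnd[OF z x] arccos_lbound[of "z \<bullet> x"] arccos_ubound[of "z \<bullet> x"] by (auto simp: geodesic_dist_def abs_le_iff)
    have \<theta>: "0 \<le> \<theta>" "\<theta> \<le> pi / 2" using d0 unfolding \<theta>_def anti min_def by auto
    have f\<theta>: "norm (e x) = \<bar>f \<theta>\<bar>"
    proof (cases "geodesic_dist z x \<le> geodesic_dist (- z) x")
      case True
      then show ?thesis using ef[OF x] by (simp add: \<theta>_def min_def)
    next
      case False
      then have "\<theta> = geodesic_dist z (- x)" by (simp add: \<theta>_def geodesic_dist_def)
      then show ?thesis using ef[of "- x"] x even by simp
    qed
    have w1: "norm (e x) \<le> 1" unfolding f\<theta> by (rule bounds(1)[OF \<theta>])
    have w2: "1 / 2 \<le> norm (e x)" if "geodesic_dist z x \<le> 1 / (2 * l)"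
    proof -
      have "1 / (2 * l) \<le> 1 / 2" using l by (simp add: divide_simps)
      then have g: "geodesic_dist z x \<le> pi / 2" using that pi_gt3 by linarith
      have "l * geodesic_dist z x \<le> l * (1 / (2 * l))" using that l by (intro mult_left_mono) auto
      then have "1 / 2 \<le> 1 - l * geodesic_dist z x" using l by simp
      also have "\<dots> \<le> f (geodesic_dist z x)" by (rule bounds(2)[OF d0(1) g])
      finally show ?thesis using ef[OF x] by simp
    qed
    have w3: "norm (e x) powr p \<le> C0 powr (p / 2) * s powr (- p * (real DIM('a) - 2) / 2)" if s: "s \<ge> 1" "s / l \<le> \<theta>" for s
    proof -
      have "1 / l \<le> s / l" using s(1) l by (intro divide_right_mono) auto
      then have "1 / l \<le> \<theta>" using s(2) by linarith
      from bounds(3)[OF this \<theta>(2)] have b: "(f \<theta>)\<^sup>2 * (l * \<theta>) ^ (m - 1) \<le> C0" .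
      have "s \<le> l * \<theta>" using s(2) l by (simp add: divide_le_eq mult.commute)
      then have "(f \<theta>)\<^sup>2 * s ^ (m - 1) \<le> (f \<theta>)\<^sup>2 * (l * \<theta>) ^ (m - 1)"
        using s by (intro mult_left_mono power_mono) auto
      with b have "(f \<theta>)\<^sup>2 * s ^ (m - 1) \<le> C0" by linarith
      then have "(norm (e x))\<^sup>2 \<le> C0 / s ^ (m - 1)" using s unfolding f\<theta> by (simp add: le_divide_eq)
      then have "((norm (e x))\<^sup>2) powr (p / 2) \<le> (C0 / s ^ (m - 1)) powr (p / 2)" using p by (intro powr_mono2) auto
      moreover have "((norm (e x))\<^sup>2) powr (p / 2) = norm (e x) powr p"
        by (cases "e x = 0") (simp_all add: powr_realpow[symmetric] powr_powr flip: powr_numeral)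
      moreover have "(C0 / s ^ (m - 1)) powr (p / 2) = C0 powr (p / 2) * s powr (- p * (real DIM('a) - 2) / 2)"
        using s C0 unfolding m(3)[symmetric] by (simp add: powr_divide powr_realpow[symmetric] powr_powr powr_minus_divide mult.commute)
      ultimately show ?thesis by simp
    qed
    show "let w = norm (zonal (zonal_poly (DIM('a) - 1) k) z x) powr p; \<theta> = min (geodesic_dist z x) (geodesic_dist (- z) x) in
       (geodesic_dist z x \<le> 1 / (2 * l) \<longrightarrow> (1 / 2) powr p \<le> w) \<and>
       w \<le> 1 \<and> (\<forall>s\<ge>1. s / l \<le> \<theta> \<longrightarrow> w \<le> C0 powr (p / 2) * s powr (- p * (real DIM('a) - 2) / 2))"
      unfolding Let_def m_def[symmetric] Q_def[symmetric] e_def[symmetric] \<theta>_def[symmetric]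
      using w1 w2 w3 p by (auto intro!: powr_mono2 powr_le1)
  qed
qed

text \<open>
  Constants: \<open>C2\<close> bounds the mass of the zonal function outside the two balls of radius \<open>R / l\<close> by
  \<open>C2 R powr (m - \<beta>) / l ^ m\<close>, where \<open>\<beta> = p (m - 1) / 2 > m\<close>, and \<open>c3 / l ^ m\<close> is a lower bound
  for its whole mass. \<open>R\<close> is so large that the former is at most half of \<open>C\<close> times the latter.
\<close>

theorem dense_if_Logvinenko_Sereda:
  fixes A :: "real \<Rightarrow> 'a::euclidean_space set"
  assumes dim: "DIM('a) \<ge> 3" and p: "2 * (real DIM('a) - 1) / (real DIM('a) - 2) < p"
    and A: "\<And>l. l \<ge> 1 \<Longrightarrow> A l \<in> sets sphere_volume"
    and LS: "Logvinenko_Sereda p A"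
  shows "symmetric_relatively_dense A"
proof -
  let ?n = "DIM('a)" and ?V = "measure lborel (ball (0::'a) 1)"
  let ?\<sigma> = "sphere_volume :: 'a measure"
  define m where "m = ?n - 1"
  have m: "real m = real ?n - 1" "m \<ge> 2" using dim by (auto simp: m_def)
  define \<beta> where "\<beta> = p * (real ?n - 2) / 2"
  have \<beta>: "\<beta> > real m" using p dim m by (simp add: \<beta>_def divide_less_eq mult_ac)
  have p2: "p > 2"
  proof -
    have "2 \<le> 2 * (real ?n - 1) / (real ?n - 2)" using dim by (simp add: le_divide_eq)
    then show ?thesis using p by linarith
  qed
  have V: "?V > 0" by (rule content_ball_pos) simp
  interpret S: finite_measure ?\<sigma> by (rule finite_measure_sphere_volume)
  define Cu where "Cu = ?n * 3 ^ ?n * ?V"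
  define cl where "cl = ?V / 32 ^ ?n"
  have Cu: "Cu > 0" "cl > 0" using V by (auto simp: Cu_def cl_def)
  have up: "measure ?\<sigma> (geodesic_ball z r) \<le> Cu * r ^ m" if "norm z = 1" "r > 0" for z r
    using geodesic_ball_volume_upper[OF that] by (simp add: Cu_def m_def)
  have low: "cl * r ^ m \<le> measure ?\<sigma> (geodesic_ball z r)" if "norm z = 1" "0 < r" "r \<le> 1" for z r
    using geodesic_ball_volume_lower[OF that] by (simp add: cl_def m_def)
  obtain C where C: "C > 0" "\<And>l e. l \<ge> 1 \<Longrightarrow> sphere_eigenfunction l e \<Longrightarrow>
       C * (LINT x:sphere 0 1|?\<sigma>. cmod (e x) powr p) \<le> (LINT x:A l|?\<sigma>. cmod (e x) powr p)"
    using LS unfolding Logvinenko_Sereda_def by blast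
  obtain C1 where C1: "C1 > 0" and zb: "\<And>l k (z::'a) x. l \<ge> 1 \<Longrightarrow> l\<^sup>2 = real k * (real k + real DIM('a) - 2) \<Longrightarrow> norm z = 1 \<Longrightarrow> norm x = 1 \<Longrightarrow>
     (let w = norm (zonal (zonal_poly (DIM('a) - 1) k) z x) powr p; \<theta> = min (geodesic_dist z x) (geodesic_dist (- z) x) in
       (geodesic_dist z x \<le> 1 / (2 * l) \<longrightarrow> (1 / 2) powr p \<le> w) \<and>
       w \<le> 1 \<and> (\<forall>s\<ge>1. s / l \<le> \<theta> \<longrightarrow> w \<le> C1 * s powr (- p * (real DIM('a) - 2) / 2)))"
    using zonal_pointwise_bounds[OF dim, of p] p2 by auto
  \<comment> \<open>the ratio of the masses on consecutive dyadic shells\<close>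
  define q where "q = 2 powr (real m - \<beta>)"
  have q: "0 < q" "q < 1" using \<beta> by (auto simp: q_def intro: powr_less_one)
  define C2 where "C2 = 2 * (C1 * (Cu * 2 ^ m)) / (1 - q)"
  have C2: "C2 > 0" using C1 Cu q by (simp add: C2_def)
  define c3 where "c3 = (1 / 2) powr p * (cl * (1 / 2) ^ m)"
  have c3: "c3 > 0" using Cu by (simp add: c3_def)
  obtain R where R: "R \<ge> 1" "C2 * R powr (real m - \<beta>) \<le> C * c3 / 2"
  proof -
    have "((\<lambda>R::real. C2 * R powr (real m - \<beta>)) \<longlongrightarrow> C2 * 0) at_top"
      by (intro tendsto_mult_left tendsto_neg_powr filterlim_ident) (use \<beta> in auto)
    then have "\<forall>\<^sub>F R in at_top. C2 * R powr (real m - \<beta>) < C * c3 / 2"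
      by (rule order_tendstoD) (use C c3 in simp)
    then have "\<forall>\<^sub>F R in at_top. R \<ge> 1 \<and> C2 * R powr (real m - \<beta>) < C * c3 / 2"
      using eventually_ge_at_top[of 1] by eventually_elim auto
    then obtain R where "R \<ge> 1" "C2 * R powr (real m - \<beta>) < C * c3 / 2"
      using eventually_happens by fastforce
    then show thesis by (intro that) auto
  qed
  define \<rho> where "\<rho> = C * c3 / 2 / (Cu * R ^ m)"
  have \<rho>: "\<rho> > 0" using C c3 Cu R by (simp add: \<rho>_def)
  show ?thesis
    unfolding symmetric_relatively_dense_def
  proof (rule exI[of _ R], rule conjI, use R in simp, rule exI[of _ \<rho>], intro conjI ballI \<rho>)
    fix l and z :: 'a assume lf: "l \<in> sphere_frequencies TYPE('a)" and zS: "z \<in> sphere 0 1"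
    have l: "l \<ge> 1" and z: "norm z = 1" "norm (- z) = 1" using lf zS by (auto simp: sphere_frequencies_def)
    obtain e0 :: "'a \<Rightarrow> complex" where e0: "sphere_eigenfunction l e0" using lf by (auto simp: sphere_frequencies_def)
    obtain k where k: "l\<^sup>2 = real k * (real k + real ?n - 2)"
      using eigenfunction_degree[OF e0 _ dim] l by (metis less_le_trans zero_less_one)
    define e where "e = zonal (zonal_poly (?n - 1) k) z"
    have eig: "sphere_eigenfunction l e" unfolding e_def by (rule zonal_eigenfunction[OF z(1) dim k])
    have sm: "sphere_smooth e" using eig by (simp add: sphere_eigenfunction_def)
    define w where "w x = norm (e x) powr p" for x
    have near: "(1 / 2) powr p \<le> w x" if "norm x = 1" "geodesic_dist z x \<le> 1 / (2 * l)" for x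
      using zb[OF l k z(1) that(1)] that(2) by (simp add: Let_def w_def e_def)
    have w1: "w x \<le> 1" if "norm x = 1" for x
      using zb[OF l k z(1) that(1)] by (simp add: Let_def w_def e_def)
    have decay: "w x \<le> C1 * s powr (- \<beta>)" if "norm x = 1" "s \<ge> 1" "s / l \<le> geodesic_dist z x" "s / l \<le> geodesic_dist (- z) x" for x s
      using zb[OF l k z(1) that(1)] that(2-4) by (simp add: Let_def w_def e_def \<beta>_def)
    have w0: "0 \<le> w x" for x by (simp add: w_def)
    have intw: "integrable ?\<sigma> w"
      unfolding w_def[abs_def] using integral_sphere_volume_cone(2)[OF sm, of "{}" p] p2 by simp
    define B where "B r = geodesic_ball z (r / l) \<union> geodesic_ball (- z) (r / l)" for r
    have gs: "geodesic_ball z r \<in> sets ?\<sigma>" "geodesic_ball (- z) r \<in> sets ?\<sigma>" for r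
      using geodesic_ball_sets[OF z(1)] geodesic_ball_sets[OF z(2)] by auto
    have Bs: "B r \<in> sets ?\<sigma>" for r unfolding B_def using gs by auto
    have mB: "measure ?\<sigma> (B r) \<le> 2 * (Cu * (r / l) ^ m)" if "r > 0" for r
    proof -
      have "measure ?\<sigma> (B r) \<le> measure ?\<sigma> (geodesic_ball z (r / l)) + measure ?\<sigma> (geodesic_ball (- z) (r / l))"
        unfolding B_def by (rule measure_Un_le) (use gs in auto)
      also have "\<dots> \<le> Cu * (r / l) ^ m + Cu * (r / l) ^ m"
        by (intro add_mono up z) (use that l in auto)
      finally show ?thesis by simp
    qed
    have total: "c3 * (1 / l) ^ m \<le> (LINT x:sphere 0 1|?\<sigma>. w x)"
    proof -
      let ?B0 = "geodesic_ball z (1 / (2 * l))"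
      have "c3 * (1 / l) ^ m = (1 / 2) powr p * (cl * (1 / (2 * l)) ^ m)"
        by (simp add: c3_def power_divide power_mult_distrib)
      also have "\<dots> \<le> (1 / 2) powr p * measure ?\<sigma> ?B0"
        by (intro mult_left_mono low z) (use l in \<open>auto simp: divide_simps\<close>)
      also have "\<dots> = (\<integral>x. (1 / 2) powr p * indicator ?B0 x \<partial>?\<sigma>)"
        using gs by simp
      also have "\<dots> \<le> (\<integral>x. indicator (sphere 0 1) x *\<^sub>R w x \<partial>?\<sigma>)"
      proof (rule integral_mono)
        show "integrable ?\<sigma> (\<lambda>x. (1 / 2) powr p * indicator ?B0 x)"
          using gs by (intro integrable_mult_right S.integrable_const_bound[where B=1]) (auto simp: indicator_def)
        show "integrable ?\<sigma> (\<lambda>x. indicator (sphere 0 1) x *\<^sub>R w x)"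
          by (rule integrable_mult_indicator[OF _ intw]) (use sets_sphere_volume_borel[of "sphere (0::'a) 1"] in auto)
        show "(1 / 2) powr p * indicator ?B0 x \<le> indicator (sphere 0 1) x *\<^sub>R w x" for x
          using near[of x] w0[of x] by (auto simp: indicator_def geodesic_ball_def)
      qed
      finally show ?thesis by (simp add: set_lebesgue_integral_def)
    qed
    have int_ind: "integrable ?\<sigma> (\<lambda>x. indicator D x :: real)" if "D \<in> sets ?\<sigma>" for D
      using that by (intro S.integrable_const_bound[where B=1]) (auto simp: indicator_def)
    have intcw: "integrable ?\<sigma> (\<lambda>x. indicator (- B R) x * w x)"
    proof (rule Bochner_Integration.integrable_bound[OF intw])
      have "(\<lambda>x. (1 - indicator (B R) x) * w x) \<in> borel_measurable ?\<sigma>"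
        using Bs borel_measurable_integrable[OF intw] by (intro borel_measurable_times borel_measurable_diff) auto
      moreover have "(1 - indicator (B R) x) = (indicator (- B R) x :: real)" for x by (simp add: indicator_def)
      ultimately show "(\<lambda>x. indicator (- B R) x * w x) \<in> borel_measurable ?\<sigma>" by simp
    qed (auto simp: indicator_def)
    have tail: "(\<integral>x. indicator (- B R) x * w x \<partial>?\<sigma>) \<le> C2 * R powr (real m - \<beta>) * (1 / l) ^ m"
    proof -
      obtain J where J: "pi * l < 2 ^ J"
        using real_arch_pow[of 2 "pi * l"] by auto
      define a where "a j = C1 * (2 ^ j * R) powr (- \<beta>)" for j :: nat
      have a0: "a j \<ge> 0" for j using C1 by (simp add: a_def)
      have intB: "integrable ?\<sigma> (\<lambda>x. a j * indicator (B r) x)" for j r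
        by (intro integrable_mult_right int_ind Bs)
      have "(\<integral>x. indicator (- B R) x * w x \<partial>?\<sigma>) \<le> (\<integral>x. (\<Sum>j<J. a j * indicator (B (2 ^ (j + 1) * R)) x) \<partial>?\<sigma>)"
      proof (rule integral_mono)
        show "integrable ?\<sigma> (\<lambda>x. indicator (- B R) x * w x)" by (rule intcw)
        show "integrable ?\<sigma> (\<lambda>x. \<Sum>j<J. a j * indicator (B (2 ^ (j + 1) * R)) x)"
          by (intro Bochner_Integration.integrable_sum intB)
        fix x assume "x \<in> space ?\<sigma>"
        then have x: "norm x = 1" by (simp add: space_sphere_volume)
        show "indicator (- B R) x * w x \<le> (\<Sum>j<J. a j * indicator (B (2 ^ (j + 1) * R)) x)"
        proof (cases "x \<in> B R")
          case True
          then show ?thesis using a0 by (auto intro!: sum_nonneg)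
        next
          case False
          define \<theta> where "\<theta> = min (geodesic_dist z x) (geodesic_dist (- z) x)"
          have "R / l \<le> \<theta>"
            using False x unfolding \<theta>_def B_def geodesic_ball_def by auto
          then have \<theta>R: "R \<le> l * \<theta>" using l by (simp add: divide_le_eq mult.commute)
          have \<theta>pi: "\<theta> \<le> pi"
          proof -
            have "\<bar>z \<bullet> x\<bar> \<le> 1" using Cauchy_Schwarz_ineq2[of z x] z x by simp
            then show ?thesis using arccos_ubound[of "z \<bullet> x"] by (auto simp: \<theta>_def geodesic_dist_def abs_le_iff)
          qed
          have J1: "J \<ge> 1"
          proof (rule ccontr)
            assume "\<not> 1 \<le> J"
            then have "J = 0" by simp
            then have "pi * l < 1" using J by simp
            moreover have "1 * 1 \<le> pi * l" using l pi_gt3 by (intro mult_mono) auto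
            ultimately show False by simp
          qed
          \<comment> \<open>the dyadic shell containing \<open>x\<close>\<close>
          define P where "P i \<longleftrightarrow> l * \<theta> < 2 ^ (i + 1) * R" for i :: nat
          have PJ: "P (J - 1)"
          proof -
            have "l * \<theta> \<le> l * pi" using \<theta>pi l by (intro mult_left_mono) auto
            also have "\<dots> < 2 ^ J * 1" using J by (simp add: mult.commute)
            also have "\<dots> \<le> 2 ^ J * R" using R by (intro mult_left_mono) auto
            finally show ?thesis using J1 by (simp add: P_def)
          qed
          define j where "j = (LEAST i. P i)"
          have Pj: "P j" unfolding j_def by (rule LeastI[of P, OF PJ])
          have jJ: "j < J" using Least_le[of P, OF PJ] J1 unfolding j_def by linarith
          have lo: "2 ^ j * R \<le> l * \<theta>"
          proof (cases j)
            case 0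
            then show ?thesis using \<theta>R by simp
          next
            case (Suc i)
            then have "\<not> P i" using not_less_Least[of i P] unfolding j_def by simp
            then show ?thesis using Suc by (simp add: P_def)
          qed
          have s1: "1 * 1 \<le> 2 ^ j * R" using R by (intro mult_mono) auto
          have "2 ^ j * R / l \<le> \<theta>" using lo l by (simp add: divide_le_eq mult.commute)
          then have "w x \<le> a j"
            unfolding a_def by (intro decay x) (use s1 in \<open>auto simp: \<theta>_def\<close>)
          moreover have "x \<in> B (2 ^ (j + 1) * R)"
          proof -
            have "\<theta> < 2 ^ (j + 1) * R / l" using Pj l unfolding P_def by (simp add: less_divide_eq mult.commute)
            then show ?thesis using x unfolding B_def geodesic_ball_def \<theta>_def by auto
          qed
          ultimately have "indicator (- B R) x * w x \<le> a j * indicator (B (2 ^ (j + 1) * R)) x" using False by simp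
          also have "\<dots> \<le> (\<Sum>j<J. a j * indicator (B (2 ^ (j + 1) * R)) x)"
            by (rule member_le_sum) (use jJ a0 in auto)
          finally show ?thesis .
        qed
      qed
      also have "\<dots> = (\<Sum>j<J. a j * measure ?\<sigma> (B (2 ^ (j + 1) * R)))"
        using intB Bs by (subst Bochner_Integration.integral_sum) auto
      also have "\<dots> \<le> (\<Sum>j<J. 2 * (C1 * (Cu * 2 ^ m)) * R powr (real m - \<beta>) * (1 / l) ^ m * q ^ j)"
      proof (rule sum_mono)
        fix j
        have "a j * measure ?\<sigma> (B (2 ^ (j + 1) * R)) \<le> a j * (2 * (Cu * (2 ^ (j + 1) * R / l) ^ m))"
          using R by (intro mult_left_mono mB a0) auto
        also have "\<dots> = 2 * (C1 * (Cu * 2 ^ m)) * ((2 ^ j * R) powr (- \<beta>) * (2 ^ j * R) ^ m) * (1 / l) ^ m"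
          by (simp add: a_def power_mult_distrib power_divide)
        also have "(2 ^ j * R) powr (- \<beta>) * (2 ^ j * R) ^ m = (2 ^ j * R) powr (real m - \<beta>)"
          using R by (simp add: powr_realpow[symmetric] flip: powr_add)
        also have "\<dots> = q ^ j * R powr (real m - \<beta>)"
          using R by (simp add: powr_mult q_def powr_powr powr_realpow[symmetric] mult.commute)
        finally show "a j * measure ?\<sigma> (B (2 ^ (j + 1) * R)) \<le> 2 * (C1 * (Cu * 2 ^ m)) * R powr (real m - \<beta>) * (1 / l) ^ m * q ^ j"
          by (simp only: mult_ac)
      qed
      also have "\<dots> = 2 * (C1 * (Cu * 2 ^ m)) * R powr (real m - \<beta>) * (1 / l) ^ m * (\<Sum>j<J. q ^ j)"
        by (simp only: sum_distrib_left)
      also have "\<dots> \<le> 2 * (C1 * (Cu * 2 ^ m)) * R powr (real m - \<beta>) * (1 / l) ^ m * (1 / (1 - q))"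
      proof (rule mult_left_mono)
        have "(\<Sum>j<J. q ^ j) = (1 - q ^ J) / (1 - q)" using q by (simp add: sum_gp_strict)
        also have "\<dots> \<le> 1 / (1 - q)" using q by (intro divide_right_mono) auto
        finally show "(\<Sum>j<J. q ^ j) \<le> 1 / (1 - q)" .
        show "0 \<le> 2 * (C1 * (Cu * 2 ^ m)) * R powr (real m - \<beta>) * (1 / l) ^ m" using C1 Cu l by simp
      qed
      finally show ?thesis by (simp add: C2_def)
    qed
    have AB: "A l \<inter> geodesic_ball z (R / l) \<in> sets ?\<sigma>" "A l \<inter> geodesic_ball (- z) (R / l) \<in> sets ?\<sigma>"
      using A[OF l] gs by auto
    have "(LINT x:A l|?\<sigma>. w x) \<le> (\<integral>x. indicator (A l \<inter> geodesic_ball z (R / l)) x + indicator (A l \<inter> geodesic_ball (- z) (R / l)) x + indicator (- B R) x * w x \<partial>?\<sigma>)"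
      unfolding set_lebesgue_integral_def
    proof (rule integral_mono)
      show "integrable ?\<sigma> (\<lambda>x. indicator (A l) x *\<^sub>R w x)"
        by (rule integrable_mult_indicator[OF A[OF l] intw])
      show "integrable ?\<sigma> (\<lambda>x. indicator (A l \<inter> geodesic_ball z (R / l)) x + indicator (A l \<inter> geodesic_ball (- z) (R / l)) x + indicator (- B R) x * w x)"
        by (intro Bochner_Integration.integrable_add int_ind intcw AB)
      show "indicator (A l) x *\<^sub>R w x \<le> indicator (A l \<inter> geodesic_ball z (R / l)) x + indicator (A l \<inter> geodesic_ball (- z) (R / l)) x + indicator (- B R) x * w x"
        if "x \<in> space ?\<sigma>" for x
        using that w1[of x] w0[of x] by (auto simp: indicator_def B_def space_sphere_volume)
    qed
    also have "\<dots> = measure ?\<sigma> (A l \<inter> geodesic_ball z (R / l)) + measure ?\<sigma> (A l \<inter> geodesic_ball (- z) (R / l)) + (\<integral>x. indicator (- B R) x * w x \<partial>?\<sigma>)"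
      using AB int_ind intcw by (subst Bochner_Integration.integral_add; simp)+
    finally have upA: "(LINT x:A l|?\<sigma>. w x) \<le> measure ?\<sigma> (A l \<inter> geodesic_ball z (R / l)) + measure ?\<sigma> (A l \<inter> geodesic_ball (- z) (R / l)) + C2 * R powr (real m - \<beta>) * (1 / l) ^ m"
      using tail by linarith
    have "C * (c3 * (1 / l) ^ m) \<le> C * (LINT x:sphere 0 1|?\<sigma>. w x)" using C total by (intro mult_left_mono) auto
    also have "\<dots> \<le> (LINT x:A l|?\<sigma>. w x)" using C(2)[OF l eig] unfolding w_def .
    finally have lowA: "C * c3 * (1 / l) ^ m \<le> (LINT x:A l|?\<sigma>. w x)" by (simp add: mult.assoc)
    have "C2 * R powr (real m - \<beta>) * (1 / l) ^ m \<le> C * c3 / 2 * (1 / l) ^ m"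
      using R(2) l by (intro mult_right_mono) auto
    then have big: "C * c3 / 2 * (1 / l) ^ m \<le> measure ?\<sigma> (A l \<inter> geodesic_ball z (R / l)) + measure ?\<sigma> (A l \<inter> geodesic_ball (- z) (R / l))"
      using upA lowA by (simp add: field_simps)
    have vol: "measure ?\<sigma> (geodesic_ball z (R / l)) \<le> Cu * (R / l) ^ m" by (rule up[OF z(1)]) (use R l in auto)
    have volpos: "measure ?\<sigma> (geodesic_ball z (R / l)) > 0"
    proof -
      have "0 < cl * (1 / l) ^ m" using Cu l by simp
      also have "\<dots> \<le> measure ?\<sigma> (geodesic_ball z (1 / l))" by (rule low[OF z(1)]) (use l in auto)
      also have "\<dots> \<le> measure ?\<sigma> (geodesic_ball z (R / l))"
      proof (rule S.finite_measure_mono[OF _ gs(1)])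
        have "1 / l \<le> R / l" using R l by (intro divide_right_mono) auto
        then show "geodesic_ball z (1 / l) \<subseteq> geodesic_ball z (R / l)" by (auto simp: geodesic_ball_def)
      qed
      finally show ?thesis .
    qed
    have "\<rho> * measure ?\<sigma> (geodesic_ball z (R / l)) \<le> \<rho> * (Cu * (R / l) ^ m)" using \<rho> vol by (intro mult_left_mono) auto
    also have "\<dots> = C * c3 / 2 * (1 / l) ^ m" using Cu R by (simp add: \<rho>_def power_divide)
    finally show "\<rho> \<le> (measure ?\<sigma> (A l \<inter> geodesic_ball z (R / l)) + measure ?\<sigma> (A l \<inter> geodesic_ball (- z) (R / l)))
       / measure ?\<sigma> (geodesic_ball z (R / l))"
      using big volpos by (simp add: le_divide_eq)
  qed
qed

theorem theorem5:
  fixes m :: nat and p :: real and A :: "real \<Rightarrow> (real ^ 'n) set"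
  assumes "CARD('n) = m + 1"
    and "m \<ge> 2"
    and "2 * real m / (real m - 1) < p"
    and "\<And>l. l \<ge> 1 \<Longrightarrow> A l \<in> sets sphere_volume"
  shows "Logvinenko_Sereda p A \<longleftrightarrow> symmetric_relatively_dense A"
proof -
  have dim: "DIM(real ^ 'n) \<ge> 3" "real DIM(real ^ 'n) = real m + 1" using assms(1,2) by auto
  have "1 \<le> 2 * real m / (real m - 1)" using assms(2) by (simp add: le_divide_eq)
  then have p: "p \<ge> 1" using assms(3) by linarith
  have p': "2 * (real DIM(real ^ 'n) - 1) / (real DIM(real ^ 'n) - 2) < p" unfolding dim(2) using assms(3) by simp
  show ?thesis
    using Logvinenko_Sereda_if_dense[of p A, OF dim(1) p assms(4)] dense_if_Logvinenko_Sereda[of p A, OF dim(1) p' assms(4)]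
    by blast
qed

end
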